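(* Let $\alpha_0,\alpha_1\ge0$ with $\alpha_0\ne\alpha_1$ and $\alpha_0+\alpha_1>1$, and let $0\le T<1$. Let $(\lambda'_k)_{k=1}^\infty$ be the decreasing sequence of zeros of the function $$F_{\alpha_0,\alpha_1,T}(\lambda)=\tan(\beta(\lambda)\ln(1-T))+\lambda\beta(\lambda)/(1+\lambda/2-\lambda\alpha_0),$$ where $\beta(\lambda)=\sqrt{(\alpha_0+\alpha_1-1)/\lambda-\alpha_0(\alpha_0-1)-1/4}$. Denote by $\wedge$ and $\vee$ the minimum and the maximum, and define $$c:=\frac{1/2-(\alpha_0\vee\alpha_1)}{(1/2-(\alpha_0\vee\alpha_1))\ln(1-T)+1}+1/2 .$$ (i) If $\alpha_0\wedge\alpha_1\ge c$, then, under $\mathbb P^{(\alpha_0)}$, the sequence of decreasing eigenvalues in the Karhunen-Loève expansion of $X^{(\alpha)}$ under the measure $\mu_{\alpha_0,\alpha_1,T}$ is given by $(\lambda_k)_{k=1}^\infty=(\lambda'_k)_{k=1}^\infty$. The corresponding normed eigenfunctions are given by $$e_k(t)=\rho_k\sqrt{1-t}\,\sin(\beta(\lambda_k)\ln(1-t)),$$ where $\rho_k$ is chosen such that $e_k$ is normalized in the $L_2(\mu_{\alpha_0,\alpha_1,T})$-norm. (ii) If $\alpha_0\wedge\alpha_1<c$, then, under $\mathbb P^{(\alpha_0)}$, the Karhunen-Loève expansion of $X^{(\alpha)}$ under the measure $\mu_{\alpha_0,\alpha_1,T}$ contains in addition to the eigenvalues from (i) a further term $\lambda_0$ with $$\lambda_0=\frac{\alpha_0+\alpha_1-1}{\alpha_0(\alpha_0-1)+1/4-\sigma_0^2}>\lambda_1,$$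 where $\sigma_0$ is the unique zero of the function $$G(\sigma)=(\sigma+\alpha_0-1/2)(\sigma+\alpha_1-1/2)-(1-T)^{2\sigma}(\sigma-\alpha_0+1/2)(\sigma-\alpha_1+1/2)$$ with $0<\sigma_0<1/2-\alpha_0$. The corresponding eigenfunction is given by $$e_0(t)=\rho_0\sqrt{1-t}\left((1-t)^{\sigma_0}-(1-t)^{-\sigma_0}\right),$$ where $\rho_0$ is chosen such that $e_0$ is normalized in the $L_2(\mu_{\alpha_0,\alpha_1,T})$-norm. (iii) If $$\alpha_1=1-\alpha_0-\frac{(1-2\alpha_0)^2\ln(1-T)}{2(1-2\alpha_0)\ln(1-T)+4},$$ then, under $\mathbb P^{(\alpha_0)}$, the Karhunen-Loève expansion of $X^{(\alpha)}$ under the measure $\mu_{\alpha_0,\alpha_1,T}$ contains in addition to the eigenvalues from (i) (and possibly (ii)) a further term $\lambda_*$ with $$\lambda_*=\frac{\alpha_0+\alpha_1-1}{\alpha_0(\alpha_0-1)+1/4}>\lambda_1 .$$ The corresponding eigenfunction is given by $$e_*(t)=\rho_*\sqrt{1-t}\,\ln(1-t),$$ where $\rho_*$ is chosen such that $e_*$ is normalized in the $L_2(\mu_{\alpha_0,\alpha_1,T})$-norm. If (ii) applies then $\lambda_*<\lambda_0$.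
   Context: For $\alpha\ge0$, the $\alpha$-Brownian bridge is the process $X^{(\alpha)}_t=\int_0^t\left(\frac{1-t}{1-s}\right)^{\alpha}dW_s$, $0\le t<1$, with $W$ standard Brownian motion (extended continuously to $t=1$), and $\mathbb P^{(\alpha)}$ is the measure it induces on $C([0,1])$; thus "under $\mathbb P^{(\alpha_0)}$" means that the scaling parameter $\alpha$ equals $\alpha_0$. The covariance function $R^{(\alpha)}(s,t)=\mathbb E[X^{(\alpha)}_sX^{(\alpha)}_t]$ is $R^{(\alpha)}(s,t)=\frac{(1-s)^\alpha(1-t)^\alpha}{1-2\alpha}\left(1-(1-(s\wedge t))^{1-2\alpha}\right)$ for $\alpha\ne1/2$ and $R^{(1/2)}(s,t)=-\sqrt{(1-s)(1-t)}\,\ln(1-(s\wedge t))$. The measure $\mu_{\alpha_0,\alpha_1,T}$ on $[0,1]$ is $$\mu_{\alpha_0,\alpha_1,T}(ds)=\frac{\delta_T(ds)}{1-T}+\frac{(\alpha_0+\alpha_1-1)\mathbf 1(s\le T)\,ds}{(1-s)^2},$$ where $\delta_T$ is the point measure at $T$ and $\mathbf 1$ is the indicator function; $L_2(\mu_{\alpha_0,\alpha_1,T})$ is the space of functions on $[0,1]$ that are square integrable with respect to it. The Karhunen-Loève expansion of $X^{(\alpha_0)}$ under $\mu_{\alpha_0,\alpha_1,T}$ is the series $X^{(\alpha_0)}_t=\sum_k Z_ke_k(t)$, converging almost surely uniformly in $t\in[0,T]$, where the $e_k$ are the orthonormalized eigenfunctions belonging to the eigenvalues $\lambda_k$ of the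 compact, self-adjoint, non-negative definite operator on $L_2(\mu_{\alpha_0,\alpha_1,T})$ given by $$(A_{R^{(\alpha_0)}}e)(t)=\int_0^1R^{(\alpha_0)}(t,s)e(s)\,\mu_{\alpha_0,\alpha_1,T}(ds),$$ and the $Z_k$ are independent centered normal random variables with $\mathbb E Z_k^2=\lambda_k$. In parts (ii) and (iii), $\lambda_1$ denotes the first term of the sequence $(\lambda_k)_{k=1}^\infty=(\lambda'_k)_{k=1}^\infty$ of part (i).
   Formalization: Bound on σ₀ is 1/2−(α₀∧α₁), since no σ₀ exists under 1/2−α₀ if α₁<α₀; (i) excludes the condition of (iii), where both conflict; zeros of F need β>0, and common poles of its two terms count as zeros; for T=0 the sequence is empty. *)

theory Defs
  imports "HOL-Probability.Probability"
begin

section \<open>The \<open>\<alpha>\<close>-Brownian bridge\<close>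

definition standard_brownian_motion :: "'a measure \<Rightarrow> (real \<Rightarrow> 'a \<Rightarrow> real) \<Rightarrow> bool" where
  "standard_brownian_motion M W \<longleftrightarrow>
     (\<forall>t\<ge>0. W t \<in> borel_measurable M) \<and>
     (AE \<omega> in M. W 0 \<omega> = 0) \<and>
     (AE \<omega> in M. continuous_on {0..} (\<lambda>t. W t \<omega>)) \<and>
     (\<forall>s t. 0 \<le> s \<and> s < t \<longrightarrow>
        distributed M lborel (\<lambda>\<omega>. W t \<omega> - W s \<omega>) (normal_density 0 (sqrt (t - s)))) \<and>
     (\<forall>n (\<tau> :: nat \<Rightarrow> real). 0 \<le> \<tau> 0 \<and> (\<forall>i<n. \<tau> i \<le> \<tau> (Suc i)) \<longrightarrow>
        prob_space.indep_vars M (\<lambda>_. borel) (\<lambda>i \<omega>. W (\<tau> (Suc i)) \<omega> - W (\<tau> i) \<omega>) {..<n})"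

text \<open>
  \<open>Y = \<integral>\<^sub>0\<^sup>t f dW\<close> (up to almost sure equality) for a deterministic integrand \<open>f\<close> that is
  continuous on \<open>[0,t]\<close>: the \<open>L\<^sup>2(M)\<close>-limit of the left-endpoint Riemann sums, i.e. of the
  integrals of step functions converging uniformly to \<open>f\<close>.
\<close>
definition wiener_integral ::
    "'a measure \<Rightarrow> (real \<Rightarrow> 'a \<Rightarrow> real) \<Rightarrow> (real \<Rightarrow> real) \<Rightarrow> real \<Rightarrow> ('a \<Rightarrow> real) \<Rightarrow> bool" where
  "wiener_integral M W f t Y \<longleftrightarrow>
     Y \<in> borel_measurable M \<and>
     (\<lambda>n. \<integral>\<^sup>+\<omega>. ennreal (((\<Sum>i<n. f (t * real i / real n) *
               (W (t * real (Suc i) / real n) \<omega> - W (t * real i / real n) \<omega>)) - Y \<omega>)\<^sup>2) \<partial>M)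
       \<longlonglongrightarrow> 0"

definition alpha_brownian_bridge ::
    "'a measure \<Rightarrow> (real \<Rightarrow> 'a \<Rightarrow> real) \<Rightarrow> real \<Rightarrow> (real \<Rightarrow> 'a \<Rightarrow> real) \<Rightarrow> bool" where
  "alpha_brownian_bridge M W \<alpha> X \<longleftrightarrow>
     (\<forall>t\<in>{0..1}. X t \<in> borel_measurable M) \<and>
     (\<forall>\<omega>\<in>space M. continuous_on {0..1} (\<lambda>t. X t \<omega>)) \<and>
     (\<forall>t\<in>{0..<1}. wiener_integral M W (\<lambda>s. ((1 - t) / (1 - s)) powr \<alpha>) t (X t))"

definition covariance_function :: "'a measure \<Rightarrow> (real \<Rightarrow> 'a \<Rightarrow> real) \<Rightarrow> real \<Rightarrow> real \<Rightarrow> real" where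
  "covariance_function M X s t = (\<integral>\<omega>. X s \<omega> * X t \<omega> \<partial>M)"

section \<open>The measure \<open>\<mu>\<close> and its \<open>L\<^sub>2\<close> space\<close>

text \<open>The measure on \<open>[0,1]\<close>, regarded as a Borel measure on the line carried by \<open>[0,T]\<close>.\<close>
definition mu :: "real \<Rightarrow> real \<Rightarrow> real \<Rightarrow> real measure" where
  "mu \<alpha>\<^sub>0 \<alpha>\<^sub>1 T = measure_of UNIV (sets borel)
     (\<lambda>A. ennreal (1 / (1 - T)) * indicator A T +
          (\<integral>\<^sup>+s. ennreal ((\<alpha>\<^sub>0 + \<alpha>\<^sub>1 - 1) / (1 - s)\<^sup>2) * indicator (A \<inter> {0..T}) s \<partial>lborel))"

lemma sets_mu [simp, measurable_cong]: "sets (mu \<alpha>\<^sub>0 \<alpha>\<^sub>1 T) = sets borel"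
  using sets.sigma_sets_eq[of "borel :: real measure"] by (simp add: mu_def sets_measure_of_conv)

lemma space_mu [simp]: "space (mu \<alpha>\<^sub>0 \<alpha>\<^sub>1 T) = UNIV"
  unfolding mu_def by (simp add: space_measure_of_conv)

lemma emeasure_mu:
  assumes A: "A \<in> sets borel"
  shows "emeasure (mu \<alpha>\<^sub>0 \<alpha>\<^sub>1 T) A =
           ennreal (1 / (1 - T)) * indicator A T +
           (\<integral>\<^sup>+s. ennreal ((\<alpha>\<^sub>0 + \<alpha>\<^sub>1 - 1) / (1 - s)\<^sup>2) * indicator (A \<inter> {0..T}) s \<partial>lborel)"
proof -
  define f where "f s = ennreal ((\<alpha>\<^sub>0 + \<alpha>\<^sub>1 - 1) / (1 - s)\<^sup>2) * indicator {0..T} s" for s :: real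
  define \<nu> where "\<nu> B = ennreal (1 / (1 - T)) * indicator B T +
     (\<integral>\<^sup>+s. ennreal ((\<alpha>\<^sub>0 + \<alpha>\<^sub>1 - 1) / (1 - s)\<^sup>2) * indicator (B \<inter> {0..T}) s \<partial>lborel)"
    for B :: "real set"
  have f [measurable]: "f \<in> borel_measurable lborel"
    unfolding f_def by measurable
  have \<nu>: "\<nu> B = ennreal (1 / (1 - T)) * emeasure (return borel T) B + emeasure (density lborel f) B"
    if B: "B \<in> sets borel" for B
  proof -
    have "emeasure (density lborel f) B = (\<integral>\<^sup>+s. f s * indicator B s \<partial>lborel)"
      using B by (intro emeasure_density) auto
    also have "\<dots> =
        (\<integral>\<^sup>+s. ennreal ((\<alpha>\<^sub>0 + \<alpha>\<^sub>1 - 1) / (1 - s)\<^sup>2) * indicator (B \<inter> {0..T}) s \<partial>lborel)"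
      by (intro nn_integral_cong) (auto simp: f_def split: split_indicator)
    finally show ?thesis
      using B by (simp add: \<nu>_def)
  qed
  have "emeasure (mu \<alpha>\<^sub>0 \<alpha>\<^sub>1 T) A = \<nu> A"
  proof (rule emeasure_measure_of)
    show "mu \<alpha>\<^sub>0 \<alpha>\<^sub>1 T = measure_of UNIV (sets borel) \<nu>"
      unfolding mu_def \<nu>_def ..
    show "A \<in> sets (mu \<alpha>\<^sub>0 \<alpha>\<^sub>1 T)"
      using A by simp
    show "positive (sets (mu \<alpha>\<^sub>0 \<alpha>\<^sub>1 T)) \<nu>"
      by (simp add: positive_def \<nu>)
    show "countably_additive (sets (mu \<alpha>\<^sub>0 \<alpha>\<^sub>1 T)) \<nu>"
    proof (rule countably_additiveI)
      fix B :: "nat \<Rightarrow> real set"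
      assume B: "range B \<subseteq> sets (mu \<alpha>\<^sub>0 \<alpha>\<^sub>1 T)" and disj: "disjoint_family B"
        and U: "(\<Union>i. B i) \<in> sets (mu \<alpha>\<^sub>0 \<alpha>\<^sub>1 T)"
      have B': "B i \<in> sets borel" for i
        using B by auto
      have "(\<Sum>i. \<nu> (B i)) =
          (\<Sum>i. ennreal (1 / (1 - T)) * emeasure (return borel T) (B i)) +
          (\<Sum>i. emeasure (density lborel f) (B i))"
        by (subst suminf_add) (auto simp: \<nu> B')
      also have "\<dots> = ennreal (1 / (1 - T)) * emeasure (return borel T) (\<Union>i. B i) +
          emeasure (density lborel f) (\<Union>i. B i)"
      proof -
        have "(\<Sum>i. emeasure (return borel T) (B i)) = emeasure (return borel T) (\<Union>i. B i)"
          using B' disj by (intro suminf_emeasure) auto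
        moreover have "(\<Sum>i. emeasure (density lborel f) (B i)) = emeasure (density lborel f) (\<Union>i. B i)"
          using B' disj by (intro suminf_emeasure) auto
        ultimately show ?thesis
          by (simp only: ennreal_suminf_cmult)
      qed
      also have "\<dots> = \<nu> (\<Union>i. B i)"
        using U by (intro \<nu>[symmetric]) (simp only: sets_mu)
      finally show "(\<Sum>i. \<nu> (B i)) = \<nu> (\<Union>i. B i)" .
    qed
  qed auto
  then show ?thesis
    by (simp add: \<nu>_def)
qed

definition in_L2 :: "real measure \<Rightarrow> (real \<Rightarrow> real) \<Rightarrow> bool" where
  "in_L2 \<mu> f \<longleftrightarrow> f \<in> borel_measurable \<mu> \<and> integrable \<mu> (\<lambda>s. (f s)\<^sup>2)"

definition L2_inner :: "real measure \<Rightarrow> (real \<Rightarrow> real) \<Rightarrow> (real \<Rightarrow> real) \<Rightarrow> real" where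
  "L2_inner \<mu> f g = (\<integral>s. f s * g s \<partial>\<mu>)"

definition L2_normalize :: "real measure \<Rightarrow> (real \<Rightarrow> real) \<Rightarrow> real \<Rightarrow> real" where
  "L2_normalize \<mu> f = (\<lambda>t. (1 / sqrt (L2_inner \<mu> f f)) * f t)"

section \<open>Karhunen-Loeve expansions\<close>

text \<open>
  The restriction to \<open>[0,1]\<close> matters although \<open>\<mu>\<close> has no mass elsewhere: the kernel is meaningful, and
  Borel measurable, only there.
\<close>
definition integral_operator ::
    "(real \<Rightarrow> real \<Rightarrow> real) \<Rightarrow> real measure \<Rightarrow> (real \<Rightarrow> real) \<Rightarrow> real \<Rightarrow> real" where
  "integral_operator R \<mu> e t = (LINT s:{0..1}|\<mu>. R t s * e s)"

text \<open>
  The families \<open>lam\<close> and \<open>e\<close>, indexed by \<open>I \<subseteq> \<nat>\<close>, are the decreasing eigenvalues and the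
  eigenfunctions of the Karhunen-Loeve expansion of \<open>X\<close> under \<open>\<mu>\<close>, on the interval \<open>[0,T]\<close>.
  The fifth conjunct says that every eigenvalue that can contribute to the expansion (that is,
  every nonzero one) is listed, according to its multiplicity: the eigenspace of \<open>l\<close> is spanned
  by the \<open>e i\<close> with \<open>lam i = l\<close>, and so is trivial if there are none.
\<close>
definition karhunen_loeve_expansion ::
    "'a measure \<Rightarrow> (real \<Rightarrow> 'a \<Rightarrow> real) \<Rightarrow> real measure \<Rightarrow> real \<Rightarrow>
     nat set \<Rightarrow> (nat \<Rightarrow> real) \<Rightarrow> (nat \<Rightarrow> real \<Rightarrow> real) \<Rightarrow> bool" where
  "karhunen_loeve_expansion M X \<mu> T I lam e \<longleftrightarrow>
     (let A = integral_operator (covariance_function M X) \<mu> in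
      (\<forall>i\<in>I. 0 < lam i) \<and>
      (\<forall>i\<in>I. \<forall>j\<in>I. i \<le> j \<longrightarrow> lam j \<le> lam i) \<and>
      (\<forall>i\<in>I. in_L2 \<mu> (e i) \<and> (AE t in \<mu>. A (e i) t = lam i * e i t)) \<and>
      (\<forall>i\<in>I. \<forall>j\<in>I. L2_inner \<mu> (e i) (e j) = (if i = j then 1 else 0)) \<and>
      (\<forall>l f. l \<noteq> 0 \<and> in_L2 \<mu> f \<and> (AE t in \<mu>. A f t = l * f t) \<longrightarrow>
         finite {i\<in>I. lam i = l} \<and>
         (AE t in \<mu>. f t = (\<Sum>i\<in>{i\<in>I. lam i = l}. L2_inner \<mu> f (e i) * e i t))) \<and>
      (\<exists>Z :: nat \<Rightarrow> 'a \<Rightarrow> real.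
         prob_space.indep_vars M (\<lambda>_. borel) Z I \<and>
         (\<forall>i\<in>I. distributed M lborel (Z i) (normal_density 0 (sqrt (lam i)))) \<and>
         (AE \<omega> in M. uniform_limit {0..T} (\<lambda>n t. \<Sum>i\<in>I \<inter> {..n}. Z i \<omega> * e i t)
                       (\<lambda>t. X t \<omega>) sequentially)))"

section \<open>Eigenvalues and eigenfunctions\<close>

definition beta_radicand :: "real \<Rightarrow> real \<Rightarrow> real \<Rightarrow> real" where
  "beta_radicand \<alpha>\<^sub>0 \<alpha>\<^sub>1 l = (\<alpha>\<^sub>0 + \<alpha>\<^sub>1 - 1) / l - \<alpha>\<^sub>0 * (\<alpha>\<^sub>0 - 1) - 1/4"

definition beta :: "real \<Rightarrow> real \<Rightarrow> real \<Rightarrow> real" where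
  "beta \<alpha>\<^sub>0 \<alpha>\<^sub>1 l = sqrt (beta_radicand \<alpha>\<^sub>0 \<alpha>\<^sub>1 l)"

definition F :: "real \<Rightarrow> real \<Rightarrow> real \<Rightarrow> real \<Rightarrow> real" where
  "F \<alpha>\<^sub>0 \<alpha>\<^sub>1 T l =
     tan (beta \<alpha>\<^sub>0 \<alpha>\<^sub>1 l * ln (1 - T)) + l * beta \<alpha>\<^sub>0 \<alpha>\<^sub>1 l / (1 + l/2 - l * \<alpha>\<^sub>0)"

text \<open>
  Conventions for the zeros of \<open>F\<close>.  Only \<open>l\<close> with a positive radicand (hence \<open>l > 0\<close>) count: where
  \<open>\<beta>\<close> vanishes, \<open>F\<close> vanishes for trivial reasons and the associated function
  \<open>sin (\<beta> ln (1 - t))\<close> is identically \<open>0\<close>.  The equation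
  \<open>tan (\<beta> ln (1 - T)) = - l \<beta> / (1 + l/2 - l \<alpha>\<^sub>0)\<close> is read in the projective line, so a common pole
  of both sides is a zero; this concerns at most \<open>l = 1 / (\<alpha>\<^sub>0 - 1/2)\<close>, and occurs only for
  exceptional \<open>T\<close>.  The explicit conditions on the two denominators are needed since \<open>tan\<close> and
  division are total: a pole of just one side must not be taken for the value \<open>0\<close>.
\<close>
definition F_zeros :: "real \<Rightarrow> real \<Rightarrow> real \<Rightarrow> real set" where
  "F_zeros \<alpha>\<^sub>0 \<alpha>\<^sub>1 T =
     {l. 0 < beta_radicand \<alpha>\<^sub>0 \<alpha>\<^sub>1 l \<and>
         ((cos (beta \<alpha>\<^sub>0 \<alpha>\<^sub>1 l * ln (1 - T)) \<noteq> 0 \<and> 1 + l/2 - l * \<alpha>\<^sub>0 \<noteq> 0 \<and> F \<alpha>\<^sub>0 \<alpha>\<^sub>1 T l = 0) \<or>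
          (cos (beta \<alpha>\<^sub>0 \<alpha>\<^sub>1 l * ln (1 - T)) = 0 \<and> 1 + l/2 - l * \<alpha>\<^sub>0 = 0))}"

text \<open>
  For \<open>T = 0\<close> the function \<open>F\<close> has no zeros (and the operator is zero on \<open>L\<^sub>2\<close>), so the
  sequence indexed by \<open>k = 1, 2, \<dots>\<close> is then the empty family.
\<close>
definition kl_indices :: "real \<Rightarrow> nat set" where
  "kl_indices T = (if T = 0 then {} else {1..})"

definition decreasing_zeros :: "real \<Rightarrow> real \<Rightarrow> real \<Rightarrow> (nat \<Rightarrow> real) \<Rightarrow> bool" where
  "decreasing_zeros \<alpha>\<^sub>0 \<alpha>\<^sub>1 T lam \<longleftrightarrow>
     (\<forall>i\<in>kl_indices T. \<forall>j\<in>kl_indices T. i < j \<longrightarrow> lam j < lam i) \<and>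
     lam ` kl_indices T = F_zeros \<alpha>\<^sub>0 \<alpha>\<^sub>1 T"

definition c_threshold :: "real \<Rightarrow> real \<Rightarrow> real \<Rightarrow> real" where
  "c_threshold \<alpha>\<^sub>0 \<alpha>\<^sub>1 T =
     (1/2 - max \<alpha>\<^sub>0 \<alpha>\<^sub>1) / ((1/2 - max \<alpha>\<^sub>0 \<alpha>\<^sub>1) * ln (1 - T) + 1) + 1/2"

definition e_sin :: "real \<Rightarrow> real \<Rightarrow> real \<Rightarrow> real \<Rightarrow> real \<Rightarrow> real" where
  "e_sin \<alpha>\<^sub>0 \<alpha>\<^sub>1 T l = L2_normalize (mu \<alpha>\<^sub>0 \<alpha>\<^sub>1 T)
     (\<lambda>t. sqrt (1 - t) * sin (beta \<alpha>\<^sub>0 \<alpha>\<^sub>1 l * ln (1 - t)))"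

definition G :: "real \<Rightarrow> real \<Rightarrow> real \<Rightarrow> real \<Rightarrow> real" where
  "G \<alpha>\<^sub>0 \<alpha>\<^sub>1 T \<sigma> =
     (\<sigma> + \<alpha>\<^sub>0 - 1/2) * (\<sigma> + \<alpha>\<^sub>1 - 1/2) -
     (1 - T) powr (2 * \<sigma>) * (\<sigma> - \<alpha>\<^sub>0 + 1/2) * (\<sigma> - \<alpha>\<^sub>1 + 1/2)"

text \<open>
  \<open>G\<close> and the threshold are symmetric in \<open>\<alpha>\<^sub>0\<close> and \<open>\<alpha>\<^sub>1\<close>, and so is the bound on \<open>\<sigma>\<^sub>0\<close>: it is
  \<open>1/2 - \<alpha>\<^sub>0\<close> for \<open>\<alpha>\<^sub>0 < \<alpha>\<^sub>1\<close>, but \<open>1/2 - \<alpha>\<^sub>1\<close> for \<open>\<alpha>\<^sub>1 < \<alpha>\<^sub>0\<close>, where \<open>1/2 - \<alpha>\<^sub>0 < 0\<close>.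
\<close>
definition is_sigma0 :: "real \<Rightarrow> real \<Rightarrow> real \<Rightarrow> real \<Rightarrow> bool" where
  "is_sigma0 \<alpha>\<^sub>0 \<alpha>\<^sub>1 T \<sigma> \<longleftrightarrow> 0 < \<sigma> \<and> \<sigma> < 1/2 - min \<alpha>\<^sub>0 \<alpha>\<^sub>1 \<and> G \<alpha>\<^sub>0 \<alpha>\<^sub>1 T \<sigma> = 0"

definition lambda_0 :: "real \<Rightarrow> real \<Rightarrow> real \<Rightarrow> real" where
  "lambda_0 \<alpha>\<^sub>0 \<alpha>\<^sub>1 \<sigma> = (\<alpha>\<^sub>0 + \<alpha>\<^sub>1 - 1) / (\<alpha>\<^sub>0 * (\<alpha>\<^sub>0 - 1) + 1/4 - \<sigma>\<^sup>2)"

definition e_0 :: "real \<Rightarrow> real \<Rightarrow> real \<Rightarrow> real \<Rightarrow> real \<Rightarrow> real" where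
  "e_0 \<alpha>\<^sub>0 \<alpha>\<^sub>1 T \<sigma> = L2_normalize (mu \<alpha>\<^sub>0 \<alpha>\<^sub>1 T)
     (\<lambda>t. sqrt (1 - t) * ((1 - t) powr \<sigma> - (1 - t) powr (- \<sigma>)))"

definition star_condition :: "real \<Rightarrow> real \<Rightarrow> real \<Rightarrow> bool" where
  "star_condition \<alpha>\<^sub>0 \<alpha>\<^sub>1 T \<longleftrightarrow>
     \<alpha>\<^sub>1 = 1 - \<alpha>\<^sub>0 - (1 - 2 * \<alpha>\<^sub>0)\<^sup>2 * ln (1 - T) / (2 * (1 - 2 * \<alpha>\<^sub>0) * ln (1 - T) + 4)"

definition lambda_star :: "real \<Rightarrow> real \<Rightarrow> real" where
  "lambda_star \<alpha>\<^sub>0 \<alpha>\<^sub>1 = (\<alpha>\<^sub>0 + \<alpha>\<^sub>1 - 1) / (\<alpha>\<^sub>0 * (\<alpha>\<^sub>0 - 1) + 1/4)"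

definition e_star :: "real \<Rightarrow> real \<Rightarrow> real \<Rightarrow> real \<Rightarrow> real" where
  "e_star \<alpha>\<^sub>0 \<alpha>\<^sub>1 T = L2_normalize (mu \<alpha>\<^sub>0 \<alpha>\<^sub>1 T) (\<lambda>t. sqrt (1 - t) * ln (1 - t))"

end

theory Submission
  imports Defs "HOL-Complex_Analysis.Complex_Analysis"
begin

text \<open>
  Write \<open>b\<^sub>0 = \<alpha>\<^sub>0 - 1/2\<close>, \<open>b\<^sub>1 = \<alpha>\<^sub>1 - 1/2\<close>, \<open>p = \<alpha>\<^sub>0 + \<alpha>\<^sub>1 - 1\<close>, \<open>L = - ln (1 - T)\<close>.  Under the
  substitution \<open>u = - ln (1 - t)\<close>, \<open>e(t) = sqrt (1 - t) * y(u)\<close>, the eigenvalue equation for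
  \<open>\<lambda> = p / (\<kappa> + b\<^sub>0\<^sup>2)\<close> becomes \<open>y'' = - \<kappa> y\<close> on \<open>[0,L]\<close> with \<open>y(0) = 0\<close>, and the point mass at \<open>T\<close>
  turns into the boundary condition \<open>(\<kappa> - b\<^sub>0 b\<^sub>1) y(L) = p y'(L)\<close>.  So every eigenspace is
  one-dimensional and the eigenvalues are given by the zeros of one function of \<open>\<kappa>\<close>: its positive
  zeros are the zeros of \<open>F\<close>, \<open>\<kappa> = 0\<close> is a zero exactly if \<open>p + b\<^sub>0 b\<^sub>1 L = 0\<close>, and a zero
  \<open>\<kappa> = - \<sigma>\<^sup>2\<close> is a zero \<open>\<sigma>\<close> of \<open>G\<close> and exists exactly if \<open>p + b\<^sub>0 b\<^sub>1 L < 0\<close>.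

  The eigenfunctions are complete because the supremum of the quadratic form of the kernel over the
  unit ball of their orthogonal complement is attained (Arzela-Ascoli) and a maximizer would be one
  more eigenfunction; with the continuity of the kernel this gives Mercer's formula on the diagonal.
  The coefficients \<open>Z\<^sub>k = \<integral> X e\<^sub>k d\<mu>\<close> are uncorrelated and jointly Gaussian, hence independent, and
  Mercer's formula says that the series converges to \<open>X\<^sub>t\<close> in mean square for each \<open>t\<close>.  Levy's
  maximal inequality, applied to increments of the partial sums, carries the modulus of continuity of
  \<open>X\<close> over to all partial sums at once; this upgrades the convergence to almost sure uniform
  convergence.
\<close>

section \<open>Independence from characteristic functions\<close>

text \<open>Two things shape the argument. The covariance is known only on [0,1), eigenfunctions are
  given only almost everywhere, and yet the series must converge at every point. All objects are
  therefore carried to continuous functions on the line: \<open>A f\<close> is continuous as soon as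
  f is square integrable, so an eigenfunction with nonzero eigenvalue has a continuous
  representative, and since \<mu> charges every part of [0,T], identities in mean square hold
  pointwise. The price is an incomplete function space; the maximizer is found as a limit of images
  \<open>A f\<close>, which stays continuous. Secondly, the listed eigenvalues must be shown to be
  all of them. One function of \<kappa>, defined across \<kappa> = 0, makes this possible: its value
  at 0 is -(p + b0 b1 L), and the sign of this number decides whether a zero exists on (0, infinity)
  only, also at 0, or also below 0. There is never more than one nonpositive zero, so a single extra
  index 0 suffices, and the situations of parts (ii) and (iii) exclude each other. The shift by 1/2
  in b0 and b1 stems from the factor sqrt (1 - t), which removes the first-order term of the
  differential equation.\<close>

lemma (in prob_space) weighted_indicator_expectation:
  fixes v Z :: "'a \<Rightarrow> real"
  assumes v[measurable]: "v \<in> borel_measurable M" and v1: "\<And>x. \<bar>v x\<bar> \<le> 1"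
    and Z[measurable]: "Z \<in> borel_measurable M"
    and char: "\<And>\<theta>. (CLINT x|M. v x * iexp (\<theta> * Z x)) = (\<integral>x. v x \<partial>M) * (CLINT x|M. iexp (\<theta> * Z x))"
    and A[measurable]: "A \<in> sets borel"
  shows "(\<integral>x. v x * indicator A (Z x) \<partial>M) = (\<integral>x. v x \<partial>M) * prob (Z -` A \<inter> space M)"
proof -
  \<comment> \<open>The weight \<open>2 + v\<close> is positive, so Levy's uniqueness theorem applies to the reweighted law.\<close>
  define c where "c = 2 + (\<integral>x. v x \<partial>M)"
  have intv: "integrable M v"
    by (rule integrable_const_bound[where B = 1]) (use v1 in auto)
  have "\<bar>\<integral>x. v x \<partial>M\<bar> \<le> 1"
  proof -
    have "\<bar>\<integral>x. v x \<partial>M\<bar> \<le> (\<integral>x. \<bar>v x\<bar> \<partial>M)" by (rule integral_abs_bound)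
    also have "\<dots> \<le> (\<integral>x. 1 \<partial>M)" using intv v1 by (intro integral_mono) auto
    finally show ?thesis by (simp add: prob_space)
  qed
  then have c: "c > 0" by (simp add: c_def)
  define w where "w x = (2 + v x) / c" for x
  have w[measurable]: "w \<in> borel_measurable M" unfolding w_def by measurable
  have w0: "w x \<ge> 0" for x using v1[of x] c by (auto simp: w_def)
  have intw: "integrable M w" unfolding w_def using intv by auto
  have iw: "(\<integral>x. w x \<partial>M) = 1" unfolding w_def using intv c by (simp add: c_def prob_space)
  define N where "N = distr (density M (\<lambda>x. ennreal (w x))) borel Z"
  have pd: "prob_space (density M (\<lambda>x. ennreal (w x)))"
    by (rule prob_spaceI) (use intw w0 iw in \<open>simp add: emeasure_density nn_integral_eq_integral cong:
      nn_integral_cong\<close>)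
  have N: "real_distribution N" unfolding N_def
    using prob_space.real_distribution_distr[OF pd, of Z] by simp
  have D: "real_distribution (distr M borel Z)" by (intro real_distribution_distr) simp
  have eq: "N = distr M borel Z"
  proof (rule Levy_uniqueness[OF N D], rule ext)
    fix \<theta>
    have int1: "integrable M (\<lambda>x. iexp (\<theta> * Z x))"
      by (intro integrable_iexp) auto
    have int2: "integrable M (\<lambda>x. complex_of_real (v x) * iexp (\<theta> * Z x))"
      by (rule integrable_const_bound[where B = 1]) (use v1 in \<open>auto simp: norm_mult\<close>)
    define \<phi> where "\<phi> = (CLINT x|M. iexp (\<theta> * Z x))"
    have "char N \<theta> = (CLINT x|M. w x *\<^sub>R iexp (\<theta> * Z x))"
      unfolding N_def char_def using w0
      by (subst integral_distr) (auto simp: integral_density)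
    also have "\<dots> = (CLINT x|M. (2 / c) * iexp (\<theta> * Z x) + (1/c) * (complex_of_real (v x) * iexp (\<theta> * Z x)))"
      by (intro Bochner_Integration.integral_cong) (auto simp: w_def scaleR_conv_of_real field_simps
        add_divide_distrib)
    also have "\<dots> = (2 / c) * (CLINT x|M. iexp (\<theta> * Z x))
      + (1/c) * (CLINT x|M. complex_of_real (v x) * iexp (\<theta> * Z x))"
      using int1 int2 by (subst Bochner_Integration.integral_add) auto
    also have "\<dots> = (2 / c) * \<phi> + (1/c) * (complex_of_real (c - 2) * \<phi>)"
      unfolding char \<phi>_def by (simp add: c_def)
    also have "\<dots> = ((2 / c) + (1/c) * complex_of_real (c - 2)) * \<phi>"
      by (simp only: distrib_right mult.assoc)
    also have "(2 / c) + (1/c) * complex_of_real (c - 2) = 1"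
      using c by (simp add: field_simps)
    also have "1 * \<phi> = char (distr M borel Z) \<theta>"
      unfolding \<phi>_def char_def by (simp add: integral_distr)
    finally show "char N \<theta> = char (distr M borel Z) \<theta>" .
  qed
  have "measure N A = (\<integral>x. w x * indicator A (Z x) \<partial>M)"
  proof -
    have "measure N A = (\<integral>x. indicator A x \<partial>N)" by (simp add: N_def)
    also have "\<dots> = (\<integral>x. w x *\<^sub>R indicator A (Z x) \<partial>M)"
      unfolding N_def using w0 by (subst integral_distr) (auto simp: integral_density)
    finally show ?thesis by simp
  qed
  moreover have "measure (distr M borel Z) A = prob (Z -` A \<inter> space M)"
    by (simp add: measure_distr)
  moreover have "(\<integral>x. w x * indicator A (Z x) \<partial>M)
     = (2 / c) * prob (Z -` A \<inter> space M) + (1/c) * (\<integral>x. v x * indicator A (Z x) \<partial>M)"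
  proof -
    have i: "(\<integral>x. indicator A (Z x) \<partial>M) = prob (Z -` A \<inter> space M)"
      by (subst Bochner_Integration.integral_cong[where g = "indicator (Z -` A \<inter> space M)"])
         (auto simp: indicator_def)
    have int1: "integrable M (\<lambda>x. indicator A (Z x) :: real)"
      by (rule integrable_const_bound[where B = 1]) auto
    have int2: "integrable M (\<lambda>x. v x * indicator A (Z x))"
      by (rule integrable_const_bound[where B = 1]) (use v1 in \<open>auto simp: indicator_def\<close>)
    have "(\<integral>x. w x * indicator A (Z x) \<partial>M) = (\<integral>x. (2/c) * indicator A (Z x)
      + (1/c) * (v x * indicator A (Z x)) \<partial>M)"
      by (intro Bochner_Integration.integral_cong) (auto simp: w_def field_simps add_divide_distrib)
    also have "\<dots> = (2 / c) * (\<integral>x. indicator A (Z x) \<partial>M) + (1/c) * (\<integral>x. v x * indicator A (Z x) \<partial>M)"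
      using int1 int2 by simp
    finally show ?thesis unfolding i .
  qed
  ultimately have "(2 / c) * prob (Z -` A \<inter> space M) + (1/c) * (\<integral>x. v x * indicator A (Z x) \<partial>M)
    = prob (Z -` A \<inter> space M)"
    using eq by simp
  then have "2 * prob (Z -` A \<inter> space M) + (\<integral>x. v x * indicator A (Z x) \<partial>M) = c * prob (Z -` A \<inter> space M)"
    using c by (simp add: field_simps)
  then show ?thesis unfolding c_def by (simp add: algebra_simps)
qed

text \<open>Cosine and sine of \<open>\<psi>\<close> are combinations of the exponentials of
  \<open>\<psi>\<close> and \<open>- \<psi>\<close>, which is why the hypothesis is asked for
  \<open>s\<close> = 1 and \<open>s\<close> = -1. The two real weights \<open>w * cos \<psi>\<close>
  and \<open>w * sin \<psi>\<close> then fall under the real lemma, and Euler's formula puts the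
  results together.\<close>

lemma (in prob_space) weighted_indicator_expectation_complex:
  fixes w \<psi> Z :: "'a \<Rightarrow> real"
  assumes w[measurable]: "w \<in> borel_measurable M" and w1: "\<And>x. \<bar>w x\<bar> \<le> 1"
    and \<psi>[measurable]: "\<psi> \<in> borel_measurable M"
    and Z[measurable]: "Z \<in> borel_measurable M"
    and char: "\<And>s \<theta>. s \<in> {1, -1::real} \<Longrightarrow> (CLINT x|M. w x * iexp (s * \<psi> x + \<theta> * Z x)) =
       (CLINT x|M. w x * iexp (s * \<psi> x)) * (CLINT x|M. iexp (\<theta> * Z x))"
    and A[measurable]: "A \<in> sets borel"
  shows "(CLINT x|M. complex_of_real (w x * indicator A (Z x)) * iexp (\<psi> x)) =
     (CLINT x|M. w x * iexp (\<psi> x)) * prob (Z -` A \<inter> space M)"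
proof -
  have int: "integrable M (\<lambda>x. complex_of_real (w x) * iexp (s * \<psi> x + \<theta> * Z x))" for s \<theta> :: real
    by (rule integrable_const_bound[where B = 1]) (use w1 in \<open>auto simp: norm_mult\<close>)
  have int0: "integrable M (\<lambda>x. complex_of_real (w x) * iexp (s * \<psi> x))" for s :: real
    using int[of s 0] by simp
  have intc: "integrable M (\<lambda>x. w x * cos (\<psi> x))"
    by (rule integrable_const_bound[where B = 1]) (use w1 in \<open>auto simp: abs_mult intro!: mult_le_one\<close>)
  have ints: "integrable M (\<lambda>x. w x * sin (\<psi> x))"
    by (rule integrable_const_bound[where B = 1]) (use w1 in \<open>auto simp: abs_mult intro!: mult_le_one\<close>)
  have ec: "complex_of_real (cos y) = (iexp y + iexp (-y)) / 2" for y :: real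
    by (simp add: cos_of_real[symmetric] cos_exp_eq)
  have es: "complex_of_real (sin y) = (iexp y - iexp (-y)) / (2 * \<i>)" for y :: real
    by (simp add: sin_of_real[symmetric] sin_exp_eq)
  have es_id: "w' * ((a - b) / (2*\<i>)) * c = (1/(2*\<i>)) * (w' * (a * c)) + (-1/(2*\<i>)) * (w' * (b * c))"
    for w' a b c :: complex
    by (simp add: field_simps)
  have ec_id: "w' * ((a + b) / 2) * c = (1/2) * (w' * (a * c)) + (1/2) * (w' * (b * c))" for w' a b c :: complex
    by (simp add: field_simps)
  have 1: "iexp (s * \<psi> x + \<theta> * Z x) = iexp (s * \<psi> x) * iexp (\<theta> * Z x)" for s \<theta> x
    by (simp add: mult_exp_exp ring_distribs)
  have idc: "complex_of_real (w x * cos (\<psi> x)) * iexp (\<theta> * Z x)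
    = (1/2) * (w x * iexp (1 * \<psi> x + \<theta> * Z x)) + (1/2) * (w x * iexp ((-1) * \<psi> x + \<theta> * Z x))" for x \<theta>
    by (simp only: 1[of 1, unfolded mult_1] 1[of "-1", unfolded mult_minus1] of_real_mult[of "w x"
      "cos (\<psi> x)"] ec ec_id mult_1 mult_minus1)
  have ids: "complex_of_real (w x * sin (\<psi> x)) * iexp (\<theta> * Z x)
    = (1/(2*\<i>)) * (w x * iexp (1 * \<psi> x + \<theta> * Z x)) + (-1/(2*\<i>)) * (w x * iexp ((-1) * \<psi> x + \<theta> * Z x))" for x \<theta>
    by (simp only: 1[of 1, unfolded mult_1] 1[of "-1", unfolded mult_minus1] of_real_mult[of "w x"
      "sin (\<psi> x)"] es es_id mult_1 mult_minus1)
  have idc0: "complex_of_real (w x * cos (\<psi> x))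
    = (1/2) * (w x * iexp (1 * \<psi> x)) + (1/2) * (w x * iexp ((-1) * \<psi> x))" for x
    using idc[of x 0] by simp
  have ids0: "complex_of_real (w x * sin (\<psi> x))
    = (1/(2*\<i>)) * (w x * iexp (1 * \<psi> x)) + (-1/(2*\<i>)) * (w x * iexp ((-1) * \<psi> x))" for x
    using ids[of x 0] by simp
  have C: "(\<integral>x. (w x * cos (\<psi> x)) * indicator A (Z x) \<partial>M) = (\<integral>x. w x * cos (\<psi> x) \<partial>M) * prob (Z -` A \<inter> space M)"
  proof (rule weighted_indicator_expectation)
    show "\<bar>w x * cos (\<psi> x)\<bar> \<le> 1" for x using w1 by (auto simp: abs_mult intro!: mult_le_one)
    fix \<theta>
    have "(CLINT x|M. complex_of_real (w x * cos (\<psi> x)) * iexp (\<theta> * Z x))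
      = (CLINT x|M. (1/2) * (w x * iexp (1 * \<psi> x + \<theta> * Z x)) + (1/2) * (w x * iexp ((-1) * \<psi> x + \<theta> * Z x)))"
      by (simp only: idc)
    also have "\<dots> = (1/2) * (CLINT x|M. w x * iexp (1 * \<psi> x + \<theta> * Z x))
      + (1/2) * (CLINT x|M. (w x * iexp ((-1) * \<psi> x + \<theta> * Z x)))"
      using int[of 1 \<theta>] int[of "-1" \<theta>]
        by (subst Bochner_Integration.integral_add) (simp_all only: integrable_mult_right
        integral_mult_right_zero)
    also have "\<dots> = ((1/2) * (CLINT x|M. w x * iexp (1 * \<psi> x))
      + (1/2) * (CLINT x|M. w x * iexp ((-1) * \<psi> x))) * (CLINT x|M. iexp (\<theta> * Z x))"
      by (subst (1 2) char) (auto simp only: algebra_simps insert_iff)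
    also have "(1/2) * (CLINT x|M. w x * iexp (1 * \<psi> x)) + (1/2) * (CLINT x|M. w x * iexp ((-1) * \<psi> x))
        = (CLINT x|M. (1/2) * (w x * iexp (1 * \<psi> x)) + (1/2) * (w x * iexp ((-1) * \<psi> x)))"
      using int0[of 1] int0[of "-1"]
        by (subst Bochner_Integration.integral_add) (simp_all only: integrable_mult_right
        integral_mult_right_zero)
    also have "\<dots> = (CLINT x|M. complex_of_real (w x * cos (\<psi> x)))"
      by (simp only: idc0)
    also have "\<dots> = complex_of_real (\<integral>x. w x * cos (\<psi> x) \<partial>M)" by (rule integral_complex_of_real)
    finally show "(CLINT x|M. complex_of_real (w x * cos (\<psi> x)) * iexp (\<theta> * Z x)) =
      complex_of_real (\<integral>x. w x * cos (\<psi> x) \<partial>M) * (CLINT x|M. iexp (\<theta> * Z x))" .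
  qed (measurable)
  have S: "(\<integral>x. (w x * sin (\<psi> x)) * indicator A (Z x) \<partial>M) = (\<integral>x. w x * sin (\<psi> x) \<partial>M) * prob (Z -` A \<inter> space M)"
  proof (rule weighted_indicator_expectation)
    show "\<bar>w x * sin (\<psi> x)\<bar> \<le> 1" for x using w1 by (auto simp: abs_mult intro!: mult_le_one)
    fix \<theta>
    have "(CLINT x|M. complex_of_real (w x * sin (\<psi> x)) * iexp (\<theta> * Z x))
      = (CLINT x|M. (1/(2*\<i>)) * (w x * iexp (1 * \<psi> x + \<theta> * Z x)) + (-1/(2*\<i>)) * (w x * iexp ((-1) * \<psi> x
        + \<theta> * Z x)))"
      by (simp only: ids)
    also have "\<dots> = (1/(2*\<i>)) * (CLINT x|M. w x * iexp (1 * \<psi> x + \<theta> * Z x))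
      + (-1/(2*\<i>)) * (CLINT x|M. (w x * iexp ((-1) * \<psi> x + \<theta> * Z x)))"
      using int[of 1 \<theta>] int[of "-1" \<theta>]
        by (subst Bochner_Integration.integral_add) (simp_all only: integrable_mult_right
        integral_mult_right_zero)
    also have "\<dots> = ((1/(2*\<i>)) * (CLINT x|M. w x * iexp (1 * \<psi> x))
      + (-1/(2*\<i>)) * (CLINT x|M. w x * iexp ((-1) * \<psi> x))) * (CLINT x|M. iexp (\<theta> * Z x))"
      by (subst (1 2) char) (auto simp only: algebra_simps insert_iff)
    also have "(1/(2*\<i>)) * (CLINT x|M. w x * iexp (1 * \<psi> x)) + (-1/(2*\<i>)) * (CLINT x|M. w x * iexp ((-1) * \<psi> x))
        = (CLINT x|M. (1/(2*\<i>)) * (w x * iexp (1 * \<psi> x)) + (-1/(2*\<i>)) * (w x * iexp ((-1) * \<psi> x)))"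
      using int0[of 1] int0[of "-1"]
        by (subst Bochner_Integration.integral_add) (simp_all only: integrable_mult_right
        integral_mult_right_zero)
    also have "\<dots> = (CLINT x|M. complex_of_real (w x * sin (\<psi> x)))"
      by (simp only: ids0)
    also have "\<dots> = complex_of_real (\<integral>x. w x * sin (\<psi> x) \<partial>M)" by (rule integral_complex_of_real)
    finally show "(CLINT x|M. complex_of_real (w x * sin (\<psi> x)) * iexp (\<theta> * Z x)) =
      complex_of_real (\<integral>x. w x * sin (\<psi> x) \<partial>M) * (CLINT x|M. iexp (\<theta> * Z x))" .
  qed (measurable)
  have eq: "iexp y = complex_of_real (cos y) + \<i> * complex_of_real (sin y)" for y :: real
    by (simp add: exp_Euler cos_of_real sin_of_real)
  have split: "(CLINT x|M. complex_of_real (u x) * iexp (\<psi> x)) =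
      complex_of_real (\<integral>x. u x * cos (\<psi> x) \<partial>M) + \<i> * complex_of_real (\<integral>x. u x * sin (\<psi> x) \<partial>M)"
    if "integrable M (\<lambda>x. u x * cos (\<psi> x))" "integrable M (\<lambda>x. u x * sin (\<psi> x))" for u :: "'a \<Rightarrow> real"
  proof -
    have "(CLINT x|M. complex_of_real (u x) * iexp (\<psi> x)) =
      (CLINT x|M. complex_of_real (u x * cos (\<psi> x)) + \<i> * complex_of_real (u x * sin (\<psi> x)))"
      by (intro Bochner_Integration.integral_cong) (auto simp: eq ring_distribs)
    also have "\<dots> = (CLINT x|M. complex_of_real (u x * cos (\<psi> x)))
      + \<i> * (CLINT x|M. complex_of_real (u x * sin (\<psi> x)))"
      using that by (subst Bochner_Integration.integral_add) (simp_all only: integrable_mult_right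
        integrable_of_real integral_mult_right_zero)
    finally show ?thesis unfolding integral_complex_of_real .
  qed
  have intc': "integrable M (\<lambda>x. (w x * indicator A (Z x)) * cos (\<psi> x))"
    by (rule integrable_const_bound[where B = 1]) (use w1 in \<open>auto simp: abs_mult indicator_def intro!:
      mult_le_one\<close>)
  have ints': "integrable M (\<lambda>x. (w x * indicator A (Z x)) * sin (\<psi> x))"
    by (rule integrable_const_bound[where B = 1]) (use w1 in \<open>auto simp: abs_mult indicator_def intro!:
      mult_le_one\<close>)
  show ?thesis
    unfolding split[OF intc' ints'] split[OF intc ints]
    using C S by (simp add: algebra_simps)
qed

text \<open>Kac's criterion. Exponentials are traded for indicators one variable at a time; once all
  are traded, the identity is the product rule for probabilities.\<close>

lemma (in prob_space) indep_vars_if_char_factorizes: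
  fixes Z :: "'i \<Rightarrow> 'a \<Rightarrow> real"
  assumes Z: "\<And>i. i \<in> I \<Longrightarrow> Z i \<in> borel_measurable M"
    and char: "\<And>J \<theta>. finite J \<Longrightarrow> J \<subseteq> I \<Longrightarrow>
      (CLINT x|M. iexp (\<Sum>j\<in>J. \<theta> j * Z j x)) = (\<Prod>j\<in>J. (CLINT x|M. iexp (\<theta> j * Z j x)))"
  shows "indep_vars (\<lambda>_. borel) Z I"
proof -
  \<comment> \<open>\<open>J\<close> holds the indices that already carry an indicator,
    \<open>H\<close> those that still carry an exponential. The induction moves one index from
    \<open>H\<close> to \<open>J\<close>, so \<open>H\<close> and the frequencies must stay
    arbitrary.\<close>
  have key: "(CLINT x|M. complex_of_real (\<Prod>j\<in>J. indicator (A j) (Z j x)) * iexp (\<Sum>h\<in>H. \<theta> h * Z h x))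
     = complex_of_real (\<Prod>j\<in>J. prob (Z j -` A j \<inter> space M)) * (\<Prod>h\<in>H. (CLINT x|M. iexp (\<theta> h * Z h x)))"
    if "finite J" "finite H" "J \<inter> H = {}" "J \<subseteq> I" "H \<subseteq> I" "\<And>j. j \<in> J \<Longrightarrow> A j \<in> sets borel"
      for J H \<theta> and A :: "'i \<Rightarrow> real set"
    using that
  proof (induction J arbitrary: H \<theta> rule: finite_induct)
    case empty
    then have H: "finite H" "H \<subseteq> I" by auto
    show ?case by (simp only: char[OF H] prod.empty of_real_1 mult_1)
  next
    case (insert i J)
    have H: "finite H" "i \<notin> H" "J \<inter> H = {}" and J: "finite J" "i \<notin> J" "i \<in> I" "J \<subseteq> I" and HI: "H \<subseteq> I"
      using insert.prems(1-4) insert.hyps by auto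
    have Ai[measurable]: "A i \<in> sets borel" and AJ: "\<And>j. j \<in> J \<Longrightarrow> A j \<in> sets borel"
      using insert.prems(5) by auto
    have H1: "finite (insert i H)" "J \<inter> insert i H = {}" "insert i H \<subseteq> I"
      using H J HI by auto
    note IH = insert.IH[OF _ _ \<open>J \<subseteq> I\<close> _ AJ]
    define w where "w x = (\<Prod>j\<in>J. indicator (A j) (Z j x) :: real)" for x
    define \<psi> where "\<psi> x = (\<Sum>h\<in>H. \<theta> h * Z h x)" for x
    have [measurable]: "w \<in> borel_measurable M" unfolding w_def
    proof (intro borel_measurable_prod)
      fix j assume "j \<in> J"
      then have [measurable]: "A j \<in> sets borel" "Z j \<in> borel_measurable M" using AJ Z J(4) by blast+
      show "(\<lambda>x. indicator (A j) (Z j x) :: real) \<in> borel_measurable M" by measurable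
    qed
    have [measurable]: "\<psi> \<in> borel_measurable M" unfolding \<psi>_def
      using HI Z by (intro borel_measurable_sum borel_measurable_times) (blast intro: borel_measurable_const)+
    have Zi[measurable]: "Z i \<in> borel_measurable M" using Z J(3) .
    have w1: "\<bar>w x\<bar> \<le> 1" for x
      unfolding w_def abs_prod by (intro prod_le_1) (auto simp: indicator_def)
    have ch: "(CLINT x|M. w x * iexp (s * \<psi> x + \<eta> * Z i x)) =
       (CLINT x|M. w x * iexp (s * \<psi> x)) * (CLINT x|M. iexp (\<eta> * Z i x))" for s \<eta> :: real
    proof -
      \<comment> \<open>The induction hypothesis is used with \<open>i\<close> still among the
        exponentials, at a free frequency \<open>\<eta>\<close>; comparison with the same identity
        without \<open>i\<close> yields the factorization that the weighted lemma asks for.\<close>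
      define \<theta>' where "\<theta>' = (\<lambda>h. if h = i then \<eta> else s * \<theta> h)"
      have "(\<Sum>h\<in>insert i H. \<theta>' h * Z h x) = s * \<psi> x + \<eta> * Z i x" for x
      proof -
        have "(\<Sum>h\<in>H. \<theta>' h * Z h x) = (\<Sum>h\<in>H. s * (\<theta> h * Z h x))"
          using H(2) by (intro sum.cong) (auto simp: \<theta>'_def)
        then show ?thesis unfolding sum.insert[OF H(1,2)] \<psi>_def sum_distrib_left by (simp add: \<theta>'_def)
      qed
      moreover have "(\<Prod>h\<in>insert i H. (CLINT x|M. iexp (\<theta>' h * Z h x))) =
          (\<Prod>h\<in>H. (CLINT x|M. iexp ((s * \<theta> h) * Z h x))) * (CLINT x|M. iexp (\<eta> * Z i x))"
      proof -
        have "(\<Prod>h\<in>H. (CLINT x|M. iexp (\<theta>' h * Z h x))) = (\<Prod>h\<in>H. (CLINT x|M. iexp ((s * \<theta> h) * Z h x)))"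
          using H(2) by (intro prod.cong) (auto simp: \<theta>'_def)
        then show ?thesis unfolding prod.insert[OF H(1,2)] by (simp add: \<theta>'_def)
      qed
      ultimately have 1: "(CLINT x|M. w x * iexp (s * \<psi> x + \<eta> * Z i x)) =
          complex_of_real (\<Prod>j\<in>J. prob (Z j -` A j \<inter> space M)) *
          ((\<Prod>h\<in>H. (CLINT x|M. iexp ((s * \<theta> h) * Z h x))) * (CLINT x|M. iexp (\<eta> * Z i x)))"
        using IH[of "insert i H" \<theta>', OF H1] by (simp only: w_def)
      have "(\<Sum>h\<in>H. (s * \<theta> h) * Z h x) = s * \<psi> x" for x
        by (simp add: \<psi>_def sum_distrib_left mult.assoc)
      then have 2: "(CLINT x|M. w x * iexp (s * \<psi> x)) =
          complex_of_real (\<Prod>j\<in>J. prob (Z j -` A j \<inter> space M)) *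
          (\<Prod>h\<in>H. (CLINT x|M. iexp ((s * \<theta> h) * Z h x)))"
        using IH[of H "\<lambda>h. s * \<theta> h", OF H(1,3) HI] by (simp only: w_def)
      show ?thesis unfolding 1 2 by simp
    qed
    have "(CLINT x|M. complex_of_real (w x * indicator (A i) (Z i x)) * iexp (\<psi> x)) =
     (CLINT x|M. w x * iexp (\<psi> x)) * prob (Z i -` A i \<inter> space M)"
      using ch w1 by (intro weighted_indicator_expectation_complex) auto
    also have "(CLINT x|M. w x * iexp (\<psi> x)) = complex_of_real (\<Prod>j\<in>J. prob (Z j -` A j \<inter> space M)) *
          (\<Prod>h\<in>H. (CLINT x|M. iexp (\<theta> h * Z h x)))"
      using IH[of H \<theta>, OF H(1,3) HI] by (simp only: w_def \<psi>_def)
    finally show ?case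
      by (simp only: prod.insert[OF insert.hyps] w_def \<psi>_def of_real_mult mult_ac)
  qed
  have fin: "indep_vars (\<lambda>_. borel) Z J" if J: "finite J" "J \<subseteq> I" "J \<noteq> {}" for J
  proof (subst indep_vars_finite[where E = "\<lambda>_. sets borel"])
    show "J \<noteq> {}" "finite J" by fact+
    show "sets borel = sigma_sets (space borel) (sets (borel :: real measure))"
      by (rule sets.sigma_sets_eq[symmetric])
    show "Z i \<in> borel_measurable M" if "i \<in> J" for i using Z that J by auto
    show "Int_stable (sets (borel :: real measure))" by (auto simp: Int_stable_def)
    show "space borel \<in> sets (borel :: real measure)" by simp
    show "sets borel \<subseteq> Pow (space (borel :: real measure))" by simp
    show "\<forall>A\<in>J \<rightarrow> sets borel. prob (\<Inter>j\<in>J. Z j -` A j \<inter> space M) = (\<Prod>j\<in>J. prob (Z j -` A j \<inter> space M))"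
    proof
      fix A :: "'i \<Rightarrow> real set" assume A: "A \<in> J \<rightarrow> sets borel"
      have "complex_of_real (\<Prod>j\<in>J. prob (Z j -` A j \<inter> space M)) =
         (CLINT x|M. complex_of_real (\<Prod>j\<in>J. indicator (A j) (Z j x)))"
        using key[of J "{}" A "\<lambda>_. 0"] J A by (simp add: Pi_iff)
      also have "\<dots> = complex_of_real (\<integral>x. (\<Prod>j\<in>J. indicator (A j) (Z j x)) \<partial>M)"
        by (rule integral_complex_of_real)
      also have "(\<integral>x. (\<Prod>j\<in>J. indicator (A j) (Z j x)) \<partial>M)
        = (\<integral>x. indicator (\<Inter>j\<in>J. Z j -` A j \<inter> space M) x \<partial>M :: real)"
      proof (intro Bochner_Integration.integral_cong refl)
        fix x assume "x \<in> space M"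
        then have "indicator (A j) (Z j x) = (indicator (Z j -` A j \<inter> space M) x :: real)" for j
          by (auto simp: indicator_def)
        then show "(\<Prod>j\<in>J. indicator (A j) (Z j x)) = (indicator (\<Inter>j\<in>J. Z j -` A j \<inter> space M) x :: real)"
          using J by (auto simp: indicator_def prod_zero_iff cong: prod.cong)
      qed
      also have "\<dots> = prob (\<Inter>j\<in>J. Z j -` A j \<inter> space M)"
        using J by (subst Bochner_Integration.integral_indicator) (auto intro!: arg_cong[where f = prob])
      finally show "prob (\<Inter>j\<in>J. Z j -` A j \<inter> space M) = (\<Prod>j\<in>J. prob (Z j -` A j \<inter> space M))"
        by (simp only: of_real_eq_iff)
    qed
  qed
  show ?thesis
    unfolding indep_vars_def2
  proof
    show "\<forall>i\<in>I. random_variable borel (Z i)" using Z by auto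
    show "indep_sets (\<lambda>i. {Z i -` A \<inter> space M |A. A \<in> sets borel}) I"
      using fin unfolding indep_vars_def2 by (subst indep_sets_finite_index_sets) auto
  qed
qed

section \<open>Uniform convergence of sums of independent symmetric terms\<close>

text \<open>Reflection at the first passage: changing the signs of all terms after index n preserves
  the joint law and the event that n is the first passage. The n-th sum is the mean of the full sum
  and the reflected full sum, so one of these exceeds the level too. Since x ranges over a countable
  set of coefficient vectors, the inequality controls suprema over x, such as a modulus of
  continuity.\<close>

lemma (in prob_space) levy_maximal_inequality:
  fixes Z :: "nat \<Rightarrow> 'a \<Rightarrow> real" and v :: "'x \<Rightarrow> nat \<Rightarrow> real"
  assumes indep: "indep_vars (\<lambda>_. borel) Z UNIV"
    and sym: "\<And>i. distr M borel (\<lambda>\<omega>. - Z i \<omega>) = distr M borel (Z i)"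
    and D: "countable D"
  shows "prob {\<omega>\<in>space M. \<exists>n\<le>m. \<exists>x\<in>D. \<epsilon> < \<bar>\<Sum>i\<le>n. v x i * Z i \<omega>\<bar>}
    \<le> 2 * prob {\<omega>\<in>space M. \<exists>x\<in>D. \<epsilon> < \<bar>\<Sum>i\<le>m. v x i * Z i \<omega>\<bar>}"
proof -
  define J where "J = {..m}"
  define Q where "Q = PiM J (\<lambda>_. borel :: real measure)"
  define S where "S n x z = (\<Sum>i\<le>n. v x i * z i)" for n x and z :: "nat \<Rightarrow> real"
  define B where "B n = {z\<in>space Q. \<exists>x\<in>D. \<epsilon> < \<bar>S n x z\<bar>}" for n
  \<comment> \<open>First passage at index n. These events are disjoint, and they depend on the
    first n + 1 coordinates only.\<close>
  define A where "A n = B n - (\<Union>k<n. B k)" for n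
  define r where "r \<omega> = restrict (\<lambda>i. Z i \<omega>) J" for \<omega>
  \<comment> \<open>The reflected vector. By independence both vectors have a product law, and by
    symmetry the factors agree.\<close>
  define r' where "r' n \<omega> = restrict (\<lambda>i. if i \<le> n then Z i \<omega> else - Z i \<omega>) J" for n \<omega>
  have Z[measurable]: "Z i \<in> borel_measurable M" for i using indep by (auto simp: indep_vars_def)
  have B[measurable]: "B n \<in> sets Q" if "n \<le> m" for n
  proof -
    have "(\<lambda>z. S n x z) \<in> borel_measurable Q" for x
      unfolding S_def Q_def using that
      by (intro borel_measurable_sum borel_measurable_times measurable_component_singleton) (auto simp: J_def)
    then have "{z\<in>space Q. \<epsilon> < \<bar>S n x z\<bar>} \<in> sets Q" for x by measurable
    then have "(\<Union>x\<in>D. {z\<in>space Q. \<epsilon> < \<bar>S n x z\<bar>}) \<in> sets Q" using D by (intro sets.countable_UN') auto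
    also have "(\<Union>x\<in>D. {z\<in>space Q. \<epsilon> < \<bar>S n x z\<bar>}) = B n" by (auto simp: B_def)
    finally show ?thesis .
  qed
  have A[measurable]: "A n \<in> sets Q" if "n \<le> m" for n
    unfolding A_def using that by (intro sets.Diff sets.finite_UN) auto
  have r[measurable]: "r \<in> measurable M Q" unfolding r_def Q_def by measurable
  have r'[measurable]: "r' n \<in> measurable M Q" for n unfolding r'_def Q_def by measurable
  have law: "distr M Q (r' n) = distr M Q r" for n
  proof -
    have J0: "J \<noteq> {}" by (auto simp: J_def)
    have i1: "indep_vars (\<lambda>_. borel) Z J" using indep by (rule indep_vars_subset) auto
    have i2: "indep_vars (\<lambda>_. borel) (\<lambda>i \<omega>. if i \<le> n then Z i \<omega> else - Z i \<omega>) J"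
      by (rule indep_vars_compose2[OF i1, where Y = "\<lambda>i x. if i \<le> n then x else - x", simplified]) simp
    have "distr M Q r = PiM J (\<lambda>i. distr M borel (Z i))"
      using i1 unfolding Q_def r_def by (subst (asm) indep_vars_iff_distr_eq_PiM'[OF J0]) auto
    also have "\<dots> = PiM J (\<lambda>i. distr M borel (\<lambda>\<omega>. if i \<le> n then Z i \<omega> else - Z i \<omega>))"
    proof (intro PiM_cong refl)
      fix i show "distr M borel (Z i) = distr M borel (\<lambda>\<omega>. if i \<le> n then Z i \<omega> else - Z i \<omega>)"
        by (cases "i \<le> n") (simp_all add: sym)
    qed
    also have "\<dots> = distr M Q (r' n)"
      using i2 unfolding Q_def r'_def by (subst (asm) indep_vars_iff_distr_eq_PiM'[OF J0]) auto
    finally show ?thesis ..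
  qed
  have flip: "prob {\<omega>\<in>space M. r' n \<omega> \<in> C} = prob {\<omega>\<in>space M. r \<omega> \<in> C}" if "C \<in> sets Q" for n C
  proof -
    have "measure (distr M Q (r' n)) C = measure (distr M Q r) C" by (simp add: law)
    then show ?thesis using that
      by (simp add: measure_distr vimage_def Int_def conj_commute)
  qed
  have Sr: "S n x (r \<omega>) = (\<Sum>i\<le>n. v x i * Z i \<omega>)" if "n \<le> m" for n x \<omega>
    unfolding S_def r_def using that by (intro sum.cong) (auto simp: J_def)
  have Sr': "S k x (r' n \<omega>) = S k x (r \<omega>)" if "k \<le> n" "n \<le> m" for k n x \<omega>
    unfolding S_def r_def r'_def using that by (intro sum.cong) (auto simp: J_def)
  have rsp: "r \<omega> \<in> space Q" "r' n \<omega> \<in> space Q" if "\<omega> \<in> space M" for \<omega> n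
    using that measurable_space[OF r] measurable_space[OF r'] by auto
  have Ainv: "r' n \<omega> \<in> A n \<longleftrightarrow> r \<omega> \<in> A n" if "\<omega> \<in> space M" "n \<le> m" for n \<omega>
    using that rsp by (auto simp: A_def B_def Sr')
  have avg: "S n x (r \<omega>) = (S m x (r \<omega>) + S m x (r' n \<omega>)) / 2" if "n \<le> m" for n x \<omega>
  proof -
    have "S m x (r \<omega>) + S m x (r' n \<omega>) = (\<Sum>i\<le>m. if i \<le> n then 2 * (v x i * Z i \<omega>) else 0)"
      unfolding S_def r_def r'_def sum.distrib[symmetric] by (intro sum.cong) (auto simp: J_def)
    also have "\<dots> = (\<Sum>i\<le>n. 2 * (v x i * Z i \<omega>))"
      using that by (intro sum.mono_neutral_cong_right) auto
    also have "\<dots> = 2 * S n x (r \<omega>)" unfolding Sr[OF that] by (simp add: sum_distrib_left)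
    finally show ?thesis by simp
  qed
  have half: "prob {\<omega>\<in>space M. r \<omega> \<in> A n} \<le> 2 * prob {\<omega>\<in>space M. r \<omega> \<in> A n \<inter> B m}" if n: "n \<le> m" for n
  proof -
    have [measurable]: "A n \<in> sets Q" "B m \<in> sets Q" using n by auto
    have "prob {\<omega>\<in>space M. r \<omega> \<in> A n} \<le> prob ({\<omega>\<in>space M. r \<omega> \<in> A n \<inter> B m} \<union> {\<omega>\<in>space M. r' n \<omega> \<in> A n \<inter> B m})"
    proof (intro finite_measure_mono)
      show "{\<omega>\<in>space M. r \<omega> \<in> A n} \<subseteq> {\<omega>\<in>space M. r \<omega> \<in> A n \<inter> B m} \<union> {\<omega>\<in>space M. r' n \<omega> \<in> A n \<inter> B m}"
      proof
        fix \<omega> assume "\<omega> \<in> {\<omega>\<in>space M. r \<omega> \<in> A n}"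
        then have w: "\<omega> \<in> space M" and a: "r \<omega> \<in> A n" by auto
        then obtain x where x: "x \<in> D" "\<epsilon> < \<bar>S n x (r \<omega>)\<bar>" by (auto simp: A_def B_def)
        then have "\<epsilon> < \<bar>S m x (r \<omega>)\<bar> \<or> \<epsilon> < \<bar>S m x (r' n \<omega>)\<bar>"
          using avg[OF n, of x \<omega>] abs_triangle_ineq[of "S m x (r \<omega>)" "S m x (r' n \<omega>)"] by simp linarith
        then have "r \<omega> \<in> B m \<or> r' n \<omega> \<in> B m" using x rsp[OF w] by (auto simp: B_def)
        then show "\<omega> \<in> {\<omega>\<in>space M. r \<omega> \<in> A n \<inter> B m} \<union> {\<omega>\<in>space M. r' n \<omega> \<in> A n \<inter> B m}"
          using w a Ainv[OF w n] by auto
      qed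
    qed measurable
    also have "\<dots> \<le> prob {\<omega>\<in>space M. r \<omega> \<in> A n \<inter> B m} + prob {\<omega>\<in>space M. r' n \<omega> \<in> A n \<inter> B m}"
      by (intro measure_Un_le) measurable
    also have "\<dots> = 2 * prob {\<omega>\<in>space M. r \<omega> \<in> A n \<inter> B m}"
      by (subst flip) auto
    finally show ?thesis .
  qed
  have disj: "disjoint_family_on (\<lambda>n. {\<omega>\<in>space M. r \<omega> \<in> A n} \<inter> C) {..m}" for C
    unfolding disjoint_family_on_def A_def
  proof (intro ballI impI)
    fix i j :: nat assume "i \<noteq> j"
    then consider "i < j" | "j < i" by linarith
    then show "{\<omega> \<in> space M. r \<omega> \<in> B i - \<Union> (B ` {..<i})} \<inter> C \<inter> ({\<omega> \<in> space M. r \<omega> \<in> B j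
      - \<Union> (B ` {..<j})} \<inter> C) = {}"
      by cases auto
  qed
  have BA: "(\<exists>n\<le>m. z \<in> B n) \<longleftrightarrow> (\<exists>n\<le>m. z \<in> A n)" for z
  proof
    assume "\<exists>n\<le>m. z \<in> B n"
    then obtain n where n: "n \<le> m" "z \<in> B n" by auto
    define k where "k = (LEAST k. z \<in> B k)"
    have "z \<in> B k" "k \<le> n" unfolding k_def using n(2) by (auto intro: LeastI Least_le)
    moreover have "z \<notin> B j" if "j < k" for j using that not_less_Least unfolding k_def by blast
    ultimately show "\<exists>n\<le>m. z \<in> A n" using n by (auto simp: A_def intro!: exI[of _ k])
  qed (auto simp: A_def)
  have Am: "{\<omega> \<in> space M. r \<omega> \<in> A n} \<in> events" if "n \<le> m" for n using A[OF that] by measurable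
  have Bm: "{\<omega> \<in> space M. r \<omega> \<in> B n} \<in> events" if "n \<le> m" for n using B[OF that] by measurable
  have "{\<omega>\<in>space M. \<exists>n\<le>m. \<exists>x\<in>D. \<epsilon> < \<bar>\<Sum>i\<le>n. v x i * Z i \<omega>\<bar>} = {\<omega>\<in>space M. \<exists>n\<le>m. r \<omega> \<in> B n}"
    by (intro Collect_cong conj_cong refl ex_cong1) (simp add: B_def Sr rsp(1))
  also have "\<dots> = (\<Union>n\<le>m. {\<omega>\<in>space M. r \<omega> \<in> A n} \<inter> space M)"
    unfolding BA by auto
  also have "prob \<dots> = (\<Sum>n\<le>m. prob ({\<omega>\<in>space M. r \<omega> \<in> A n} \<inter> space M))"
    using Am disj by (intro finite_measure_finite_Union) auto
  also have "\<dots> \<le> (\<Sum>n\<le>m. 2 * prob ({\<omega>\<in>space M. r \<omega> \<in> A n} \<inter> {\<omega>\<in>space M. r \<omega> \<in> B m}))"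
  proof (intro sum_mono)
    fix n assume "n \<in> {..m}"
    then show "prob ({\<omega>\<in>space M. r \<omega> \<in> A n} \<inter> space M)
      \<le> 2 * prob ({\<omega>\<in>space M. r \<omega> \<in> A n} \<inter> {\<omega>\<in>space M. r \<omega> \<in> B m})"
      using half[of n] by (simp add: Int_def Collect_conj_eq[symmetric] cong: conj_cong)
  qed
  also have "\<dots> = 2 * prob (\<Union>n\<le>m. {\<omega>\<in>space M. r \<omega> \<in> A n} \<inter> {\<omega>\<in>space M. r \<omega> \<in> B m})"
    using Am Bm disj by (subst finite_measure_finite_Union) (auto simp: sum_distrib_left)
  also have "\<dots> \<le> 2 * prob {\<omega>\<in>space M. r \<omega> \<in> B m}"
    using Bm[of m] by (intro mult_left_mono finite_measure_mono) auto
  also have "{\<omega>\<in>space M. r \<omega> \<in> B m} = {\<omega>\<in>space M. \<exists>x\<in>D. \<epsilon> < \<bar>\<Sum>i\<le>m. v x i * Z i \<omega>\<bar>}"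
    by (intro Collect_cong conj_cong refl) (simp add: B_def Sr rsp(1))
  finally show ?thesis .
qed

lemma measurable_Bex_countable:
  fixes g :: "'x \<Rightarrow> 'a \<Rightarrow> real"
  assumes "countable D" "\<And>x. x \<in> D \<Longrightarrow> g x \<in> borel_measurable M"
  shows "{\<omega>\<in>space M. \<exists>x\<in>D. \<epsilon> < \<bar>g x \<omega>\<bar>} \<in> sets M"
proof -
  have "{\<omega>\<in>space M. \<epsilon> < \<bar>g x \<omega>\<bar>} \<in> sets M" if "x \<in> D" for x
    using assms(2)[OF that] by measurable
  then have "(\<Union>x\<in>D. {\<omega>\<in>space M. \<epsilon> < \<bar>g x \<omega>\<bar>}) \<in> sets M"
    using assms(1) by (intro sets.countable_UN') auto
  also have "(\<Union>x\<in>D. {\<omega>\<in>space M. \<epsilon> < \<bar>g x \<omega>\<bar>}) = {\<omega>\<in>space M. \<exists>x\<in>D. \<epsilon> < \<bar>g x \<omega>\<bar>}" by auto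
  finally show ?thesis .
qed

text \<open>Convergence in probability is available for each x separately, hence jointly only for
  finitely many x. The maximal inequality is applied on a finite part of \<open>D\<close>, where the
  gap between \<open>\<epsilon>'\<close> and \<open>\<epsilon>\<close> absorbs the distance to the
  limit; then the finite parts grow.\<close>

lemma (in prob_space) levy_maximal_inequality_limit:
  fixes Z :: "nat \<Rightarrow> 'a \<Rightarrow> real" and v :: "'x \<Rightarrow> nat \<Rightarrow> real" and y :: "'x \<Rightarrow> 'a \<Rightarrow> real"
  assumes indep: "indep_vars (\<lambda>_. borel) Z UNIV"
    and sym: "\<And>i. distr M borel (\<lambda>\<omega>. - Z i \<omega>) = distr M borel (Z i)"
    and D: "countable D"
    and y: "\<And>x. x \<in> D \<Longrightarrow> y x \<in> borel_measurable M"
    and conv: "\<And>x \<delta>. x \<in> D \<Longrightarrow> 0 < \<delta> \<Longrightarrow>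
      (\<lambda>m. prob {\<omega>\<in>space M. \<delta> < \<bar>(\<Sum>i\<le>m. v x i * Z i \<omega>) - y x \<omega>\<bar>}) \<longlonglongrightarrow> 0"
    and \<epsilon>: "\<epsilon>' < \<epsilon>"
  shows "prob {\<omega>\<in>space M. \<exists>n. \<exists>x\<in>D. \<epsilon> < \<bar>\<Sum>i\<le>n. v x i * Z i \<omega>\<bar>}
    \<le> 2 * prob {\<omega>\<in>space M. \<exists>x\<in>D. \<epsilon>' < \<bar>y x \<omega>\<bar>}"
proof (cases "D = {}")
  case False
  define S where "S n x \<omega> = (\<Sum>i\<le>n. v x i * Z i \<omega>)" for n x \<omega>
  have Z[measurable]: "Z i \<in> borel_measurable M" for i using indep by (auto simp: indep_vars_def)
  have S[measurable]: "S n x \<in> borel_measurable M" for n x unfolding S_def by measurable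
  define Dk where "Dk k = from_nat_into D ` {..k}" for k
  have Dk: "finite (Dk k)" "Dk k \<subseteq> D" for k
    using from_nat_into[OF False] by (auto simp: Dk_def)
  have Dmono: "Dk i \<subseteq> Dk j" if "i \<le> j" for i j using that by (auto simp: Dk_def)
  have DU: "\<exists>k. x \<in> Dk k" if "x \<in> D" for x
    using from_nat_into_surj[OF D that] by (auto simp: Dk_def)
  \<comment> \<open>One parameter bounds the number of terms and the set of coefficient vectors
    together, so a single increasing union exhausts the event.\<close>
  define E where "E k = {\<omega>\<in>space M. \<exists>n\<le>k. \<exists>x\<in>Dk k. \<epsilon> < \<bar>S n x \<omega>\<bar>}" for k
  have Em: "E k \<in> events" for k
  proof -
    have "(\<Union>n\<le>k. {\<omega>\<in>space M. \<exists>x\<in>Dk k. \<epsilon> < \<bar>S n x \<omega>\<bar>}) \<in> events"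
      using Dk(1)[of k] by (intro sets.finite_UN measurable_Bex_countable) (auto simp: countable_finite)
    also have "(\<Union>n\<le>k. {\<omega>\<in>space M. \<exists>x\<in>Dk k. \<epsilon> < \<bar>S n x \<omega>\<bar>}) = E k" by (auto simp: E_def)
    finally show ?thesis .
  qed
  have bound: "prob (E k) \<le> 2 * prob {\<omega>\<in>space M. \<exists>x\<in>D. \<epsilon>' < \<bar>y x \<omega>\<bar>}" (is "_ \<le> 2 * ?p") for k
  proof (rule tendsto_lowerbound)
    let ?b = "\<lambda>m. 2 * (?p + (\<Sum>x\<in>Dk k. prob {\<omega>\<in>space M. \<epsilon> - \<epsilon>' < \<bar>S m x \<omega> - y x \<omega>\<bar>}))"
    have "?b \<longlonglongrightarrow> 2 * (?p + (\<Sum>x\<in>Dk k. 0))"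
    proof (intro tendsto_mult tendsto_add tendsto_const tendsto_sum)
      fix x assume "x \<in> Dk k"
      then show "(\<lambda>m. prob {\<omega>\<in>space M. \<epsilon> - \<epsilon>' < \<bar>S m x \<omega> - y x \<omega>\<bar>}) \<longlonglongrightarrow> 0"
        unfolding S_def using Dk(2)[of k] \<epsilon> by (intro conv) auto
    qed
    then show "?b \<longlonglongrightarrow> 2 * ?p" by simp
    show "\<forall>\<^sub>F m in sequentially. prob (E k) \<le> ?b m"
      using eventually_ge_at_top[of k]
    proof eventually_elim
      case (elim m)
      have cF: "countable (Dk k)" using Dk by (simp add: countable_finite)
      have ev1: "{\<omega>\<in>space M. \<exists>n\<le>m. \<exists>x\<in>Dk k. \<epsilon> < \<bar>S n x \<omega>\<bar>} \<in> events"
      proof -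
        have "(\<Union>n\<le>m. {\<omega>\<in>space M. \<exists>x\<in>Dk k. \<epsilon> < \<bar>S n x \<omega>\<bar>}) \<in> events"
          using cF by (intro sets.finite_UN measurable_Bex_countable) auto
        also have "(\<Union>n\<le>m. {\<omega>\<in>space M. \<exists>x\<in>Dk k. \<epsilon> < \<bar>S n x \<omega>\<bar>}) = {\<omega>\<in>space M. \<exists>n\<le>m. \<exists>x\<in>Dk k. \<epsilon> < \<bar>S n x \<omega>\<bar>}"
          by auto
        finally show ?thesis .
      qed
      have ev2: "{\<omega>\<in>space M. \<epsilon> - \<epsilon>' < \<bar>S m x \<omega> - y x \<omega>\<bar>} \<in> events" if "x \<in> Dk k" for x
      proof -
        have [measurable]: "y x \<in> borel_measurable M" using that Dk(2)[of k] y by auto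
        show ?thesis by measurable
      qed
      have ev3: "{\<omega>\<in>space M. \<exists>x\<in>D. \<epsilon>' < \<bar>y x \<omega>\<bar>} \<in> events"
        using D y by (intro measurable_Bex_countable) auto
      have "prob (E k) \<le> prob {\<omega>\<in>space M. \<exists>n\<le>m. \<exists>x\<in>Dk k. \<epsilon> < \<bar>S n x \<omega>\<bar>}"
      proof (rule finite_measure_mono[OF _ ev1], rule subsetI)
        fix \<omega> assume "\<omega> \<in> E k"
        then obtain n x where "\<omega> \<in> space M" "n \<le> k" "x \<in> Dk k" "\<epsilon> < \<bar>S n x \<omega>\<bar>" by (auto simp: E_def)
        moreover have "n \<le> m" using \<open>n \<le> k\<close> elim by simp
        ultimately show "\<omega> \<in> {\<omega>\<in>space M. \<exists>n\<le>m. \<exists>x\<in>Dk k. \<epsilon> < \<bar>S n x \<omega>\<bar>}" by blast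
      qed
      also have "\<dots> \<le> 2 * prob {\<omega>\<in>space M. \<exists>x\<in>Dk k. \<epsilon> < \<bar>S m x \<omega>\<bar>}"
        unfolding S_def using Dk by (intro levy_maximal_inequality[OF indep sym]) (auto simp: countable_finite)
      also have "prob {\<omega>\<in>space M. \<exists>x\<in>Dk k. \<epsilon> < \<bar>S m x \<omega>\<bar>} \<le>
          prob ({\<omega>\<in>space M. \<exists>x\<in>D. \<epsilon>' < \<bar>y x \<omega>\<bar>} \<union> (\<Union>x\<in>Dk k. {\<omega>\<in>space M. \<epsilon> - \<epsilon>' < \<bar>S m x \<omega> - y x \<omega>\<bar>}))"
      proof (intro finite_measure_mono sets.Un sets.finite_UN ev3 ev2 Dk)
        show "{\<omega>\<in>space M. \<exists>x\<in>Dk k. \<epsilon> < \<bar>S m x \<omega>\<bar>} \<subseteq> {\<omega>\<in>space M. \<exists>x\<in>D. \<epsilon>'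
          < \<bar>y x \<omega>\<bar>} \<union> (\<Union>x\<in>Dk k. {\<omega>\<in>space M. \<epsilon> - \<epsilon>' < \<bar>S m x \<omega> - y x \<omega>\<bar>})"
        proof
          fix \<omega> assume "\<omega> \<in> {\<omega>\<in>space M. \<exists>x\<in>Dk k. \<epsilon> < \<bar>S m x \<omega>\<bar>}"
          then obtain x where x: "\<omega> \<in> space M" "x \<in> Dk k" "\<epsilon> < \<bar>S m x \<omega>\<bar>" by auto
          then have "\<epsilon>' < \<bar>y x \<omega>\<bar> \<or> \<epsilon> - \<epsilon>' < \<bar>S m x \<omega> - y x \<omega>\<bar>" by linarith
          then show "\<omega> \<in> {\<omega>\<in>space M. \<exists>x\<in>D. \<epsilon>' < \<bar>y x \<omega>\<bar>} \<union> (\<Union>x\<in>Dk k. {\<omega>\<in>space M. \<epsilon> - \<epsilon>' < \<bar>S m x \<omega> - y x \<omega>\<bar>})"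
            using x Dk(2)[of k] by auto
        qed
      qed
      also have "\<dots> \<le> ?p + prob (\<Union>x\<in>Dk k. {\<omega>\<in>space M. \<epsilon> - \<epsilon>' < \<bar>S m x \<omega> - y x \<omega>\<bar>})"
        by (intro measure_Un_le ev3 sets.finite_UN ev2 Dk)
      also have "prob (\<Union>x\<in>Dk k. {\<omega>\<in>space M. \<epsilon> - \<epsilon>' < \<bar>S m x \<omega> - y x \<omega>\<bar>})
        \<le> (\<Sum>x\<in>Dk k. prob {\<omega>\<in>space M. \<epsilon> - \<epsilon>' < \<bar>S m x \<omega> - y x \<omega>\<bar>})"
        using ev2 by (intro finite_measure_subadditive_finite Dk) auto
      finally show ?case by simp
    qed
  qed simp
  have inc: "incseq E"
  proof (rule incseq_SucI)
    fix n show "E n \<subseteq> E (Suc n)"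
    proof
      fix \<omega> assume "\<omega> \<in> E n"
      then obtain k x where kx: "\<omega> \<in> space M" "k \<le> n" "x \<in> Dk n" "\<epsilon> < \<bar>S k x \<omega>\<bar>" by (auto simp: E_def)
      moreover have "k \<le> Suc n" "x \<in> Dk (Suc n)" using kx Dmono[of n "Suc n"] by auto
      ultimately show "\<omega> \<in> E (Suc n)" unfolding E_def by blast
    qed
  qed
  have "(\<lambda>k. prob (E k)) \<longlonglongrightarrow> prob (\<Union>k. E k)"
    using Em inc by (intro finite_Lim_measure_incseq) auto
  then have "prob (\<Union>k. E k) \<le> 2 * prob {\<omega>\<in>space M. \<exists>x\<in>D. \<epsilon>' < \<bar>y x \<omega>\<bar>}"
    by (rule tendsto_upperbound) (use bound in auto)
  also have "(\<Union>k. E k) = {\<omega>\<in>space M. \<exists>n. \<exists>x\<in>D. \<epsilon> < \<bar>S n x \<omega>\<bar>}"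
  proof (intro set_eqI iffI)
    fix \<omega> assume "\<omega> \<in> {\<omega>\<in>space M. \<exists>n. \<exists>x\<in>D. \<epsilon> < \<bar>S n x \<omega>\<bar>}"
    then obtain n x where nx: "\<omega> \<in> space M" "x \<in> D" "\<epsilon> < \<bar>S n x \<omega>\<bar>" by auto
    then obtain k where k: "x \<in> Dk k" using DU by auto
    have "n \<le> max k n" "x \<in> Dk (max k n)" using k Dmono[of k "max k n"] by auto
    then have "\<omega> \<in> E (max k n)" unfolding E_def using nx by blast
    then show "\<omega> \<in> (\<Union>k. E k)" by auto
  next
    fix \<omega> assume "\<omega> \<in> (\<Union>k. E k)"
    then obtain k n x where "\<omega> \<in> space M" "x \<in> Dk k" "\<epsilon> < \<bar>S n x \<omega>\<bar>" by (auto simp: E_def)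
    then show "\<omega> \<in> {\<omega>\<in>space M. \<exists>n. \<exists>x\<in>D. \<epsilon> < \<bar>S n x \<omega>\<bar>}" using Dk(2)[of k] by blast
  qed
  finally show ?thesis unfolding S_def .
qed simp

lemma (in prob_space) prob_tendsto_0:
  assumes [measurable]: "\<And>n. A n \<in> events"
    and ev: "\<And>\<omega>. \<omega> \<in> space M \<Longrightarrow> \<forall>\<^sub>F n in sequentially. \<omega> \<notin> A n"
  shows "(\<lambda>n. prob (A n)) \<longlonglongrightarrow> 0"
proof -
  have "(\<lambda>n. \<integral>\<omega>. indicator (A n) \<omega> \<partial>M :: real) \<longlonglongrightarrow> (\<integral>\<omega>. 0 \<partial>M)"
  proof (rule integral_dominated_convergence[where w = "\<lambda>_. 1"])
    show "AE \<omega> in M. (\<lambda>n. indicator (A n) \<omega> :: real) \<longlonglongrightarrow> 0"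
    proof (rule AE_I2)
      fix \<omega> assume "\<omega> \<in> space M"
      from ev[OF this] show "(\<lambda>n. indicator (A n) \<omega> :: real) \<longlonglongrightarrow> 0"
        by (intro tendsto_eventually) (auto elim: eventually_mono)
    qed
  qed (auto simp: indicator_def)
  then show ?thesis by simp
qed

text \<open>The Ito-Nisio theorem for C([0,T]). The maximal inequality is used twice: for the
  coefficients \<open>e i t - e i (\<pi> K t)\<close> it makes the partial sums equicontinuous in
  probability, which reduces uniform convergence in probability to finitely many grid points; for
  coefficients cut off below N it turns this into almost sure convergence.\<close>

lemma (in prob_space) ito_nisio:
  fixes Z :: "nat \<Rightarrow> 'a \<Rightarrow> real" and e :: "nat \<Rightarrow> real \<Rightarrow> real" and Y :: "real \<Rightarrow> 'a \<Rightarrow> real"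
  assumes indep: "indep_vars (\<lambda>_. borel) Z UNIV"
    and sym: "\<And>i. distr M borel (\<lambda>\<omega>. - Z i \<omega>) = distr M borel (Z i)"
    and T: "0 \<le> T"
    and Y[measurable]: "\<And>t. Y t \<in> borel_measurable M"
    and paths: "\<And>\<omega>. \<omega> \<in> space M \<Longrightarrow> continuous_on {0..T} (\<lambda>t. Y t \<omega>)"
    and e: "\<And>i. continuous_on {0..T} (e i)"
    and conv: "\<And>t \<delta>. t \<in> {0..T} \<Longrightarrow> 0 < \<delta> \<Longrightarrow>
      (\<lambda>m. prob {\<omega>\<in>space M. \<delta> < \<bar>(\<Sum>i\<le>m. e i t * Z i \<omega>) - Y t \<omega>\<bar>}) \<longlonglongrightarrow> 0"
  shows "AE \<omega> in M. uniform_limit {0..T} (\<lambda>n t. \<Sum>i\<le>n. e i t * Z i \<omega>) (\<lambda>t. Y t \<omega>) sequentially"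
proof -
  have Z[measurable]: "Z i \<in> borel_measurable M" for i using indep by (auto simp: indep_vars_def)
  \<comment> \<open>A countable dense set that contains every grid, so that suprema over it give
    measurable events.\<close>
  define D where "D = \<rat> \<inter> {0..T}"
  define \<pi> where "\<pi> K t = real_of_int \<lfloor>real (Suc K) * t\<rfloor> / real (Suc K)" for K t
  define Gr where "Gr K = (\<lambda>j. real_of_int j / real (Suc K)) ` {0..\<lfloor>real (Suc K) * T\<rfloor>}" for K
  have cD: "countable D" unfolding D_def using countable_rat by auto
  have fin: "finite (Gr K)" for K by (simp add: Gr_def)
  have \<pi>Gr: "\<pi> K t \<in> Gr K" if "t \<in> {0..T}" for K t
    unfolding \<pi>_def Gr_def using that by (intro imageI) (auto intro!: floor_mono mult_left_mono)
  have Gr: "Gr K \<subseteq> D" for K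
  proof
    fix x assume "x \<in> Gr K"
    then obtain j where j: "x = real_of_int j / real (Suc K)" "0 \<le> j" "j \<le> \<lfloor>real (Suc K) * T\<rfloor>"
      by (auto simp: Gr_def)
    have "real_of_int j \<le> real (Suc K) * T" using j(3) by linarith
    then have "x \<le> T" unfolding j(1) by (simp add: field_simps)
    moreover have "0 \<le> x" unfolding j(1) using j(2) by simp
    moreover have "x \<in> \<rat>" unfolding j(1) by simp
    ultimately show "x \<in> D" by (simp add: D_def)
  qed
  have DT: "D \<subseteq> {0..T}" by (auto simp: D_def)
  have \<pi>close: "\<bar>\<pi> K t - t\<bar> \<le> 1 / real (Suc K)" for K t
  proof -
    have "\<bar>real_of_int \<lfloor>real (Suc K) * t\<rfloor> - real (Suc K) * t\<bar> \<le> 1" by linarith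
    moreover have "\<pi> K t - t = (real_of_int \<lfloor>real (Suc K) * t\<rfloor> - real (Suc K) * t) / real (Suc K)"
      unfolding \<pi>_def by (simp add: diff_divide_distrib del: of_nat_Suc)
    ultimately show ?thesis by (simp add: abs_divide divide_right_mono del: of_nat_Suc)
  qed
  define osc where "osc K \<delta> = {\<omega>\<in>space M. \<exists>t\<in>D. \<delta> < \<bar>Y t \<omega> - Y (\<pi> K t) \<omega>\<bar>}" for K \<delta>
  have oscm[measurable]: "osc K \<delta> \<in> events" for K \<delta>
    unfolding osc_def using cD by (intro measurable_Bex_countable) auto
  have osc0: "(\<lambda>K. prob (osc K \<delta>)) \<longlonglongrightarrow> 0" if "0 < \<delta>" for \<delta>
  proof (rule prob_tendsto_0)
    fix \<omega> assume w: "\<omega> \<in> space M"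
    have "uniformly_continuous_on {0..T} (\<lambda>t. Y t \<omega>)"
      using paths[OF w] by (intro compact_uniformly_continuous) auto
    then obtain \<eta> where \<eta>: "0 < \<eta>" "\<And>s t. s \<in> {0..T} \<Longrightarrow> t \<in> {0..T} \<Longrightarrow> dist t s < \<eta> \<Longrightarrow> dist (Y t \<omega>) (Y s \<omega>) < \<delta>"
      unfolding uniformly_continuous_on_def using \<open>0 < \<delta>\<close> by metis
    have "(\<lambda>K. 1 / real (Suc K)) \<longlonglongrightarrow> 0" using LIMSEQ_inverse_real_of_nat by (simp add: inverse_eq_divide)
    then have "\<forall>\<^sub>F K in sequentially. 1 / real (Suc K) < \<eta>" using \<eta>(1) by (rule order_tendstoD)
    then show "\<forall>\<^sub>F K in sequentially. \<omega> \<notin> osc K \<delta>"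
    proof eventually_elim
      case (elim K)
      have "\<bar>Y t \<omega> - Y (\<pi> K t) \<omega>\<bar> < \<delta>" if "t \<in> D" for t
      proof -
        have t: "t \<in> {0..T}" using that DT by auto
        have "\<pi> K t \<in> {0..T}" using \<pi>Gr[OF t] Gr DT by blast
        then show ?thesis using \<eta>(2)[of "\<pi> K t" t] t \<pi>close[of K t] elim by (simp add: dist_real_def)
      qed
      then show ?case by (force simp: osc_def)
    qed
  qed simp
  define S where "S n t \<omega> = (\<Sum>i\<le>n. e i t * Z i \<omega>)" for n t \<omega>
  have S[measurable]: "S n t \<in> borel_measurable M" for n t unfolding S_def by measurable
  have convS: "(\<lambda>m. prob {\<omega>\<in>space M. \<delta> < \<bar>S m t \<omega> - Y t \<omega>\<bar>}) \<longlonglongrightarrow> 0" if "t \<in> {0..T}" "0 < \<delta>" for t \<delta>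
    using conv[OF that] unfolding S_def .
  \<comment> \<open>Increments of the partial sums are sums of the same variables with other
    coefficients, and their limit is the increment of \<open>Y\<close>.\<close>
  have oscS: "prob {\<omega>\<in>space M. \<exists>n. \<exists>t\<in>D. \<delta> < \<bar>S n t \<omega> - S n (\<pi> K t) \<omega>\<bar>} \<le> 2 * prob (osc K \<delta>')"
    if "\<delta>' < \<delta>" for K \<delta> \<delta>'
  proof -
    have eq: "(\<Sum>i\<le>n. (e i t - e i (\<pi> K t)) * Z i \<omega>) = S n t \<omega> - S n (\<pi> K t) \<omega>" for n t \<omega>
      by (simp add: S_def sum_subtractf left_diff_distrib)
    have "prob {\<omega>\<in>space M. \<exists>n. \<exists>t\<in>D. \<delta> < \<bar>\<Sum>i\<le>n. (e i t - e i (\<pi> K t)) * Z i \<omega>\<bar>} \<le>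
       2 * prob {\<omega>\<in>space M. \<exists>t\<in>D. \<delta>' < \<bar>Y t \<omega> - Y (\<pi> K t) \<omega>\<bar>}"
    proof (rule levy_maximal_inequality_limit[OF indep sym cD _ _ that])
      fix t \<delta> :: real assume "t \<in> D" "0 < \<delta>"
      then have t: "t \<in> {0..T}" "\<pi> K t \<in> {0..T}" using DT \<pi>Gr[of t K] Gr[of K] by blast+
      have d: "0 < \<delta> / 2" using \<open>0 < \<delta>\<close> by simp
      have "(\<lambda>m. prob {\<omega>\<in>space M. \<delta>/2 < \<bar>S m t \<omega> - Y t \<omega>\<bar>} + prob {\<omega>\<in>space M. \<delta>/2
        < \<bar>S m (\<pi> K t) \<omega> - Y (\<pi> K t) \<omega>\<bar>}) \<longlonglongrightarrow> 0 + 0"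
        by (intro tendsto_add convS t d)
      then have lim: "(\<lambda>m. prob {\<omega>\<in>space M. \<delta>/2 < \<bar>S m t \<omega> - Y t \<omega>\<bar>} + prob {\<omega>\<in>space M. \<delta>/2
        < \<bar>S m (\<pi> K t) \<omega> - Y (\<pi> K t) \<omega>\<bar>}) \<longlonglongrightarrow> 0" by simp
      show "(\<lambda>m. prob {\<omega>\<in>space M. \<delta> < \<bar>(\<Sum>i\<le>m. (e i t - e i (\<pi> K t)) * Z i \<omega>) - (Y t \<omega> - Y (\<pi> K t) \<omega>)\<bar>}) \<longlonglongrightarrow> 0"
      proof (rule tendsto_sandwich[OF _ _ tendsto_const lim])
        show "\<forall>\<^sub>F m in sequentially. prob {\<omega>\<in>space M. \<delta>
          < \<bar>(\<Sum>i\<le>m. (e i t - e i (\<pi> K t)) * Z i \<omega>) - (Y t \<omega> - Y (\<pi> K t) \<omega>)\<bar>}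
            \<le> prob {\<omega>\<in>space M. \<delta>/2 < \<bar>S m t \<omega> - Y t \<omega>\<bar>} + prob {\<omega>\<in>space M. \<delta>/2 < \<bar>S m (\<pi> K t) \<omega> - Y (\<pi> K t) \<omega>\<bar>}"
        proof (rule always_eventually, rule allI)
          fix m
          have "prob {\<omega>\<in>space M. \<delta> < \<bar>(\<Sum>i\<le>m. (e i t - e i (\<pi> K t)) * Z i \<omega>) - (Y t \<omega> - Y (\<pi> K t) \<omega>)\<bar>}
             \<le> prob ({\<omega>\<in>space M. \<delta>/2 < \<bar>S m t \<omega> - Y t \<omega>\<bar>} \<union> {\<omega>\<in>space M. \<delta>/2 < \<bar>S m (\<pi> K t) \<omega> - Y (\<pi> K t) \<omega>\<bar>})"
            unfolding eq
          proof (rule finite_measure_mono)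
            have "\<delta>/2 < \<bar>S m t \<omega> - Y t \<omega>\<bar> \<or> \<delta>/2 < \<bar>S m (\<pi> K t) \<omega> - Y (\<pi> K t) \<omega>\<bar>"
              if "\<delta> < \<bar>S m t \<omega> - S m (\<pi> K t) \<omega> - (Y t \<omega> - Y (\<pi> K t) \<omega>)\<bar>" for \<omega>
              using that by linarith
            then show "{\<omega>\<in>space M. \<delta> < \<bar>S m t \<omega> - S m (\<pi> K t) \<omega> - (Y t \<omega> - Y (\<pi> K t) \<omega>)\<bar>} \<subseteq>
              {\<omega>\<in>space M. \<delta>/2 < \<bar>S m t \<omega> - Y t \<omega>\<bar>} \<union> {\<omega>\<in>space M. \<delta>/2 < \<bar>S m (\<pi> K t) \<omega> - Y (\<pi> K t) \<omega>\<bar>}"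
              by blast
          qed measurable
          also have "\<dots> \<le> prob {\<omega>\<in>space M. \<delta>/2 < \<bar>S m t \<omega> - Y t \<omega>\<bar>} + prob {\<omega>\<in>space M. \<delta>/2
            < \<bar>S m (\<pi> K t) \<omega> - Y (\<pi> K t) \<omega>\<bar>}"
            by (intro measure_Un_le) measurable
          finally show "prob {\<omega>\<in>space M. \<delta> < \<bar>(\<Sum>i\<le>m. (e i t - e i (\<pi> K t)) * Z i \<omega>) - (Y t \<omega> - Y (\<pi> K t) \<omega>)\<bar>}
            \<le> prob {\<omega>\<in>space M. \<delta>/2 < \<bar>S m t \<omega> - Y t \<omega>\<bar>} + prob {\<omega>\<in>space M. \<delta>/2
              < \<bar>S m (\<pi> K t) \<omega> - Y (\<pi> K t) \<omega>\<bar>}" .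
        qed
      qed simp
    qed measurable
    then show ?thesis unfolding eq osc_def .
  qed
  define p where "p \<delta> n = prob {\<omega>\<in>space M. \<exists>t\<in>D. \<delta> < \<bar>Y t \<omega> - S n t \<omega>\<bar>}" for \<delta> n
  have evp[measurable]: "{\<omega>\<in>space M. \<exists>t\<in>D. \<delta> < \<bar>Y t \<omega> - S n t \<omega>\<bar>} \<in> events" for \<delta> n
    using cD by (intro measurable_Bex_countable) auto
  have evn: "{\<omega>\<in>space M. \<exists>n\<ge>N. \<exists>t\<in>D. \<delta> < \<bar>g n t \<omega>\<bar>} \<in> events"
    if "\<And>n t. g n t \<in> borel_measurable M" for \<delta> N and g :: "nat \<Rightarrow> real \<Rightarrow> 'a \<Rightarrow> real"
  proof -
    have "(\<Union>n\<in>{N..}. {\<omega>\<in>space M. \<exists>t\<in>D. \<delta> < \<bar>g n t \<omega>\<bar>}) \<in> events"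
      using cD that by (intro sets.countable_UN' measurable_Bex_countable) auto
    also have "(\<Union>n\<in>{N..}. {\<omega>\<in>space M. \<exists>t\<in>D. \<delta> < \<bar>g n t \<omega>\<bar>}) = {\<omega>\<in>space M. \<exists>n\<ge>N. \<exists>t\<in>D. \<delta> < \<bar>g n t \<omega>\<bar>}" by blast
    finally show ?thesis .
  qed
  \<comment> \<open>A deviation above \<open>\<delta>\<close> between path and partial sum is due to
    the path leaving its grid value by \<open>\<delta>/4\<close>, the sum leaving its grid value by
    \<open>\<delta>/3\<close>, or an error of \<open>\<delta>/3\<close> at a grid point. Since 1/4 <
    1/3 strictly, the second event costs at most twice the first; in total this is 3
    \<open>\<eta>/6\<close> + \<open>\<eta>/6\<close>.\<close>
  have p0: "p \<delta> \<longlonglongrightarrow> 0" if \<delta>: "0 < \<delta>" for \<delta>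
  proof (rule LIMSEQ_I)
    fix \<eta> :: real assume \<eta>: "0 < \<eta>"
    have "\<forall>\<^sub>F K in sequentially. prob (osc K (\<delta>/4)) < \<eta> / 6"
      using osc0[of "\<delta>/4"] \<delta> \<eta> by (intro order_tendstoD) auto
    then obtain K where K: "prob (osc K (\<delta>/4)) < \<eta> / 6" by (auto simp: eventually_sequentially)
    have "(\<lambda>n. \<Sum>g\<in>Gr K. prob {\<omega>\<in>space M. \<delta>/3 < \<bar>S n g \<omega> - Y g \<omega>\<bar>}) \<longlonglongrightarrow> (\<Sum>g\<in>Gr K. 0)"
      using Gr DT \<delta> by (intro tendsto_sum convS) (blast, simp)
    then have "(\<lambda>n. \<Sum>g\<in>Gr K. prob {\<omega>\<in>space M. \<delta>/3 < \<bar>S n g \<omega> - Y g \<omega>\<bar>}) \<longlonglongrightarrow> 0" by simp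
    then have "\<forall>\<^sub>F n in sequentially. (\<Sum>g\<in>Gr K. prob {\<omega>\<in>space M. \<delta>/3 < \<bar>S n g \<omega> - Y g \<omega>\<bar>}) < \<eta> / 6"
      using \<eta> by (intro order_tendstoD) auto
    then obtain N where N: "\<And>n. n \<ge> N \<Longrightarrow> (\<Sum>g\<in>Gr K. prob {\<omega>\<in>space M. \<delta>/3 < \<bar>S n g \<omega> - Y g \<omega>\<bar>}) < \<eta> / 6"
      by (auto simp: eventually_sequentially)
    show "\<exists>N. \<forall>n\<ge>N. norm (p \<delta> n - 0) < \<eta>"
    proof (intro exI allI impI)
      fix n assume n: "n \<ge> N"
      let ?A = "osc K (\<delta>/4)"
      let ?B = "{\<omega>\<in>space M. \<exists>n\<ge>0. \<exists>t\<in>D. \<delta>/3 < \<bar>S n t \<omega> - S n (\<pi> K t) \<omega>\<bar>}"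
      let ?C = "\<Union>g\<in>Gr K. {\<omega>\<in>space M. \<delta>/3 < \<bar>S n g \<omega> - Y g \<omega>\<bar>}"
      have B: "?B \<in> events" by (rule evn) measurable
      have C: "?C \<in> events" using fin by (intro sets.finite_UN) auto
      have "p \<delta> n \<le> prob (?A \<union> ?B \<union> ?C)" unfolding p_def
      proof (rule finite_measure_mono)
        show "{\<omega>\<in>space M. \<exists>t\<in>D. \<delta> < \<bar>Y t \<omega> - S n t \<omega>\<bar>} \<subseteq> ?A \<union> ?B \<union> ?C"
        proof
          fix \<omega> assume "\<omega> \<in> {\<omega>\<in>space M. \<exists>t\<in>D. \<delta> < \<bar>Y t \<omega> - S n t \<omega>\<bar>}"
          then obtain t where t: "\<omega> \<in> space M" "t \<in> D" "\<delta> < \<bar>Y t \<omega> - S n t \<omega>\<bar>" by blast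
          have g: "\<pi> K t \<in> Gr K" using t DT by (intro \<pi>Gr) auto
          have "\<delta>/4 < \<bar>Y t \<omega> - Y (\<pi> K t) \<omega>\<bar> \<or> \<delta>/3 < \<bar>S n t \<omega> - S n (\<pi> K t) \<omega>\<bar> \<or> \<delta>/3
            < \<bar>S n (\<pi> K t) \<omega> - Y (\<pi> K t) \<omega>\<bar>"
            using t(3) \<delta> by linarith
          then show "\<omega> \<in> ?A \<union> ?B \<union> ?C"
          proof (elim disjE)
            assume "\<delta>/4 < \<bar>Y t \<omega> - Y (\<pi> K t) \<omega>\<bar>"
            then have "\<omega> \<in> ?A" unfolding osc_def using t by blast
            then show ?thesis by blast
          next
            assume "\<delta>/3 < \<bar>S n t \<omega> - S n (\<pi> K t) \<omega>\<bar>"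
            then have "\<omega> \<in> ?B" using t by blast
            then show ?thesis by blast
          next
            assume "\<delta>/3 < \<bar>S n (\<pi> K t) \<omega> - Y (\<pi> K t) \<omega>\<bar>"
            then have "\<omega> \<in> ?C" using t g by blast
            then show ?thesis by blast
          qed
        qed
        show "?A \<union> ?B \<union> ?C \<in> events" by (intro sets.Un B C oscm)
      qed
      also have "\<dots> \<le> prob (?A \<union> ?B) + prob ?C" by (intro measure_Un_le sets.Un B C oscm)
      also have "prob (?A \<union> ?B) \<le> prob ?A + prob ?B" by (intro measure_Un_le B oscm)
      also have "prob ?B \<le> 2 * prob ?A" using oscS[of "\<delta>/4" "\<delta>/3" K] \<delta> by simp
      also have "prob ?C \<le> (\<Sum>g\<in>Gr K. prob {\<omega>\<in>space M. \<delta>/3 < \<bar>S n g \<omega> - Y g \<omega>\<bar>})"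
        using fin by (intro finite_measure_subadditive_finite) auto
      finally have "p \<delta> n < \<eta>" using N[OF n] K \<eta> by linarith
      moreover have "0 \<le> p \<delta> n" by (simp add: p_def)
      ultimately show "norm (p \<delta> n - 0) < \<eta>" by simp
    qed
  qed
  \<comment> \<open>Coefficients set to 0 up to N turn the differences from the N-th sum into
    partial sums again, with limit \<open>Y\<close> minus the N-th sum.\<close>
  have tail: "prob {\<omega>\<in>space M. \<exists>n\<ge>N. \<exists>t\<in>D. \<delta> < \<bar>S n t \<omega> - S N t \<omega>\<bar>} \<le> 2 * p \<delta>' N" if "\<delta>' < \<delta>" for \<delta> \<delta>' N
  proof -
    have eq: "(\<Sum>i\<le>n. (if N < i then e i t else 0) * Z i \<omega>) = S n t \<omega> - S N t \<omega>" if "N \<le> n" for n t \<omega>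
    proof -
      have "S n t \<omega> = (\<Sum>i\<in>{..N} \<union> {N<..n}. e i t * Z i \<omega>)" unfolding S_def using that by (intro sum.cong) auto
      also have "\<dots> = S N t \<omega> + (\<Sum>i\<in>{N<..n}. e i t * Z i \<omega>)" unfolding S_def by (intro sum.union_disjoint) auto
      also have "(\<Sum>i\<in>{N<..n}. e i t * Z i \<omega>) = (\<Sum>i\<le>n. (if N < i then e i t else 0) * Z i \<omega>)"
        by (intro sum.mono_neutral_cong_left) auto
      finally show ?thesis by simp
    qed
    let ?W = "\<lambda>n t \<omega>. \<Sum>i\<le>n. (if N < i then e i t else 0) * Z i \<omega>"
    have "prob {\<omega>\<in>space M. \<exists>n\<ge>N. \<exists>t\<in>D. \<delta> < \<bar>S n t \<omega> - S N t \<omega>\<bar>} \<le> prob {\<omega>\<in>space M. \<exists>n\<ge>0. \<exists>t\<in>D. \<delta> < \<bar>?W n t \<omega>\<bar>}"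
    proof (rule finite_measure_mono)
      show "{\<omega>\<in>space M. \<exists>n\<ge>N. \<exists>t\<in>D. \<delta> < \<bar>S n t \<omega> - S N t \<omega>\<bar>} \<subseteq> {\<omega>\<in>space M. \<exists>n\<ge>0. \<exists>t\<in>D. \<delta> < \<bar>?W n t \<omega>\<bar>}"
      proof
        fix \<omega> assume "\<omega> \<in> {\<omega>\<in>space M. \<exists>n\<ge>N. \<exists>t\<in>D. \<delta> < \<bar>S n t \<omega> - S N t \<omega>\<bar>}"
        then obtain n t where w: "\<omega> \<in> space M" "n \<ge> N" "t \<in> D" "\<delta> < \<bar>S n t \<omega> - S N t \<omega>\<bar>" by blast
        then have "\<delta> < \<bar>?W n t \<omega>\<bar>" by (simp only: eq)
        then show "\<omega> \<in> {\<omega>\<in>space M. \<exists>n\<ge>0. \<exists>t\<in>D. \<delta> < \<bar>?W n t \<omega>\<bar>}" using w by blast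
      qed
      show "{\<omega>\<in>space M. \<exists>n\<ge>0. \<exists>t\<in>D. \<delta> < \<bar>?W n t \<omega>\<bar>} \<in> events" by (rule evn) measurable
    qed
    also have "\<dots> = prob {\<omega>\<in>space M. \<exists>n. \<exists>t\<in>D. \<delta> < \<bar>?W n t \<omega>\<bar>}" by simp
    also have "\<dots> \<le> 2 * prob {\<omega>\<in>space M. \<exists>t\<in>D. \<delta>' < \<bar>Y t \<omega> - S N t \<omega>\<bar>}"
    proof (rule levy_maximal_inequality_limit[OF indep sym cD _ _ that])
      fix t \<gamma> :: real assume t: "t \<in> D" and \<gamma>: "0 < \<gamma>"
      have "(\<lambda>m. prob {\<omega>\<in>space M. \<gamma> < \<bar>S m t \<omega> - Y t \<omega>\<bar>}) \<longlonglongrightarrow> 0" using t DT \<gamma> by (intro convS) auto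
      moreover have "\<forall>\<^sub>F m in sequentially. prob {\<omega>\<in>space M. \<gamma> < \<bar>S m t \<omega> - Y t \<omega>\<bar>} =
          prob {\<omega>\<in>space M. \<gamma> < \<bar>?W m t \<omega> - (Y t \<omega> - S N t \<omega>)\<bar>}"
        using eventually_ge_at_top[of N] by eventually_elim (simp only: eq diff_diff_eq2 diff_add_cancel)
      ultimately show "(\<lambda>m. prob {\<omega>\<in>space M. \<gamma> < \<bar>?W m t \<omega> - (Y t \<omega> - S N t \<omega>)\<bar>}) \<longlonglongrightarrow> 0"
        by (rule Lim_transform_eventually)
    qed measurable
    finally show ?thesis unfolding p_def .
  qed
  define Bad where "Bad \<delta> N = {\<omega>\<in>space M. \<exists>n\<ge>N. \<exists>t\<in>D. \<delta> < \<bar>S n t \<omega> - Y t \<omega>\<bar>}" for \<delta> N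
  have Bad[measurable]: "Bad \<delta> N \<in> events" for \<delta> N unfolding Bad_def by (rule evn) measurable
  have Badp: "prob (Bad (2*\<delta>) N) \<le> 2 * p (\<delta>/2) N + p \<delta> N" if \<delta>: "0 < \<delta>" for \<delta> N
  proof -
    let ?A = "{\<omega>\<in>space M. \<exists>n\<ge>N. \<exists>t\<in>D. \<delta> < \<bar>S n t \<omega> - S N t \<omega>\<bar>}"
    let ?B = "{\<omega>\<in>space M. \<exists>t\<in>D. \<delta> < \<bar>Y t \<omega> - S N t \<omega>\<bar>}"
    have A: "?A \<in> events" by (rule evn) measurable
    have "prob (Bad (2*\<delta>) N) \<le> prob (?A \<union> ?B)"
    proof (rule finite_measure_mono)
      show "Bad (2*\<delta>) N \<subseteq> ?A \<union> ?B"
      proof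
        fix \<omega> assume "\<omega> \<in> Bad (2*\<delta>) N"
        then obtain n t where w: "\<omega> \<in> space M" "n \<ge> N" "t \<in> D" "2 * \<delta> < \<bar>S n t \<omega> - Y t \<omega>\<bar>" unfolding Bad_def
          by blast
        then have "\<delta> < \<bar>S n t \<omega> - S N t \<omega>\<bar> \<or> \<delta> < \<bar>Y t \<omega> - S N t \<omega>\<bar>" by linarith
        then show "\<omega> \<in> ?A \<union> ?B" using w by blast
      qed
    qed (intro sets.Un A evp)
    also have "\<dots> \<le> prob ?A + prob ?B" by (intro measure_Un_le A evp)
    also have "prob ?A \<le> 2 * p (\<delta>/2) N" using \<delta> by (intro tail) simp
    finally show ?thesis by (simp add: p_def)
  qed
  have null: "AE \<omega> in M. \<not> (\<forall>N. \<omega> \<in> Bad (2 * \<delta>) N)" if \<delta>: "0 < \<delta>" for \<delta>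
  proof -
    have "prob (\<Inter>N. Bad (2*\<delta>) N) \<le> 0"
    proof (rule tendsto_lowerbound)
      have "(\<lambda>N. 2 * p (\<delta>/2) N + p \<delta> N) \<longlonglongrightarrow> 2 * 0 + 0" using \<delta> by (intro tendsto_intros p0) auto
      then show "(\<lambda>N. 2 * p (\<delta>/2) N + p \<delta> N) \<longlonglongrightarrow> 0" by simp
      show "\<forall>\<^sub>F N in sequentially. prob (\<Inter>N. Bad (2*\<delta>) N) \<le> 2 * p (\<delta>/2) N + p \<delta> N"
      proof (rule always_eventually, rule allI)
        fix N
        have "prob (\<Inter>N. Bad (2*\<delta>) N) \<le> prob (Bad (2*\<delta>) N)" by (intro finite_measure_mono) auto
        also note Badp[OF \<delta>]
        finally show "prob (\<Inter>N. Bad (2*\<delta>) N) \<le> 2 * p (\<delta>/2) N + p \<delta> N" .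
      qed
    qed simp
    then have "prob (\<Inter>N. Bad (2*\<delta>) N) = 0" by (simp add: measure_le_0_iff)
    then have "(\<Inter>N. Bad (2*\<delta>) N) \<in> null_sets M" by (intro null_setsI) (auto simp: emeasure_eq_measure)
    then show ?thesis by (rule AE_I') auto
  qed
  \<comment> \<open>Countably many thresholds suffice, so the exceptional null sets can be
    united.\<close>
  have "AE \<omega> in M. \<forall>k. \<not> (\<forall>N. \<omega> \<in> Bad (2 * (1 / real (Suc k))) N)"
    unfolding AE_all_countable by (intro allI null) simp
  then show ?thesis
  proof (rule AE_mp, intro AE_I2 impI)
    fix \<omega> assume w: "\<omega> \<in> space M" and good: "\<forall>k. \<not> (\<forall>N. \<omega> \<in> Bad (2 * (1 / real (Suc k))) N)"
    show "uniform_limit {0..T} (\<lambda>n t. \<Sum>i\<le>n. e i t * Z i \<omega>) (\<lambda>t. Y t \<omega>) sequentially"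
      unfolding S_def[symmetric]
    proof (rule uniform_limitI)
      fix \<eta> :: real assume \<eta>: "0 < \<eta>"
      then obtain k where k: "1 / real (Suc k) < \<eta> / 2"
        using reals_Archimedean[of "\<eta>/2"] by (auto simp: inverse_eq_divide)
      obtain N where N: "\<omega> \<notin> Bad (2 * (1 / real (Suc k))) N" using good by blast
      have "\<bar>S n t \<omega> - Y t \<omega>\<bar> \<le> 2 * (1 / real (Suc k))" if "n \<ge> N" "t \<in> D" for n t
        using N that w unfolding Bad_def by (force simp: not_less)
      \<comment> \<open>The bound is known on rational times; a non-strict bound survives the limit
        along the grid points that tend to t.\<close>
      have bd: "\<bar>S n t \<omega> - Y t \<omega>\<bar> \<le> 2 * (1 / real (Suc k))" if n: "n \<ge> N" and t: "t \<in> {0..T}" for n t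
      proof (rule tendsto_upperbound)
        have \<pi>T: "\<pi> K t \<in> {0..T}" for K using \<pi>Gr[OF t] Gr DT by blast
        have "continuous_on {0..T} (\<lambda>t. \<bar>S n t \<omega> - Y t \<omega>\<bar>)"
          unfolding S_def using e paths[OF w] by (intro continuous_intros) auto
        moreover have "(\<lambda>K. \<pi> K t) \<longlonglongrightarrow> t"
        proof (rule LIM_zero_cancel, rule Lim_null_comparison)
          show "\<forall>\<^sub>F K in sequentially. norm (\<pi> K t - t) \<le> 1 / real (Suc K)"
            using \<pi>close by (auto intro!: always_eventually)
          show "(\<lambda>K. 1 / real (Suc K)) \<longlonglongrightarrow> 0" using LIMSEQ_inverse_real_of_nat by (simp add: inverse_eq_divide)
        qed
        ultimately show "(\<lambda>K. \<bar>S n (\<pi> K t) \<omega> - Y (\<pi> K t) \<omega>\<bar>) \<longlonglongrightarrow> \<bar>S n t \<omega> - Y t \<omega>\<bar>"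
          by (rule continuous_on_tendsto_compose) (use t \<pi>T in \<open>auto intro!: always_eventually\<close>)
        show "\<forall>\<^sub>F K in sequentially. \<bar>S n (\<pi> K t) \<omega> - Y (\<pi> K t) \<omega>\<bar> \<le> 2 * (1 / real (Suc k))"
          using \<pi>Gr[OF t] Gr by (intro always_eventually allI \<open>\<And>n t. n \<ge> N \<Longrightarrow> t \<in> D
            \<Longrightarrow> \<bar>S n t \<omega> - Y t \<omega>\<bar> \<le> 2 * (1 / real (Suc k))\<close> n) blast
      qed simp
      show "\<forall>\<^sub>F n in sequentially. \<forall>t\<in>{0..T}. dist (S n t \<omega>) (Y t \<omega>) < \<eta>"
        using eventually_ge_at_top[of N]
      proof eventually_elim
        case (elim n)
        have "2 * (1 / real (Suc k)) < \<eta>" using k by simp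
        then show ?case using bd[OF elim] unfolding dist_real_def by (meson le_less_trans)
      qed
    qed
  qed
qed

section \<open>Gaussian random variables\<close>

definition sqint :: "'a measure \<Rightarrow> ('a \<Rightarrow> real) \<Rightarrow> bool" where
  "sqint M f \<longleftrightarrow> f \<in> borel_measurable M \<and> integrable M (\<lambda>x. (f x)\<^sup>2)"

lemma sqint_measurable: "sqint M f \<Longrightarrow> f \<in> borel_measurable M"
  by (simp add: sqint_def)

lemma sqint_cong: "(\<And>x. x \<in> space M \<Longrightarrow> f x = g x) \<Longrightarrow> sqint M f \<longleftrightarrow> sqint M g"
  unfolding sqint_def by (intro conj_cong measurable_cong Bochner_Integration.integrable_cong refl) auto

lemma sqint_mult_integrable:
  assumes "sqint M f" "sqint M g"
  shows "integrable M (\<lambda>x. f x * g x)"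
proof (rule Bochner_Integration.integrable_bound[of _ "\<lambda>x. (f x)\<^sup>2 + (g x)\<^sup>2"])
  show "integrable M (\<lambda>x. (f x)\<^sup>2 + (g x)\<^sup>2)" using assms by (auto simp: sqint_def)
  show "(\<lambda>x. f x * g x) \<in> borel_measurable M" using assms by (auto simp: sqint_def)
  show "AE x in M. norm (f x * g x) \<le> norm ((f x)\<^sup>2 + (g x)\<^sup>2)"
  proof (rule AE_I2)
    fix x
    have "\<bar>f x * g x\<bar> \<le> (\<bar>f x\<bar>\<^sup>2 + \<bar>g x\<bar>\<^sup>2) / 2"
      using sum_squares_bound[of "\<bar>f x\<bar>" "\<bar>g x\<bar>"] by (simp add: abs_mult)
    then show "norm (f x * g x) \<le> norm ((f x)\<^sup>2 + (g x)\<^sup>2)" by simp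
  qed
qed

lemma sqint_cmult: "sqint M f \<Longrightarrow> sqint M (\<lambda>x. c * f x)"
  by (auto simp: sqint_def power_mult_distrib)

lemma sqint_0: "sqint M (\<lambda>x. 0)"
  by (auto simp: sqint_def)

lemma sqint_add:
  assumes "sqint M f" "sqint M g"
  shows "sqint M (\<lambda>x. f x + g x)"
proof -
  have "integrable M (\<lambda>x. (f x)\<^sup>2 + (g x)\<^sup>2 + 2 * (f x * g x))"
    using assms sqint_mult_integrable[OF assms] by (auto simp: sqint_def)
  moreover have "(f x)\<^sup>2 + (g x)\<^sup>2 + 2 * (f x * g x) = (f x + g x)\<^sup>2" for x
    by (simp add: power2_sum)
  moreover have "(\<lambda>x. f x + g x) \<in> borel_measurable M" using assms by (auto simp: sqint_def)
  ultimately show ?thesis by (simp add: sqint_def)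
qed

lemma sqint_diff: "sqint M f \<Longrightarrow> sqint M g \<Longrightarrow> sqint M (\<lambda>x. f x - g x)"
  using sqint_add[of M f "\<lambda>x. (-1) * g x"] sqint_cmult[of M g "-1"] by simp

lemma sqint_sum: "(\<And>i. i \<in> I \<Longrightarrow> sqint M (f i)) \<Longrightarrow> sqint M (\<lambda>x. \<Sum>i\<in>I. f i x)"
  by (induction I rule: infinite_finite_induct) (auto intro: sqint_add sqint_0)

text \<open>The quadratic polynomial t \<mapsto> \<integral> (f + t g)^2 is nonnegative. If its
  leading coefficient vanishes it has no vertex, so that case is treated apart.\<close>

lemma integral_cauchy_schwarz:
  assumes f: "sqint M f" and g: "sqint M g"
  shows "(\<integral>x. f x * g x \<partial>M)\<^sup>2 \<le> (\<integral>x. (f x)\<^sup>2 \<partial>M) * (\<integral>x. (g x)\<^sup>2 \<partial>M)"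
proof -
  define A B C where "A = (\<integral>x. (f x)\<^sup>2 \<partial>M)" and "B = (\<integral>x. f x * g x \<partial>M)" and "C = (\<integral>x. (g x)\<^sup>2 \<partial>M)"
  have pos: "0 \<le> A + 2 * t * B + t\<^sup>2 * C" for t
  proof -
    have "0 \<le> (\<integral>x. (f x + t * g x)\<^sup>2 \<partial>M)" by simp
    also have "\<dots> = (\<integral>x. (f x)\<^sup>2 + (2 * t) * (f x * g x) + t\<^sup>2 * (g x)\<^sup>2 \<partial>M)"
      by (intro Bochner_Integration.integral_cong) (auto simp: power2_eq_square algebra_simps)
    also have "\<dots> = A + 2 * t * B + t\<^sup>2 * C"
      unfolding A_def B_def C_def using f g sqint_mult_integrable[OF f g] by (auto simp: sqint_def)
    finally show ?thesis .
  qed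
  have "0 \<le> C" by (simp add: C_def)
  have "B\<^sup>2 \<le> A * C"
  proof (cases "C = 0")
    case True
    have "B = 0"
    proof (rule ccontr)
      assume "B \<noteq> 0"
      \<comment> \<open>Without a quadratic term this choice of t would give the value -1.\<close>
      have "0 \<le> A + 2 * (- (A + 1) / (2 * B)) * B" using pos[of "- (A + 1) / (2 * B)"] True by simp
      also have "\<dots> = -1" using \<open>B \<noteq> 0\<close> by (simp add: field_simps)
      finally show False by simp
    qed
    then show ?thesis using True by simp
  next
    case False
    then have "0 < C" using \<open>0 \<le> C\<close> by simp
    have "0 \<le> (A + 2 * (-B/C) * B + (-B/C)\<^sup>2 * C) * C" using pos[of "-B/C"] \<open>0 < C\<close> by simp
    also have "\<dots> = A * C - B\<^sup>2" using \<open>0 < C\<close> by (simp add: field_simps power2_eq_square)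
    finally show ?thesis by simp
  qed
  then show ?thesis by (simp add: A_def B_def C_def)
qed

definition L2_conv :: "'a measure \<Rightarrow> (nat \<Rightarrow> 'a \<Rightarrow> real) \<Rightarrow> ('a \<Rightarrow> real) \<Rightarrow> bool" where
  "L2_conv M f g \<longleftrightarrow> (\<forall>n. sqint M (f n)) \<and> sqint M g \<and> (\<lambda>n. \<integral>x. (f n x - g x)\<^sup>2 \<partial>M) \<longlonglongrightarrow> 0"

text \<open>The hypothesis uses the nonnegative integral because square integrability of the limit
  is not known beforehand. One index at distance below 1 provides it.\<close>

lemma L2_convI_nn:
  assumes f: "\<And>n. sqint M (f n)" and g[measurable]: "g \<in> borel_measurable M"
    and lim: "(\<lambda>n. \<integral>\<^sup>+x. ennreal ((f n x - g x)\<^sup>2) \<partial>M) \<longlonglongrightarrow> 0"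
  shows "L2_conv M f g"
proof -
  have [measurable]: "f n \<in> borel_measurable M" for n using f by (simp add: sqint_def)
  have "\<forall>\<^sub>F n in sequentially. (\<integral>\<^sup>+x. ennreal ((f n x - g x)\<^sup>2) \<partial>M) < 1"
    using lim by (rule order_tendstoD) simp
  then obtain n where n: "(\<integral>\<^sup>+x. ennreal ((f n x - g x)\<^sup>2) \<partial>M) < 1" by (auto simp: eventually_sequentially)
  have "sqint M (\<lambda>x. f n x - g x)" unfolding sqint_def
    using n by (auto intro!: integrableI_nonneg less_trans[OF n])
  from sqint_diff[OF f[of n] this] have g': "sqint M g" by simp
  have eq: "(\<integral>\<^sup>+x. ennreal ((f n x - g x)\<^sup>2) \<partial>M) = ennreal (\<integral>x. (f n x - g x)\<^sup>2 \<partial>M)" for n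
    using sqint_diff[OF f g', of n] by (intro nn_integral_eq_integral) (auto simp: sqint_def)
  have "(\<lambda>n. ennreal (\<integral>x. (f n x - g x)\<^sup>2 \<partial>M)) \<longlonglongrightarrow> ennreal 0" using lim by (simp add: eq)
  then have "(\<lambda>n. \<integral>x. (f n x - g x)\<^sup>2 \<partial>M) \<longlonglongrightarrow> 0"
    by (subst (asm) tendsto_ennreal_iff) auto
  then show ?thesis using f g' by (simp add: L2_conv_def)
qed

lemma L2_conv_add:
  assumes "L2_conv M f f'" "L2_conv M g g'"
  shows "L2_conv M (\<lambda>n x. f n x + g n x) (\<lambda>x. f' x + g' x)"
proof -
  note s = assms[unfolded L2_conv_def]
  have "(\<lambda>n. \<integral>x. ((f n x + g n x) - (f' x + g' x))\<^sup>2 \<partial>M) \<longlonglongrightarrow> 0"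
  proof (rule tendsto_sandwich[OF _ _ tendsto_const])
    show "(\<lambda>n. 2 * (\<integral>x. (f n x - f' x)\<^sup>2 \<partial>M) + 2 * (\<integral>x. (g n x - g' x)\<^sup>2 \<partial>M)) \<longlonglongrightarrow> 0"
      using tendsto_add[OF tendsto_mult[OF tendsto_const[of 2]] tendsto_mult[OF tendsto_const[of 2]]] s
        by fastforce
    show "\<forall>\<^sub>F n in sequentially. (\<integral>x. ((f n x + g n x) - (f' x + g' x))\<^sup>2 \<partial>M) \<le>
      2 * (\<integral>x. (f n x - f' x)\<^sup>2 \<partial>M) + 2 * (\<integral>x. (g n x - g' x)\<^sup>2 \<partial>M)"
    proof (rule always_eventually, rule allI)
      fix n
      have s1: "sqint M (\<lambda>x. f n x - f' x)" "sqint M (\<lambda>x. g n x - g' x)"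
        "sqint M (\<lambda>x. (f n x + g n x) - (f' x + g' x))"
        using s by (auto intro!: sqint_diff sqint_add)
      have "(\<integral>x. ((f n x + g n x) - (f' x + g' x))\<^sup>2 \<partial>M) \<le> (\<integral>x. 2 * (f n x - f' x)\<^sup>2 + 2 * (g n x - g' x)\<^sup>2 \<partial>M)"
      proof (rule integral_mono)
        show "((f n x + g n x) - (f' x + g' x))\<^sup>2 \<le> 2 * (f n x - f' x)\<^sup>2 + 2 * (g n x - g' x)\<^sup>2" for x
          using sum_squares_bound[of "f n x - f' x" "g n x - g' x"]
            by (simp add: power2_eq_square algebra_simps)
      qed (use s1 in \<open>auto simp: sqint_def\<close>)
      then show "(\<integral>x. ((f n x + g n x) - (f' x + g' x))\<^sup>2 \<partial>M) \<le>
        2 * (\<integral>x. (f n x - f' x)\<^sup>2 \<partial>M) + 2 * (\<integral>x. (g n x - g' x)\<^sup>2 \<partial>M)"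
        using s1 by (simp add: sqint_def)
    qed
  qed (auto intro!: always_eventually)
  then show ?thesis using s by (auto simp: L2_conv_def intro: sqint_add)
qed

lemma L2_conv_cmult:
  assumes "L2_conv M f g"
  shows "L2_conv M (\<lambda>n x. c * f n x) (\<lambda>x. c * g x)"
proof -
  have "(\<lambda>n. c\<^sup>2 * (\<integral>x. (f n x - g x)\<^sup>2 \<partial>M)) \<longlonglongrightarrow> c\<^sup>2 * 0"
    using assms by (intro tendsto_mult tendsto_const) (simp add: L2_conv_def)
  moreover have "c\<^sup>2 * (\<integral>x. (f n x - g x)\<^sup>2 \<partial>M) = (\<integral>x. (c * f n x - c * g x)\<^sup>2 \<partial>M)" for n
    by (simp add: right_diff_distrib[symmetric] power_mult_distrib)
  ultimately show ?thesis using assms by (auto simp: L2_conv_def intro: sqint_cmult)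
qed

lemma L2_conv_sum:
  assumes "\<And>i. i \<in> I \<Longrightarrow> L2_conv M (f i) (g i)"
  shows "L2_conv M (\<lambda>n x. \<Sum>i\<in>I. f i n x) (\<lambda>x. \<Sum>i\<in>I. g i x)"
  using assms
proof (induction I rule: infinite_finite_induct)
  case (insert i I)
  then show ?case by (simp add: L2_conv_add)
qed (auto simp: L2_conv_def sqint_0)

text \<open>Cauchy-Schwarz handles one varying factor; that gives convergence of the squared norms,
  and polarization gives the case of two varying factors.\<close>

lemma L2_conv_inner:
  assumes "L2_conv M f f'" "L2_conv M g g'"
  shows "(\<lambda>n. \<integral>x. f n x * g n x \<partial>M) \<longlonglongrightarrow> (\<integral>x. f' x * g' x \<partial>M)"
proof -
  note s = assms[unfolded L2_conv_def]
  have half: "(\<lambda>n. \<integral>x. h n x * k x \<partial>M) \<longlonglongrightarrow> (\<integral>x. h' x * k x \<partial>M)"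
    if h: "L2_conv M h h'" and k: "sqint M k" for h :: "nat \<Rightarrow> 'a \<Rightarrow> real" and h' k
  proof -
    note h = h[unfolded L2_conv_def]
    have "(\<lambda>n. \<integral>x. (h n x - h' x) * k x \<partial>M) \<longlonglongrightarrow> 0"
    proof (rule Lim_null_comparison)
      show "\<forall>\<^sub>F n in sequentially. norm (\<integral>x. (h n x - h' x) * k x \<partial>M)
        \<le> sqrt ((\<integral>x. (h n x - h' x)\<^sup>2 \<partial>M) * (\<integral>x. (k x)\<^sup>2 \<partial>M))"
      proof (rule always_eventually, rule allI)
        fix n
        show "norm (\<integral>x. (h n x - h' x) * k x \<partial>M) \<le> sqrt ((\<integral>x. (h n x - h' x)\<^sup>2 \<partial>M) * (\<integral>x. (k x)\<^sup>2 \<partial>M))"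
          using integral_cauchy_schwarz[of M "\<lambda>x. h n x - h' x" k] h k
          by (simp add: real_le_rsqrt sqint_diff)
      qed
      have "(\<lambda>n. sqrt ((\<integral>x. (h n x - h' x)\<^sup>2 \<partial>M) * (\<integral>x. (k x)\<^sup>2 \<partial>M))) \<longlonglongrightarrow> sqrt (0 * (\<integral>x. (k x)\<^sup>2 \<partial>M))"
        using h by (intro tendsto_intros) auto
      then show "(\<lambda>n. sqrt ((\<integral>x. (h n x - h' x)\<^sup>2 \<partial>M) * (\<integral>x. (k x)\<^sup>2 \<partial>M))) \<longlonglongrightarrow> 0" by simp
    qed
    moreover have "(\<integral>x. (h n x - h' x) * k x \<partial>M) = (\<integral>x. h n x * k x \<partial>M) - (\<integral>x. h' x * k x \<partial>M)" for n
      using h k by (simp add: left_diff_distrib sqint_mult_integrable)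
    ultimately show ?thesis by (simp add: LIM_zero_iff)
  qed
  have polar: "a * b = ((a + b)\<^sup>2 - a\<^sup>2 - b\<^sup>2) / 2" for a b :: real
    by (simp add: power2_eq_square algebra_simps)
  have sq: "(\<lambda>n. \<integral>x. (h n x)\<^sup>2 \<partial>M) \<longlonglongrightarrow> (\<integral>x. (h' x)\<^sup>2 \<partial>M)" if h: "L2_conv M h h'" for h :: "nat \<Rightarrow> 'a \<Rightarrow> real" and h'
  proof -
    note hs = h[unfolded L2_conv_def]
    have "(\<lambda>n. (\<integral>x. (h n x - h' x)\<^sup>2 \<partial>M) + 2 * (\<integral>x. h n x * h' x \<partial>M) - (\<integral>x. (h' x)\<^sup>2 \<partial>M)) \<longlonglongrightarrow> 0
      + 2 * (\<integral>x. h' x * h' x \<partial>M) - (\<integral>x. (h' x)\<^sup>2 \<partial>M)"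
      using hs half[OF h] by (intro tendsto_intros) auto
    moreover have "(\<integral>x. (h n x - h' x)\<^sup>2 \<partial>M) + 2 * (\<integral>x. h n x * h' x \<partial>M) - (\<integral>x. (h' x)\<^sup>2 \<partial>M)
      = (\<integral>x. (h n x)\<^sup>2 \<partial>M)" for n
    proof -
      have "(\<integral>x. (h n x)\<^sup>2 \<partial>M) = (\<integral>x. (h n x - h' x)\<^sup>2 + 2 * (h n x * h' x) - (h' x)\<^sup>2 \<partial>M)"
        by (intro Bochner_Integration.integral_cong) (auto simp: power2_eq_square algebra_simps)
      also have "\<dots> = (\<integral>x. (h n x - h' x)\<^sup>2 \<partial>M) + 2 * (\<integral>x. h n x * h' x \<partial>M) - (\<integral>x. (h' x)\<^sup>2 \<partial>M)"
        using hs sqint_mult_integrable[of M "h n" h'] sqint_diff[of M "h n" h'] by (auto simp: sqint_def)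
      finally show ?thesis ..
    qed
    ultimately show ?thesis by (simp add: power2_eq_square)
  qed
  have id: "(\<integral>x. p x * q x \<partial>M) = ((\<integral>x. (p x + q x)\<^sup>2 \<partial>M) - (\<integral>x. (p x)\<^sup>2 \<partial>M) - (\<integral>x. (q x)\<^sup>2 \<partial>M)) / 2"
    if "sqint M p" "sqint M q" for p q :: "'a \<Rightarrow> real"
    unfolding polar using that sqint_add[OF that] by (simp add: sqint_def)
  have "(\<lambda>n. ((\<integral>x. (f n x + g n x)\<^sup>2 \<partial>M) - (\<integral>x. (f n x)\<^sup>2 \<partial>M) - (\<integral>x. (g n x)\<^sup>2 \<partial>M)) / 2) \<longlonglongrightarrow>
     ((\<integral>x. (f' x + g' x)\<^sup>2 \<partial>M) - (\<integral>x. (f' x)\<^sup>2 \<partial>M) - (\<integral>x. (g' x)\<^sup>2 \<partial>M)) / 2"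
    using sq[OF L2_conv_add[OF assms]] sq[OF assms(1)] sq[OF assms(2)] by (intro tendsto_intros) auto
  then show ?thesis using s by (simp only: id)
qed

text \<open>The characteristic function at frequency 1 only, with the variance read off the variable
  itself. Required of all multiples of a variable, it says that the variable is centered Gaussian;
  variance 0 is included.\<close>

definition gaussian_rv :: "'a measure \<Rightarrow> ('a \<Rightarrow> real) \<Rightarrow> bool" where
  "gaussian_rv M Y \<longleftrightarrow> sqint M Y \<and>
     (CLINT x|M. iexp (Y x)) = complex_of_real (exp (- (\<integral>x. (Y x)\<^sup>2 \<partial>M) / 2))"

text \<open>The map y \<mapsto> exp (i y) is 1-Lipschitz, so convergence in mean square moves both
  sides of the defining identity to the limit.\<close>

lemma (in prob_space) gaussian_rv_limit:
  assumes g: "\<And>n. gaussian_rv M (Y n)" and lim: "L2_conv M Y V"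
  shows "gaussian_rv M V"
proof -
  note s = lim[unfolded L2_conv_def]
  have [measurable]: "Y n \<in> borel_measurable M" "V \<in> borel_measurable M" for n
    using s by (auto simp: sqint_def)
  have int: "integrable M (\<lambda>x. iexp (f x))" if "f \<in> borel_measurable M" for f :: "'a \<Rightarrow> real"
    using that by (intro integrable_iexp) auto
  have s1: "sqint M (\<lambda>x. 1)" by (simp add: sqint_def)
  have "(\<lambda>n. (CLINT x|M. iexp (Y n x)) - (CLINT x|M. iexp (V x))) \<longlonglongrightarrow> 0"
  proof (rule Lim_null_comparison)
    show "\<forall>\<^sub>F n in sequentially. norm ((CLINT x|M. iexp (Y n x)) - (CLINT x|M. iexp (V x)))
      \<le> sqrt (\<integral>x. (Y n x - V x)\<^sup>2 \<partial>M)"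
    proof (rule always_eventually, rule allI)
      fix n
      have d: "sqint M (\<lambda>x. Y n x - V x)" using s by (auto intro: sqint_diff)
      then have d': "sqint M (\<lambda>x. \<bar>Y n x - V x\<bar>)" by (simp add: sqint_def)
      have "norm ((CLINT x|M. iexp (Y n x)) - (CLINT x|M. iexp (V x)))
        = norm (CLINT x|M. iexp (Y n x) - iexp (V x))"
        using int by simp
      also have "\<dots> \<le> (\<integral>x. norm (iexp (Y n x) - iexp (V x)) \<partial>M)" by (rule integral_norm_bound)
      also have "\<dots> \<le> (\<integral>x. \<bar>Y n x - V x\<bar> \<partial>M)"
      proof (rule integral_mono)
        show "integrable M (\<lambda>x. \<bar>Y n x - V x\<bar>)" using sqint_mult_integrable[OF d' s1] by simp
        show "integrable M (\<lambda>x. norm (iexp (Y n x) - iexp (V x)))" using int by auto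
        fix x
        have "iexp (Y n x) - iexp (V x) = iexp (V x) * (iexp (Y n x - V x) - 1)"
          by (simp add: right_diff_distrib mult_exp_exp)
        then have "norm (iexp (Y n x) - iexp (V x)) = norm (iexp (Y n x - V x) - 1)" by (simp add: norm_mult)
        also have "\<dots> \<le> \<bar>Y n x - V x\<bar>" using iexp_approx1[of "Y n x - V x" 0] by simp
        finally show "norm (iexp (Y n x) - iexp (V x)) \<le> \<bar>Y n x - V x\<bar>" .
      qed
      also have "\<dots> \<le> sqrt (\<integral>x. (Y n x - V x)\<^sup>2 \<partial>M)"
        using integral_cauchy_schwarz[OF d' s1] by (intro real_le_rsqrt) (simp add: prob_space)
      finally show "norm ((CLINT x|M. iexp (Y n x)) - (CLINT x|M. iexp (V x)))
        \<le> sqrt (\<integral>x. (Y n x - V x)\<^sup>2 \<partial>M)" .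
    qed
    show "(\<lambda>n. sqrt (\<integral>x. (Y n x - V x)\<^sup>2 \<partial>M)) \<longlonglongrightarrow> 0"
      using tendsto_real_sqrt[of _ 0] s by fastforce
  qed
  then have 1: "(\<lambda>n. CLINT x|M. iexp (Y n x)) \<longlonglongrightarrow> (CLINT x|M. iexp (V x))"
    by (rule LIM_zero_cancel)
  have "(\<lambda>n. complex_of_real (exp (- (\<integral>x. Y n x * Y n x \<partial>M) / 2))) \<longlonglongrightarrow> complex_of_real (exp (- (\<integral>x. V x
    * V x \<partial>M) / 2))"
    by (intro tendsto_intros L2_conv_inner lim) simp
  then have 2: "(\<lambda>n. CLINT x|M. iexp (Y n x)) \<longlonglongrightarrow> complex_of_real (exp (- (\<integral>x. (V x)\<^sup>2 \<partial>M) / 2))"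
    using g by (simp add: gaussian_rv_def power2_eq_square)
  show ?thesis using LIMSEQ_unique[OF 1 2] s by (simp add: gaussian_rv_def)
qed

lemma (in prob_space) gaussian_char:
  assumes "\<And>\<theta>. gaussian_rv M (\<lambda>x. \<theta> * Z x)"
  shows "char (distr M borel Z) \<theta> = complex_of_real (exp (- \<theta>\<^sup>2 * (\<integral>x. (Z x)\<^sup>2 \<partial>M) / 2))"
proof -
  have [measurable]: "Z \<in> borel_measurable M" using assms[of 1] by (simp add: gaussian_rv_def sqint_def)
  have "char (distr M borel Z) \<theta> = (CLINT x|M. iexp (\<theta> * Z x))"
    unfolding char_def by (simp add: integral_distr)
  also have "\<dots> = complex_of_real (exp (- (\<integral>x. (\<theta> * Z x)\<^sup>2 \<partial>M) / 2))"
    using assms by (simp only: gaussian_rv_def)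
  finally show ?thesis by (simp add: power_mult_distrib)
qed

lemma (in prob_space) gaussian_symmetric:
  assumes g: "\<And>\<theta>. gaussian_rv M (\<lambda>x. \<theta> * Z x)"
  shows "distr M borel (\<lambda>x. - Z x) = distr M borel Z"
proof (rule Levy_uniqueness)
  have [measurable]: "Z \<in> borel_measurable M" using g[of 1] by (simp add: gaussian_rv_def sqint_def)
  show "real_distribution (distr M borel (\<lambda>x. - Z x))" "real_distribution (distr M borel Z)"
    by (intro real_distribution_distr; simp)+
  have g': "gaussian_rv M (\<lambda>x. \<theta> * - Z x)" for \<theta> using g[of "-\<theta>"] by simp
  show "char (distr M borel (\<lambda>x. - Z x)) = char (distr M borel Z)"
    by (rule ext) (simp add: gaussian_char[OF g] gaussian_char[OF g'])
qed

lemma (in prob_space) gaussian_distributed_normal: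
  assumes g: "\<And>\<theta>. gaussian_rv M (\<lambda>x. \<theta> * Z x)" and l: "(\<integral>x. (Z x)\<^sup>2 \<partial>M) = l" "0 < l"
  shows "distributed M lborel Z (normal_density 0 (sqrt l))"
proof -
  have [measurable]: "Z \<in> borel_measurable M" using g[of 1] by (simp add: gaussian_rv_def sqint_def)
  have gs: "gaussian_rv M (\<lambda>x. \<theta> * (Z x / sqrt l))" for \<theta> using g[of "\<theta> / sqrt l"] by simp
  have "(\<integral>x. (Z x / sqrt l)\<^sup>2 \<partial>M) = 1" using l by (simp add: power_divide)
  then have "char (distr M borel (\<lambda>x. Z x / sqrt l)) = char std_normal_distribution"
    by (intro ext) (simp add: gaussian_char[OF gs] char_std_normal_distribution)
  then have "distr M borel (\<lambda>x. Z x / sqrt l) = std_normal_distribution"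
    by (intro Levy_uniqueness real_distribution_distr) (auto simp: real_dist_normal_dist)
  moreover have "distr M lborel (\<lambda>x. Z x / sqrt l) = distr M borel (\<lambda>x. Z x / sqrt l)"
    by (intro distr_cong) auto
  ultimately have "distributed M lborel (\<lambda>x. Z x / sqrt l) std_normal_density"
    by (simp add: distributed_def)
  then show ?thesis using normal_standard_normal_convert[of "sqrt l" Z 0] l by simp
qed

text \<open>Without cross terms the variance of a combination is the sum of the variances, so its
  characteristic function is a product and Kac's criterion applies.\<close>

lemma (in prob_space) gaussian_uncorrelated_indep:
  fixes Z :: "'i \<Rightarrow> 'a \<Rightarrow> real"
  assumes g: "\<And>J \<theta>. finite J \<Longrightarrow> J \<subseteq> I \<Longrightarrow> gaussian_rv M (\<lambda>x. \<Sum>j\<in>J. \<theta> j * Z j x)"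
    and uncor: "\<And>i j. i \<in> I \<Longrightarrow> j \<in> I \<Longrightarrow> i \<noteq> j \<Longrightarrow> (\<integral>x. Z i x * Z j x \<partial>M) = 0"
  shows "indep_vars (\<lambda>_. borel) Z I"
proof (rule indep_vars_if_char_factorizes)
  have sq: "sqint M (Z i)" if "i \<in> I" for i
    using g[of "{i}" "\<lambda>_. 1"] that by (simp add: gaussian_rv_def)
  then show "Z i \<in> borel_measurable M" if "i \<in> I" for i using that by (simp add: sqint_def)
  fix J \<theta> assume J: "finite J" "J \<subseteq> I"
  have one: "(CLINT x|M. iexp (\<theta> j * Z j x)) = complex_of_real (exp (- ((\<theta> j)\<^sup>2 * (\<integral>x. (Z j x)\<^sup>2 \<partial>M)) / 2))"
    if "j \<in> J" for j
  proof -
    have "{j} \<subseteq> I" using that J by auto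
    then show ?thesis using g[of "{j}" \<theta>] by (simp add: gaussian_rv_def power_mult_distrib)
  qed
  have "(\<integral>x. (\<Sum>j\<in>J. \<theta> j * Z j x)\<^sup>2 \<partial>M) = (\<integral>x. (\<Sum>i\<in>J. \<Sum>j\<in>J. (\<theta> i * \<theta> j) * (Z i x * Z j x)) \<partial>M)"
    by (intro Bochner_Integration.integral_cong) (auto simp: power2_eq_square sum_product mult_ac)
  also have "\<dots> = (\<Sum>i\<in>J. \<Sum>j\<in>J. (\<theta> i * \<theta> j) * (\<integral>x. Z i x * Z j x \<partial>M))"
  proof -
    have "integrable M (\<lambda>x. Z i x * Z j x)" if "i \<in> J" "j \<in> J" for i j
      using that sq J by (intro sqint_mult_integrable) auto
    then show ?thesis by simp
  qed
  also have "\<dots> = (\<Sum>i\<in>J. \<Sum>j\<in>J. if j = i then (\<theta> i * \<theta> i) * (\<integral>x. Z i x * Z i x \<partial>M) else 0)"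
    using uncor J by (intro sum.cong refl) (auto split: if_splits)
  also have "\<dots> = (\<Sum>i\<in>J. (\<theta> i)\<^sup>2 * (\<integral>x. (Z i x)\<^sup>2 \<partial>M))"
    using J by (simp add: power2_eq_square)
  finally have v: "(\<integral>x. (\<Sum>j\<in>J. \<theta> j * Z j x)\<^sup>2 \<partial>M) = (\<Sum>i\<in>J. (\<theta> i)\<^sup>2 * (\<integral>x. (Z i x)\<^sup>2 \<partial>M))" .
  have "(CLINT x|M. iexp (\<Sum>j\<in>J. \<theta> j * Z j x)) = complex_of_real (exp (- (\<integral>x. (\<Sum>j\<in>J. \<theta> j * Z j x)\<^sup>2 \<partial>M) / 2))"
    using g[OF J, of \<theta>] by (simp only: gaussian_rv_def)
  also have "- (\<integral>x. (\<Sum>j\<in>J. \<theta> j * Z j x)\<^sup>2 \<partial>M) / 2 = (\<Sum>j\<in>J. - ((\<theta> j)\<^sup>2 * (\<integral>x. (Z j x)\<^sup>2 \<partial>M)) / 2)"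
    unfolding v by (simp add: sum_negf sum_divide_distrib)
  also have "complex_of_real (exp \<dots>) = (\<Prod>j\<in>J. complex_of_real (exp (- ((\<theta> j)\<^sup>2 * (\<integral>x. (Z j x)\<^sup>2 \<partial>M)) / 2)))"
    using J by (simp only: exp_sum of_real_prod)
  also have "\<dots> = (\<Prod>j\<in>J. (CLINT x|M. iexp (\<theta> j * Z j x)))"
    using one by (intro prod.cong) auto
  finally show "(CLINT x|M. iexp (\<Sum>j\<in>J. \<theta> j * Z j x)) = (\<Prod>j\<in>J. (CLINT x|M. iexp (\<theta> j * Z j x)))" .
qed

section \<open>Mercer's theorem\<close>

lemma continuous_on_integral_dominated:
  fixes H :: "real \<Rightarrow> 'b \<Rightarrow> real"
  assumes m: "\<And>t. H t \<in> borel_measurable N" and w: "integrable N w"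
    and c: "\<And>s. continuous_on UNIV (\<lambda>t. H t s)" and b: "\<And>t. AE s in N. \<bar>H t s\<bar> \<le> w s"
  shows "continuous_on UNIV (\<lambda>t. \<integral>s. H t s \<partial>N)"
proof (rule continuous_at_imp_continuous_on, rule ballI)
  fix t
  show "isCont (\<lambda>t. \<integral>s. H t s \<partial>N) t"
    unfolding continuous_at_sequentially comp_def
  proof (intro allI impI)
    fix u :: "nat \<Rightarrow> real" assume u: "u \<longlonglongrightarrow> t"
    show "(\<lambda>n. \<integral>s. H (u n) s \<partial>N) \<longlonglongrightarrow> (\<integral>s. H t s \<partial>N)"
    proof (rule integral_dominated_convergence[where w = w])
      show "AE s in N. (\<lambda>n. H (u n) s) \<longlonglongrightarrow> H t s"
        by (rule AE_I2, rule continuous_on_tendsto_compose[OF c u]) auto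
    qed (use m w b in auto)
  qed
qed

text \<open>The assumption \<open>full\<close> expresses that the support is all of [0,T], in the
  form in which it is used: a continuous function that vanishes almost everywhere vanishes at each
  point of [0,T]. The kernel lives on the whole plane so that continuity and bounds need no
  restriction.\<close>

locale mercer_kernel = finite_measure \<mu> for \<mu> :: "real measure" +
  fixes T B :: real and K :: "real \<Rightarrow> real \<Rightarrow> real"
  assumes T: "0 \<le> T" and sets_\<mu>: "sets \<mu> = sets borel" and conc: "AE s in \<mu>. s \<in> {0..T}"
    and full: "\<And>f s. continuous_on UNIV f \<Longrightarrow> AE s in \<mu>. f s = 0 \<Longrightarrow> s \<in> {0..T} \<Longrightarrow> f s = (0::real)"
    and K_cont: "continuous_on UNIV (\<lambda>(s, t). K s t)"
    and K_sym: "K s t = K t s"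
    and K_bdd: "\<bar>K s t\<bar> \<le> B"
begin

definition A :: "(real \<Rightarrow> real) \<Rightarrow> real \<Rightarrow> real" where
  "A f t = (\<integral>s. K t s * f s \<partial>\<mu>)"

abbreviation ip :: "(real \<Rightarrow> real) \<Rightarrow> (real \<Rightarrow> real) \<Rightarrow> real" where
  "ip f g \<equiv> (\<integral>s. f s * g s \<partial>\<mu>)"

abbreviation q :: "(real \<Rightarrow> real) \<Rightarrow> real" where
  "q f \<equiv> (\<integral>s. (f s)\<^sup>2 \<partial>\<mu>)"

lemma meas_\<mu>: "f \<in> borel_measurable \<mu> \<longleftrightarrow> f \<in> borel_measurable borel"
  using measurable_cong_sets[OF sets_\<mu> refl] by blast

lemma space_\<mu>: "space \<mu> = UNIV"
  using sets_eq_imp_space_eq[OF sets_\<mu>] by simp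

lemma sqint_cont:
  assumes "continuous_on UNIV f"
  shows "sqint \<mu> f"
proof -
  have m: "f \<in> borel_measurable \<mu>" unfolding meas_\<mu> using assms by (rule borel_measurable_continuous_onI)
  have "compact (f ` {0..T})"
    by (intro compact_continuous_image continuous_on_subset[OF assms]) auto
  then obtain b where "\<forall>x\<in>f ` {0..T}. norm x \<le> b"
    using compact_imp_bounded[of "f ` {0..T}"] bounded_iff[of "f ` {0..T}"] by metis
  then have b: "\<bar>f s\<bar> \<le> b" if "s \<in> {0..T}" for s using that by auto
  have "integrable \<mu> (\<lambda>s. (f s)\<^sup>2)"
  proof (rule integrable_const_bound[where B = "b\<^sup>2"])
    show "AE s in \<mu>. norm ((f s)\<^sup>2) \<le> b\<^sup>2"
      using conc by eventually_elim (use b in \<open>auto simp: abs_le_square_iff[symmetric] intro: order_trans[OF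
        _ abs_ge_self]\<close>)
  qed (use m in measurable)
  then show ?thesis using m by (simp add: sqint_def)
qed

lemma K_meas[measurable]: "(\<lambda>s. K t s) \<in> borel_measurable borel"
proof -
  have "continuous_on UNIV (\<lambda>s. (\<lambda>(s, t). K s t) (t, s))"
    by (intro continuous_on_compose2[OF K_cont] continuous_intros) auto
  then show ?thesis by (intro borel_measurable_continuous_onI) simp
qed

lemma K_cont1: "continuous_on UNIV (\<lambda>t. K t s)"
proof -
  have "continuous_on UNIV (\<lambda>t. (\<lambda>(s, t). K s t) (t, s))"
    by (intro continuous_on_compose2[OF K_cont] continuous_intros) auto
  then show ?thesis by simp
qed

lemma K_cont2: "continuous_on UNIV (K t)"
  using K_cont1[of t] by (simp add: K_sym[of t])

lemma sqint_K: "sqint \<mu> (K t)"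
  by (rule sqint_cont[OF K_cont2])

lemma sqint_1: "sqint \<mu> (\<lambda>_. c)"
  by (rule sqint_cont) simp

lemma sqint_integrable: "sqint \<mu> f \<Longrightarrow> integrable \<mu> f"
  using sqint_mult_integrable[OF _ sqint_1[of 1], of f] by simp

lemma A_cont:
  assumes "sqint \<mu> f"
  shows "continuous_on UNIV (A f)"
  unfolding A_def
proof (rule continuous_on_integral_dominated[where w = "\<lambda>s. B * \<bar>f s\<bar>"])
  have [measurable]: "f \<in> borel_measurable borel" using assms by (simp add: sqint_def meas_\<mu>)
  show "(\<lambda>s. K t s * f s) \<in> borel_measurable \<mu>" for t unfolding meas_\<mu> by measurable
  show "integrable \<mu> (\<lambda>s. B * \<bar>f s\<bar>)" using sqint_integrable[OF assms] by simp
  show "continuous_on UNIV (\<lambda>t. K t s * f s)" for s by (intro continuous_intros K_cont1)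
  show "AE s in \<mu>. \<bar>K t s * f s\<bar> \<le> B * \<bar>f s\<bar>" for t
    using K_bdd by (intro AE_I2) (auto simp: abs_mult intro!: mult_right_mono)
qed

lemma A_linear:
  assumes "sqint \<mu> f" "sqint \<mu> g"
  shows "A (\<lambda>s. a * f s + b * g s) t = a * A f t + b * A g t"
proof -
  have "A (\<lambda>s. a * f s + b * g s) t = (\<integral>s. a * (K t s * f s) + b * (K t s * g s) \<partial>\<mu>)"
    unfolding A_def by (intro Bochner_Integration.integral_cong) (auto simp: algebra_simps)
  then show ?thesis
    using sqint_mult_integrable[OF sqint_K assms(1), of t] sqint_mult_integrable[OF sqint_K assms(2), of t]
    by (simp add: A_def)
qed

lemma A_selfadjoint:
  assumes f: "sqint \<mu> f" and g: "sqint \<mu> g"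
  shows "ip (A f) g = ip f (A g)"
proof -
  interpret P: pair_sigma_finite \<mu> \<mu> ..
  have [measurable]: "f \<in> borel_measurable \<mu>" "g \<in> borel_measurable \<mu>" using f g by (auto simp: sqint_def)
  have Km: "(\<lambda>(s, t). K s t) \<in> borel_measurable (\<mu> \<Otimes>\<^sub>M \<mu>)"
  proof -
    have "(\<lambda>(s, t). K s t) \<in> borel_measurable (borel \<Otimes>\<^sub>M borel)"
      using borel_measurable_continuous_onI[OF K_cont] by (simp add: borel_prod)
    then show ?thesis using measurable_cong_sets[OF sets_pair_measure_cong[OF sets_\<mu> sets_\<mu>] refl] by blast
  qed
  have int: "integrable (\<mu> \<Otimes>\<^sub>M \<mu>) (\<lambda>(t, s). K t s * f s * g t)"
  proof (rule P.Fubini_integrable)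
    show "(\<lambda>(t, s). K t s * f s * g t) \<in> borel_measurable (\<mu> \<Otimes>\<^sub>M \<mu>)"
      using Km by (simp add: case_prod_beta')
    have i: "integrable \<mu> (\<lambda>s. K t s * f s * g t)" for t
      using sqint_mult_integrable[OF sqint_K f, of t] by simp
    then show "AE t in \<mu>. integrable \<mu> (\<lambda>s. (\<lambda>(t, s). K t s * f s * g t) (t, s))" by simp
    show "integrable \<mu> (\<lambda>t. \<integral>s. norm ((\<lambda>(t, s). K t s * f s * g t) (t, s)) \<partial>\<mu>)"
    proof (rule Bochner_Integration.integrable_bound[of _ "\<lambda>t. (B * (\<integral>s. \<bar>f s\<bar> \<partial>\<mu>)) * \<bar>g t\<bar>"])
      show "integrable \<mu> (\<lambda>t. (B * (\<integral>s. \<bar>f s\<bar> \<partial>\<mu>)) * \<bar>g t\<bar>)" using sqint_integrable[OF g] by simp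
      show "(\<lambda>t. \<integral>s. norm ((\<lambda>(t, s). K t s * f s * g t) (t, s)) \<partial>\<mu>) \<in> borel_measurable \<mu>"
        using Km by (intro borel_measurable_lebesgue_integral) (simp add: case_prod_beta')
      show "AE t in \<mu>. norm (\<integral>s. norm ((\<lambda>(t, s). K t s * f s * g t) (t, s)) \<partial>\<mu>)
        \<le> norm ((B * (\<integral>s. \<bar>f s\<bar> \<partial>\<mu>)) * \<bar>g t\<bar>)"
      proof (rule AE_I2)
        fix t
        have "(\<integral>s. \<bar>K t s * f s * g t\<bar> \<partial>\<mu>) \<le> (\<integral>s. (B * \<bar>f s\<bar>) * \<bar>g t\<bar> \<partial>\<mu>)"
        proof (rule integral_mono)
          show "integrable \<mu> (\<lambda>s. \<bar>K t s * f s * g t\<bar>)" by (rule integrable_abs[OF i])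
          show "integrable \<mu> (\<lambda>s. (B * \<bar>f s\<bar>) * \<bar>g t\<bar>)" using sqint_integrable[OF f] by simp
          show "\<bar>K t s * f s * g t\<bar> \<le> (B * \<bar>f s\<bar>) * \<bar>g t\<bar>" for s
            using K_bdd by (auto simp: abs_mult intro!: mult_right_mono)
        qed
        then show "norm (\<integral>s. norm ((\<lambda>(t, s). K t s * f s * g t) (t, s)) \<partial>\<mu>)
          \<le> norm ((B * (\<integral>s. \<bar>f s\<bar> \<partial>\<mu>)) * \<bar>g t\<bar>)"
          by simp
      qed
    qed
  qed
  have "ip (A f) g = (\<integral>t. \<integral>s. K t s * f s * g t \<partial>\<mu> \<partial>\<mu>)" by (simp add: A_def)
  also have "\<dots> = (\<integral>s. \<integral>t. K t s * f s * g t \<partial>\<mu> \<partial>\<mu>)"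
    by (rule P.Fubini_integral[OF int, symmetric])
  also have "\<dots> = (\<integral>s. f s * (\<integral>t. K s t * g t \<partial>\<mu>) \<partial>\<mu>)"
    by (intro Bochner_Integration.integral_cong refl, subst integral_mult_right_zero[symmetric])
       (auto intro!: Bochner_Integration.integral_cong simp: K_sym mult_ac)
  finally show ?thesis by (simp add: A_def)
qed

lemma A_bound:
  assumes f: "sqint \<mu> f"
  shows "(A f t)\<^sup>2 \<le> B\<^sup>2 * measure \<mu> UNIV * q f"
proof -
  have "(A f t)\<^sup>2 \<le> q (K t) * q f"
    unfolding A_def by (rule integral_cauchy_schwarz[OF sqint_K f])
  also have "q (K t) \<le> (\<integral>s. B\<^sup>2 \<partial>\<mu>)"
    using sqint_K[of t] K_bdd by (intro integral_mono)
      (auto simp: sqint_def abs_le_square_iff[symmetric] intro: order_trans[OF _ abs_ge_self])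
  also have "(\<integral>s. B\<^sup>2 \<partial>\<mu>) = B\<^sup>2 * measure \<mu> UNIV" by (simp add: space_\<mu>)
  finally show ?thesis by (simp add: mult_right_mono)
qed

lemma A_qbound:
  assumes f: "sqint \<mu> f"
  shows "q (A f) \<le> (B * measure \<mu> UNIV)\<^sup>2 * q f"
proof -
  have "q (A f) \<le> (\<integral>t. B\<^sup>2 * measure \<mu> UNIV * q f \<partial>\<mu>)"
    using sqint_cont[OF A_cont[OF f]] by (intro integral_mono A_bound f) (auto simp: sqint_def)
  also have "\<dots> = (B * measure \<mu> UNIV)\<^sup>2 * q f" by (simp add: space_\<mu> power2_eq_square)
  finally show ?thesis .
qed

lemma q_eq_0:
  assumes "continuous_on UNIV f" "q f = 0" "t \<in> {0..T}"
  shows "f t = 0"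
proof (rule full[OF assms(1) _ assms(3)])
  have "AE s in \<mu>. (f s)\<^sup>2 = 0"
    using assms(2) sqint_cont[OF assms(1)] by (subst (asm) integral_nonneg_eq_0_iff_AE) (auto simp: sqint_def)
  then show "AE s in \<mu>. f s = 0" by simp
qed

lemma L2_conv_uniform:
  assumes f: "\<And>n. continuous_on UNIV (f n)" and g: "continuous_on UNIV g"
    and u: "\<And>\<epsilon>. 0 < \<epsilon> \<Longrightarrow> \<exists>N. \<forall>n\<ge>N. \<forall>s\<in>{0..T}. \<bar>f n s - g s\<bar> < \<epsilon>"
  shows "L2_conv \<mu> f g"
proof -
  have "(\<lambda>n. q (\<lambda>s. f n s - g s)) \<longlonglongrightarrow> 0"
  proof (rule LIMSEQ_I)
    fix \<eta> :: real assume \<eta>: "0 < \<eta>"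
    define m where "m = measure \<mu> UNIV"
    have m: "0 \<le> m" by (simp add: m_def)
    define \<epsilon> where "\<epsilon> = sqrt (\<eta> / (m + 1))"
    have \<epsilon>: "0 < \<epsilon>" "\<epsilon>\<^sup>2 * m < \<eta>" using \<eta> m by (auto simp: \<epsilon>_def field_simps)
    obtain N where N: "\<And>n s. n \<ge> N \<Longrightarrow> s \<in> {0..T} \<Longrightarrow> \<bar>f n s - g s\<bar> < \<epsilon>" using u[OF \<epsilon>(1)] by blast
    show "\<exists>N. \<forall>n\<ge>N. norm (q (\<lambda>s. f n s - g s) - 0) < \<eta>"
    proof (intro exI allI impI)
      fix n assume n: "n \<ge> N"
      have s: "sqint \<mu> (\<lambda>s. f n s - g s)" by (intro sqint_cont continuous_intros f g)
      have "q (\<lambda>s. f n s - g s) \<le> (\<integral>s. \<epsilon>\<^sup>2 \<partial>\<mu>)"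
      proof (rule integral_mono_AE)
        show "AE s in \<mu>. (f n s - g s)\<^sup>2 \<le> \<epsilon>\<^sup>2"
          using conc
        proof eventually_elim
          case (elim s)
          have "\<bar>f n s - g s\<bar> \<le> \<bar>\<epsilon>\<bar>" using N[OF n elim] by simp
          then show ?case by (simp add: abs_le_square_iff)
        qed
      qed (use s in \<open>auto simp: sqint_def\<close>)
      also have "\<dots> = \<epsilon>\<^sup>2 * m" by (simp add: m_def space_\<mu>)
      finally show "norm (q (\<lambda>s. f n s - g s) - 0) < \<eta>" using \<epsilon> by simp
    qed
  qed
  then show ?thesis using sqint_cont[OF f] sqint_cont[OF g] by (simp add: L2_conv_def)
qed

text \<open>For fixed t, evaluating \<open>A f\<close> at t is the inner product with
  \<open>K t\<close>; so mean square convergence of the arguments gives pointwise convergence of the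
  images.\<close>

lemma L2_conv_A: "L2_conv \<mu> f g \<Longrightarrow> (\<lambda>n. A (f n) t) \<longlonglongrightarrow> A g t"
  unfolding A_def by (rule L2_conv_inner) (auto simp: L2_conv_def sqint_K)

lemma L2_conv_A':
  assumes fg: "L2_conv \<mu> f g"
  shows "L2_conv \<mu> (\<lambda>n. A (f n)) (A g)"
proof -
  note s = fg[unfolded L2_conv_def]
  have "(\<lambda>n. q (\<lambda>s. A (f n) s - A g s)) \<longlonglongrightarrow> 0"
  proof (rule tendsto_sandwich[OF _ _ tendsto_const])
    have "(\<lambda>n. (B * measure \<mu> UNIV)\<^sup>2 * q (\<lambda>s. f n s - g s)) \<longlonglongrightarrow> (B * measure \<mu> UNIV)\<^sup>2 * 0"
      using s by (intro tendsto_intros) auto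
    then show "(\<lambda>n. (B * measure \<mu> UNIV)\<^sup>2 * q (\<lambda>s. f n s - g s)) \<longlonglongrightarrow> 0" by simp
    have "q (\<lambda>s. A (f n) s - A g s) \<le> (B * measure \<mu> UNIV)\<^sup>2 * q (\<lambda>s. f n s - g s)" for n
      using A_qbound[of "\<lambda>s. f n s - g s"] A_linear[of "f n" g 1 "-1"] s by (simp add: sqint_diff)
    then show "\<forall>\<^sub>F n in sequentially. q (\<lambda>s. A (f n) s - A g s) \<le> (B * measure \<mu> UNIV)\<^sup>2 * q (\<lambda>s. f n s - g s)"
      by simp
  qed (auto intro!: always_eventually)
  then show ?thesis using s by (auto simp: L2_conv_def intro: sqint_cont A_cont)
qed

text \<open>On the continuous functions orthogonal to all \<open>e i\<close>, the squared norm of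
  \<open>A f\<close> is maximized over the unit ball. The extremal limit h solves A(A h) = N^2 h,
  and since A^2 - N^2 = (A + N)(A - N), either (A - N) h or h itself is an eigenfunction of A in the
  complement, against \<open>compl\<close>.\<close>

lemma A_vanishes_on_complement:
  fixes e :: "nat \<Rightarrow> real \<Rightarrow> real"
  assumes e: "\<And>i. continuous_on UNIV (e i)"
    and eig: "\<And>i t. A (e i) t = lam i * e i t"
    and compl: "\<And>l f. l \<noteq> 0 \<Longrightarrow> continuous_on UNIV f \<Longrightarrow> (\<And>t. t \<in> {0..T} \<Longrightarrow> A f t = l * f t) \<Longrightarrow>
       (\<And>i. ip f (e i) = 0) \<Longrightarrow> q f = 0"
    and f0: "continuous_on UNIV f0" "\<And>i. ip f0 (e i) = 0" and t0: "t0 \<in> {0..T}"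
  shows "A f0 t0 = 0"
proof (rule ccontr)
  assume nz: "A f0 t0 \<noteq> 0"
  define H where "H = {f. continuous_on UNIV f \<and> (\<forall>i. ip f (e i) = 0)}"
  have Hs: "sqint \<mu> f" if "f \<in> H" for f using that by (auto simp: H_def intro: sqint_cont)
  have He: "sqint \<mu> (e i)" for i by (rule sqint_cont[OF e])
  have HA: "A f \<in> H" if f: "f \<in> H" for f
  proof -
    have "ip (A f) (e i) = 0" for i
    proof -
      have "ip (A f) (e i) = ip f (A (e i))" by (rule A_selfadjoint[OF Hs[OF f] He])
      also have "\<dots> = (\<integral>s. lam i * (f s * e i s) \<partial>\<mu>)"
        by (intro Bochner_Integration.integral_cong) (auto simp: eig)
      also have "\<dots> = 0" using f by (simp add: H_def)
      finally show ?thesis .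
    qed
    then show ?thesis using A_cont[OF Hs[OF f]] by (simp add: H_def)
  qed
  have Hlin: "(\<lambda>s. a * f s + b * g s) \<in> H" if f: "f \<in> H" and g: "g \<in> H" for f g a b
  proof -
    have "ip (\<lambda>s. a * f s + b * g s) (e i) = 0" for i
    proof -
      have "ip (\<lambda>s. a * f s + b * g s) (e i) = (\<integral>s. a * (f s * e i s) + b * (g s * e i s) \<partial>\<mu>)"
        by (intro Bochner_Integration.integral_cong) (auto simp: algebra_simps)
      also have "\<dots> = a * ip f (e i) + b * ip g (e i)"
        using sqint_mult_integrable[OF Hs[OF f] He] sqint_mult_integrable[OF Hs[OF g] He] by simp
      also have "\<dots> = 0" using f g by (simp add: H_def)
      finally show ?thesis .
    qed
    then show ?thesis using f g by (auto simp: H_def intro!: continuous_intros)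
  qed
  \<comment> \<open>Only a supremum at this stage: the space \<open>H\<close> of continuous
    functions is not complete, so a maximizer among the \<open>f\<close> themselves cannot be
    expected.\<close>
  define Q where "Q = {q (A f) |f. f \<in> H \<and> q f \<le> 1}"
  define N2 where "N2 = Sup Q"
  have bddQ: "bdd_above Q"
  proof (rule bdd_aboveI)
    fix x assume "x \<in> Q"
    then obtain f where f: "x = q (A f)" "f \<in> H" "q f \<le> 1" by (auto simp: Q_def)
    have "q (A f) \<le> (B * measure \<mu> UNIV)\<^sup>2 * q f" by (rule A_qbound[OF Hs[OF f(2)]])
    also have "\<dots> \<le> (B * measure \<mu> UNIV)\<^sup>2 * 1" using f(3) by (intro mult_left_mono) auto
    finally show "x \<le> (B * measure \<mu> UNIV)\<^sup>2" using f by simp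
  qed
  have Qscale: "q (A (\<lambda>s. c * f s)) = c\<^sup>2 * q (A f)" "q (\<lambda>s. c * f s) = c\<^sup>2 * q f" if "f \<in> H" for f c
    using A_linear[OF Hs[OF that] Hs[OF that], of c 0] by (simp_all add: power_mult_distrib)
  have qA0: "q (A f) = 0" if "f \<in> H" "q f = 0" for f
  proof -
    have "q (A f) \<le> 0" using A_qbound[OF Hs[OF that(1)]] that(2) by simp
    then show ?thesis by (simp add: antisym)
  qed
  have normA: "q (A f) \<le> N2 * q f" if f: "f \<in> H" for f
  proof (cases "q f = 0")
    case False
    then have qf: "0 < q f" by (simp add: less_le)
    define c where "c = 1 / sqrt (q f)"
    have c: "c\<^sup>2 = 1 / q f" using qf by (simp add: c_def power_divide)
    have "(\<lambda>s. c * f s + 0 * f s) \<in> H" by (rule Hlin[OF f f])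
    then have "q (A (\<lambda>s. c * f s)) \<in> Q" unfolding Q_def using Qscale(2)[OF f, of c] qf c by auto
    then have "q (A (\<lambda>s. c * f s)) \<le> N2" unfolding N2_def using bddQ by (rule cSup_upper)
    then show ?thesis using qf unfolding Qscale(1)[OF f] c by (simp add: field_simps)
  qed (use qA0[OF f] in simp)
  have f0H: "f0 \<in> H" using f0 by (simp add: H_def)
  have "q (A f0) \<noteq> 0" using q_eq_0[OF A_cont[OF Hs[OF f0H]] _ t0] nz by auto
  then have "0 < q (A f0)" by (simp add: less_le)
  then have N2: "0 < N2" using normA[OF f0H]
    by (smt (verit) Bochner_Integration.integral_nonneg mult_nonpos_nonneg zero_le_power2)
  have "\<exists>f. f \<in> H \<and> q f \<le> 1 \<and> N2 - 1 / real (Suc n) < q (A f)" for n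
  proof -
    have "(\<lambda>s. 0 * f0 s + 0 * f0 s) \<in> H" by (rule Hlin[OF f0H f0H])
    then have "q (A (\<lambda>s. 0)) \<in> Q" unfolding Q_def by auto
    then have "Q \<noteq> {}" by auto
    moreover have "N2 - 1 / real (Suc n) < Sup Q" by (simp add: N2_def)
    ultimately obtain x where "x \<in> Q" "N2 - 1 / real (Suc n) < x" using less_cSupD by blast
    then show ?thesis by (auto simp: Q_def)
  qed
  then obtain f where f: "\<And>n. f n \<in> H" "\<And>n. q (f n) \<le> 1" "\<And>n. N2 - 1 / real (Suc n) < q (A (f n))" by metis
  define M0 where "M0 = sqrt (B\<^sup>2 * measure \<mu> UNIV)"
  obtain g k where gk: "continuous_on {0..T} g" "strict_mono (k :: nat \<Rightarrow> nat)"
    "\<And>\<epsilon>. 0 < \<epsilon> \<Longrightarrow> \<exists>N. \<forall>n x. n \<ge> N \<and> x \<in> {0..T} \<longrightarrow> norm (A (f (k n)) x - g x) < \<epsilon>"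
  proof (rule Arzela_Ascoli[of "{0..T}" "\<lambda>n. A (f n)" M0])
    show "norm (A (f n) x) \<le> M0" for n x
    proof -
      have "(A (f n) x)\<^sup>2 \<le> B\<^sup>2 * measure \<mu> UNIV * q (f n)" by (rule A_bound[OF Hs[OF f(1)]])
      also have "\<dots> \<le> B\<^sup>2 * measure \<mu> UNIV * 1" using f(2)[of n] by (intro mult_left_mono) auto
      finally show ?thesis by (simp add: M0_def real_le_rsqrt)
    qed
    \<comment> \<open>Equicontinuity: by Cauchy-Schwarz all images of the unit ball share the
      modulus of continuity of the map x \<mapsto> \<open>K x\<close> in mean square.\<close>
    fix x \<epsilon> :: real assume "0 < \<epsilon>"
    have "continuous_on UNIV (\<lambda>y. \<integral>s. (K x s - K y s)\<^sup>2 \<partial>\<mu>)"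
    proof (rule continuous_on_integral_dominated[where w = "\<lambda>_. (2 * B)\<^sup>2"])
      show "(\<lambda>s. (K x s - K t s)\<^sup>2) \<in> borel_measurable \<mu>" for t unfolding meas_\<mu> by measurable
      show "AE s in \<mu>. \<bar>(K x s - K t s)\<^sup>2\<bar> \<le> (2 * B)\<^sup>2" for t
      proof (rule AE_I2)
        fix s
        have "\<bar>K x s - K t s\<bar> \<le> \<bar>2 * B\<bar>" using K_bdd[of x s] K_bdd[of t s] by linarith
        then show "\<bar>(K x s - K t s)\<^sup>2\<bar> \<le> (2 * B)\<^sup>2" unfolding abs_le_square_iff by simp
      qed
    qed (auto intro!: continuous_intros K_cont1)
    then have "isCont (\<lambda>y. \<integral>s. (K x s - K y s)\<^sup>2 \<partial>\<mu>) x" by (simp add: continuous_on_eq_continuous_at)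
    from this[unfolded continuous_at_eps_delta, rule_format, of "\<epsilon>\<^sup>2"] \<open>0 < \<epsilon>\<close>
    obtain d where d: "0 < d" "\<And>y. \<bar>y - x\<bar> < d \<Longrightarrow> \<bar>\<integral>s. (K x s - K y s)\<^sup>2 \<partial>\<mu>\<bar> < \<epsilon>\<^sup>2"
      by (auto simp: dist_real_def)
    have "norm (A (f n) x - A (f n) y) < \<epsilon>" if y: "\<bar>x - y\<bar> < d" for n y
    proof -
      have s: "sqint \<mu> (\<lambda>s. K x s - K y s)" by (intro sqint_diff sqint_K)
      have "A (f n) x - A (f n) y = (\<integral>s. (K x s - K y s) * f n s \<partial>\<mu>)"
        using sqint_mult_integrable[OF sqint_K Hs[OF f(1)]] by (simp add: A_def left_diff_distrib)
      then have "(A (f n) x - A (f n) y)\<^sup>2 \<le> (\<integral>s. (K x s - K y s)\<^sup>2 \<partial>\<mu>) * q (f n)"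
        using integral_cauchy_schwarz[OF s Hs[OF f(1)], of n] by simp
      also have "\<dots> \<le> (\<integral>s. (K x s - K y s)\<^sup>2 \<partial>\<mu>) * 1" using f(2)[of n] by (intro mult_left_mono) auto
      also have "\<dots> < \<epsilon>\<^sup>2" using d(2)[of y] y by (simp add: abs_minus_commute)
      finally have "\<bar>A (f n) x - A (f n) y\<bar>\<^sup>2 < \<epsilon>\<^sup>2" by simp
      from power2_less_imp_less[OF this] \<open>0 < \<epsilon>\<close> show ?thesis by simp
    qed
    then show "\<exists>d>0. \<forall>n y. y \<in> {0..T} \<and> norm (x - y) < d \<longrightarrow> norm (A (f n) x - A (f n) y) < \<epsilon>"
      using d(1) by auto
  qed auto
  \<comment> \<open>The limit function is controlled on [0,T] only; clamping its argument gives a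
    continuous function on the line.\<close>
  define h where "h s = g (max 0 (min T s))" for s
  have hg: "h s = g s" if "s \<in> {0..T}" for s using that by (auto simp: h_def)
  have hc: "continuous_on UNIV h" unfolding h_def
    by (rule continuous_on_compose2[OF gk(1)]) (use T in \<open>auto intro!: continuous_intros\<close>)
  define F' where "F' n = A (f (k n))" for n
  have F': "F' n \<in> H" for n unfolding F'_def by (rule HA[OF f(1)])
  have conv: "L2_conv \<mu> F' h"
  proof (rule L2_conv_uniform)
    show "continuous_on UNIV (F' n)" for n using F' by (simp add: H_def)
    show "\<exists>N. \<forall>n\<ge>N. \<forall>s\<in>{0..T}. \<bar>F' n s - h s\<bar> < \<epsilon>" if eps: "0 < \<epsilon>" for \<epsilon>
    proof -
      obtain N where "\<And>n x. n \<ge> N \<Longrightarrow> x \<in> {0..T} \<Longrightarrow> \<bar>A (f (k n)) x - g x\<bar> < \<epsilon>"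
        using gk(3)[OF eps] by (metis real_norm_def)
      then show ?thesis unfolding F'_def by (intro exI[of _ N] allI impI ballI) (simp only: hg)
    qed
  qed (rule hc)
  have hH: "h \<in> H"
  proof -
    have "ip h (e i) = 0" for i
    proof -
      have "(\<lambda>n. ip (F' n) (e i)) \<longlonglongrightarrow> ip h (e i)"
        by (rule L2_conv_inner[OF conv]) (use He in \<open>auto simp: L2_conv_def\<close>)
      moreover have "ip (F' n) (e i) = 0" for n using F' by (simp add: H_def)
      ultimately show ?thesis by (simp add: LIMSEQ_const_iff)
    qed
    then show ?thesis using hc by (simp add: H_def)
  qed
  have kn: "N2 - 1 / real (Suc n) < q (F' n)" for n
  proof -
    have "n \<le> k n" by (rule strict_mono_imp_increasing[OF gk(2)])
    then have "1 / real (Suc (k n)) \<le> 1 / real (Suc n)" by (simp add: field_simps)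
    then show ?thesis using f(3)[of "k n"] by (simp add: F'_def)
  qed
  have inv0: "(\<lambda>n. 1 / real (Suc n)) \<longlonglongrightarrow> 0" using LIMSEQ_inverse_real_of_nat by (simp add: inverse_eq_divide)
  have "q h \<ge> N2"
  proof (rule tendsto_le)
    show "(\<lambda>n. q (F' n)) \<longlonglongrightarrow> q h" using L2_conv_inner[OF conv conv] by (simp add: power2_eq_square)
    show "(\<lambda>n. N2 - 1 / real (Suc n)) \<longlonglongrightarrow> N2" using tendsto_diff[OF tendsto_const inv0, of N2] by simp
    show "\<forall>\<^sub>F n in sequentially. N2 - 1 / real (Suc n) \<le> q (F' n)" using kn
      by (auto intro!: always_eventually less_imp_le)
  qed simp
  have AAh: "A (A h) t = N2 * h t" if t: "t \<in> {0..T}" for t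
  proof -
    \<comment> \<open>The residual (A^2 - N2) f of the maximizing sequence. Expanding the square
      bounds its squared norm by N2 times the distance of \<open>q (F' n)\<close> from the supremum,
      so it tends to 0; applying A once more makes everything converge pointwise.\<close>
    define r where "r n = (\<lambda>s. 1 * A (F' n) s + (- N2) * f (k n) s)" for n
    have rH: "r n \<in> H" for n unfolding r_def by (rule Hlin[OF HA[OF F'] f(1)])
    have qr: "q (r n) \<le> N2 * (1 / real (Suc n))" for n
    proof -
      have s1: "sqint \<mu> (A (F' n))" "sqint \<mu> (f (k n))" "sqint \<mu> (F' n)" using Hs HA F' f(1) by auto
      have "q (r n) = (\<integral>s. (A (F' n) s)\<^sup>2 + (- 2 * N2) * (A (F' n) s * f (k n) s) + N2\<^sup>2 * (f (k n) s)\<^sup>2 \<partial>\<mu>)"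
        unfolding r_def by (intro Bochner_Integration.integral_cong) (auto simp: power2_eq_square algebra_simps)
      also have "\<dots> = q (A (F' n)) + (- 2 * N2) * ip (A (F' n)) (f (k n)) + N2\<^sup>2 * q (f (k n))"
        using s1 sqint_mult_integrable[OF s1(1,2)] by (simp add: sqint_def)
      also have "ip (A (F' n)) (f (k n)) = q (F' n)"
        unfolding A_selfadjoint[OF s1(3,2)] by (simp add: F'_def power2_eq_square)
      also have "q (A (F' n)) \<le> N2 * q (F' n)" by (rule normA[OF F'])
      also have "N2\<^sup>2 * q (f (k n)) \<le> N2\<^sup>2 * 1" using f(2) by (intro mult_left_mono) auto
      finally have "q (r n) \<le> N2 * (N2 - q (F' n))" by (simp add: power2_eq_square algebra_simps)
      also have "\<dots> \<le> N2 * (1 / real (Suc n))" using N2 kn[of n] by (intro mult_left_mono) auto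
      finally show ?thesis .
    qed
    have lim0: "(\<lambda>n. A (r n) t) \<longlonglongrightarrow> 0"
    proof (rule Lim_null_comparison)
      let ?c = "B\<^sup>2 * measure \<mu> UNIV * N2"
      show "\<forall>\<^sub>F n in sequentially. norm (A (r n) t) \<le> sqrt (?c * (1 / real (Suc n)))"
      proof (rule always_eventually, rule allI)
        fix n
        have "(A (r n) t)\<^sup>2 \<le> B\<^sup>2 * measure \<mu> UNIV * q (r n)" by (rule A_bound[OF Hs[OF rH]])
        also have "\<dots> \<le> B\<^sup>2 * measure \<mu> UNIV * (N2 * (1 / real (Suc n)))" using qr by (intro mult_left_mono) auto
        finally show "norm (A (r n) t) \<le> sqrt (?c * (1 / real (Suc n)))" by (simp add: real_le_rsqrt)
      qed
      show "(\<lambda>n. sqrt (?c * (1 / real (Suc n)))) \<longlonglongrightarrow> 0"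
        using tendsto_real_sqrt[OF tendsto_mult[OF tendsto_const[of ?c] inv0]] by simp
    qed
    have req: "A (r n) t = A (A (F' n)) t - N2 * F' n t" for n
      unfolding r_def using A_linear[of "A (F' n)" "f (k n)" 1 "-N2" t] Hs HA F' f(1) by (simp add: F'_def)
    have "(\<lambda>n. A (A (F' n)) t - N2 * F' n t) \<longlonglongrightarrow> A (A h) t - N2 * h t"
    proof (intro tendsto_diff tendsto_mult tendsto_const)
      show "(\<lambda>n. A (A (F' n)) t) \<longlonglongrightarrow> A (A h) t" by (rule L2_conv_A[OF L2_conv_A'[OF conv]])
      show "(\<lambda>n. F' n t) \<longlonglongrightarrow> h t"
      proof (rule LIMSEQ_I)
        fix \<epsilon> :: real assume "0 < \<epsilon>"
        then show "\<exists>N. \<forall>n\<ge>N. norm (F' n t - h t) < \<epsilon>" using gk(3)[of \<epsilon>] t by (auto simp: F'_def hg)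
      qed
    qed
    then have "A (A h) t - N2 * h t = 0" by (rule LIMSEQ_unique[OF _ lim0[unfolded req]])
    then show ?thesis by simp
  qed
  define N where "N = sqrt N2"
  have NN: "0 < N" "N * N = N2" using N2 by (auto simp: N_def)
  \<comment> \<open>Applying A + N to (A - N) h gives 0, so this is an eigenfunction for -N unless
    it vanishes; if it vanishes, h is one for N. Both are excluded by \<open>compl\<close>, while h
    has norm at least N.\<close>
  define kk where "kk = (\<lambda>s. 1 * A h s + (- N) * h s)"
  have kH: "kk \<in> H" unfolding kk_def by (rule Hlin[OF HA[OF hH] hH])
  have Akk: "A kk t = (- N) * kk t" if "t \<in> {0..T}" for t
    unfolding kk_def A_linear[OF Hs[OF HA[OF hH]] Hs[OF hH]] AAh[OF that] NN(2)[symmetric]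
    by (simp add: algebra_simps)
  have "q kk = 0" using kH NN(1) Akk by (intro compl[of "-N"]) (auto simp: H_def)
  then have "kk t = 0" if "t \<in> {0..T}" for t using q_eq_0[of kk t] kH that by (auto simp: H_def)
  then have "A h t = N * h t" if "t \<in> {0..T}" for t using that by (simp add: kk_def)
  then have "q h = 0" using hH NN(1) by (intro compl[of N]) (auto simp: H_def)
  then show False using \<open>q h \<ge> N2\<close> N2 by simp
qed

theorem mercer_diagonal:
  fixes e :: "nat \<Rightarrow> real \<Rightarrow> real"
  assumes e: "\<And>i. continuous_on UNIV (e i)"
    and eig: "\<And>i t. A (e i) t = lam i * e i t"
    and orth: "\<And>i j. i \<noteq> j \<Longrightarrow> ip (e i) (e j) = 0"
    and nrm: "\<And>i. e i = (\<lambda>_. 0) \<or> ip (e i) (e i) = 1"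
    and lam: "\<And>i. 0 \<le> lam i"
    and compl: "\<And>l f. l \<noteq> 0 \<Longrightarrow> continuous_on UNIV f \<Longrightarrow> (\<And>t. t \<in> {0..T} \<Longrightarrow> A f t = l * f t) \<Longrightarrow>
       (\<And>i. ip f (e i) = 0) \<Longrightarrow> q f = 0"
    and bessel: "\<And>n t. (\<Sum>i\<le>n. lam i * (e i t)\<^sup>2) \<le> K t t"
    and t: "t \<in> {0..T}"
  shows "(\<lambda>n. \<Sum>i\<le>n. lam i * (e i t)\<^sup>2) \<longlonglongrightarrow> K t t"
proof -
  define P where "P n = (\<Sum>i\<le>n. lam i * (e i t)\<^sup>2)" for n
  define S where "S n s = (\<Sum>i\<le>n. lam i * e i t * e i s)" for n s
  have incP: "incseq P" unfolding P_def using lam by (intro incseq_SucI) simp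
  obtain p where p: "P \<longlonglongrightarrow> p" "\<And>n. P n \<le> p"
    using incseq_convergent[OF incP, of "K t t"] bessel[of t] unfolding P_def by (metis bessel)
  have KB: "K s s \<le> B" for s using K_bdd[of s s] by linarith
  have B0: "0 \<le> B" using K_bdd[of 0 0] by linarith
  \<comment> \<open>Cauchy-Schwarz with the weight \<open>lam i\<close> split evenly: the factor in
    t tends to 0, and the factor in s is bounded by Bessel's inequality, uniformly in s.\<close>
  have diff: "(S m s - S n s)\<^sup>2 \<le> (P m - P n) * B" if "n \<le> m" for m n s
  proof -
    have split: "(\<Sum>i\<le>m. g i) - (\<Sum>i\<le>n. g i) = (\<Sum>i\<in>{n<..m}. g i)" for g :: "nat \<Rightarrow> real"
    proof -
      have "(\<Sum>i\<le>m. g i) = (\<Sum>i\<in>{..n} \<union> {n<..m}. g i)" using that by (intro sum.cong) auto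
      also have "\<dots> = (\<Sum>i\<le>n. g i) + (\<Sum>i\<in>{n<..m}. g i)" by (intro sum.union_disjoint) auto
      finally show ?thesis by simp
    qed
    have "S m s - S n s = (\<Sum>i\<in>{n<..m}. (sqrt (lam i) * e i t) * (sqrt (lam i) * e i s))"
      unfolding S_def split using lam by (intro sum.cong) auto
    then have "(S m s - S n s)\<^sup>2 \<le> (\<Sum>i\<in>{n<..m}. (sqrt (lam i) * e i t)\<^sup>2) * (\<Sum>i\<in>{n<..m}. (sqrt (lam i)
      * e i s)\<^sup>2)"
      by (simp add: Cauchy_Schwarz_ineq_sum)
    also have "(\<Sum>i\<in>{n<..m}. (sqrt (lam i) * e i t)\<^sup>2) = P m - P n"
      unfolding P_def split using lam by (intro sum.cong) (auto simp: power_mult_distrib)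
    also have "(P m - P n) * (\<Sum>i\<in>{n<..m}. (sqrt (lam i) * e i s)\<^sup>2) \<le> (P m - P n) * B"
    proof (rule mult_left_mono)
      have "(\<Sum>i\<in>{n<..m}. (sqrt (lam i) * e i s)\<^sup>2) = (\<Sum>i\<in>{n<..m}. lam i * (e i s)\<^sup>2)"
        using lam by (intro sum.cong) (auto simp: power_mult_distrib)
      also have "\<dots> \<le> (\<Sum>i\<le>m. lam i * (e i s)\<^sup>2)" using lam by (intro sum_mono2) auto
      also have "\<dots> \<le> B" using bessel[of s m] KB[of s] by linarith
      finally show "(\<Sum>i\<in>{n<..m}. (sqrt (lam i) * e i s)\<^sup>2) \<le> B" .
      show "0 \<le> P m - P n" using incP that by (simp add: incseq_def)
    qed
    finally show ?thesis .
  qed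
  have conv: "convergent (\<lambda>n. S n s)" for s
  proof (rule Cauchy_convergent, rule metric_CauchyI)
    fix \<epsilon> :: real assume \<epsilon>: "0 < \<epsilon>"
    have "0 < \<epsilon>\<^sup>2 / (B + 1)" using \<epsilon> B0 by simp
    then obtain N where N: "\<And>m. m \<ge> N \<Longrightarrow> norm (P m - p) < \<epsilon>\<^sup>2 / (B + 1)"
      using LIMSEQ_D[OF p(1)] by blast
    have *: "dist (S m s) (S n s) < \<epsilon>" if "n \<ge> N" "m \<ge> n" for m n
    proof -
      have "P m - P n \<le> \<epsilon>\<^sup>2 / (B + 1)" using N[OF that(1)] p(2)[of m] by (simp add: abs_if split: if_splits)
      then have "(S m s - S n s)\<^sup>2 \<le> \<epsilon>\<^sup>2 / (B + 1) * B"
        using diff[OF that(2), of s] B0 mult_right_mono by (blast intro: order_trans)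
      also have "\<dots> < \<epsilon>\<^sup>2" using \<epsilon> B0 by (simp add: field_simps)
      finally have "\<bar>S m s - S n s\<bar>\<^sup>2 < \<epsilon>\<^sup>2" by simp
      from power2_less_imp_less[OF this] \<epsilon> show ?thesis by (simp add: dist_real_def)
    qed
    show "\<exists>N. \<forall>m\<ge>N. \<forall>n\<ge>N. dist (S m s) (S n s) < \<epsilon>"
    proof (intro exI allI impI)
      fix m n assume "N \<le> m" "N \<le> n"
      then show "dist (S m s) (S n s) < \<epsilon>"
        using *[of n m] *[of m n] by (cases "n \<le> m") (auto simp: dist_commute)
    qed
  qed
  define g where "g s = lim (\<lambda>n. S n s)" for s
  have Sg: "(\<lambda>n. S n s) \<longlonglongrightarrow> g s" for s using conv[of s] by (simp add: g_def convergent_LIMSEQ_iff)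
  have tail: "(g s - S n s)\<^sup>2 \<le> (p - P n) * B" for s n
  proof (rule LIMSEQ_le)
    show "(\<lambda>m. (S m s - S n s)\<^sup>2) \<longlonglongrightarrow> (g s - S n s)\<^sup>2" by (intro tendsto_intros Sg)
    show "(\<lambda>m. (P m - P n) * B) \<longlonglongrightarrow> (p - P n) * B" by (intro tendsto_intros p)
    show "\<exists>N. \<forall>m\<ge>N. (S m s - S n s)\<^sup>2 \<le> (P m - P n) * B" using diff by blast
  qed
  have unif: "\<exists>N. \<forall>n\<ge>N. \<forall>s. \<bar>S n s - g s\<bar> < \<epsilon>" if \<epsilon>: "0 < \<epsilon>" for \<epsilon>
  proof -
    have "0 < \<epsilon>\<^sup>2 / (B + 1)" using \<epsilon> B0 by simp
    then obtain N where N: "\<And>m. m \<ge> N \<Longrightarrow> norm (P m - p) < \<epsilon>\<^sup>2 / (B + 1)"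
      using LIMSEQ_D[OF p(1)] by blast
    show ?thesis
    proof (intro exI allI impI)
      fix n s assume n: "n \<ge> N"
      have "p - P n \<le> \<epsilon>\<^sup>2 / (B + 1)" using N[OF n] by (simp add: abs_if split: if_splits)
      then have "(g s - S n s)\<^sup>2 \<le> \<epsilon>\<^sup>2 / (B + 1) * B"
        using tail[of s n] B0 mult_right_mono by (blast intro: order_trans)
      also have "\<dots> < \<epsilon>\<^sup>2" using \<epsilon> B0 by (simp add: field_simps)
      finally have "\<bar>g s - S n s\<bar>\<^sup>2 < \<epsilon>\<^sup>2" by simp
      from power2_less_imp_less[OF this] \<epsilon> show "\<bar>S n s - g s\<bar> < \<epsilon>" by (simp add: abs_minus_commute)
    qed
  qed
  have Sc: "continuous_on UNIV (S n)" for n unfolding S_def by (intro continuous_intros e)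
  have gc: "continuous_on UNIV g"
  proof (rule uniform_limit_theorem[of _ S sequentially])
    show "uniform_limit UNIV S g sequentially"
    proof (rule uniform_limitI)
      fix \<epsilon> :: real assume "0 < \<epsilon>"
      from unif[OF this] show "\<forall>\<^sub>F n in sequentially. \<forall>s\<in>UNIV. dist (S n s) (g s) < \<epsilon>"
        by (simp add: eventually_sequentially dist_real_def)
    qed
  qed (use Sc in auto)
  have L2: "L2_conv \<mu> S g"
    by (rule L2_conv_uniform[OF Sc gc]) (use unif in meson)
  have es: "sqint \<mu> (e i)" for i by (rule sqint_cont[OF e])
  have ipS: "ip (S n) f = (\<Sum>i\<le>n. lam i * e i t * ip f (e i))" if f: "sqint \<mu> f" for n f
  proof -
    have "ip (S n) f = (\<integral>s. (\<Sum>i\<le>n. (lam i * e i t) * (f s * e i s)) \<partial>\<mu>)"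
      unfolding S_def by (intro Bochner_Integration.integral_cong) (auto simp: sum_distrib_right
        sum_distrib_left mult_ac)
    also have "\<dots> = (\<Sum>i\<le>n. lam i * e i t * ip f (e i))"
      using sqint_mult_integrable[OF f es] by simp
    finally show ?thesis .
  qed
  have ipS_lim: "(\<lambda>n. ip (S n) f) \<longlonglongrightarrow> ip g f" if "sqint \<mu> f" for f
    by (rule L2_conv_inner[OF L2]) (use that in \<open>auto simp: L2_conv_def\<close>)
  define r where "r s = K t s - g s" for s
  have rc: "continuous_on UNIV r" unfolding r_def by (intro continuous_intros gc K_cont2)
  have rs: "sqint \<mu> r" by (rule sqint_cont[OF rc])
  have gs: "sqint \<mu> g" by (rule sqint_cont[OF gc])
  have r_orth: "ip r (e j) = 0" for j
  proof -
    have "ip (S n) (e j) = lam j * e j t" if "j \<le> n" for n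
    proof -
      have "ip (S n) (e j) = (\<Sum>i\<le>n. if i = j then lam j * e j t else 0)"
        unfolding ipS[OF es] using orth nrm
          by (intro sum.cong refl) (metis mult_cancel_left1 mult_zero_right mult.right_neutral)
      then show ?thesis using that by simp
    qed
    then have "(\<lambda>n. ip (S n) (e j)) \<longlonglongrightarrow> lam j * e j t"
      by (intro tendsto_eventually) (auto simp: eventually_sequentially)
    then have "ip g (e j) = lam j * e j t" using ipS_lim[OF es[of j]] LIMSEQ_unique by blast
    moreover have "ip (K t) (e j) = lam j * e j t" using eig[of j t] by (simp add: A_def)
    moreover have "ip r (e j) = ip (K t) (e j) - ip g (e j)"
      unfolding r_def using sqint_mult_integrable[OF sqint_K es] sqint_mult_integrable[OF gs es]
      by (simp add: left_diff_distrib)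
    ultimately show ?thesis by simp
  qed
  \<comment> \<open>The operator is evaluated at the very point t that was fixed to define
    r.\<close>
  have "A r t = 0" by (rule A_vanishes_on_complement[OF e eig compl rc r_orth t])
  then have "ip (K t) r = 0" by (simp add: A_def)
  moreover have "ip g r = 0"
    using ipS_lim[OF rs] by (simp add: ipS[OF rs] r_orth LIMSEQ_const_iff)
  moreover have "q r = ip (K t) r - ip g r"
  proof -
    have "q r = (\<integral>s. K t s * r s - g s * r s \<partial>\<mu>)"
      by (intro Bochner_Integration.integral_cong) (auto simp: r_def power2_eq_square algebra_simps)
    then show ?thesis using sqint_mult_integrable[OF sqint_K rs] sqint_mult_integrable[OF gs rs] by simp
  qed
  ultimately have "q r = 0" by simp
  then have "r t = 0" by (rule q_eq_0[OF rc _ t])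
  then have "K t t = g t" by (simp add: r_def)
  moreover have "S n t = P n" for n by (simp add: S_def P_def power2_eq_square mult.assoc)
  ultimately show ?thesis using Sg[of t] by (simp add: P_def)
qed

end

section \<open>The expansion of a continuous Gaussian process\<close>

locale gaussian_path_process = mercer_kernel \<mu> T B K + M: prob_space M
  for \<mu> T B K and M :: "'a measure" +
  fixes Y :: "real \<Rightarrow> 'a \<Rightarrow> real"
  assumes paths: "\<And>\<omega>. \<omega> \<in> space M \<Longrightarrow> continuous_on UNIV (\<lambda>t. Y t \<omega>)"
    and gauss: "\<And>J c. finite J \<Longrightarrow> gaussian_rv M (\<lambda>\<omega>. \<Sum>t\<in>J. c t * Y t \<omega>)"
    and cov: "(\<integral>\<omega>. Y s \<omega> * Y t \<omega> \<partial>M) = K s t"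
begin

lemma sqint_Y: "sqint M (Y t)"
  using gauss[of "{t}" "\<lambda>_. 1"] by (simp add: gaussian_rv_def)

lemma Y_meas[measurable]: "Y t \<in> borel_measurable M"
  using sqint_Y by (simp add: sqint_def)

definition Zf :: "(real \<Rightarrow> real) \<Rightarrow> 'a \<Rightarrow> real" where
  "Zf f \<omega> = (\<integral>s. Y s \<omega> * f s \<partial>\<mu>)"

definition grid :: "nat \<Rightarrow> real \<Rightarrow> real" where
  "grid n s = real_of_int \<lfloor>real (Suc n) * s\<rfloor> / real (Suc n)"

lemma grid_meas[measurable]: "grid n \<in> borel_measurable borel"
  unfolding grid_def by measurable

lemma grid_range:
  assumes "s \<in> {0..T}" shows "grid n s \<in> {0..T}"
proof -
  have "real_of_int \<lfloor>real (Suc n) * s\<rfloor> \<le> real (Suc n) * s" by linarith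
  then have "grid n s \<le> s" unfolding grid_def by (simp add: field_simps)
  moreover have "0 \<le> grid n s" unfolding grid_def using assms by simp
  ultimately show ?thesis using assms by auto
qed

lemma grid_tendsto: "(\<lambda>n. grid n s) \<longlonglongrightarrow> s"
proof (rule LIM_zero_cancel, rule Lim_null_comparison)
  show "\<forall>\<^sub>F n in sequentially. norm (grid n s - s) \<le> 1 / real (Suc n)"
  proof (rule always_eventually, rule allI)
    fix n
    have "\<bar>real_of_int \<lfloor>real (Suc n) * s\<rfloor> - real (Suc n) * s\<bar> \<le> 1" by linarith
    moreover have "grid n s - s = (real_of_int \<lfloor>real (Suc n) * s\<rfloor> - real (Suc n) * s) / real (Suc n)"
      unfolding grid_def by (simp add: diff_divide_distrib del: of_nat_Suc)
    ultimately show "norm (grid n s - s) \<le> 1 / real (Suc n)"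
      by (simp add: abs_divide divide_right_mono del: of_nat_Suc)
  qed
  show "(\<lambda>n. 1 / real (Suc n)) \<longlonglongrightarrow> 0" using LIMSEQ_inverse_real_of_nat by (simp add: inverse_eq_divide)
qed

lemma bounded_on:
  assumes "continuous_on UNIV (g :: real \<Rightarrow> real)"
  obtains b where "\<And>s. s \<in> {0..T} \<Longrightarrow> \<bar>g s\<bar> \<le> b"
proof -
  have "compact (g ` {0..T})"
    by (intro compact_continuous_image continuous_on_subset[OF assms]) auto
  then obtain b where "\<forall>x\<in>g ` {0..T}. norm x \<le> b"
    using compact_imp_bounded[of "g ` {0..T}"] bounded_iff[of "g ` {0..T}"] by metis
  then have "\<bar>g s\<bar> \<le> b" if "s \<in> {0..T}" for s using that by auto
  then show ?thesis by (rule that)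
qed

lemma sqint_grid:
  assumes g: "continuous_on UNIV g"
  shows "sqint \<mu> (\<lambda>s. g (grid n s))"
proof -
  have [measurable]: "g \<in> borel_measurable borel" using g by (rule borel_measurable_continuous_onI)
  have m: "(\<lambda>s. g (grid n s)) \<in> borel_measurable \<mu>" unfolding meas_\<mu> by measurable
  obtain b where b: "\<And>s. s \<in> {0..T} \<Longrightarrow> \<bar>g s\<bar> \<le> b" using bounded_on[OF g] by blast
  have "integrable \<mu> (\<lambda>s. (g (grid n s))\<^sup>2)"
  proof (rule integrable_const_bound[where B = "b\<^sup>2"])
    show "AE s in \<mu>. norm ((g (grid n s))\<^sup>2) \<le> b\<^sup>2"
      using conc
    proof eventually_elim
      case (elim s)
      have "\<bar>g (grid n s)\<bar> \<le> \<bar>b\<bar>" using b[OF grid_range[OF elim], of n] by linarith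
      then show ?case by (simp add: abs_le_square_iff)
    qed
  qed (use m in measurable)
  then show ?thesis using m by (simp add: sqint_def)
qed

lemma grid_integral_lim:
  fixes f g :: "real \<Rightarrow> real"
  assumes g: "continuous_on UNIV g" and f: "continuous_on UNIV f"
  shows "(\<lambda>n. \<integral>s. g (grid n s) * f s \<partial>\<mu>) \<longlonglongrightarrow> (\<integral>s. g s * f s \<partial>\<mu>)"
proof -
  obtain b where b: "\<And>s. s \<in> {0..T} \<Longrightarrow> \<bar>g s\<bar> \<le> b" using bounded_on[OF g] by blast
  show ?thesis
  proof (rule integral_dominated_convergence[where w = "\<lambda>s. b * \<bar>f s\<bar>"])
    show "(\<lambda>s. g s * f s) \<in> borel_measurable \<mu>" "\<And>n. (\<lambda>s. g (grid n s) * f s) \<in> borel_measurable \<mu>"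
      using sqint_measurable[OF sqint_grid[OF g]] sqint_measurable[OF sqint_cont[OF g]] sqint_measurable[OF
        sqint_cont[OF f]]
      by (auto intro: borel_measurable_times)
    show "integrable \<mu> (\<lambda>s. b * \<bar>f s\<bar>)" using sqint_integrable[OF sqint_cont[OF f]] by simp
    show "AE s in \<mu>. (\<lambda>n. g (grid n s) * f s) \<longlonglongrightarrow> g s * f s"
      by (intro AE_I2 tendsto_mult tendsto_const continuous_on_tendsto_compose[OF g grid_tendsto]) auto
    show "AE s in \<mu>. norm (g (grid n s) * f s) \<le> b * \<bar>f s\<bar>" for n
      using conc
    proof eventually_elim
      case (elim s)
      then show ?case using b[OF grid_range[OF elim], of n] by (simp add: abs_mult mult_right_mono)
    qed
  qed
qed

text \<open>The coefficient with the path frozen on a grid. It is a finite combination of values of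
  \<open>Y\<close>, hence Gaussian by assumption.\<close>

definition Zn :: "(real \<Rightarrow> real) \<Rightarrow> nat \<Rightarrow> 'a \<Rightarrow> real" where
  "Zn f n \<omega> = (\<integral>s. Y (grid n s) \<omega> * f s \<partial>\<mu>)"

text \<open>The weights are the integrals of f over the grid cells. They do not depend on the
  integrated function, so the same combination serves for the paths and for covariances with a fixed
  variable.\<close>

lemma Zn_sum:
  assumes f: "continuous_on UNIV f"
  obtains J w where "finite J"
    "\<And>\<omega>. \<omega> \<in> space M \<Longrightarrow> Zn f n \<omega> = (\<Sum>t\<in>J. w t * Y t \<omega>)"
    "\<And>g. continuous_on UNIV g \<Longrightarrow> (\<integral>s. g (grid n s) * f s \<partial>\<mu>) = (\<Sum>t\<in>J. w t * g t)"
proof -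
  define J where "J = (\<lambda>j. real_of_int j / real (Suc n)) ` {0..\<lfloor>real (Suc n) * T\<rfloor>}"
  define w where "w t = (\<integral>s. indicator {s. grid n s = t} s * f s \<partial>\<mu>)" for t
  have fin: "finite J" by (simp add: J_def)
  have fs: "sqint \<mu> f" by (rule sqint_cont[OF f])
  have gJ: "grid n s \<in> J" if "s \<in> {0..T}" for s
    unfolding grid_def J_def using that by (intro imageI) (auto intro!: floor_mono mult_left_mono)
  have key: "(\<integral>s. g (grid n s) * f s \<partial>\<mu>) = (\<Sum>t\<in>J. w t * g t)" for g :: "real \<Rightarrow> real"
  proof -
    have ii: "integrable \<mu> (\<lambda>s. indicator {s. grid n s = t} s * f s)" for t
    proof -
      have "{s. grid n s = t} \<in> sets borel" by measurable
      then have "{s. grid n s = t} \<in> sets \<mu>" by (simp add: sets_\<mu>)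
      from integrable_mult_indicator[OF this sqint_integrable[OF fs]] show ?thesis by simp
    qed
    have "(\<integral>s. g (grid n s) * f s \<partial>\<mu>) = (\<integral>s. (\<Sum>t\<in>J. g t * (indicator {s. grid n s = t} s * f s)) \<partial>\<mu>)"
    proof (rule integral_cong_AE)
      show "AE s in \<mu>. g (grid n s) * f s = (\<Sum>t\<in>J. g t * (indicator {s. grid n s = t} s * f s))"
        using conc
      proof eventually_elim
        case (elim s)
        have "(\<Sum>t\<in>J. g t * (indicator {s. grid n s = t} s * f s)) = (\<Sum>t\<in>J. if t
          = grid n s then g t * f s else 0)"
          by (intro sum.cong refl) (auto simp: indicator_def)
        then show ?case using gJ[OF elim] fin by simp
      qed
      show "(\<lambda>s. \<Sum>t\<in>J. g t * (indicator {s. grid n s = t} s * f s)) \<in> borel_measurable \<mu>"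
        using ii by (intro borel_measurable_sum borel_measurable_times borel_measurable_const
          borel_measurable_integrable) auto
      then show "(\<lambda>s. g (grid n s) * f s) \<in> borel_measurable \<mu>"
      proof -
        have fm: "f \<in> borel_measurable borel" using fs by (simp add: sqint_def meas_\<mu>)
        have "(\<lambda>s. g (real_of_int i / real (Suc n))) \<in> borel_measurable borel" for i :: int by simp
        moreover have "(\<lambda>s. \<lfloor>real (Suc n) * s\<rfloor>) \<in> measurable borel (count_space UNIV)" by measurable
        ultimately have "(\<lambda>s. (\<lambda>i s. g (real_of_int i / real (Suc n))) \<lfloor>real (Suc n)
          * s\<rfloor> s) \<in> borel_measurable borel"
          by (rule measurable_compose_countable)
        then show ?thesis using fm unfolding meas_\<mu> grid_def by simp
      qed
    qed
    also have "\<dots> = (\<Sum>t\<in>J. w t * g t)" using ii by (simp add: w_def mult.commute)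
    finally show ?thesis .
  qed
  show ?thesis
  proof (rule that[OF fin])
    show "Zn f n \<omega> = (\<Sum>t\<in>J. w t * Y t \<omega>)" for \<omega> unfolding Zn_def by (rule key)
    show "(\<integral>s. g (grid n s) * f s \<partial>\<mu>) = (\<Sum>t\<in>J. w t * g t)" for g by (rule key)
  qed
qed

text \<open>Frozen on a grid, \<open>Y\<close> takes countably many times and is jointly measurable;
  path continuity passes this to the limit.\<close>

lemma Y_joint: "(\<lambda>(s, \<omega>). Y s \<omega>) \<in> borel_measurable (\<mu> \<Otimes>\<^sub>M M)"
  and Y_grid_joint: "(\<lambda>(s, \<omega>). Y (grid n s) \<omega>) \<in> borel_measurable (\<mu> \<Otimes>\<^sub>M M)"
proof -
  show g: "(\<lambda>(s, \<omega>). Y (grid n s) \<omega>) \<in> borel_measurable (\<mu> \<Otimes>\<^sub>M M)" for n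
  proof -
    have "(\<lambda>x. Y (real_of_int i / real (Suc n)) (snd x)) \<in> borel_measurable (\<mu> \<Otimes>\<^sub>M M)" for i :: int
      by measurable
    moreover have "(\<lambda>x. \<lfloor>real (Suc n) * fst x\<rfloor>) \<in> measurable (\<mu> \<Otimes>\<^sub>M M) (count_space UNIV)"
    proof -
      have "(fst :: real \<times> 'a \<Rightarrow> real) \<in> measurable (\<mu> \<Otimes>\<^sub>M M) borel"
        using measurable_fst[of \<mu> M] measurable_cong_sets[OF refl sets_\<mu>] by blast
      then show ?thesis by measurable
    qed
    ultimately have "(\<lambda>x. (\<lambda>i x. Y (real_of_int i / real (Suc n)) (snd x)) \<lfloor>real (Suc n)
      * fst x\<rfloor> x) \<in> borel_measurable (\<mu> \<Otimes>\<^sub>M M)"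
      by (rule measurable_compose_countable)
    then show ?thesis by (simp add: grid_def case_prod_beta')
  qed
  show "(\<lambda>(s, \<omega>). Y s \<omega>) \<in> borel_measurable (\<mu> \<Otimes>\<^sub>M M)"
  proof (rule borel_measurable_LIMSEQ_real[OF _ g])
    fix x assume "x \<in> space (\<mu> \<Otimes>\<^sub>M M)"
    then obtain s \<omega> where x: "x = (s, \<omega>)" "\<omega> \<in> space M" by (auto simp: space_pair_measure)
    show "(\<lambda>n. (case x of (s, \<omega>) \<Rightarrow> Y (grid n s) \<omega>)) \<longlonglongrightarrow> (case x of (s, \<omega>) \<Rightarrow> Y s \<omega>)"
      unfolding x(1) prod.case by (rule continuous_on_tendsto_compose[OF paths[OF x(2)] grid_tendsto]) auto
  qed
qed

lemma Zf_meas[measurable]: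
  assumes "continuous_on UNIV f"
  shows "Zf f \<in> borel_measurable M"
proof -
  have "(\<lambda>(\<omega>, s). Y s \<omega>) \<in> borel_measurable (M \<Otimes>\<^sub>M \<mu>)"
    using measurable_pair_swap[OF Y_joint] by (simp add: case_prod_beta')
  moreover have "f \<in> borel_measurable \<mu>" using sqint_cont[OF assms] by (simp add: sqint_def)
  ultimately show ?thesis unfolding Zf_def[abs_def]
    by (intro borel_measurable_lebesgue_integral) (simp add: case_prod_beta')
qed

lemma increment_var: "(\<integral>\<omega>. (Y s \<omega> - Y t \<omega>)\<^sup>2 \<partial>M) = K s s - 2 * K s t + K t t"
proof -
  have "(\<integral>\<omega>. (Y s \<omega> - Y t \<omega>)\<^sup>2 \<partial>M) = (\<integral>\<omega>. Y s \<omega> * Y s \<omega> - 2 * (Y s \<omega> * Y t \<omega>) + Y t \<omega> * Y t \<omega> \<partial>M)"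
    by (intro Bochner_Integration.integral_cong) (auto simp: power2_eq_square algebra_simps)
  also have "\<dots> = K s s - 2 * K s t + K t t"
    unfolding cov[symmetric] using sqint_mult_integrable[OF sqint_Y sqint_Y] by simp
  finally show ?thesis .
qed

text \<open>Cauchy-Schwarz in s and Tonelli bound the mean square error by \<open>q f\<close> times
  the integrated variance of the increment from s to its grid point, and that variance is small by
  continuity of the kernel. Nonnegative integrals are used because \<open>Zf f\<close> is not yet
  known to be square integrable.\<close>

lemma Zn_conv:
  assumes f: "continuous_on UNIV f"
  shows "L2_conv M (Zn f) (Zf f)"
proof (rule L2_convI_nn)
  interpret P: pair_sigma_finite \<mu> M ..
  show "sqint M (Zn f n)" for n
  proof -
    obtain J w where J: "finite J" "\<And>\<omega>. \<omega> \<in> space M \<Longrightarrow> Zn f n \<omega> = (\<Sum>t\<in>J. w t * Y t \<omega>)"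
      using Zn_sum[OF f, of n] by metis
    have "sqint M (\<lambda>\<omega>. \<Sum>t\<in>J. w t * Y t \<omega>)" by (intro sqint_sum sqint_cmult sqint_Y)
    then show ?thesis by (simp add: sqint_cong[of M "Zn f n" "\<lambda>\<omega>. \<Sum>t\<in>J. w t * Y t \<omega>", OF J(2)])
  qed
  show "Zf f \<in> borel_measurable M" by (rule Zf_meas[OF f])
  \<comment> \<open>The variance of the increment between s and its grid point, written with the
    kernel.\<close>
  define D where "D n s = K (grid n s) (grid n s) - 2 * K (grid n s) s + K s s" for n s
  have Dm: "D n \<in> borel_measurable \<mu>" for n
  proof -
    have p: "(\<lambda>s. K (u s) (v s)) \<in> borel_measurable borel"
      if "u \<in> borel_measurable borel" "v \<in> borel_measurable borel" for u v :: "real \<Rightarrow> real"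
      using measurable_compose[OF borel_measurable_Pair[OF that] borel_measurable_continuous_onI[OF K_cont]]
        by simp
    show ?thesis unfolding meas_\<mu> D_def
      by (intro borel_measurable_add borel_measurable_diff borel_measurable_times borel_measurable_const p
        grid_meas measurable_ident_sets refl)
  qed
  have D0: "0 \<le> D n s" for n s unfolding D_def increment_var[symmetric] by simp
  have DB: "D n s \<le> 4 * B" for n s
    using K_bdd[of "grid n s" "grid n s"] K_bdd[of "grid n s" s] K_bdd[of s s] unfolding D_def by linarith
  have Dlim: "(\<lambda>n. \<integral>s. D n s \<partial>\<mu>) \<longlonglongrightarrow> (\<integral>s. 0 \<partial>\<mu>)"
  proof (rule integral_dominated_convergence[where w = "\<lambda>_. 4 * B"])
    show "AE s in \<mu>. (\<lambda>n. D n s) \<longlonglongrightarrow> 0"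
    proof (rule AE_I2)
      fix s
      have c: "(\<lambda>n. (\<lambda>(s, t). K s t) (u n, v n)) \<longlonglongrightarrow> (\<lambda>(s, t). K s t) (s, s)"
        if "u \<longlonglongrightarrow> s" "v \<longlonglongrightarrow> s" for u v :: "nat \<Rightarrow> real"
        by (rule continuous_on_tendsto_compose[OF K_cont tendsto_Pair[OF that]]) auto
      have "(\<lambda>n. D n s) \<longlonglongrightarrow> K s s - 2 * K s s + K s s"
        unfolding D_def using c[OF grid_tendsto grid_tendsto] c[OF grid_tendsto tendsto_const]
        by (intro tendsto_intros) auto
      then show "(\<lambda>n. D n s) \<longlonglongrightarrow> 0" by simp
    qed
    show "AE s in \<mu>. norm (D n s) \<le> 4 * B" for n using D0 DB by simp
  qed (use Dm in auto)
  have bound: "(\<integral>\<^sup>+\<omega>. ennreal ((Zn f n \<omega> - Zf f \<omega>)\<^sup>2) \<partial>M) \<le> ennreal (q f * (\<integral>s. D n s \<partial>\<mu>))" for n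
  proof -
    have "(\<integral>\<^sup>+\<omega>. ennreal ((Zn f n \<omega> - Zf f \<omega>)\<^sup>2) \<partial>M) \<le>
       (\<integral>\<^sup>+\<omega>. ennreal (q f) * (\<integral>\<^sup>+s. ennreal ((Y (grid n s) \<omega> - Y s \<omega>)\<^sup>2) \<partial>\<mu>) \<partial>M)"
    proof (rule nn_integral_mono)
      fix \<omega> assume w: "\<omega> \<in> space M"
      have s1: "sqint \<mu> (\<lambda>s. Y (grid n s) \<omega>)" "sqint \<mu> (\<lambda>s. Y s \<omega>)" "sqint \<mu> f"
        using sqint_grid[OF paths[OF w]] sqint_cont[OF paths[OF w]] sqint_cont[OF f] by auto
      have s2: "sqint \<mu> (\<lambda>s. Y (grid n s) \<omega> - Y s \<omega>)" by (rule sqint_diff[OF s1(1,2)])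
      have "Zn f n \<omega> - Zf f \<omega> = (\<integral>s. (Y (grid n s) \<omega> - Y s \<omega>) * f s \<partial>\<mu>)"
        using sqint_mult_integrable[OF s1(1,3)] sqint_mult_integrable[OF s1(2,3)]
        by (simp add: Zn_def Zf_def left_diff_distrib)
      then have "(Zn f n \<omega> - Zf f \<omega>)\<^sup>2 \<le> q f * (\<integral>s. (Y (grid n s) \<omega> - Y s \<omega>)\<^sup>2 \<partial>\<mu>)"
        using integral_cauchy_schwarz[OF s2 s1(3)] by (simp add: mult.commute)
      then have "ennreal ((Zn f n \<omega> - Zf f \<omega>)\<^sup>2) \<le> ennreal (q f * (\<integral>s. (Y (grid n s) \<omega> - Y s \<omega>)\<^sup>2 \<partial>\<mu>))"
        by (rule ennreal_leI)
      also have "\<dots> = ennreal (q f) * (\<integral>\<^sup>+s. ennreal ((Y (grid n s) \<omega> - Y s \<omega>)\<^sup>2) \<partial>\<mu>)"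
        using s2 by (subst nn_integral_eq_integral) (auto simp: sqint_def ennreal_mult)
      finally show "ennreal ((Zn f n \<omega> - Zf f \<omega>)\<^sup>2)
        \<le> ennreal (q f) * (\<integral>\<^sup>+s. ennreal ((Y (grid n s) \<omega> - Y s \<omega>)\<^sup>2) \<partial>\<mu>)" .
    qed
    also have "\<dots> = ennreal (q f) * (\<integral>\<^sup>+\<omega>. (\<integral>\<^sup>+s. ennreal ((Y (grid n s) \<omega> - Y s \<omega>)\<^sup>2) \<partial>\<mu>) \<partial>M)"
    proof (rule nn_integral_cmult)
      have "(\<lambda>(\<omega>, s). ennreal ((Y (grid n s) \<omega> - Y s \<omega>)\<^sup>2)) \<in> borel_measurable (M \<Otimes>\<^sub>M \<mu>)"
        using measurable_pair_swap[OF Y_joint] measurable_pair_swap[OF Y_grid_joint[of n]]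
          by (simp add: case_prod_beta')
      then show "(\<lambda>\<omega>. \<integral>\<^sup>+s. ennreal ((Y (grid n s) \<omega> - Y s \<omega>)\<^sup>2) \<partial>\<mu>) \<in> borel_measurable M"
        by (rule borel_measurable_nn_integral)
    qed
    also have "(\<integral>\<^sup>+\<omega>. (\<integral>\<^sup>+s. ennreal ((Y (grid n s) \<omega> - Y s \<omega>)\<^sup>2) \<partial>\<mu>) \<partial>M) =
       (\<integral>\<^sup>+s. (\<integral>\<^sup>+\<omega>. ennreal ((Y (grid n s) \<omega> - Y s \<omega>)\<^sup>2) \<partial>M) \<partial>\<mu>)"
    proof (rule P.Fubini'[of "\<lambda>s \<omega>. ennreal ((Y (grid n s) \<omega> - Y s \<omega>)\<^sup>2)"])
      show "(\<lambda>(s, \<omega>). ennreal ((Y (grid n s) \<omega> - Y s \<omega>)\<^sup>2)) \<in> borel_measurable (\<mu> \<Otimes>\<^sub>M M)"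
        using Y_joint Y_grid_joint[of n] by (simp add: case_prod_beta')
    qed
    also have "\<dots> = (\<integral>\<^sup>+s. ennreal (D n s) \<partial>\<mu>)"
    proof (rule nn_integral_cong)
      fix s
      have "sqint M (\<lambda>\<omega>. Y (grid n s) \<omega> - Y s \<omega>)" by (intro sqint_diff sqint_Y)
      then have "(\<integral>\<^sup>+\<omega>. ennreal ((Y (grid n s) \<omega> - Y s \<omega>)\<^sup>2) \<partial>M) = ennreal (\<integral>\<omega>. (Y (grid n s) \<omega> - Y s \<omega>)\<^sup>2 \<partial>M)"
        by (intro nn_integral_eq_integral) (auto simp: sqint_def)
      then show "(\<integral>\<^sup>+\<omega>. ennreal ((Y (grid n s) \<omega> - Y s \<omega>)\<^sup>2) \<partial>M) = ennreal (D n s)"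
        by (simp add: increment_var D_def)
    qed
    also have "\<dots> = ennreal (\<integral>s. D n s \<partial>\<mu>)"
    proof (rule nn_integral_eq_integral)
      show "integrable \<mu> (D n)"
        by (rule integrable_const_bound[where B = "4 * B"]) (use Dm D0 DB in auto)
    qed (use D0 in simp)
    finally show ?thesis using D0 by (simp add: ennreal_mult Bochner_Integration.integral_nonneg)
  qed
  have "(\<lambda>n. ennreal (q f * (\<integral>s. D n s \<partial>\<mu>))) \<longlonglongrightarrow> ennreal (q f * 0)"
    using Dlim by (intro tendsto_ennrealI tendsto_mult tendsto_const) simp
  then have "(\<lambda>n. ennreal (q f * (\<integral>s. D n s \<partial>\<mu>))) \<longlonglongrightarrow> 0" by simp
  then show "(\<lambda>n. \<integral>\<^sup>+\<omega>. ennreal ((Zn f n \<omega> - Zf f \<omega>)\<^sup>2) \<partial>M) \<longlonglongrightarrow> 0"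
    by (rule tendsto_sandwich[OF _ _ tendsto_const, rotated 2]) (auto intro!: always_eventually bound)
qed

lemma gaussian_Zf:
  assumes f: "continuous_on UNIV f"
  shows "gaussian_rv M (Zf f)"
proof (rule M.gaussian_rv_limit[OF _ Zn_conv[OF f]])
  fix n
  obtain J w where J: "finite J" "\<And>\<omega>. \<omega> \<in> space M \<Longrightarrow> Zn f n \<omega> = (\<Sum>t\<in>J. w t * Y t \<omega>)"
    using Zn_sum[OF f, of n] by metis
  have "gaussian_rv M (\<lambda>\<omega>. \<Sum>t\<in>J. w t * Y t \<omega>)" by (rule gauss[OF J(1)])
  moreover have "(CLINT \<omega>|M. iexp (Zn f n \<omega>)) = (CLINT \<omega>|M. iexp (\<Sum>t\<in>J. w t * Y t \<omega>))"
    "(\<integral>\<omega>. (Zn f n \<omega>)\<^sup>2 \<partial>M) = (\<integral>\<omega>. (\<Sum>t\<in>J. w t * Y t \<omega>)\<^sup>2 \<partial>M)"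
    using J(2) by (auto intro!: Bochner_Integration.integral_cong)
  moreover have "sqint M (Zn f n)" using Zn_conv[OF f] by (simp add: L2_conv_def)
  ultimately show "gaussian_rv M (Zn f n)" by (simp only: gaussian_rv_def)
qed

text \<open>Expectation and integral over s are exchanged by way of the grid sums: there the
  exchange is finite, and both sides converge because \<open>\<phi>\<close> is continuous.\<close>

lemma Zf_inner:
  assumes f: "continuous_on UNIV f" and V: "sqint M V"
    and \<phi>: "continuous_on UNIV \<phi>" "\<And>t. (\<integral>\<omega>. Y t \<omega> * V \<omega> \<partial>M) = \<phi> t"
  shows "(\<integral>\<omega>. Zf f \<omega> * V \<omega> \<partial>M) = ip \<phi> f"
proof (rule LIMSEQ_unique)
  show "(\<lambda>n. \<integral>\<omega>. Zn f n \<omega> * V \<omega> \<partial>M) \<longlonglongrightarrow> (\<integral>\<omega>. Zf f \<omega> * V \<omega> \<partial>M)"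
    by (rule L2_conv_inner[OF Zn_conv[OF f]]) (use V in \<open>simp add: L2_conv_def\<close>)
  have "(\<integral>\<omega>. Zn f n \<omega> * V \<omega> \<partial>M) = (\<integral>s. \<phi> (grid n s) * f s \<partial>\<mu>)" for n
  proof -
    obtain J w where J: "finite J" "\<And>\<omega>. \<omega> \<in> space M \<Longrightarrow> Zn f n \<omega> = (\<Sum>t\<in>J. w t * Y t \<omega>)"
      "\<And>g. continuous_on UNIV g \<Longrightarrow> (\<integral>s. g (grid n s) * f s \<partial>\<mu>) = (\<Sum>t\<in>J. w t * g t)"
      using Zn_sum[OF f, of n] by metis
    have "(\<integral>\<omega>. Zn f n \<omega> * V \<omega> \<partial>M) = (\<integral>\<omega>. (\<Sum>t\<in>J. w t * (Y t \<omega> * V \<omega>)) \<partial>M)"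
      using J(2) by (intro Bochner_Integration.integral_cong) (auto simp: sum_distrib_right mult.assoc)
    also have "\<dots> = (\<Sum>t\<in>J. w t * \<phi> t)"
      using sqint_mult_integrable[OF sqint_Y V] by (simp add: \<phi>(2))
    finally show ?thesis using J(3)[OF \<phi>(1)] by simp
  qed
  then show "(\<lambda>n. \<integral>\<omega>. Zn f n \<omega> * V \<omega> \<partial>M) \<longlonglongrightarrow> ip \<phi> f"
    using grid_integral_lim[OF \<phi>(1) f] by simp
qed

text \<open>The residual variance is the kernel on the diagonal minus the partial Mercer sum. Its
  nonnegativity is the Bessel inequality needed for Mercer's theorem, and Mercer's theorem in return
  sends it to 0. Markov's inequality then gives the convergence in probability that starts the
  passage to uniform convergence.\<close>

theorem karhunen_loeve:
  fixes e :: "nat \<Rightarrow> real \<Rightarrow> real"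
  assumes e: "\<And>i. continuous_on UNIV (e i)"
    and eig: "\<And>i t. A (e i) t = lam i * e i t"
    and orth: "\<And>i j. i \<noteq> j \<Longrightarrow> ip (e i) (e j) = 0"
    and nrm: "\<And>i. e i = (\<lambda>_. 0) \<or> ip (e i) (e i) = 1"
    and lam: "\<And>i. 0 \<le> lam i"
    and compl: "\<And>l f. l \<noteq> 0 \<Longrightarrow> continuous_on UNIV f \<Longrightarrow> (\<And>t. t \<in> {0..T} \<Longrightarrow> A f t = l * f t) \<Longrightarrow>
       (\<And>i. ip f (e i) = 0) \<Longrightarrow> q f = 0"
  shows "M.indep_vars (\<lambda>_. borel) (\<lambda>i. Zf (e i)) UNIV"
    and "\<And>i. ip (e i) (e i) = 1 \<Longrightarrow> 0 < lam i \<Longrightarrow>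
      distributed M lborel (Zf (e i)) (normal_density 0 (sqrt (lam i)))"
    and "AE \<omega> in M. uniform_limit {0..T} (\<lambda>n t. \<Sum>i\<le>n. e i t * Zf (e i) \<omega>) (\<lambda>t. Y t \<omega>) sequentially"
proof -
  define Z where "Z i = Zf (e i)" for i
  have g1: "gaussian_rv M (Z i)" for i unfolding Z_def by (rule gaussian_Zf[OF e])
  then have Zs: "sqint M (Z i)" for i by (simp add: gaussian_rv_def)
  then have Zm[measurable]: "Z i \<in> borel_measurable M" for i by (simp add: sqint_def)
  have es: "sqint \<mu> (e i)" for i by (rule sqint_cont[OF e])
  have ZY: "(\<integral>\<omega>. Z i \<omega> * Y t \<omega> \<partial>M) = lam i * e i t" for i t
  proof -
    have "(\<integral>\<omega>. Z i \<omega> * Y t \<omega> \<partial>M) = ip (K t) (e i)"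
      unfolding Z_def by (rule Zf_inner[OF e sqint_Y K_cont2]) (simp add: cov K_sym)
    then show ?thesis using eig[of i t] by (simp add: A_def)
  qed
  have ZZ: "(\<integral>\<omega>. Z i \<omega> * Z j \<omega> \<partial>M) = lam j * ip (e j) (e i)" for i j
  proof -
    have "(\<integral>\<omega>. Z i \<omega> * Z j \<omega> \<partial>M) = ip (\<lambda>t. lam j * e j t) (e i)"
      unfolding Z_def[of i]
    proof (rule Zf_inner[OF e Zs])
      show "continuous_on UNIV (\<lambda>t. lam j * e j t)" by (intro continuous_intros e)
      show "(\<integral>\<omega>. Y t \<omega> * Z j \<omega> \<partial>M) = lam j * e j t" for t using ZY[of j t] by (simp add: mult.commute)
    qed
    then show ?thesis by (simp add: mult.assoc)
  qed
  \<comment> \<open>\<open>Zf\<close> is linear in its argument, so a combination of coefficients is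
    the coefficient of a combination. This gives joint Gaussianity.\<close>
  have comb: "gaussian_rv M (\<lambda>\<omega>. \<Sum>j\<in>J. \<theta> j * Z j \<omega>)" for J \<theta>
  proof -
    have fc: "continuous_on UNIV (\<lambda>s. \<Sum>j\<in>J. \<theta> j * e j s)" by (intro continuous_intros e)
    have eq: "Zf (\<lambda>s. \<Sum>j\<in>J. \<theta> j * e j s) \<omega> = (\<Sum>j\<in>J. \<theta> j * Z j \<omega>)" if w: "\<omega> \<in> space M" for \<omega>
    proof -
      have "Zf (\<lambda>s. \<Sum>j\<in>J. \<theta> j * e j s) \<omega> = (\<integral>s. (\<Sum>j\<in>J. \<theta> j * (Y s \<omega> * e j s)) \<partial>\<mu>)"
        unfolding Zf_def by (intro Bochner_Integration.integral_cong) (auto simp: sum_distrib_left mult_ac)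
      also have "\<dots> = (\<Sum>j\<in>J. \<theta> j * Z j \<omega>)"
        using sqint_mult_integrable[OF sqint_cont[OF paths[OF w]] es] by (simp add: Z_def Zf_def)
      finally show ?thesis .
    qed
    have "(CLINT \<omega>|M. iexp (Zf (\<lambda>s. \<Sum>j\<in>J. \<theta> j * e j s) \<omega>)) = (CLINT \<omega>|M. iexp (\<Sum>j\<in>J. \<theta> j * Z j \<omega>))"
      "(\<integral>\<omega>. (Zf (\<lambda>s. \<Sum>j\<in>J. \<theta> j * e j s) \<omega>)\<^sup>2 \<partial>M) = (\<integral>\<omega>. (\<Sum>j\<in>J. \<theta> j * Z j \<omega>)\<^sup>2 \<partial>M)"
      using eq by (auto intro!: Bochner_Integration.integral_cong)
    moreover have "sqint M (\<lambda>\<omega>. \<Sum>j\<in>J. \<theta> j * Z j \<omega>)" by (intro sqint_sum sqint_cmult Zs)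
    ultimately show ?thesis using gaussian_Zf[OF fc] by (simp only: gaussian_rv_def)
  qed
  have g\<theta>: "gaussian_rv M (\<lambda>\<omega>. \<theta> * Z i \<omega>)" for \<theta> i using comb[of "\<lambda>_. \<theta>" "{i}"] by simp
  show ind: "M.indep_vars (\<lambda>_. borel) (\<lambda>i. Zf (e i)) UNIV"
    unfolding Z_def[symmetric]
    by (rule M.gaussian_uncorrelated_indep) (auto simp: comb ZZ orth)
  show "distributed M lborel (Zf (e i)) (normal_density 0 (sqrt (lam i)))"
    if "ip (e i) (e i) = 1" "0 < lam i" for i
    unfolding Z_def[symmetric]
    by (rule M.gaussian_distributed_normal[OF g\<theta> _ that(2)]) (use ZZ[of i i] that in \<open>simp add:
      power2_eq_square\<close>)
  \<comment> \<open>The form that also holds for the padded indices, where \<open>e i\<close> is the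
    zero function and has norm 0 instead of 1.\<close>
  have lame: "lam i * ip (e i) (e i) * (e i t)\<^sup>2 = lam i * (e i t)\<^sup>2" for i t
    using nrm[of i] by auto
  have resid: "(\<integral>\<omega>. ((\<Sum>i\<le>n. e i t * Z i \<omega>) - Y t \<omega>)\<^sup>2 \<partial>M) = K t t - (\<Sum>i\<le>n. lam i * (e i t)\<^sup>2)" for n t
  proof -
    let ?S = "\<lambda>\<omega>. \<Sum>i\<le>n. e i t * Z i \<omega>"
    have Ss: "sqint M ?S" by (intro sqint_sum sqint_cmult Zs)
    have ZZi: "integrable M (\<lambda>\<omega>. Z i \<omega> * Z j \<omega>)" for i j by (rule sqint_mult_integrable[OF Zs Zs])
    have ZYi: "integrable M (\<lambda>\<omega>. Z i \<omega> * Y s \<omega>)" for i s by (rule sqint_mult_integrable[OF Zs sqint_Y])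
    have SY: "(\<integral>\<omega>. ?S \<omega> * Y t \<omega> \<partial>M) = (\<Sum>i\<le>n. lam i * (e i t)\<^sup>2)"
    proof -
      have "(\<integral>\<omega>. ?S \<omega> * Y t \<omega> \<partial>M) = (\<integral>\<omega>. (\<Sum>i\<le>n. e i t * (Z i \<omega> * Y t \<omega>)) \<partial>M)"
        by (intro Bochner_Integration.integral_cong) (auto simp: sum_distrib_right mult.assoc)
      also have "\<dots> = (\<Sum>i\<le>n. e i t * (lam i * e i t))" using ZYi by (simp add: ZY)
      finally show ?thesis by (simp add: power2_eq_square mult_ac)
    qed
    have SS: "(\<integral>\<omega>. ?S \<omega> * ?S \<omega> \<partial>M) = (\<Sum>i\<le>n. lam i * (e i t)\<^sup>2)"
    proof -
      have "(\<integral>\<omega>. ?S \<omega> * ?S \<omega> \<partial>M) = (\<integral>\<omega>. (\<Sum>i\<le>n. \<Sum>j\<le>n. (e i t * e j t) * (Z i \<omega> * Z j \<omega>)) \<partial>M)"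
        by (intro Bochner_Integration.integral_cong) (auto simp: sum_product mult_ac)
      also have "\<dots> = (\<Sum>i\<le>n. \<Sum>j\<le>n. (e i t * e j t) * (lam j * ip (e j) (e i)))" using ZZi by (simp add: ZZ)
      also have "\<dots> = (\<Sum>i\<le>n. \<Sum>j\<le>n. if j = i then lam i * ip (e i) (e i) * (e i t)\<^sup>2 else 0)"
        by (intro sum.cong refl) (auto simp: orth power2_eq_square mult_ac)
      also have "\<dots> = (\<Sum>i\<le>n. lam i * (e i t)\<^sup>2)" by (simp add: lame)
      finally show ?thesis .
    qed
    have "(\<integral>\<omega>. (?S \<omega> - Y t \<omega>)\<^sup>2 \<partial>M) = (\<integral>\<omega>. ?S \<omega> * ?S \<omega> - 2 * (?S \<omega> * Y t \<omega>) + Y t \<omega> * Y t \<omega> \<partial>M)"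
      by (intro Bochner_Integration.integral_cong) (auto simp: power2_eq_square algebra_simps)
    also have "\<dots> = (\<integral>\<omega>. ?S \<omega> * ?S \<omega> \<partial>M) - 2 * (\<integral>\<omega>. ?S \<omega> * Y t \<omega> \<partial>M) + (\<integral>\<omega>. Y t \<omega> * Y t \<omega> \<partial>M)"
      using sqint_mult_integrable[OF Ss Ss] sqint_mult_integrable[OF Ss sqint_Y[of t]]
        sqint_mult_integrable[OF sqint_Y[of t] sqint_Y[of t]]
      by (subst Bochner_Integration.integral_add | subst Bochner_Integration.integral_diff | simp)+
    finally show ?thesis unfolding SY SS cov by simp
  qed
  have bessel: "(\<Sum>i\<le>n. lam i * (e i t)\<^sup>2) \<le> K t t" for n t
  proof -
    have "0 \<le> (\<integral>\<omega>. ((\<Sum>i\<le>n. e i t * Z i \<omega>) - Y t \<omega>)\<^sup>2 \<partial>M)" by simp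
    then show ?thesis unfolding resid by simp
  qed
  have "AE \<omega> in M. uniform_limit {0..T} (\<lambda>n t. \<Sum>i\<le>n. e i t * Z i \<omega>) (\<lambda>t. Y t \<omega>) sequentially"
  proof (rule M.ito_nisio[OF _ _ T Y_meas])
    show "M.indep_vars (\<lambda>_. borel) Z UNIV" using ind by (simp add: Z_def[abs_def])
    show "distr M borel (\<lambda>\<omega>. - Z i \<omega>) = distr M borel (Z i)" for i
      by (rule M.gaussian_symmetric[OF g\<theta>])
    show "continuous_on {0..T} (\<lambda>t. Y t \<omega>)" if "\<omega> \<in> space M" for \<omega>
      by (rule continuous_on_subset[OF paths[OF that]]) simp
    show "continuous_on {0..T} (e i)" for i by (rule continuous_on_subset[OF e]) simp
    fix t \<delta> :: real assume t: "t \<in> {0..T}" and \<delta>: "0 < \<delta>"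
    have "(\<lambda>n. \<Sum>i\<le>n. lam i * (e i t)\<^sup>2) \<longlonglongrightarrow> K t t"
      by (rule mercer_diagonal[of e lam, OF e eig orth nrm lam compl bessel t])
    then have "(\<lambda>n. (K t t - (\<Sum>i\<le>n. lam i * (e i t)\<^sup>2)) / \<delta>\<^sup>2) \<longlonglongrightarrow> (K t t - K t t) / \<delta>\<^sup>2"
      using \<delta> by (intro tendsto_divide tendsto_diff tendsto_const) auto
    then have lim: "(\<lambda>n. (K t t - (\<Sum>i\<le>n. lam i * (e i t)\<^sup>2)) / \<delta>\<^sup>2) \<longlonglongrightarrow> 0" by simp
    show "(\<lambda>m. M.prob {\<omega> \<in> space M. \<delta> < \<bar>(\<Sum>i\<le>m. e i t * Z i \<omega>) - Y t \<omega>\<bar>}) \<longlonglongrightarrow> 0"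
    proof (rule tendsto_sandwich[OF _ _ tendsto_const lim])
      show "\<forall>\<^sub>F m in sequentially. M.prob {\<omega> \<in> space M. \<delta> < \<bar>(\<Sum>i\<le>m. e i t * Z i \<omega>) - Y t \<omega>\<bar>}
        \<le> (K t t - (\<Sum>i\<le>m. lam i * (e i t)\<^sup>2)) / \<delta>\<^sup>2"
      proof (rule always_eventually, rule allI)
        fix m
        let ?d = "\<lambda>\<omega>. (\<Sum>i\<le>m. e i t * Z i \<omega>) - Y t \<omega>"
        have ds: "sqint M ?d" by (intro sqint_diff sqint_sum sqint_cmult Zs sqint_Y)
        have "M.prob {\<omega> \<in> space M. \<delta> < \<bar>?d \<omega>\<bar>} \<le> M.prob {\<omega> \<in> space M. (?d \<omega>)\<^sup>2 \<ge> \<delta>\<^sup>2}"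
        proof (rule M.finite_measure_mono)
          show "{\<omega> \<in> space M. \<delta> < \<bar>?d \<omega>\<bar>} \<subseteq> {\<omega> \<in> space M. (?d \<omega>)\<^sup>2 \<ge> \<delta>\<^sup>2}"
            using \<delta> by (auto simp: abs_le_square_iff[symmetric])
        qed measurable
        also have "\<dots> \<le> (\<integral>\<omega>. (?d \<omega>)\<^sup>2 \<partial>M) / \<delta>\<^sup>2"
          using ds \<delta> by (intro integral_Markov_inequality_measure[where A = "space M"]) (auto simp: sqint_def)
        finally show "M.prob {\<omega> \<in> space M. \<delta> < \<bar>?d \<omega>\<bar>} \<le> (K t t - (\<Sum>i\<le>m. lam i * (e i t)\<^sup>2)) / \<delta>\<^sup>2"
          unfolding resid .
      qed
    qed (auto intro!: always_eventually)
  qed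
  then show "AE \<omega> in M. uniform_limit {0..T} (\<lambda>n t. \<Sum>i\<le>n. e i t * Zf (e i) \<omega>) (\<lambda>t. Y t \<omega>) sequentially"
    by (simp add: Z_def)
qed

end

section \<open>Wiener integrals and the bridge\<close>

lemma (in prob_space) gaussian_rv_cong_AE:
  assumes "AE x in M. f x = g x" "g \<in> borel_measurable M" "gaussian_rv M f"
  shows "gaussian_rv M g"
proof -
  have [measurable]: "f \<in> borel_measurable M" "g \<in> borel_measurable M" using assms
    by (auto simp: gaussian_rv_def sqint_def)
  have "integrable M (\<lambda>x. (f x)\<^sup>2) \<longleftrightarrow> integrable M (\<lambda>x. (g x)\<^sup>2)"
    using assms(1) by (intro integrable_cong_AE) auto
  moreover have "(\<integral>x. (f x)\<^sup>2 \<partial>M) = (\<integral>x. (g x)\<^sup>2 \<partial>M)"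
    using assms(1) by (intro integral_cong_AE) auto
  moreover have "(CLINT x|M. iexp (f x)) = (CLINT x|M. iexp (g x))"
    using assms(1) by (intro integral_cong_AE) auto
  ultimately show ?thesis using assms(3) by (simp add: gaussian_rv_def sqint_def)
qed

lemma (in prob_space) normal_imp_gaussian_rv:
  assumes D: "distributed M lborel V (normal_density 0 \<sigma>)" and \<sigma>: "0 < \<sigma>"
  shows "(\<integral>x. (V x)\<^sup>2 \<partial>M) = \<sigma>\<^sup>2" and "gaussian_rv M (\<lambda>x. c * V x)"
proof -
  have V[measurable]: "V \<in> borel_measurable M" using distributed_measurable[OF D] by simp
  have i2: "integrable M (\<lambda>x. (V x)\<^sup>2)"
    using integrable_normal_moment[OF \<sigma>, of 0 2]
    by (subst distributed_integrable[OF D, of "\<lambda>x. x\<^sup>2", symmetric]) (auto simp: \<sigma> normal_density_nonneg)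
  show v: "(\<integral>x. (V x)\<^sup>2 \<partial>M) = \<sigma>\<^sup>2"
    using normal_distributed_variance[OF \<sigma> D] normal_distributed_expectation[OF \<sigma> D] by simp
  have "distributed M lborel (\<lambda>x. V x / \<sigma>) std_normal_density"
    using D normal_standard_normal_convert[OF \<sigma>, of V 0] by simp
  then have "distr M lborel (\<lambda>x. V x / \<sigma>) = std_normal_distribution" by (simp add: distributed_def)
  moreover have "distr M lborel (\<lambda>x. V x / \<sigma>) = distr M borel (\<lambda>x. V x / \<sigma>)" by (intro distr_cong) auto
  ultimately have "char (distr M borel (\<lambda>x. V x / \<sigma>)) (c * \<sigma>) = complex_of_real (exp (- (c * \<sigma>)\<^sup>2 / 2))"
    by (simp add: char_std_normal_distribution)
  moreover have "char (distr M borel (\<lambda>x. V x / \<sigma>)) (c * \<sigma>) = (CLINT x|M. iexp (c * V x))"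
    unfolding char_def using \<sigma> by (simp add: integral_distr)
  ultimately show "gaussian_rv M (\<lambda>x. c * V x)"
    using i2 v by (simp add: gaussian_rv_def sqint_def power_mult_distrib)
qed

section \<open>Finite combinations of values of Brownian motion\<close>

locale brownian = prob_space M for M :: "'a measure" +
  fixes W :: "real \<Rightarrow> 'a \<Rightarrow> real"
  assumes bm: "standard_brownian_motion M W"
begin

lemma W_meas: "0 \<le> t \<Longrightarrow> W t \<in> borel_measurable M"
  using bm by (simp add: standard_brownian_motion_def)

lemma W0: "AE \<omega> in M. W 0 \<omega> = 0"
  using bm by (simp add: standard_brownian_motion_def)

lemma W_normal: "0 \<le> s \<Longrightarrow> s < t \<Longrightarrow>
    distributed M lborel (\<lambda>\<omega>. W t \<omega> - W s \<omega>) (normal_density 0 (sqrt (t - s)))"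
  using bm by (simp add: standard_brownian_motion_def)

lemma W_indep: "0 \<le> \<tau> 0 \<Longrightarrow> (\<And>i. i < n \<Longrightarrow> \<tau> i \<le> \<tau> (Suc i)) \<Longrightarrow>
    indep_vars (\<lambda>_. borel) (\<lambda>i \<omega>. W (\<tau> (Suc i)) \<omega> - W (\<tau> i) \<omega>) {..<n}" for \<tau> :: "nat \<Rightarrow> real"
  using bm by (simp add: standard_brownian_motion_def)

lemma increment_gaussian:
  assumes "0 \<le> s" "s \<le> t"
  shows "gaussian_rv M (\<lambda>\<omega>. c * (W t \<omega> - W s \<omega>))"
    and "(\<integral>\<omega>. (W t \<omega> - W s \<omega>)\<^sup>2 \<partial>M) = t - s"
    and "sqint M (\<lambda>\<omega>. W t \<omega> - W s \<omega>)"
proof -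
  have *: "gaussian_rv M (\<lambda>\<omega>. c * (W t \<omega> - W s \<omega>)) \<and> (\<integral>\<omega>. (W t \<omega> - W s \<omega>)\<^sup>2 \<partial>M) = t - s" for c
  proof (cases "s = t")
    case True
    then show ?thesis by (simp add: gaussian_rv_def sqint_def prob_space)
  next
    case False
    then have "s < t" using assms by simp
    note D = W_normal[OF assms(1) this]
    have "0 < sqrt (t - s)" using \<open>s < t\<close> by simp
    from normal_imp_gaussian_rv[OF D this] \<open>s < t\<close> show ?thesis by simp
  qed
  then show "gaussian_rv M (\<lambda>\<omega>. c * (W t \<omega> - W s \<omega>))" "(\<integral>\<omega>. (W t \<omega> - W s \<omega>)\<^sup>2 \<partial>M) = t - s" by auto
  show "sqint M (\<lambda>\<omega>. W t \<omega> - W s \<omega>)" using *[of 1] by (simp add: gaussian_rv_def)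
qed

lemma W_sq:
  assumes "0 \<le> t"
  shows "sqint M (W t)" "(\<integral>\<omega>. (W t \<omega>)\<^sup>2 \<partial>M) = t"
proof -
  have [measurable]: "W t \<in> borel_measurable M" "W 0 \<in> borel_measurable M" using W_meas assms by auto
  have ae: "AE \<omega> in M. (W t \<omega> - W 0 \<omega>)\<^sup>2 = (W t \<omega>)\<^sup>2" using W0 by eventually_elim simp
  have "integrable M (\<lambda>\<omega>. (W t \<omega> - W 0 \<omega>)\<^sup>2) \<longleftrightarrow> integrable M (\<lambda>\<omega>. (W t \<omega>)\<^sup>2)"
    by (rule integrable_cong_AE[OF _ _ ae]) measurable
  then show "sqint M (W t)" using increment_gaussian(3)[of 0 t] assms by (simp add: sqint_def)
  have "(\<integral>\<omega>. (W t \<omega> - W 0 \<omega>)\<^sup>2 \<partial>M) = (\<integral>\<omega>. (W t \<omega>)\<^sup>2 \<partial>M)"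
    by (rule integral_cong_AE[OF _ _ ae]) measurable
  then show "(\<integral>\<omega>. (W t \<omega>)\<^sup>2 \<partial>M) = t" using increment_gaussian(2)[of 0 t] assms by simp
qed

lemma W_cov:
  assumes "0 \<le> s" "0 \<le> t"
  shows "(\<integral>\<omega>. W s \<omega> * W t \<omega> \<partial>M) = min s t"
proof -
  have main: "(\<integral>\<omega>. W s \<omega> * W t \<omega> \<partial>M) = s" if st: "0 \<le> s" "s \<le> t" for s t
  proof -
    have q: "sqint M (W s)" "sqint M (W t)" using W_sq that by auto
    have "(\<integral>\<omega>. (W t \<omega> - W s \<omega>)\<^sup>2 \<partial>M) = (\<integral>\<omega>. (W t \<omega>)\<^sup>2 - 2 * (W s \<omega> * W t \<omega>) + (W s \<omega>)\<^sup>2 \<partial>M)"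
      by (intro Bochner_Integration.integral_cong) (auto simp: power2_eq_square algebra_simps)
    also have "\<dots> = t - 2 * (\<integral>\<omega>. W s \<omega> * W t \<omega> \<partial>M) + s"
      using q sqint_mult_integrable[OF q] W_sq(2)[of s] W_sq(2)[of t] that by (simp add: sqint_def)
    finally show ?thesis using increment_gaussian(2)[OF st] by simp
  qed
  show ?thesis
    using main[of s t] main[of t s] assms by (cases "s \<le> t") (auto simp: min_def mult.commute)
qed

text \<open>Riemann sums for different end points use different grids. The linear span is closed
  under combining them, so joint Gaussianity of the bridge follows from Gaussianity of single
  elements.\<close>

definition wspan :: "('a \<Rightarrow> real) \<Rightarrow> bool" where
  "wspan V \<longleftrightarrow> (\<exists>P c. finite P \<and> P \<subseteq> {0..} \<and> V = (\<lambda>\<omega>. \<Sum>t\<in>P. c t * W t \<omega>))"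

lemma wspan_W: "0 \<le> t \<Longrightarrow> wspan (W t)"
  unfolding wspan_def by (rule exI[of _ "{t}"], rule exI[of _ "\<lambda>_. 1"]) simp

lemma wspan_cmult:
  assumes "wspan V" shows "wspan (\<lambda>\<omega>. a * V \<omega>)"
proof -
  obtain P c where "finite P" "P \<subseteq> {0..}" "V = (\<lambda>\<omega>. \<Sum>t\<in>P. c t * W t \<omega>)"
    using assms by (auto simp: wspan_def)
  then show ?thesis unfolding wspan_def
    by (intro exI[of _ P] exI[of _ "\<lambda>t. a * c t"]) (simp add: sum_distrib_left mult.assoc)
qed

lemma wspan_0: "wspan (\<lambda>\<omega>. 0)"
  unfolding wspan_def by (rule exI[of _ "{}"]) simp

lemma wspan_add:
  assumes "wspan V" "wspan V'" shows "wspan (\<lambda>\<omega>. V \<omega> + V' \<omega>)"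
proof -
  obtain P c where P: "finite P" "P \<subseteq> {0..}" "V = (\<lambda>\<omega>. \<Sum>t\<in>P. c t * W t \<omega>)"
    using assms by (auto simp: wspan_def)
  obtain P' c' where P': "finite P'" "P' \<subseteq> {0..}" "V' = (\<lambda>\<omega>. \<Sum>t\<in>P'. c' t * W t \<omega>)"
    using assms by (auto simp: wspan_def)
  define d where "d t = (if t \<in> P then c t else 0) + (if t \<in> P' then c' t else 0)" for t
  have "V \<omega> + V' \<omega> = (\<Sum>t\<in>P \<union> P'. d t * W t \<omega>)" for \<omega>
  proof -
    have "V \<omega> = (\<Sum>t\<in>P \<union> P'. (if t \<in> P then c t else 0) * W t \<omega>)"
      unfolding P(3) using P(1) P'(1) by (intro sum.mono_neutral_cong_left) auto
    moreover have "V' \<omega> = (\<Sum>t\<in>P \<union> P'. (if t \<in> P' then c' t else 0) * W t \<omega>)"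
      unfolding P'(3) using P(1) P'(1) by (intro sum.mono_neutral_cong_left) auto
    ultimately show ?thesis by (simp add: d_def distrib_right sum.distrib)
  qed
  then show ?thesis unfolding wspan_def using P P' by (intro exI[of _ "P \<union> P'"] exI[of _ d]) auto
qed

lemma wspan_diff: "wspan V \<Longrightarrow> wspan V' \<Longrightarrow> wspan (\<lambda>\<omega>. V \<omega> - V' \<omega>)"
  using wspan_add[of V "\<lambda>\<omega>. (-1) * V' \<omega>"] wspan_cmult[of V' "-1"] by simp

lemma wspan_sum: "(\<And>i. i \<in> I \<Longrightarrow> wspan (V i)) \<Longrightarrow> wspan (\<lambda>\<omega>. \<Sum>i\<in>I. V i \<omega>)"
  by (induction I rule: infinite_finite_induct) (auto intro: wspan_add wspan_0)

text \<open>Sort the times; the sum telescopes into a combination of independent increments.\<close>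
lemma wspan_gaussian:
  assumes "wspan V"
  shows "gaussian_rv M V"
proof -
  obtain P c where P: "finite P" "P \<subseteq> {0..}" "V = (\<lambda>\<omega>. \<Sum>t\<in>P. c t * W t \<omega>)"
    using assms by (auto simp: wspan_def)
  \<comment> \<open>Time 0 is added so that the telescoping sums start at \<open>W 0\<close>. This
    variable vanishes almost surely only, hence the almost sure equality below.\<close>
  define xs where "xs = sorted_list_of_set (insert 0 P)"
  define n where "n = length xs - 1"
  define \<tau> where "\<tau> i = xs ! min i n" for i
  have xs: "sorted xs" "set xs = insert 0 P"
    unfolding xs_def using P(1) set_sorted_list_of_set[of
      "insert 0 P"] sorted_list_of_set.sorted_sorted_key_list_of_set[of "insert 0 P"]
      by (simp_all only: finite_insert list.map_ident)
  then have len: "length xs = Suc n" by (cases xs) (auto simp: n_def)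
  have mono: "\<tau> i \<le> \<tau> j" if "i \<le> j" for i j
    unfolding \<tau>_def using that len by (intro sorted_nth_mono xs) auto
  have surj: "\<exists>j\<le>n. \<tau> j = t" if "t \<in> insert 0 P" for t
  proof -
    have "t \<in> set xs" using that unfolding xs(2) .
    then obtain j where "j < length xs" "xs ! j = t" unfolding in_set_conv_nth by blast
    then show ?thesis using len by (intro exI[of _ j]) (auto simp: \<tau>_def)
  qed
  have ge0: "0 \<le> \<tau> i" for i
  proof -
    have "\<tau> i \<in> set xs" unfolding \<tau>_def using len by (intro nth_mem) auto
    then show ?thesis using xs(2) P(2) by auto
  qed
  obtain j0 where "\<tau> j0 = 0" using surj[of 0] by auto
  then have \<tau>0: "\<tau> 0 = 0" using mono[of 0 j0] ge0[of 0] by simp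
  obtain j where j: "\<And>t. t \<in> P \<Longrightarrow> j t \<le> n" "\<And>t. t \<in> P \<Longrightarrow> \<tau> (j t) = t"
  proof -
    have "\<forall>t\<in>P. \<exists>j. j \<le> n \<and> \<tau> j = t" using surj by blast
    from bchoice[OF this] show ?thesis using that by blast
  qed
  \<comment> \<open>Summation by parts: an increment is counted by every time of \<open>P\<close>
    that lies beyond it.\<close>
  define d where "d i = (\<Sum>t\<in>P. if i < j t then c t else 0)" for i
  define \<Delta> where "\<Delta> i \<omega> = W (\<tau> (Suc i)) \<omega> - W (\<tau> i) \<omega>" for i \<omega>
  define U where "U \<omega> = (\<Sum>i<n. d i * \<Delta> i \<omega>)" for \<omega>
  have ae: "AE \<omega> in M. U \<omega> = V \<omega>"
    using W0
  proof eventually_elim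
    case (elim \<omega>)
    have Wt: "W t \<omega> = (\<Sum>i<n. if i < j t then \<Delta> i \<omega> else 0)" if t: "t \<in> P" for t
    proof -
      have "W t \<omega> = W (\<tau> (j t)) \<omega> - W (\<tau> 0) \<omega>" using j(2)[OF t] elim by (simp add: \<tau>0)
      also have "\<dots> = (\<Sum>i<j t. \<Delta> i \<omega>)"
        unfolding \<Delta>_def by (rule sum_lessThan_telescope[symmetric])
      also have "\<dots> = (\<Sum>i<n. if i < j t then \<Delta> i \<omega> else 0)"
        using j(1)[OF t] by (intro sum.mono_neutral_cong_left) auto
      finally show ?thesis .
    qed
    have "U \<omega> = (\<Sum>i<n. \<Sum>t\<in>P. (if i < j t then c t else 0) * \<Delta> i \<omega>)"
      by (simp add: U_def d_def sum_distrib_right)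
    also have "\<dots> = (\<Sum>t\<in>P. \<Sum>i<n. (if i < j t then c t else 0) * \<Delta> i \<omega>)" by (rule sum.swap)
    also have "\<dots> = (\<Sum>t\<in>P. c t * W t \<omega>)"
    proof (intro sum.cong refl)
      fix t assume t: "t \<in> P"
      show "(\<Sum>i<n. (if i < j t then c t else 0) * \<Delta> i \<omega>) = c t * W t \<omega>"
        unfolding Wt[OF t] sum_distrib_left by (intro sum.cong) auto
    qed
    finally show ?case by (simp add: P(3))
  qed
  have \<Delta>g: "gaussian_rv M (\<lambda>\<omega>. a * \<Delta> i \<omega>)" "(\<integral>\<omega>. (\<Delta> i \<omega>)\<^sup>2 \<partial>M) = \<tau> (Suc i) - \<tau> i" "sqint M (\<Delta> i)" for a i
    unfolding \<Delta>_def using increment_gaussian[OF ge0[of i] mono[of i "Suc i"]] by auto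
  have \<Delta>m[measurable]: "\<Delta> i \<in> borel_measurable M" for i using \<Delta>g(3) by (simp add: sqint_def)
  have uncor: "(\<integral>\<omega>. \<Delta> i \<omega> * \<Delta> k \<omega> \<partial>M) = 0" if "i < k" for i k
  proof -
    have q: "sqint M (W (\<tau> l))" for l using W_sq ge0 by auto
    have "(\<integral>\<omega>. \<Delta> i \<omega> * \<Delta> k \<omega> \<partial>M) = (\<integral>\<omega>. W (\<tau> (Suc i)) \<omega> * W (\<tau> (Suc k)) \<omega> - W (\<tau> (Suc i)) \<omega> * W (\<tau> k) \<omega>
        - W (\<tau> i) \<omega> * W (\<tau> (Suc k)) \<omega> + W (\<tau> i) \<omega> * W (\<tau> k) \<omega> \<partial>M)"
      by (intro Bochner_Integration.integral_cong) (auto simp: \<Delta>_def algebra_simps)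
    also have "\<dots> = min (\<tau> (Suc i)) (\<tau> (Suc k)) - min (\<tau> (Suc i)) (\<tau> k) - min (\<tau> i) (\<tau> (Suc k))
      + min (\<tau> i) (\<tau> k)"
      using sqint_mult_integrable[OF q q] by (simp add: W_cov[OF ge0 ge0])
    also have "\<dots> = 0"
      using mono[of "Suc i" k] mono[of "Suc i" "Suc k"] mono[of i "Suc k"] mono[of i k] that
        by (simp add: min_absorb1)
    finally show ?thesis .
  qed
  have uncor': "(\<integral>\<omega>. \<Delta> i \<omega> * \<Delta> k \<omega> \<partial>M) = 0" if "i \<noteq> k" for i k
    using uncor[of i k] uncor[of k i] that by (cases "i < k") (auto simp: mult.commute)
  have "gaussian_rv M U"
  proof -
    have "sqint M U" unfolding U_def by (intro sqint_sum sqint_cmult \<Delta>g)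
    moreover have "(\<integral>\<omega>. (U \<omega>)\<^sup>2 \<partial>M) = (\<Sum>i<n. (\<integral>\<omega>. (d i * \<Delta> i \<omega>)\<^sup>2 \<partial>M))"
    proof -
      have "(\<integral>\<omega>. (U \<omega>)\<^sup>2 \<partial>M) = (\<integral>\<omega>. (\<Sum>i<n. \<Sum>k<n. (d i * d k) * (\<Delta> i \<omega> * \<Delta> k \<omega>)) \<partial>M)"
        by (intro Bochner_Integration.integral_cong) (auto simp: U_def power2_eq_square sum_product mult_ac)
      also have "\<dots> = (\<Sum>i<n. \<Sum>k<n. (d i * d k) * (\<integral>\<omega>. \<Delta> i \<omega> * \<Delta> k \<omega> \<partial>M))"
        using sqint_mult_integrable[OF \<Delta>g(3) \<Delta>g(3)] by simp
      also have "\<dots> = (\<Sum>i<n. \<Sum>k<n. if k = i then (d i * d i) * (\<integral>\<omega>. \<Delta> i \<omega> * \<Delta> i \<omega> \<partial>M) else 0)"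
        by (intro sum.cong refl) (auto simp: uncor')
      also have "\<dots> = (\<Sum>i<n. (\<integral>\<omega>. (d i * \<Delta> i \<omega>)\<^sup>2 \<partial>M))"
        by (simp add: power2_eq_square mult_ac)
      finally show ?thesis .
    qed
    moreover have "(CLINT \<omega>|M. iexp (U \<omega>)) = (\<Prod>i<n. complex_of_real (exp (- (\<integral>\<omega>. (d i * \<Delta> i \<omega>)\<^sup>2 \<partial>M) / 2)))"
    proof -
      have ind: "indep_vars (\<lambda>_. borel) (\<lambda>i \<omega>. d i * \<Delta> i \<omega>) {..<n}"
        using W_indep[of \<tau> n] ge0 mono
        by (intro indep_vars_compose2[where Y = "\<lambda>i x. d i * x" and M' = "\<lambda>_. borel"]) (auto simp: \<Delta>_def)
      have "(CLINT \<omega>|M. iexp (U \<omega>)) = char (distr M borel (\<lambda>\<omega>. \<Sum>i<n. d i * \<Delta> i \<omega>)) 1"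
        unfolding char_def U_def by (simp add: integral_distr)
      also have "\<dots> = (\<Prod>i<n. char (distr M borel (\<lambda>\<omega>. d i * \<Delta> i \<omega>)) 1)" by (rule char_distr_sum[OF ind])
      also have "\<dots> = (\<Prod>i<n. (CLINT \<omega>|M. iexp (d i * \<Delta> i \<omega>)))"
        unfolding char_def by (simp add: integral_distr)
      also have "\<dots> = (\<Prod>i<n. complex_of_real (exp (- (\<integral>\<omega>. (d i * \<Delta> i \<omega>)\<^sup>2 \<partial>M) / 2)))"
        using \<Delta>g(1) by (intro prod.cong refl) (simp only: gaussian_rv_def)
      finally show ?thesis .
    qed
    moreover have "(\<Prod>i<n. complex_of_real (exp (- (\<integral>\<omega>. (d i * \<Delta> i \<omega>)\<^sup>2 \<partial>M) / 2))) =
       complex_of_real (exp (- (\<Sum>i<n. (\<integral>\<omega>. (d i * \<Delta> i \<omega>)\<^sup>2 \<partial>M)) / 2))"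
      by (simp only: of_real_prod[symmetric] exp_sum[symmetric] finite_lessThan sum_negf[symmetric]
        sum_divide_distrib)
    ultimately show ?thesis by (simp only: gaussian_rv_def)
  qed
  moreover have "V \<in> borel_measurable M"
    unfolding P(3) using P(2) W_meas by (intro borel_measurable_sum borel_measurable_times) auto
  ultimately show ?thesis using gaussian_rv_cong_AE[OF ae] by blast
qed

end

text \<open>The step function whose Wiener integral is the left-endpoint Riemann sum. Its cells are
  open on the left, so they partition (0,t].\<close>

definition left_step :: "(real \<Rightarrow> real) \<Rightarrow> real \<Rightarrow> nat \<Rightarrow> real \<Rightarrow> real" where
  "left_step f t n r = (\<Sum>i<n. f (t * real i / real n) *
     indicator {t * real i / real n<..t * real (Suc i) / real n} r)"

text \<open>On left-open cells the cell index of r is the ceiling of n r / t minus 1, which turns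
  the sum into a single evaluation close to r.\<close>

lemma left_step_eq:
  assumes t: "0 \<le> t" and n: "0 < n"
  shows "left_step f t n r =
    (if 0 < r \<and> r \<le> t then f (t * (real_of_int \<lceil>real n * r / t\<rceil> - 1) / real n) else 0)"
proof (cases "0 < r \<and> r \<le> t")
  case True
  then have tp: "0 < t" by simp
  define i0 where "i0 = nat (\<lceil>real n * r / t\<rceil> - 1)"
  have pos: "0 < real n * r / t" using True tp n by simp
  have le: "real n * r / t \<le> real n" using True tp n by (simp add: divide_le_eq)
  have c1: "0 < \<lceil>real n * r / t\<rceil>" using pos by simp
  have c2: "\<lceil>real n * r / t\<rceil> \<le> int n" using le by (simp add: ceiling_le_iff)
  obtain k where k: "\<lceil>real n * r / t\<rceil> = k" by simp
  have i0: "i0 < n" "real i0 = real_of_int \<lceil>real n * r / t\<rceil> - 1" using c1 c2 unfolding i0_def k by auto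
  have iff: "r \<in> {t * real i / real n<..t * real (Suc i) / real n} \<longleftrightarrow> i = i0" for i
  proof -
    have "t * real i / real n < r \<longleftrightarrow> real i < real n * r / t" using tp n by (simp add: field_simps)
    moreover have "r \<le> t * real (Suc i) / real n \<longleftrightarrow> real n * r / t \<le> real (Suc i)" using tp n
      by (simp add: field_simps)
    ultimately have "r \<in> {t * real i / real n<..t * real (Suc i) / real n} \<longleftrightarrow>
       real_of_int (int i + 1) - 1 < real n * r / t \<and> real n * r / t
         \<le> real_of_int (int i + 1)" by (simp add: add.commute)
    also have "\<dots> \<longleftrightarrow> \<lceil>real n * r / t\<rceil> = int i + 1" using ceiling_eq_iff[of "real n * r / t" "int i + 1"] by simp
    also have "\<dots> \<longleftrightarrow> i = i0" using c1 unfolding i0_def k by auto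
    finally show ?thesis .
  qed
  have "left_step f t n r = (\<Sum>i<n. if i = i0 then f (t * real i / real n) else 0)"
    unfolding left_step_def indicator_def iff by (intro sum.cong refl) simp
  also have "\<dots> = f (t * real i0 / real n)" using i0(1) by simp
  finally show ?thesis using True by (simp add: i0(2))
next
  case False
  have "indicator {t * real i / real n<..t * real (Suc i) / real n} r = (0::real)" if "i < n" for i
  proof -
    have "0 \<le> t * real i / real n" using t by simp
    moreover have "t * real (Suc i) / real n \<le> t"
    proof -
      have "t * real (Suc i) \<le> t * real n" using t that by (intro mult_left_mono) auto
      then show ?thesis using n by (simp add: divide_le_eq)
    qed
    ultimately show ?thesis using False by (auto simp: indicator_def)
  qed
  then show ?thesis using False by (auto simp: left_step_def)
qed

lemma left_step_point:
  assumes "0 < r" "r \<le> t" "0 < n"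
  shows "t * (real_of_int \<lceil>real n * r / t\<rceil> - 1) / real n \<in> {0..t}"
    and "\<bar>t * (real_of_int \<lceil>real n * r / t\<rceil> - 1) / real n - r\<bar> \<le> t / real n"
proof -
  have tp: "0 < t" using assms by simp
  define c where "c = real_of_int \<lceil>real n * r / t\<rceil>"
  have c: "real n * r / t \<le> c" "c < real n * r / t + 1" unfolding c_def by linarith+
  have "0 < real n * r / t" using assms tp by simp
  then have "1 \<le> c" unfolding c_def by (simp add: one_le_ceiling le_of_int_ceiling)
  have up: "t * (c - 1) / real n < r" using c(2) tp assms by (simp add: field_simps)
  have lo: "r - t / real n \<le> t * (c - 1) / real n" using c(1) tp assms by (simp add: field_simps)
  have "0 \<le> t * (c - 1) / real n" using \<open>1 \<le> c\<close> tp by simp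
  then show "t * (real_of_int \<lceil>real n * r / t\<rceil> - 1) / real n \<in> {0..t}"
    using up assms unfolding c_def by auto
  show "\<bar>t * (real_of_int \<lceil>real n * r / t\<rceil> - 1) / real n - r\<bar> \<le> t / real n"
    using up lo unfolding c_def by linarith
qed

lemma left_step_tendsto:
  assumes t: "0 \<le> t" and f: "continuous_on {0..t} f"
  shows "(\<lambda>n. left_step f t n r) \<longlonglongrightarrow> f r * indicator {0<..t} r"
proof (cases "0 < r \<and> r \<le> t")
  case True
  define p where "p n = t * (real_of_int \<lceil>real n * r / t\<rceil> - 1) / real n" for n
  have lim: "p \<longlonglongrightarrow> r"
  proof (rule LIM_zero_cancel, rule Lim_null_comparison)
    show "\<forall>\<^sub>F n in sequentially. norm (p n - r) \<le> t / real n"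
      using eventually_gt_at_top[of 0] by eventually_elim (use True left_step_point(2) in \<open>simp add: p_def\<close>)
    show "(\<lambda>n. t / real n) \<longlonglongrightarrow> 0" by (rule lim_const_over_n)
  qed
  have "(\<lambda>n. f (p n)) \<longlonglongrightarrow> f r"
  proof (rule continuous_on_tendsto_compose[OF f lim])
    show "r \<in> {0..t}" using True by simp
    show "\<forall>\<^sub>F n in sequentially. p n \<in> {0..t}"
      using eventually_gt_at_top[of 0]
    proof eventually_elim
      case (elim n)
      show ?case unfolding p_def by (rule left_step_point(1)) (use True elim in auto)
    qed
  qed
  moreover have "\<forall>\<^sub>F n in sequentially. f (p n) = left_step f t n r"
    using eventually_gt_at_top[of 0]
    by eventually_elim (use True in \<open>simp add: left_step_eq[OF t] p_def\<close>)
  ultimately have "(\<lambda>n. left_step f t n r) \<longlonglongrightarrow> f r" by (rule Lim_transform_eventually)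
  then show ?thesis using True by simp
next
  case False
  have "\<forall>\<^sub>F n in sequentially. left_step f t n r = 0"
    using eventually_gt_at_top[of 0] by eventually_elim (simp only: left_step_eq[OF t] False if_False)
  then show ?thesis using False by (simp add: tendsto_eventually)
qed

lemma left_step_bound:
  assumes t: "0 \<le> t" and f: "\<And>s. s \<in> {0..t} \<Longrightarrow> \<bar>f s\<bar> \<le> C" and C: "0 \<le> C"
  shows "\<bar>left_step f t n r\<bar> \<le> C * indicator {0..t} r"
proof (cases "n = 0")
  case True
  then show ?thesis using C by (simp add: left_step_def)
next
  case False
  then show ?thesis using f left_step_point(1)[of r t n] C
    by (auto simp: left_step_eq[OF t])
qed

lemma left_step_meas[measurable]: "left_step f t n \<in> borel_measurable borel"
  unfolding left_step_def by measurable

section \<open>The isometry of the Wiener integral\<close>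

context brownian
begin

definition riemann_sum :: "(real \<Rightarrow> real) \<Rightarrow> real \<Rightarrow> nat \<Rightarrow> 'a \<Rightarrow> real" where
  "riemann_sum f t n \<omega> = (\<Sum>i<n. f (t * real i / real n) *
     (W (t * real (Suc i) / real n) \<omega> - W (t * real i / real n) \<omega>))"

lemma riemann_sum_wspan: "0 \<le> t \<Longrightarrow> wspan (riemann_sum f t n)"
  unfolding riemann_sum_def by (intro wspan_sum wspan_cmult wspan_diff wspan_W) auto

text \<open>With the covariance \<open>min s t\<close>, the inner product of two increments is the
  length of the overlap of their intervals.\<close>

lemma increment_inner:
  assumes "0 \<le> a" "a \<le> b" "0 \<le> c" "c \<le> d"
  shows "(\<integral>\<omega>. (W b \<omega> - W a \<omega>) * (W d \<omega> - W c \<omega>) \<partial>M) = (\<integral>r. indicator {a<..b} r * indicator {c<..d} r \<partial>lborel)"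
    and "integrable lborel (\<lambda>r. indicator {a<..b} r * indicator {c<..d} r :: real)"
proof -
  have q: "sqint M (W u)" if "0 \<le> u" for u using W_sq(1)[OF that] .
  have p: "0 \<le> b" "0 \<le> d" using assms by auto
  have "(\<integral>\<omega>. (W b \<omega> - W a \<omega>) * (W d \<omega> - W c \<omega>) \<partial>M)
    = (\<integral>\<omega>. W b \<omega> * W d \<omega> - W b \<omega> * W c \<omega> - W a \<omega> * W d \<omega> + W a \<omega> * W c \<omega> \<partial>M)"
    by (intro Bochner_Integration.integral_cong) (auto simp: algebra_simps)
  also have "\<dots> = min b d - min b c - min a d + min a c"
    using sqint_mult_integrable[OF q q] assms p by (simp add: W_cov)
  also have "\<dots> = max 0 (min b d - max a c)" using assms by (auto simp: min_def max_def)
  also have "\<dots> = measure lborel {max a c<..min b d}"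
    by (cases "max a c \<le> min b d") auto
  also have "\<dots> = (\<integral>r. indicator {max a c<..min b d} r \<partial>lborel)" by simp
  also have "\<dots> = (\<integral>r. indicator {a<..b} r * indicator {c<..d} r \<partial>lborel)"
    by (intro Bochner_Integration.integral_cong) (auto simp: indicator_def)
  finally show "(\<integral>\<omega>. (W b \<omega> - W a \<omega>) * (W d \<omega> - W c \<omega>) \<partial>M)
    = (\<integral>r. indicator {a<..b} r * indicator {c<..d} r \<partial>lborel)" .
  have "(\<lambda>r. indicator {a<..b} r * indicator {c<..d} r :: real) = indicator {max a c<..min b d}"
    by (auto simp: indicator_def)
  moreover have "integrable lborel (indicator {max a c<..min b d} :: real \<Rightarrow> real)"
    by (intro integrable_real_indicator emeasure_bounded_finite bounded_subset[OF bounded_closed_interval[of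
      "max a c" "min b d"]]) auto
  ultimately show "integrable lborel (\<lambda>r. indicator {a<..b} r * indicator {c<..d} r :: real)" by simp
qed

lemma riemann_sum_inner:
  assumes s: "0 \<le> s" and t: "0 \<le> t"
  shows "(\<integral>\<omega>. riemann_sum f s n \<omega> * riemann_sum g t n \<omega> \<partial>M)
      = (\<integral>r. left_step f s n r * left_step g t n r \<partial>lborel)"
proof -
  define D where "D u i \<omega> = W (u * real (Suc i) / real n) \<omega> - W (u * real i / real n) \<omega>" for u i \<omega>
  define E where "E u i = (indicator {u * real i / real n<..u * real (Suc i) / real n} :: real \<Rightarrow> real)" for u i
  have ord: "0 \<le> u * real i / real n" "u * real i / real n \<le> u * real (Suc i) / real n" if "0 \<le> u" for u i
    using that by (auto intro!: divide_right_mono mult_left_mono)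
  have DE: "(\<integral>\<omega>. D s i \<omega> * D t j \<omega> \<partial>M) = (\<integral>r. E s i r * E t j r \<partial>lborel)"
    "integrable lborel (\<lambda>r. E s i r * E t j r)" for i j
    unfolding D_def E_def using increment_inner[OF ord[OF s] ord[OF t], of i j] by auto
  have Dq: "sqint M (D u i)" if "0 \<le> u" for u i
    unfolding D_def by (rule increment_gaussian(3)[OF ord[OF that]])
  have "(\<integral>\<omega>. riemann_sum f s n \<omega> * riemann_sum g t n \<omega> \<partial>M) =
     (\<integral>\<omega>. (\<Sum>i<n. \<Sum>j<n. (f (s * real i / real n) * g (t * real j / real n)) * (D s i \<omega> * D t j \<omega>)) \<partial>M)"
    by (intro Bochner_Integration.integral_cong) (auto simp: riemann_sum_def D_def sum_product mult_ac)
  also have "\<dots> = (\<Sum>i<n. \<Sum>j<n. (f (s * real i / real n) * g (t * real j / real n)) * (\<integral>r. E s i r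
    * E t j r \<partial>lborel))"
    using sqint_mult_integrable[OF Dq[OF s] Dq[OF t]] by (simp add: DE(1))
  also have "\<dots> = (\<integral>r. (\<Sum>i<n. \<Sum>j<n. (f (s * real i / real n) * g (t * real j / real n)) * (E s i r
    * E t j r)) \<partial>lborel)"
    using DE(2) by simp
  also have "\<dots> = (\<integral>r. left_step f s n r * left_step g t n r \<partial>lborel)"
    by (intro Bochner_Integration.integral_cong) (simp_all only: left_step_def E_def sum_product mult_ac)
  finally show ?thesis .
qed

text \<open>For step functions the isometry is bilinearity together with the overlap rule, even
  though the two grids differ. Both sides then pass to the limit, the left one in mean square and
  the right one by dominated convergence.\<close>

lemma wiener_isometry:
  assumes s: "0 \<le> s" and t: "0 \<le> t"
    and f: "continuous_on {0..s} f" and g: "continuous_on {0..t} g"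
    and Y: "wiener_integral M W f s Y" and V: "wiener_integral M W g t V"
  shows "(\<integral>\<omega>. Y \<omega> * V \<omega> \<partial>M) = (\<integral>r. (f r * indicator {0<..s} r) * (g r * indicator {0<..t} r) \<partial>lborel)"
    and "L2_conv M (riemann_sum f s) Y"
proof -
  have conv: "L2_conv M (riemann_sum h u) U" if "wiener_integral M W h u U" "0 \<le> u" for h u U
  proof (rule L2_convI_nn)
    show "sqint M (riemann_sum h u n)" for n
      using wspan_gaussian[OF riemann_sum_wspan[OF that(2)]] by (simp add: gaussian_rv_def)
  qed (use that in \<open>auto simp: wiener_integral_def riemann_sum_def\<close>)
  then show "L2_conv M (riemann_sum f s) Y" using Y s by blast
  have bdd: "\<exists>C\<ge>0. \<forall>x\<in>{0..u}. \<bar>h x\<bar> \<le> C" if "continuous_on {0..u} h" for h :: "real \<Rightarrow> real" and u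
  proof -
    have "compact (h ` {0..u})" using that by (intro compact_continuous_image) auto
    then obtain b where "\<forall>x\<in>h ` {0..u}. norm x \<le> b"
      using compact_imp_bounded[of "h ` {0..u}"] bounded_iff[of "h ` {0..u}"] by metis
    then show ?thesis by (intro exI[of _ "max 0 b"]) (auto simp: le_max_iff_disj)
  qed
  obtain C1 where C1: "0 \<le> C1" "\<And>x. x \<in> {0..s} \<Longrightarrow> \<bar>f x\<bar> \<le> C1" using bdd[OF f] by blast
  obtain C2 where C2: "0 \<le> C2" "\<And>x. x \<in> {0..t} \<Longrightarrow> \<bar>g x\<bar> \<le> C2" using bdd[OF g] by blast
  have l1: "(\<lambda>n. \<integral>\<omega>. riemann_sum f s n \<omega> * riemann_sum g t n \<omega> \<partial>M) \<longlonglongrightarrow> (\<integral>\<omega>. Y \<omega> * V \<omega> \<partial>M)"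
    by (intro L2_conv_inner conv Y V s t)
  have l2: "(\<lambda>n. \<integral>r. left_step f s n r * left_step g t n r \<partial>lborel) \<longlonglongrightarrow> (\<integral>r. (f r * indicator {0<..s} r)
    * (g r * indicator {0<..t} r) \<partial>lborel)"
  proof (rule integral_dominated_convergence[where w = "\<lambda>r. (C1 * C2) * indicator {0..s} r"])
    show "AE r in lborel. (\<lambda>n. left_step f s n r * left_step g t n r) \<longlonglongrightarrow> (f r * indicator {0<..s} r) * (g r
      * indicator {0<..t} r)"
      by (intro AE_I2 tendsto_mult left_step_tendsto s t f g)
    show "(\<lambda>r. (f r * indicator {0<..s} r) * (g r * indicator {0<..t} r)) \<in> borel_measurable lborel"
    proof (rule borel_measurable_LIMSEQ_real[where u = "\<lambda>n r. left_step f s n r * left_step g t n r"])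
      show "(\<lambda>n. left_step f s n r * left_step g t n r) \<longlonglongrightarrow> (f r * indicator {0<..s} r) * (g r
        * indicator {0<..t} r)" for r
        by (intro tendsto_mult left_step_tendsto s t f g)
    qed measurable
    show "AE r in lborel. norm (left_step f s n r * left_step g t n r) \<le> (C1 * C2) * indicator {0..s} r" for n
    proof (rule AE_I2)
      fix r
      have a: "\<bar>left_step f s n r\<bar> \<le> C1 * indicator {0..s} r" by (rule left_step_bound[OF s C1(2,1)])
      have "\<bar>left_step g t n r\<bar> \<le> C2 * indicator {0..t} r" by (rule left_step_bound[OF t C2(2,1)])
      also have "\<dots> \<le> C2" using C2(1) by (auto simp: indicator_def)
      finally have b: "\<bar>left_step g t n r\<bar> \<le> C2" .
      have "\<bar>left_step f s n r\<bar> * \<bar>left_step g t n r\<bar> \<le> (C1 * indicator {0..s} r) * C2"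
        using a b C1(1) by (intro mult_mono) auto
      then show "norm (left_step f s n r * left_step g t n r) \<le> (C1 * C2) * indicator {0..s} r"
        by (simp add: abs_mult mult_ac)
    qed
    show "integrable lborel (\<lambda>r. (C1 * C2) * indicator {0..s} r)"
      by (intro integrable_mult_right integrable_real_indicator emeasure_bounded_finite) auto
  qed measurable
  show "(\<integral>\<omega>. Y \<omega> * V \<omega> \<partial>M) = (\<integral>r. (f r * indicator {0<..s} r) * (g r * indicator {0<..t} r) \<partial>lborel)"
    using LIMSEQ_unique[OF l1] l2 unfolding riemann_sum_inner[OF s t] by blast
qed

end

section \<open>Covariance and Gaussianity of the bridge\<close>

definition bridge_phi :: "real \<Rightarrow> real \<Rightarrow> real" where
  "bridge_phi \<alpha> t = (1 - t) powr \<alpha>"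

text \<open>The bridge is \<open>bridge_phi\<close> times the martingale \<integral> (1 -
  r)^(-\<alpha>) dW, and this is the variance of that martingale. Kept as an integral, it treats
  \<alpha> = 1/2 like every other value.\<close>

definition bridge_tau :: "real \<Rightarrow> real \<Rightarrow> real" where
  "bridge_tau \<alpha> t = integral {0..t} (\<lambda>r. (1 - r) powr (- 2 * \<alpha>))"

lemma (in brownian) bridge_covariance:
  assumes X: "\<And>t. t \<in> {0..<1} \<Longrightarrow> wiener_integral M W (\<lambda>s. ((1 - t) / (1 - s)) powr \<alpha>) t (X t)"
    and s: "s \<in> {0..<1}" and t: "t \<in> {0..<1}"
  shows "(\<integral>\<omega>. X s \<omega> * X t \<omega> \<partial>M) = bridge_phi \<alpha> s * bridge_phi \<alpha> t * bridge_tau \<alpha> (min s t)"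
proof -
  have c: "continuous_on {0..u} (\<lambda>s. ((1 - u) / (1 - s)) powr \<alpha>)" if "u \<in> {0..<1}" for u
    using that by (intro continuous_intros) auto
  define m where "m = min s t"
  have m: "m \<in> {0..<1}" using s t by (auto simp: m_def)
  have si: "set_integrable lborel {0..m} (\<lambda>r. (1 - r) powr (- 2 * \<alpha>))"
    using m by (intro borel_integrable_atLeastAtMost' continuous_intros) auto
  have "(\<integral>\<omega>. X s \<omega> * X t \<omega> \<partial>M) = (\<integral>r. (((1 - s) / (1 - r)) powr \<alpha> * indicator {0<..s} r) * (((1 - t) / (1
    - r)) powr \<alpha> * indicator {0<..t} r) \<partial>lborel)"
    using s t by (intro wiener_isometry(1) X c) auto
  also have "\<dots> = (\<integral>r. (bridge_phi \<alpha> s * bridge_phi \<alpha> t) * (indicator {0..m} r * (1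
    - r) powr (- 2 * \<alpha>)) \<partial>lborel)"
  proof (rule integral_cong_AE)
    show "AE r in lborel. (((1 - s) / (1 - r)) powr \<alpha> * indicator {0<..s} r) * (((1 - t) / (1
      - r)) powr \<alpha> * indicator {0<..t} r) =
       (bridge_phi \<alpha> s * bridge_phi \<alpha> t) * (indicator {0..m} r * (1 - r) powr (- 2 * \<alpha>))"
      \<comment> \<open>The isometry works with left-open intervals, the variance integral with a
        closed one; they differ at r = 0 only.\<close>
      using AE_lborel_singleton[of "0::real"]
    proof eventually_elim
      case (elim r)
      show ?case
      proof (cases "r \<in> {0<..m}")
        case True
        have "(1 - r) powr (- 2 * \<alpha>) = 1 / ((1 - r) powr \<alpha> * (1 - r) powr \<alpha>)"
          by (simp add: powr_add[symmetric] powr_minus_divide[symmetric])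
        then show ?thesis using True s t m
          by (auto simp: m_def bridge_phi_def powr_divide field_simps)
      next
        case False
        then show ?thesis using elim by (auto simp: m_def indicator_def)
      qed
    qed
  qed measurable
  also have "\<dots> = (bridge_phi \<alpha> s * bridge_phi \<alpha> t) * (LINT r:{0..m}|lborel. (1 - r) powr (- 2 * \<alpha>))"
    by (simp add: set_lebesgue_integral_def)
  also have "(LINT r:{0..m}|lborel. (1 - r) powr (- 2 * \<alpha>)) = bridge_tau \<alpha> m"
    unfolding bridge_tau_def by (rule set_borel_integral_eq_integral(2)[OF si])
  finally show ?thesis by (simp add: m_def)
qed

text \<open>A finite combination of bridge values is the mean square limit of elements of
  \<open>wspan\<close>, and Gaussianity is closed under such limits.\<close>

lemma (in brownian) bridge_gaussian:
  assumes X: "\<And>t. t \<in> {0..<1} \<Longrightarrow> wiener_integral M W (\<lambda>s. ((1 - t) / (1 - s)) powr \<alpha>) t (X t)"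
    and J: "finite J" "\<And>i. i \<in> J \<Longrightarrow> u i \<in> {0..<1}"
  shows "gaussian_rv M (\<lambda>\<omega>. \<Sum>i\<in>J. c i * X (u i) \<omega>)"
proof (rule gaussian_rv_limit)
  define V where "V n \<omega> = (\<Sum>i\<in>J. c i * riemann_sum (\<lambda>s. ((1 - u i) / (1 - s)) powr \<alpha>) (u i) n \<omega>)" for n \<omega>
  show "gaussian_rv M (V n)" for n
    unfolding V_def using J by (intro wspan_gaussian wspan_sum wspan_cmult riemann_sum_wspan) auto
  show "L2_conv M V (\<lambda>\<omega>. \<Sum>i\<in>J. c i * X (u i) \<omega>)"
    unfolding V_def
  proof (intro L2_conv_sum L2_conv_cmult)
    fix i assume i: "i \<in> J"
    have c: "continuous_on {0..u i} (\<lambda>s. ((1 - u i) / (1 - s)) powr \<alpha>)"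
      using J(2)[OF i] by (intro continuous_intros) auto
    show "L2_conv M (riemann_sum (\<lambda>s. ((1 - u i) / (1 - s)) powr \<alpha>) (u i)) (X (u i))"
      using J(2)[OF i] by (intro wiener_isometry(2)[OF _ _ c c X X]) auto
  qed
qed

section \<open>The eigenvalue problem for the bridge\<close>

text \<open>The measure is given by its values on sets, so the formula is extended from indicators
  to measurable functions by the standard induction.\<close>

lemma nn_integral_mu:
  assumes "g \<in> borel_measurable borel"
  shows "(\<integral>\<^sup>+s. g s \<partial>mu a0 a1 T) = ennreal (1 / (1 - T)) * g T +
    (\<integral>\<^sup>+s. g s * (ennreal ((a0 + a1 - 1) / (1 - s)\<^sup>2) * indicator {0..T} s) \<partial>lborel)"
  using assms
proof (induction g rule: borel_measurable_induct)
  case (cong f g)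
  then have "f = g" by auto
  then show ?case using cong by simp
next
  case (set A)
  have "(\<integral>\<^sup>+s. indicator A s * (ennreal ((a0 + a1 - 1) / (1 - s)\<^sup>2) * indicator {0..T} s) \<partial>lborel)
     = (\<integral>\<^sup>+s. ennreal ((a0 + a1 - 1) / (1 - s)\<^sup>2) * indicator (A \<inter> {0..T}) s \<partial>lborel)"
    by (intro nn_integral_cong) (auto simp: indicator_def)
  then show ?case using set by (simp add: emeasure_mu)
next
  case (mult u c)
  note [measurable] = mult(2)
  have "(\<integral>\<^sup>+s. c * u s * (ennreal ((a0 + a1 - 1) / (1 - s)\<^sup>2) * indicator {0..T} s) \<partial>lborel)
    = c * (\<integral>\<^sup>+s. u s * (ennreal ((a0 + a1 - 1) / (1 - s)\<^sup>2) * indicator {0..T} s) \<partial>lborel)"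
    by (subst nn_integral_cmult[symmetric]) (auto simp: mult.assoc)
  moreover have "(\<integral>\<^sup>+s. c * u s \<partial>mu a0 a1 T) = c * (\<integral>\<^sup>+s. u s \<partial>mu a0 a1 T)"
    by (rule nn_integral_cmult) measurable
  ultimately show ?case using mult by (simp add: distrib_left mult_ac)
next
  case (add u v)
  note [measurable] = add(1,3)
  have "(\<integral>\<^sup>+s. (v s + u s) * (ennreal ((a0 + a1 - 1) / (1 - s)\<^sup>2) * indicator {0..T} s) \<partial>lborel)
    = (\<integral>\<^sup>+s. v s * (ennreal ((a0 + a1 - 1) / (1 - s)\<^sup>2) * indicator {0..T} s) \<partial>lborel)
    + (\<integral>\<^sup>+s. u s * (ennreal ((a0 + a1 - 1) / (1 - s)\<^sup>2) * indicator {0..T} s) \<partial>lborel)"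
    by (subst nn_integral_add[symmetric]) (auto simp: distrib_right)
  moreover have "(\<integral>\<^sup>+s. v s + u s \<partial>mu a0 a1 T) = (\<integral>\<^sup>+s. v s \<partial>mu a0 a1 T) + (\<integral>\<^sup>+s. u s \<partial>mu a0 a1 T)"
    by (rule nn_integral_add) measurable
  ultimately show ?case using add by (simp add: distrib_left algebra_simps)
next
  case (seq U)
  note [measurable] = seq(1)
  let ?w = "\<lambda>s. ennreal ((a0 + a1 - 1) / (1 - s)\<^sup>2) * indicator {0..T} s"
  have inc: "incseq (\<lambda>i s. U i s * ?w s)"
    using seq(3) by (auto simp: incseq_def le_fun_def intro!: mult_right_mono)
  have incT: "incseq (\<lambda>i. U i T)" using seq(3) by (auto simp: incseq_def le_fun_def)
  have inci: "incseq (\<lambda>i. \<integral>\<^sup>+s. U i s * ?w s \<partial>lborel)"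
    using inc by (auto simp: incseq_def le_fun_def intro!: nn_integral_mono)
  have e: "(SUP i. U i) s = (SUP i. U i s)" for s by (rule SUP_apply)
  have "(\<integral>\<^sup>+s. (SUP i. U i) s * ?w s \<partial>lborel) = (\<integral>\<^sup>+s. (SUP i. U i s * ?w s) \<partial>lborel)"
    unfolding e by (simp only: SUP_mult_right_ennreal)
  also have "\<dots> = (SUP i. \<integral>\<^sup>+s. U i s * ?w s \<partial>lborel)"
    by (rule nn_integral_monotone_convergence_SUP[OF inc]) measurable
  finally have 1: "(\<integral>\<^sup>+s. (SUP i. U i) s * ?w s \<partial>lborel) = (SUP i. \<integral>\<^sup>+s. U i s * ?w s \<partial>lborel)" .
  have "(\<integral>\<^sup>+s. (SUP i. U i) s \<partial>mu a0 a1 T) = (SUP i. \<integral>\<^sup>+s. U i s \<partial>mu a0 a1 T)"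
    unfolding e by (rule nn_integral_monotone_convergence_SUP[OF seq(3)]) measurable
  also have "\<dots> = (SUP i. ennreal (1 / (1 - T)) * U i T + (\<integral>\<^sup>+s. U i s * ?w s \<partial>lborel))"
    using seq.IH by simp
  also have "\<dots> = (SUP i. ennreal (1 / (1 - T)) * U i T) + (SUP i. \<integral>\<^sup>+s. U i s * ?w s \<partial>lborel)"
    using incT by (intro ennreal_SUP_add inci) (auto simp: incseq_def intro!: mult_left_mono)
  also have "(SUP i. ennreal (1 / (1 - T)) * U i T) = ennreal (1 / (1 - T)) * (SUP i. U i T)"
    by (simp only: SUP_mult_left_ennreal)
  finally show ?case unfolding seq(5) by (simp only: e 1[unfolded e])
qed

section \<open>The measure, the kernel and its continuation\<close>

locale bridge_setup =
  fixes a0 a1 T :: real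
  assumes p_pos: "1 < a0 + a1" and T0: "0 \<le> T" and T1: "T < 1"
begin

definition b0 :: real where "b0 = a0 - 1/2"
definition b1 :: real where "b1 = a1 - 1/2"
definition p :: real where "p = a0 + a1 - 1"
definition L :: real where "L = - ln (1 - T)"

lemma p: "0 < p" "p = b0 + b1" using p_pos by (auto simp: p_def b0_def b1_def)

lemma w_cont: "continuous_on {0..T} (\<lambda>s. p / (1 - s)\<^sup>2)"
  using T1 by (intro continuous_intros) auto

text \<open>For nonnegative f the Bochner integral can be read off the nonnegative one; the signed
  case follows by splitting into positive and negative parts.\<close>

lemma has_integral_mu_nonneg:
  assumes f: "continuous_on {0..T} f" and m[measurable]: "f \<in> borel_measurable borel" and nn: "\<And>s. 0 \<le> f s"
  shows "has_bochner_integral (mu a0 a1 T) f (f T / (1 - T) + integral {0..T} (\<lambda>s. f s * (p / (1 - s)\<^sup>2)))"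
proof (rule has_bochner_integral_nn_integral)
  show "f \<in> borel_measurable (mu a0 a1 T)" by measurable
  have si: "set_integrable lborel {0..T} (\<lambda>s. f s * (p / (1 - s)\<^sup>2))"
    by (intro borel_integrable_atLeastAtMost' continuous_on_mult f w_cont)
  have wn: "0 \<le> p / (1 - s)\<^sup>2" for s using p by simp
  have I: "(LINT s:{0..T}|lborel. f s * (p / (1 - s)\<^sup>2)) = integral {0..T} (\<lambda>s. f s * (p / (1 - s)\<^sup>2))"
    by (rule set_borel_integral_eq_integral(2)[OF si])
  have Wn: "0 \<le> indicator {0..T} s *\<^sub>R (f s * (p / (1 - s)\<^sup>2))" for s
    using mult_nonneg_nonneg[OF nn wn] by (intro scaleR_nonneg_nonneg) auto
  have I0: "0 \<le> integral {0..T} (\<lambda>s. f s * (p / (1 - s)\<^sup>2))"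
    unfolding I[symmetric] set_lebesgue_integral_def by (rule Bochner_Integration.integral_nonneg) (rule Wn)
  have "(\<integral>\<^sup>+s. ennreal (f s) * (ennreal (p / (1 - s)\<^sup>2) * indicator {0..T} s) \<partial>lborel)
     = (\<integral>\<^sup>+s. ennreal (indicator {0..T} s *\<^sub>R (f s * (p / (1 - s)\<^sup>2))) \<partial>lborel)"
  proof (rule nn_integral_cong)
    fix s show "ennreal (f s) * (ennreal (p / (1 - s)\<^sup>2) * indicator {0..T} s)
      = ennreal (indicator {0..T} s *\<^sub>R (f s * (p / (1 - s)\<^sup>2)))"
    proof (cases "s \<in> {0..T}")
      case True
      then show ?thesis by (simp only: indicator_simps scaleR_one mult_1_right ennreal_mult[OF nn wn])
    next
      case False
      then show ?thesis by (auto simp: indicator_def)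
    qed
  qed
  also have "\<dots> = ennreal (LINT s:{0..T}|lborel. f s * (p / (1 - s)\<^sup>2))"
    unfolding set_lebesgue_integral_def
  proof (rule nn_integral_eq_integral)
    show "integrable lborel (\<lambda>s. indicator {0..T} s *\<^sub>R (f s * (p / (1 - s)\<^sup>2)))"
      using si unfolding set_integrable_def .
    show "AE s in lborel. 0 \<le> indicator {0..T} s *\<^sub>R (f s * (p / (1 - s)\<^sup>2))" by (intro AE_I2 Wn)
  qed
  finally have J: "(\<integral>\<^sup>+s. ennreal (f s) * (ennreal (p / (1 - s)\<^sup>2) * indicator {0..T} s) \<partial>lborel)
    = ennreal (LINT s:{0..T}|lborel. f s * (p / (1 - s)\<^sup>2))" .
  have "(\<integral>\<^sup>+s. ennreal (f s) \<partial>mu a0 a1 T) = ennreal (1 / (1 - T)) * ennreal (f T)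
    + (\<integral>\<^sup>+s. ennreal (f s) * (ennreal (p / (1 - s)\<^sup>2) * indicator {0..T} s) \<partial>lborel)"
    unfolding p_def by (rule nn_integral_mu) measurable
  also have "\<dots> = ennreal (1 / (1 - T)) * ennreal (f T) + ennreal (integral {0..T} (\<lambda>s. f s * (p / (1 - s)\<^sup>2)))"
    unfolding J I ..
  also have "\<dots> = ennreal (f T / (1 - T) + integral {0..T} (\<lambda>s. f s * (p / (1 - s)\<^sup>2)))"
    using nn[of T] T1 I0 by (simp add: ennreal_mult[symmetric] ennreal_plus[symmetric] del: ennreal_plus)
  finally show "(\<integral>\<^sup>+s. ennreal (f s) \<partial>mu a0 a1 T)
    = ennreal (f T / (1 - T) + integral {0..T} (\<lambda>s. f s * (p / (1 - s)\<^sup>2)))" .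
  show "0 \<le> f T / (1 - T) + integral {0..T} (\<lambda>s. f s * (p / (1 - s)\<^sup>2))"
    using I0 nn[of T] T1 by simp
  show "AE s in mu a0 a1 T. 0 \<le> f s" using nn by simp
qed

lemma integral_mu:
  assumes f: "continuous_on {0..T} f" and m[measurable]: "f \<in> borel_measurable borel"
  shows "(\<integral>s. f s \<partial>mu a0 a1 T) = f T / (1 - T) + integral {0..T} (\<lambda>s. f s * (p / (1 - s)\<^sup>2))"
proof -
  define g where "g s = max 0 (f s)" for s
  define h where "h s = max 0 (- f s)" for s
  have fgh: "f s = g s - h s" for s by (auto simp: g_def h_def max_def)
  have cg: "continuous_on {0..T} g" "continuous_on {0..T} h" unfolding g_def h_def
    by (intro continuous_intros f)+
  have m: "g \<in> borel_measurable borel" "h \<in> borel_measurable borel" unfolding g_def h_def by measurable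
  have G: "has_bochner_integral (mu a0 a1 T) g (g T / (1 - T) + integral {0..T} (\<lambda>s. g s * (p / (1 - s)\<^sup>2)))"
    by (rule has_integral_mu_nonneg[OF cg(1) m(1)]) (simp add: g_def)
  have H: "has_bochner_integral (mu a0 a1 T) h (h T / (1 - T) + integral {0..T} (\<lambda>s. h s * (p / (1 - s)\<^sup>2)))"
    by (rule has_integral_mu_nonneg[OF cg(2) m(2)]) (simp add: h_def)
  have "(\<integral>s. f s \<partial>mu a0 a1 T) = (g T / (1 - T)
    + integral {0..T} (\<lambda>s. g s * (p / (1 - s)\<^sup>2))) - (h T / (1 - T)
    + integral {0..T} (\<lambda>s. h s * (p / (1 - s)\<^sup>2)))"
    unfolding fgh using has_bochner_integral_diff[OF G H] by (rule has_bochner_integral_integral_eq)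
  also have "integral {0..T} (\<lambda>s. g s * (p / (1 - s)\<^sup>2)) - integral {0..T} (\<lambda>s. h s * (p / (1 - s)\<^sup>2))
    = integral {0..T} (\<lambda>s. g s * (p / (1 - s)\<^sup>2) - h s * (p / (1 - s)\<^sup>2))"
    by (intro Henstock_Kurzweil_Integration.integral_diff[symmetric] integrable_continuous_real
      continuous_on_mult cg w_cont)
  ultimately have "(\<integral>s. f s \<partial>mu a0 a1 T) = (g T / (1 - T) - h T / (1 - T))
    + integral {0..T} (\<lambda>s. g s * (p / (1 - s)\<^sup>2) - h s * (p / (1 - s)\<^sup>2))"
    by simp
  then show ?thesis unfolding fgh by (simp add: diff_divide_distrib left_diff_distrib)
qed

lemma finite_measure_mu: "finite_measure (mu a0 a1 T)"
proof (rule finite_measureI)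
  have "has_bochner_integral (mu a0 a1 T) (\<lambda>_. 1) (1 / (1 - T) + integral {0..T} (\<lambda>s. 1 * (p / (1 - s)\<^sup>2)))"
    by (rule has_integral_mu_nonneg) auto
  then have "integrable (mu a0 a1 T) (\<lambda>_. 1 :: real)" by (rule integrable.intros)
  then have "(\<integral>\<^sup>+s. ennreal (norm (1::real)) \<partial>mu a0 a1 T) < \<infinity>" unfolding integrable_iff_bounded by blast
  then show "emeasure (mu a0 a1 T) (space (mu a0 a1 T)) \<noteq> \<infinity>" by simp
qed

lemma AE_mu: "AE s in mu a0 a1 T. s \<in> {0..T}"
proof (rule AE_I[where N = "- {0..T}"])
  have "emeasure (mu a0 a1 T) (- {0..T}) = 0"
    using T0 by (subst emeasure_mu) (auto simp: indicator_def)
  then show "emeasure (mu a0 a1 T) (- {0..T}) = 0" .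
qed auto

text \<open>The square integral is a sum of two nonnegative terms. For T > 0 the positive continuous
  density forces f to vanish throughout; for T = 0 only the point mass is left, and it sits on the
  whole interval.\<close>

lemma mu_full_support:
  assumes f: "continuous_on UNIV f" and ae: "AE s in mu a0 a1 T. f s = (0::real)" and s: "s \<in> {0..T}"
  shows "f s = 0"
proof -
  have fT: "continuous_on {0..T} f" by (rule continuous_on_subset[OF f]) simp
  have [measurable]: "f \<in> borel_measurable borel" using f by (rule borel_measurable_continuous_onI)
  have "(\<integral>s. (f s)\<^sup>2 \<partial>mu a0 a1 T) = (\<integral>s. 0 \<partial>mu a0 a1 T)"
    using ae by (intro integral_cong_AE) auto
  then have eq: "(f T)\<^sup>2 / (1 - T) + integral {0..T} (\<lambda>s. (f s)\<^sup>2 * (p / (1 - s)\<^sup>2)) = 0"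
    by (subst (asm) integral_mu) (auto intro!: continuous_intros fT)
  have c: "continuous_on {0..T} (\<lambda>s. (f s)\<^sup>2 * (p / (1 - s)\<^sup>2))"
    by (intro continuous_on_mult continuous_on_power fT w_cont)
  have nn: "0 \<le> (f s)\<^sup>2 * (p / (1 - s)\<^sup>2)" for s using p by simp
  have "0 \<le> integral {0..T} (\<lambda>s. (f s)\<^sup>2 * (p / (1 - s)\<^sup>2))"
    using nn by (intro integral_nonneg integrable_continuous_real c) auto
  moreover have "0 \<le> (f T)\<^sup>2 / (1 - T)" using T1 by simp
  ultimately have z: "(f T)\<^sup>2 / (1 - T) = 0" "integral {0..T} (\<lambda>s. (f s)\<^sup>2 * (p / (1 - s)\<^sup>2)) = 0" using eq
    by linarith+
  show ?thesis
  proof (cases "T = 0")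
    case True
    then show ?thesis using z(1) s T1 by simp
  next
    case False
    then have "0 < T" using T0 by simp
    then have "\<forall>x\<in>{0..T}. (f x)\<^sup>2 * (p / (1 - x)\<^sup>2) = 0"
      using integral_eq_0_iff[OF c] nn z(2) by auto
    then have "(f s)\<^sup>2 * (p / (1 - s)\<^sup>2) = 0" using s by blast
    then show ?thesis using p s T1 by auto
  qed
qed

text \<open>Constant continuation outside \<open>[0,T]\<close> makes the kernel continuous and bounded on the whole plane.\<close>
definition clamp :: "real \<Rightarrow> real" where "clamp t = max 0 (min T t)"

lemma clamp: "clamp t \<in> {0..T}" "t \<in> {0..T} \<Longrightarrow> clamp t = t" "clamp (clamp t) = clamp t"
  using T0 by (auto simp: clamp_def)

lemma clamp_cont: "continuous_on S clamp"
  unfolding clamp_def by (intro continuous_intros)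

lemma cont_clamp: "continuous_on {0..T} f \<Longrightarrow> continuous_on UNIV (\<lambda>t. f (clamp t))"
  by (rule continuous_on_compose2[OF _ clamp_cont]) (use clamp in auto)

abbreviation phi :: "real \<Rightarrow> real" where "phi \<equiv> bridge_phi a0"
abbreviation tau :: "real \<Rightarrow> real" where "tau \<equiv> bridge_tau a0"

definition kern :: "real \<Rightarrow> real \<Rightarrow> real" where
  "kern s t = phi (clamp s) * phi (clamp t) * tau (min (clamp s) (clamp t))"

lemma powr_cont: "continuous_on {0..T} (\<lambda>t. (1 - t) powr b)"
  using T1 by (intro continuous_intros) auto

lemma phi_cont: "continuous_on {0..T} phi"
  unfolding bridge_phi_def[abs_def] by (rule powr_cont)

lemma tau_deriv:
  assumes "t \<in> {0..T}"
  shows "(tau has_real_derivative (1 - t) powr (- 2 * a0)) (at t within {0..T})"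
  unfolding bridge_tau_def[abs_def]
  by (rule integral_has_real_derivative[OF powr_cont assms])

lemma tau_0: "tau 0 = 0" by (simp add: bridge_tau_def)

lemma tau_cont: "continuous_on {0..T} tau"
  using tau_deriv by (meson DERIV_continuous_on)

lemma kern_cont: "continuous_on UNIV (\<lambda>(s, t). kern s t)"
proof -
  have m: "continuous_on UNIV (\<lambda>x. tau (min (clamp (fst x)) (clamp (snd x))))"
    by (rule continuous_on_compose2[OF tau_cont])
       (use clamp(1) in \<open>auto intro!: continuous_on_min continuous_on_compose2[OF clamp_cont[of UNIV]]
         continuous_on_fst continuous_on_snd continuous_on_id simp: min_le_iff_disj\<close>)
  have "continuous_on UNIV (\<lambda>x. phi (clamp (fst x)))" "continuous_on UNIV (\<lambda>x. phi (clamp (snd x)))"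
    by (rule continuous_on_compose2[OF phi_cont]; use clamp in \<open>auto intro!: continuous_intros
      continuous_on_compose2[OF clamp_cont]\<close>)+
  then show ?thesis unfolding kern_def case_prod_beta' by (intro continuous_on_mult m)
qed

lemma kern_bdd: "\<exists>B. \<forall>s t. \<bar>kern s t\<bar> \<le> B"
proof -
  have "compact ((\<lambda>(s, t). kern s t) ` ({0..T} \<times> {0..T}))"
    by (intro compact_continuous_image continuous_on_subset[OF kern_cont] compact_Times) auto
  from compact_imp_bounded[OF this] obtain B where B: "\<forall>x\<in>(\<lambda>(s, t). kern s t) ` ({0..T} \<times> {0..T}). norm x \<le> B"
    unfolding bounded_iff by metis
  have "\<bar>kern s t\<bar> \<le> B" for s t
  proof -
    have "kern s t = kern (clamp s) (clamp t)" by (simp add: kern_def clamp(3))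
    moreover have "kern (clamp s) (clamp t) \<in> (\<lambda>(s, t). kern s t) ` ({0..T} \<times> {0..T})"
      using clamp(1)[of s] clamp(1)[of t] by force
    ultimately show ?thesis using B by (metis real_norm_def)
  qed
  then show ?thesis by blast
qed

text \<open>A locale parameter has to be a fixed term, so a bound is chosen once among those that
  compactness provides.\<close>

definition Bd :: real where "Bd = (SOME B. \<forall>s t. \<bar>kern s t\<bar> \<le> B)"

lemma kern_sym: "kern s t = kern t s" by (simp add: kern_def min.commute mult_ac)

sublocale mercer_kernel "mu a0 a1 T" T Bd kern
proof -
  interpret finite_measure "mu a0 a1 T" by (rule finite_measure_mu)
  have Bd: "\<bar>kern s t\<bar> \<le> Bd" for s t unfolding Bd_def using someI_ex[OF kern_bdd] by blast
  show "mercer_kernel (mu a0 a1 T) T Bd kern"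
    by unfold_locales (rule T0 sets_mu AE_mu mu_full_support kern_cont kern_sym Bd; assumption?)+
qed

end

text \<open>The solutions of \<open>y'' = - \<kappa> y\<close> with initial values \<open>(0, 1)\<close> and \<open>(1, 0)\<close>, for \<open>\<kappa>\<close> of either sign.\<close>
definition gsin :: "real \<Rightarrow> real \<Rightarrow> real" where
  "gsin \<kappa> u = (if 0 < \<kappa> then sin (sqrt \<kappa> * u) / sqrt \<kappa> else if \<kappa> = 0 then u
     else sinh (sqrt (- \<kappa>) * u) / sqrt (- \<kappa>))"

definition gcos :: "real \<Rightarrow> real \<Rightarrow> real" where
  "gcos \<kappa> u = (if 0 < \<kappa> then cos (sqrt \<kappa> * u) else if \<kappa> = 0 then 1 else cosh (sqrt (- \<kappa>) * u))"

lemma gsin_0 [simp]: "gsin \<kappa> 0 = 0" and gcos_0 [simp]: "gcos \<kappa> 0 = 1"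
  by (auto simp: gsin_def gcos_def)

lemma gsin_deriv: "(gsin \<kappa> has_real_derivative gcos \<kappa> u) (at u within S)"
proof -
  consider "0 < \<kappa>" | "\<kappa> = 0" | "\<kappa> < 0" by linarith
  then show ?thesis
  proof cases
    case 1
    have "((\<lambda>u. sin (sqrt \<kappa> * u) / sqrt \<kappa>) has_real_derivative cos (sqrt \<kappa> * u)
      * sqrt \<kappa> / sqrt \<kappa>) (at u within S)"
      by (intro DERIV_cdivide) (auto intro!: derivative_eq_intros)
    then show ?thesis unfolding gsin_def[abs_def] gcos_def using 1 by simp
  next
    case 2
    then show ?thesis unfolding gsin_def[abs_def] gcos_def by (auto intro!: derivative_eq_intros)
  next
    case 3
    have "((\<lambda>u. sinh (sqrt (- \<kappa>) * u) / sqrt (- \<kappa>)) has_real_derivative cosh (sqrt (- \<kappa>) * u)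
      * sqrt (- \<kappa>) / sqrt (- \<kappa>)) (at u within S)"
      by (intro DERIV_cdivide) (auto intro!: derivative_eq_intros)
    then show ?thesis unfolding gsin_def[abs_def] gcos_def using 3 by simp
  qed
qed

lemma gcos_deriv: "(gcos \<kappa> has_real_derivative - \<kappa> * gsin \<kappa> u) (at u within S)"
proof -
  consider "0 < \<kappa>" | "\<kappa> = 0" | "\<kappa> < 0" by linarith
  then show ?thesis
  proof cases
    case 1
    define r where "r = sqrt \<kappa>"
    have r: "0 < r" "\<kappa> = r * r" using 1 by (auto simp: r_def)
    have "((\<lambda>u. cos (r * u)) has_real_derivative - sin (r * u) * r) (at u within S)"
      by (auto intro!: derivative_eq_intros)
    moreover have "- \<kappa> * gsin \<kappa> u = - sin (r * u) * r"
      using 1 r(1) unfolding gsin_def r_def[symmetric] by (simp add: r(2))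
    ultimately show ?thesis unfolding gcos_def[abs_def] r_def[symmetric] using 1 by simp
  next
    case 2
    then show ?thesis unfolding gcos_def[abs_def] by (auto intro!: derivative_eq_intros)
  next
    case 3
    define r where "r = sqrt (- \<kappa>)"
    have r: "0 < r" "- \<kappa> = r * r" using 3 by (auto simp: r_def)
    have "((\<lambda>u. cosh (r * u)) has_real_derivative sinh (r * u) * r) (at u within S)"
      by (auto intro!: derivative_eq_intros)
    moreover have "- \<kappa> * gsin \<kappa> u = sinh (r * u) * r"
    proof -
      have "gsin \<kappa> u = sinh (r * u) / r" using 3 by (simp add: gsin_def r_def)
      then show ?thesis using r(1) unfolding r(2) by simp
    qed
    ultimately show ?thesis unfolding gcos_def[abs_def] r_def[symmetric] using 3 by simp
  qed
qed

text \<open>The energy integral of y'' = - \<kappa> y. It is what inverts the pair of constants of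
  motion in \<open>eigen_forward\<close> and so replaces a uniqueness theorem for the
  equation.\<close>

lemma gcos_gsin: "(gcos \<kappa> u)\<^sup>2 + \<kappa> * (gsin \<kappa> u)\<^sup>2 = 1"
proof -
  consider "0 < \<kappa>" | "\<kappa> = 0" | "\<kappa> < 0" by linarith
  then show ?thesis
  proof cases
    case 3
    then show ?thesis
      using hyperbolic_pythagoras[of "sqrt (- \<kappa>) * u"]
      by (simp add: gsin_def gcos_def power_divide)
  qed (auto simp: gsin_def gcos_def power_divide)
qed

lemma powr_one_minus_deriv:
  assumes "t < (1::real)"
  shows "((\<lambda>t. (1 - t) powr b) has_real_derivative - b * (1 - t) powr b / (1 - t)) (at t within S)"
proof -
  have "((\<lambda>t. (1 - t) powr b) has_real_derivative b * (1 - t) powr (b - 1) * (0 - 1)) (at t within S)"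
  proof (rule has_field_derivative_at_within)
    have "((\<lambda>t. (1 - t) powr b) has_real_derivative b * (1 - t) powr (b - of_nat 1) * (0 - 1)) (at t)"
      using assms by (intro DERIV_fun_powr DERIV_diff DERIV_const DERIV_ident) auto
    then show "((\<lambda>t. (1 - t) powr b) has_real_derivative b * (1 - t) powr (b - 1) * (0 - 1)) (at t)" by simp
  qed
  moreover have "(1 - t) powr (b - 1) = (1 - t) powr b / (1 - t)"
    using assms by (simp add: powr_diff)
  ultimately show ?thesis by simp
qed

section \<open>The eigenvalue equation as a boundary value problem\<close>

context bridge_setup
begin

definition u :: "real \<Rightarrow> real" where "u t = - ln (1 - t)"

lemma u_deriv: "t < 1 \<Longrightarrow> (u has_real_derivative 1 / (1 - t)) (at t within S)"
  unfolding u_def[abs_def] by (auto intro!: derivative_eq_intros)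

lemma u_0 [simp]: "u 0 = 0" and u_T: "u T = L" by (simp_all add: u_def L_def)

lemma gsin_u_deriv:
  assumes "t < 1" shows "((\<lambda>t. gsin \<kappa> (u t)) has_real_derivative gcos \<kappa> (u t) / (1 - t)) (at t within S)"
  using DERIV_chain2[OF gsin_deriv u_deriv[OF assms], of \<kappa> S] by simp

lemma gcos_u_deriv:
  assumes "t < 1" shows "((\<lambda>t. gcos \<kappa> (u t)) has_real_derivative - \<kappa> * gsin \<kappa> (u t) / (1 - t)) (at t within S)"
  using DERIV_chain2[OF gcos_deriv u_deriv[OF assms], of \<kappa> S] by simp

definition dens :: "(real \<Rightarrow> real) \<Rightarrow> real \<Rightarrow> real" where
  "dens f s = phi s * f s * (p / (1 - s)\<^sup>2)"

lemma dens_cont: "continuous_on {0..T} f \<Longrightarrow> continuous_on {0..T} (dens f)"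
  unfolding dens_def[abs_def] by (intro continuous_on_mult phi_cont w_cont)

text \<open>The minimum in the kernel switches at s = t, so the integral is cut there. The point
  mass lies to the right of t, or at t, and joins the second piece.\<close>

lemma A_formula:
  assumes f: "continuous_on {0..T} f" and m[measurable]: "f \<in> borel_measurable borel" and t: "t \<in> {0..T}"
  shows "A f t = phi t * (integral {0..t} (\<lambda>s. tau s * dens f s) +
     tau t * (integral {t..T} (dens f) + phi T * f T / (1 - T)))"
proof -
  have kc: "continuous_on {0..T} (\<lambda>s. kern t s * f s)"
    by (intro continuous_on_mult f continuous_on_subset[OF K_cont2]) simp
  have c1: "continuous_on {0..t} (\<lambda>s. tau s * dens f s)" "continuous_on {t..T} (dens f)"
    using t by (auto intro!: continuous_on_mult continuous_on_subset[OF tau_cont] continuous_on_subset[OF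
      dens_cont[OF f]])
  have "A f t = kern t T * f T / (1 - T) + integral {0..T} (\<lambda>s. kern t s * f s * (p / (1 - s)\<^sup>2))"
    unfolding A_def by (rule integral_mu[OF kc]) measurable
  also have "kern t T = phi t * phi T * tau t"
    using t T0 clamp(2)[of t] clamp(2)[of T] by (simp add: kern_def min_absorb1)
  also have "integral {0..T} (\<lambda>s. kern t s * f s * (p / (1 - s)\<^sup>2)) =
     integral {0..t} (\<lambda>s. kern t s * f s * (p / (1 - s)\<^sup>2))
       + integral {t..T} (\<lambda>s. kern t s * f s * (p / (1 - s)\<^sup>2))"
    using t by (intro Henstock_Kurzweil_Integration.integral_combine[symmetric] integrable_continuous_real
      continuous_on_mult kc w_cont) auto
  also have "integral {0..t} (\<lambda>s. kern t s * f s * (p / (1 - s)\<^sup>2))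
    = integral {0..t} (\<lambda>s. phi t * (tau s * dens f s))"
    using t clamp(2) by (intro Henstock_Kurzweil_Integration.integral_cong) (auto simp: kern_def dens_def
      min_absorb2)
  also have "\<dots> = phi t * integral {0..t} (\<lambda>s. tau s * dens f s)"
    by (rule Henstock_Kurzweil_Integration.integral_mult_right)
  also have "integral {t..T} (\<lambda>s. kern t s * f s * (p / (1 - s)\<^sup>2))
    = integral {t..T} (\<lambda>s. (phi t * tau t) * dens f s)"
    using t clamp(2) by (intro Henstock_Kurzweil_Integration.integral_cong) (auto simp: kern_def dens_def
      min_absorb1)
  also have "\<dots> = (phi t * tau t) * integral {t..T} (dens f)"
    by (rule Henstock_Kurzweil_Integration.integral_mult_right)
  finally show ?thesis by (simp add: algebra_simps)
qed

text \<open>The defect in the boundary condition at L of the solution with y(0) = 0 and y'(0) =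
  1.\<close>

definition charfun :: "real \<Rightarrow> real" where
  "charfun \<kappa> = (\<kappa> - b0 * b1) * gsin \<kappa> L - p * gcos \<kappa> L"

definition efun :: "real \<Rightarrow> real \<Rightarrow> real" where
  "efun \<kappa> t = sqrt (1 - t) * gsin \<kappa> (u t)"

lemma phi_eq: "t < 1 \<Longrightarrow> phi t = (1 - t) powr b0 * sqrt (1 - t)"
  unfolding bridge_phi_def b0_def by (simp add: powr_half_sqrt[symmetric] powr_add[symmetric])

lemma tau'_eq: "t < 1 \<Longrightarrow> (1 - t) powr (- 2 * a0) = 1 / ((1 - t) powr b0 * (1 - t) powr b0 * (1 - t))"
proof -
  assume t: "t < 1"
  have "(1 - t) powr b0 * (1 - t) powr b0 * (1 - t) = (1 - t) powr (2 * a0)"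
    using t powr_add[of "1 - t" "b0 + b0" 1] powr_add[of "1 - t" b0 b0] by (simp add: b0_def)
  then show ?thesis by (simp add: powr_minus_divide)
qed

text \<open>The equation \<open>A f\<close> = l f itself supplies the smoothness of f, since the
  right-hand side of \<open>A_formula\<close> is built from integrals. Differentiation gives a
  linear first-order system in the variable \<open>u\<close>, whose solutions are identified by two
  constants of motion; the boundary condition appears on evaluating at T.\<close>

lemma eigen_forward:
  assumes f: "continuous_on {0..T} f" and m: "f \<in> borel_measurable borel"
    and l: "l \<noteq> 0" and eig: "\<And>t. t \<in> {0..T} \<Longrightarrow> A f t = l * f t"
  defines "\<kappa> \<equiv> p / l - b0\<^sup>2"
  obtains c where "\<And>t. t \<in> {0..T} \<Longrightarrow> f t = c * efun \<kappa> t" "c = 0 \<or> charfun \<kappa> = 0"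
proof -
  define I1 where "I1 t = integral {0..t} (\<lambda>s. tau s * dens f s)" for t
  define Kf where "Kf t = integral {t..T} (dens f) + phi T * f T / (1 - T)" for t
  define P where "P t = (1 - t) powr b0" for t
  define h where "h t = (I1 t + tau t * Kf t) / l" for t
  define g where "g t = P t * h t" for t
  \<comment> \<open>This is the rescaled tail integral including the point mass. With it,
    \<open>gd\<close> below is the derivative of g with respect to \<open>u\<close>: the derivative
    of \<open>tau\<close> leaves a multiple of the tail, and the power (1 - t)^b0 contributes - b0
    g.\<close>
  define k where "k t = (1 - t) powr (- b0) * Kf t / l" for t
  define gd where "gd t = k t - b0 * g t" for t
  have lt1: "t < 1" if "t \<in> {0..T}" for t using that T1 by auto
  have Pp: "0 < P t" if "t \<in> {0..T}" for t using lt1[OF that] by (simp add: P_def)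
  have dI1: "(I1 has_real_derivative tau t * dens f t) (at t within {0..T})" if "t \<in> {0..T}" for t
    unfolding I1_def by (rule integral_has_real_derivative[OF _ that]) (intro continuous_on_mult tau_cont
      dens_cont f)
  have dKf: "(Kf has_real_derivative - dens f t) (at t within {0..T})" if t: "t \<in> {0..T}" for t
  proof -
    have d: "((\<lambda>t. integral {0..T} (dens f) - integral {0..t} (dens f)
      + phi T * f T / (1 - T)) has_real_derivative 0 - dens f t + 0) (at t within {0..T})"
      by (intro DERIV_add DERIV_diff DERIV_const integral_has_real_derivative[OF dens_cont[OF f] t])
    have eq: "integral {0..T} (dens f) - integral {0..t} (dens f) + phi T * f T / (1 - T) = Kf t"
      if "t \<in> {0..T}" for t
    proof -
      have "integral {0..t} (dens f) + integral {t..T} (dens f) = integral {0..T} (dens f)"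
        using that by (intro Henstock_Kurzweil_Integration.integral_combine integrable_continuous_real
          dens_cont f) auto
      then show ?thesis by (simp add: Kf_def)
    qed
    have "(Kf has_real_derivative 0 - dens f t + 0) (at t within {0..T})"
      by (rule has_field_derivative_transform_within[OF d zero_less_one t eq])
    then show ?thesis by simp
  qed
  have fg: "f t = sqrt (1 - t) * g t" if t: "t \<in> {0..T}" for t
  proof -
    have "l * f t = phi t * (I1 t + tau t * Kf t)"
      using eig[OF t] A_formula[OF f m t] by (simp add: I1_def Kf_def)
    then have "f t = phi t * h t" using l by (simp add: h_def field_simps)
    then show ?thesis using phi_eq[OF lt1[OF t]] by (simp add: g_def P_def)
  qed
  have dh: "(h has_real_derivative (1 - t) powr (- 2 * a0) * Kf t / l) (at t within {0..T})" if t: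
    "t \<in> {0..T}" for t
  proof -
    have "((\<lambda>t. (I1 t + tau t * Kf t) / l) has_real_derivative
       (tau t * dens f t + ((1 - t) powr (- 2 * a0) * Kf t + - dens f t * tau t)) / l) (at t within {0..T})"
      by (intro DERIV_cdivide DERIV_add DERIV_mult dI1 tau_deriv dKf t)
    then show ?thesis unfolding h_def[abs_def] by simp
  qed
  have dg: "(g has_real_derivative gd t / (1 - t)) (at t within {0..T})" if t: "t \<in> {0..T}" for t
  proof -
    have y: "0 < 1 - t" using lt1[OF t] by simp
    have "((\<lambda>t. P t * h t) has_real_derivative - b0 * P t / (1 - t) * h t
      + (1 - t) powr (- 2 * a0) * Kf t / l * P t) (at t within {0..T})"
      unfolding P_def by (intro DERIV_mult powr_one_minus_deriv lt1 dh t)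
    moreover have "- b0 * P t / (1 - t) * h t + (1 - t) powr (- 2 * a0) * Kf t / l * P t = gd t / (1 - t)"
    proof -
      have "- b0 * P t / y * h t + 1 / (P t * P t * y) * Kf t / l * P t
        = (1 / P t * Kf t / l - b0 * (P t * h t)) / y" if "0 < y" for y
        using that Pp[OF t] l by (simp add: field_simps)
      then show ?thesis using y unfolding tau'_eq[OF lt1[OF t]] gd_def g_def k_def powr_minus_divide
        P_def[symmetric] by simp
    qed
    ultimately show ?thesis unfolding g_def[abs_def] by simp
  qed
  have dk: "(k has_real_derivative (b0 * k t - p / l * g t) / (1 - t)) (at t within {0..T})" if t:
    "t \<in> {0..T}" for t
  proof -
    have y: "0 < 1 - t" using lt1[OF t] by simp
    have "((\<lambda>t. (1 - t) powr (- b0) * Kf t / l) has_real_derivative (- (- b0) * (1 - t) powr (- b0) / (1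
      - t) * Kf t + - dens f t * (1 - t) powr (- b0)) / l) (at t within {0..T})"
      by (intro DERIV_cdivide DERIV_mult powr_one_minus_deriv lt1 dKf t)
    moreover have "dens f t = P t * g t * p / (1 - t)"
    proof -
      have "dens f t = P t * (sqrt (1 - t) * sqrt (1 - t)) * g t * (p / (1 - t)\<^sup>2)"
        unfolding dens_def fg[OF t] phi_eq[OF lt1[OF t]] P_def by simp
      also have "sqrt (1 - t) * sqrt (1 - t) = 1 - t" using y by simp
      finally show ?thesis using y by (simp add: power2_eq_square)
    qed
    moreover have "(- (- b0) * (1 - t) powr (- b0) / (1 - t) * Kf t
      + - (P t * g t * p / (1 - t)) * (1 - t) powr (- b0)) / l = (b0 * k t - p / l * g t) / (1 - t)"
    proof -
      have "(- (- b0) * (1 / P t) / y * Kf t + - (P t * g t * p / y) * (1 / P t)) / l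
        = (b0 * (1 / P t * Kf t / l) - p / l * g t) / y" if "0 < y" for y
        using that Pp[OF t] l by (simp add: field_simps)
      then show ?thesis using y unfolding k_def powr_minus_divide P_def[symmetric] by blast
    qed
    ultimately show ?thesis unfolding k_def[abs_def] by simp
  qed
  have dgd: "(gd has_real_derivative - \<kappa> * g t / (1 - t)) (at t within {0..T})" if t: "t \<in> {0..T}" for t
  proof -
    have "((\<lambda>t. k t - b0 * g t) has_real_derivative (b0 * k t - p / l * g t) / (1 - t) - b0 * (gd t / (1
      - t))) (at t within {0..T})"
      by (intro DERIV_diff DERIV_cmult dk dg t)
    moreover have "(b0 * k t - p / l * g t) / (1 - t) - b0 * (gd t / (1 - t)) = - \<kappa> * g t / (1 - t)"
      unfolding gd_def \<kappa>_def times_divide_eq_right diff_divide_distrib[symmetric]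
        by (simp add: algebra_simps power2_eq_square)
    ultimately show ?thesis unfolding gd_def[abs_def] by simp
  qed
  \<comment> \<open>The Wronskians of g with \<open>gsin \<kappa>\<close> and, next, with
    \<open>gcos \<kappa>\<close>. They are constant because all three functions solve the same
    second-order equation.\<close>
  have "\<exists>c. \<forall>t\<in>{0..T}. g t * gcos \<kappa> (u t) - gd t * gsin \<kappa> (u t) = c"
  proof (rule has_field_derivative_zero_constant)
    fix t assume t: "t \<in> {0..T}"
    have "((\<lambda>t. g t * gcos \<kappa> (u t) - gd t * gsin \<kappa> (u t)) has_real_derivative
       (gd t / (1 - t) * gcos \<kappa> (u t) + - \<kappa> * gsin \<kappa> (u t) / (1 - t) * g t) - (- \<kappa> * g t / (1
         - t) * gsin \<kappa> (u t) + gcos \<kappa> (u t) / (1 - t) * gd t)) (at t within {0..T})"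
      by (intro DERIV_diff DERIV_mult dg dgd gcos_u_deriv gsin_u_deriv lt1 t)
    then show "((\<lambda>t. g t * gcos \<kappa> (u t) - gd t * gsin \<kappa> (u t)) has_real_derivative 0) (at t within {0..T})"
      by (simp add: mult.commute)
  qed simp
  then obtain c1 where c1: "\<And>t. t \<in> {0..T} \<Longrightarrow> g t * gcos \<kappa> (u t) - gd t * gsin \<kappa> (u t) = c1" by blast
  have "\<exists>c. \<forall>t\<in>{0..T}. gd t * gcos \<kappa> (u t) + \<kappa> * (g t * gsin \<kappa> (u t)) = c"
  proof (rule has_field_derivative_zero_constant)
    fix t assume t: "t \<in> {0..T}"
    have "((\<lambda>t. gd t * gcos \<kappa> (u t) + \<kappa> * (g t * gsin \<kappa> (u t))) has_real_derivative
       (- \<kappa> * g t / (1 - t) * gcos \<kappa> (u t) + - \<kappa> * gsin \<kappa> (u t) / (1 - t) * gd t)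
         + \<kappa> * (gd t / (1 - t) * gsin \<kappa> (u t) + gcos \<kappa> (u t) / (1 - t) * g t)) (at t within {0..T})"
      by (intro DERIV_add DERIV_cmult DERIV_mult dg dgd gcos_u_deriv gsin_u_deriv lt1 t)
    then show "((\<lambda>t. gd t * gcos \<kappa> (u t) + \<kappa> * (g t
      * gsin \<kappa> (u t))) has_real_derivative 0) (at t within {0..T})"
      by (simp add: algebra_simps)
  qed simp
  then obtain c where c: "\<And>t. t \<in> {0..T} \<Longrightarrow> gd t * gcos \<kappa> (u t) + \<kappa> * (g t * gsin \<kappa> (u t)) = c" by blast
  \<comment> \<open>At t = 0 the first integral is empty and \<open>tau\<close> vanishes; this is
    the condition y(0) = 0, and it makes the first constant 0.\<close>
  have "h 0 = 0" by (simp add: h_def I1_def tau_0)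
  then have g0: "g 0 = 0" by (simp add: g_def)
  have "c1 = 0" using c1[of 0] T0 g0 by simp
  then have E1: "g t * gcos \<kappa> (u t) = gd t * gsin \<kappa> (u t)" if "t \<in> {0..T}" for t using c1[OF that] by simp
  have gS: "g t = c * gsin \<kappa> (u t)" if t: "t \<in> {0..T}" for t
  proof -
    have "g t = (g t * gcos \<kappa> (u t)) * gcos \<kappa> (u t) + \<kappa> * g t * (gsin \<kappa> (u t))\<^sup>2"
      using arg_cong[OF gcos_gsin[of \<kappa> "u t"], of "\<lambda>x. g t * x"] by (simp add: algebra_simps power2_eq_square)
    also have "\<dots> = (gd t * gcos \<kappa> (u t) + \<kappa> * (g t * gsin \<kappa> (u t))) * gsin \<kappa> (u t)"
      unfolding E1[OF t] by (simp add: algebra_simps power2_eq_square)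
    also have "\<dots> = c * gsin \<kappa> (u t)" by (simp only: c[OF t])
    finally show ?thesis .
  qed
  have gdC: "gd t = c * gcos \<kappa> (u t)" if t: "t \<in> {0..T}" for t
  proof -
    have "gd t = (gd t * gcos \<kappa> (u t)) * gcos \<kappa> (u t) + \<kappa> * gsin \<kappa> (u t) * (gd t * gsin \<kappa> (u t))"
      using arg_cong[OF gcos_gsin[of \<kappa> "u t"], of "\<lambda>x. gd t * x"] by (simp add: algebra_simps power2_eq_square)
    also have "\<dots> = (gd t * gcos \<kappa> (u t) + \<kappa> * (g t * gsin \<kappa> (u t))) * gcos \<kappa> (u t)"
      unfolding E1[OF t, symmetric] by (simp add: algebra_simps)
    also have "\<dots> = c * gcos \<kappa> (u t)" by (simp only: c[OF t])
    finally show ?thesis .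
  qed
  have Tin: "T \<in> {0..T}" using T0 by simp
  \<comment> \<open>At t = T the tail integral is empty and the point mass alone remains. This ties
    the derivative to the value and is the second boundary condition.\<close>
  have kT: "k T = g T / l"
  proof -
    have y: "0 < 1 - T" using T1 by simp
    have "Kf T = P T * (sqrt (1 - T) * sqrt (1 - T)) * g T / (1 - T)"
      unfolding Kf_def fg[OF Tin] phi_eq[OF T1] P_def by simp
    also have "sqrt (1 - T) * sqrt (1 - T) = 1 - T" using y by simp
    finally have "Kf T = P T * g T" using y by simp
    then show ?thesis unfolding k_def powr_minus_divide P_def[symmetric] using Pp[OF Tin] by simp
  qed
  have "gd T = (1 / l - b0) * g T" unfolding gd_def kT by (simp add: left_diff_distrib)
  then have "c * gcos \<kappa> L = (1 / l - b0) * (c * gsin \<kappa> L)" using gS[OF Tin] gdC[OF Tin] by (simp add: u_T)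
  moreover have "1 / l = (\<kappa> + b0\<^sup>2) / p" unfolding \<kappa>_def using p(1) l by (simp add: field_simps)
  ultimately have "c * gcos \<kappa> L = ((\<kappa> + b0\<^sup>2) / p - b0) * (c * gsin \<kappa> L)" by simp
  then have "c * (p * gcos \<kappa> L) = c * ((\<kappa> + b0\<^sup>2 - b0 * p) * gsin \<kappa> L)" using p(1) by (simp add: field_simps)
  moreover have "\<kappa> + b0\<^sup>2 - b0 * p = \<kappa> - b0 * b1" unfolding p(2) by (simp add: power2_eq_square algebra_simps)
  ultimately have "c = 0 \<or> charfun \<kappa> = 0" unfolding charfun_def by auto
  moreover have "f t = c * efun \<kappa> t" if "t \<in> {0..T}" for t
    using fg[OF that] gS[OF that] by (simp add: efun_def)
  ultimately show ?thesis using that by blast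
qed

lemma efun_cont: "continuous_on {0..T} (efun \<kappa>)"
proof -
  have "continuous_on {0..T} (\<lambda>t. gsin \<kappa> (u t))"
    by (rule DERIV_continuous_on, rule gsin_u_deriv) (use T1 in auto)
  then show ?thesis unfolding efun_def[abs_def] by (intro continuous_intros)
qed

lemma efun_meas[measurable]: "efun \<kappa> \<in> borel_measurable borel"
proof -
  have "gsin \<kappa> \<in> borel_measurable borel"
    by (rule borel_measurable_continuous_onI, rule DERIV_continuous_on, rule gsin_deriv)
  moreover have "u \<in> borel_measurable borel" unfolding u_def[abs_def] by measurable
  ultimately show ?thesis unfolding efun_def[abs_def] by measurable
qed

text \<open>The forward computation tells the antiderivatives of the two integrands in
  \<open>A_formula\<close>; here they are verified by differentiation and inserted.\<close>

lemma eigen_converse: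
  assumes root: "charfun \<kappa> = 0" and \<kappa>: "\<kappa> + b0\<^sup>2 \<noteq> 0" and t: "t \<in> {0..T}"
  shows "A (efun \<kappa>) t = p / (\<kappa> + b0\<^sup>2) * efun \<kappa> t"
proof -
  define l where "l = p / (\<kappa> + b0\<^sup>2)"
  have l: "l \<noteq> 0" "l * (\<kappa> + b0\<^sup>2) = p" using \<kappa> p(1) by (auto simp: l_def)
  define P where "P t = (1 - t) powr b0" for t
  define g where "g t = gsin \<kappa> (u t)" for t
  define k where "k t = gcos \<kappa> (u t) + b0 * gsin \<kappa> (u t)" for t
  define Kf where "Kf t = l * (P t * k t)" for t
  define h where "h t = (1 - t) powr (- b0) * g t" for t
  let ?q = "dens (efun \<kappa>)"
  have lt1: "t < 1" if "t \<in> {0..T}" for t using that T1 by auto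
  have Pp: "0 < P t" if "t \<in> {0..T}" for t using lt1[OF that] by (simp add: P_def)
  have q: "?q t = P t * g t * p / (1 - t)" if t: "t \<in> {0..T}" for t
  proof -
    have y: "0 < 1 - t" using lt1[OF t] by simp
    have "?q t = P t * (sqrt (1 - t) * sqrt (1 - t)) * g t * (p / (1 - t)\<^sup>2)"
      unfolding dens_def efun_def phi_eq[OF lt1[OF t]] P_def g_def by simp
    also have "sqrt (1 - t) * sqrt (1 - t) = 1 - t" using y by simp
    finally show ?thesis using y by (simp add: power2_eq_square)
  qed
  have dKf: "(Kf has_real_derivative - ?q t) (at t within S)" if t: "t \<in> {0..T}" for t S
  proof -
    have y: "0 < 1 - t" using lt1[OF t] by simp
    have "((\<lambda>t. l * (P t * k t)) has_real_derivative
      l * (- b0 * P t / (1 - t) * k t + (- \<kappa> * gsin \<kappa> (u t) / (1 - t)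
        + b0 * (gcos \<kappa> (u t) / (1 - t))) * P t)) (at t within S)"
      unfolding P_def k_def
      by (intro DERIV_cmult DERIV_mult DERIV_add powr_one_minus_deriv gcos_u_deriv gsin_u_deriv lt1 t)
    moreover have "l * (- b0 * P t / (1 - t) * k t + (- \<kappa> * gsin \<kappa> (u t) / (1 - t)
      + b0 * (gcos \<kappa> (u t) / (1 - t))) * P t)
       = - (l * (\<kappa> + b0\<^sup>2)) * P t * g t / (1 - t)"
    proof -
      have "l * (- b0 * P t / y * (C + b0 * S) + (- \<kappa> * S / y + b0 * (C / y)) * P t)
        = - (l * (\<kappa> + b0\<^sup>2)) * P t * S / y" if "0 < y" for y C S
        using that by (simp add: field_simps power2_eq_square)
      then show ?thesis using y unfolding k_def g_def by blast
    qed
    ultimately show ?thesis unfolding Kf_def[abs_def] q[OF t] l(2) by (simp add: mult_ac)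
  qed
  have y: "0 < 1 - t" using lt1[OF t] by simp
  \<comment> \<open>The assumption that \<kappa> is a zero of \<open>charfun\<close> enters here:
    the antiderivative ends exactly at the contribution of the point mass.\<close>
  have KT: "Kf T = phi T * efun \<kappa> T / (1 - T)"
  proof -
    have y: "0 < 1 - T" using T1 by simp
    have "p * gcos \<kappa> L = (\<kappa> - b0 * b1) * gsin \<kappa> L" using root by (simp add: charfun_def)
    then have "p * (gcos \<kappa> L + b0 * gsin \<kappa> L) = (\<kappa> - b0 * b1 + b0 * p) * gsin \<kappa> L"
      by (simp add: algebra_simps)
    moreover have "(\<kappa> + b0\<^sup>2) * (l * (gcos \<kappa> L + b0 * gsin \<kappa> L)) = p * (gcos \<kappa> L + b0 * gsin \<kappa> L)"
      unfolding l(2)[symmetric] by (simp add: mult_ac)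
    ultimately have "(\<kappa> + b0\<^sup>2) * (l * (gcos \<kappa> L + b0 * gsin \<kappa> L)) = (\<kappa> - b0 * b1 + b0 * p) * gsin \<kappa> L" by simp
    also have "\<kappa> - b0 * b1 + b0 * p = \<kappa> + b0\<^sup>2" unfolding p(2) by (simp add: power2_eq_square algebra_simps)
    finally have "l * k T = g T" using \<kappa> by (simp add: k_def g_def u_T)
    then have "Kf T = P T * g T" unfolding Kf_def by (simp add: mult_ac)
    moreover have "phi T * efun \<kappa> T = P T * g T * (sqrt (1 - T) * sqrt (1 - T))"
      unfolding efun_def phi_eq[OF T1] P_def g_def by simp
    moreover have "sqrt (1 - T) * sqrt (1 - T) = 1 - T" using y by simp
    ultimately show ?thesis using y by simp
  qed
  have Iq: "integral {t..T} ?q + phi T * efun \<kappa> T / (1 - T) = Kf t"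
  proof -
    have "((\<lambda>s. - ?q s) has_integral (Kf T - Kf t)) {t..T}"
      using t dKf by (intro fundamental_theorem_of_calculus) (auto simp flip:
        has_real_derivative_iff_has_vector_derivative)
    from has_integral_neg[OF this] have "(?q has_integral - (Kf T - Kf t)) {t..T}" by simp
    then show ?thesis using KT by (simp add: integral_unique)
  qed
  have It: "integral {0..t} (\<lambda>s. tau s * ?q s) = l * h t - tau t * Kf t"
  proof -
    \<comment> \<open>The derivative of l h cancels against the term that comes from differentiating
      \<open>tau\<close>, leaving the integrand.\<close>
    have d: "((\<lambda>s. l * h s - tau s * Kf s) has_real_derivative tau s * ?q s) (at s within {0..t})" if s:
      "s \<in> {0..t}" for s
    proof -
      have sT: "s \<in> {0..T}" using s t by auto
      have y: "0 < 1 - s" using lt1[OF sT] by simp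
      have "((\<lambda>s. l * ((1 - s) powr (- b0) * g s) - tau s * Kf s) has_real_derivative
        l * (- (- b0) * (1 - s) powr (- b0) / (1 - s) * g s + gcos \<kappa> (u s) / (1 - s) * (1 - s) powr (- b0))
          - ((1 - s) powr (- 2 * a0) * Kf s + - ?q s * tau s)) (at s within {0..t})"
        unfolding g_def using t
        by (intro DERIV_diff DERIV_cmult DERIV_mult powr_one_minus_deriv gsin_u_deriv lt1 sT dKf
          DERIV_subset[OF tau_deriv[OF sT]]) auto
      moreover have "l * (- (- b0) * (1 - s) powr (- b0) / (1 - s) * g s
        + gcos \<kappa> (u s) / (1 - s) * (1 - s) powr (- b0)) = (1 - s) powr (- 2 * a0) * Kf s"
      proof -
        have "l * (- (- b0) * (1 / P s) / y * S + C / y * (1 / P s))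
          = 1 / (P s * P s * y) * (l * (P s * (C + b0 * S)))" if "0 < y" for y C S
          using that Pp[OF sT] by (simp add: field_simps)
        then show ?thesis using y unfolding tau'_eq[OF lt1[OF sT]] Kf_def powr_minus_divide P_def[symmetric]
          k_def g_def by blast
      qed
      ultimately show ?thesis unfolding h_def by (simp add: mult.commute)
    qed
    have "((\<lambda>s. tau s * ?q s) has_integral ((l * h t - tau t * Kf t) - (l * h 0 - tau 0 * Kf 0))) {0..t}"
      using t d by (intro fundamental_theorem_of_calculus) (auto simp flip:
        has_real_derivative_iff_has_vector_derivative)
    then show ?thesis by (simp add: integral_unique tau_0 h_def g_def)
  qed
  have "A (efun \<kappa>) t = phi t * (l * h t)"
    unfolding A_formula[OF efun_cont efun_meas t] It Iq by simp
  also have "\<dots> = l * efun \<kappa> t"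
    unfolding phi_eq[OF lt1[OF t]] h_def powr_minus_divide efun_def g_def using y by simp
  finally show ?thesis by (simp add: l_def)
qed

text \<open>Otherwise value and derivative of the solution would both vanish at L, against the
  energy integral. As T carries a point mass, the eigenfunction can be normalized.\<close>

lemma charfun_root_nonvanishing:
  assumes "charfun \<kappa> = 0" shows "efun \<kappa> T \<noteq> 0"
proof
  assume "efun \<kappa> T = 0"
  then have s: "gsin \<kappa> L = 0" using T1 by (simp add: efun_def u_T)
  then have "gcos \<kappa> L = 0" using assms p(1) by (simp add: charfun_def)
  then show False using gcos_gsin[of \<kappa> L] s by simp
qed

section \<open>From zeros of the characteristic function to the expansion\<close>

lemma A_cong:
  assumes m: "f \<in> borel_measurable borel" "g \<in> borel_measurable borel" and eq: "AE s in mu a0 a1 T. f s = g s"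
  shows "A f t = A g t"
  unfolding A_def
proof (rule integral_cong_AE)
  have K: "(\<lambda>s. kern t s) \<in> borel_measurable borel" by (rule K_meas)
  show "(\<lambda>s. kern t s * f s) \<in> borel_measurable (mu a0 a1 T)"
    "(\<lambda>s. kern t s * g s) \<in> borel_measurable (mu a0 a1 T)"
    unfolding meas_\<mu> using K m by (auto intro: borel_measurable_times)
  show "AE s in mu a0 a1 T. kern t s * f s = kern t s * g s" using eq by eventually_elim simp
qed

lemma A_clamp: "A f (clamp t) = A f t"
  unfolding A_def by (simp add: kern_def clamp(3))

lemma AE_clamp: "AE s in mu a0 a1 T. f (clamp s) = f s"
  using AE_mu by eventually_elim (simp add: clamp(2))

lemma ip_cong_AE:
  assumes m: "f \<in> borel_measurable borel" "g \<in> borel_measurable borel" "f' \<in> borel_measurable borel"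
      "g' \<in> borel_measurable borel"
    and eq: "AE s in mu a0 a1 T. f s = f' s" "AE s in mu a0 a1 T. g s = g' s"
  shows "ip f g = ip f' g'"
proof (rule integral_cong_AE)
  show "(\<lambda>s. f s * g s) \<in> borel_measurable (mu a0 a1 T)" "(\<lambda>s. f' s * g' s) \<in> borel_measurable (mu a0 a1 T)"
    unfolding meas_\<mu> using m by (auto intro: borel_measurable_times)
  show "AE s in mu a0 a1 T. f s * g s = f' s * g' s" using eq by eventually_elim simp
qed

text \<open>The kernel R agrees with the explicit one on [0,1) and is unknown elsewhere, while the
  integral runs over [0,1]. The integrands agree almost everywhere since \<mu> is carried by [0,T];
  the work lies in measurability.\<close>

lemma integral_operator_eq_A:
  assumes R: "\<And>s t. s \<in> {0..<1} \<Longrightarrow> t \<in> {0..<1} \<Longrightarrow> R s t = phi s * phi t * tau (min s t)"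
    and f[measurable]: "f \<in> borel_measurable borel" and t: "t \<in> {0..T}"
  shows "integral_operator R (mu a0 a1 T) f t = A f t"
  unfolding integral_operator_def set_lebesgue_integral_def A_def
proof (rule integral_cong_AE)
  have t1: "t \<in> {0..<1}" using t T1 by auto
  \<comment> \<open>A measurable form of R t on [0,1]: the formula on [0,1), and at s = 1 the
    unknown value, which concerns a single point. Clamping the minimum changes nothing there, as t
    \<le> T.\<close>
  define H where "H s = indicator {0..<1} s * (phi t * phi s * tau (clamp (min t s)))
    + indicator {1} s * R t 1" for s
  have tm: "(\<lambda>s. tau (clamp s)) \<in> borel_measurable borel"
    by (rule borel_measurable_continuous_onI[OF cont_clamp[OF tau_cont]])
  have "(\<lambda>s. min t s) \<in> borel_measurable borel" by measurable
  from measurable_compose[OF this tm] have tm': "(\<lambda>s. tau (clamp (min t s))) \<in> borel_measurable borel" .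
  have pm: "phi \<in> borel_measurable borel" unfolding bridge_phi_def[abs_def] by measurable
  have Hm: "H \<in> borel_measurable borel" unfolding H_def[abs_def]
    by (intro borel_measurable_add borel_measurable_times tm' pm borel_measurable_const
      borel_measurable_indicator) auto
  have eq: "indicator {0..1} s *\<^sub>R (R t s * f s) = H s * f s" for s
  proof -
    consider "s \<in> {0..<1}" | "s = 1" | "s \<notin> {0..1}" by force
    then show ?thesis
    proof cases
      case 1
      then have "clamp (min t s) = min t s" using t by (intro clamp(2)) (auto simp: min_le_iff_disj)
      then show ?thesis using 1 R[OF t1 1] by (simp add: H_def)
    next
      case 2
      then show ?thesis by (simp add: H_def)
    next
      case 3
      then show ?thesis by (auto simp: H_def indicator_def)
    qed
  qed
  show "(\<lambda>s. indicator {0..1} s *\<^sub>R (R t s * f s)) \<in> borel_measurable (mu a0 a1 T)"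
    unfolding eq meas_\<mu> using Hm f by (rule borel_measurable_times)
  show "(\<lambda>s. kern t s * f s) \<in> borel_measurable (mu a0 a1 T)"
    unfolding meas_\<mu> using K_meas f by (rule borel_measurable_times)
  show "AE s in mu a0 a1 T. indicator {0..1} s *\<^sub>R (R t s * f s) = kern t s * f s"
    using AE_mu
  proof eventually_elim
    case (elim s)
    then have "s \<in> {0..<1}" "s \<in> {0..1}" using T1 by auto
    then show ?case using R[OF t1] t elim clamp(2) by (simp add: kern_def)
  qed
qed

text \<open>Common interface of all three parts: given all zeros of \<open>charfun\<close> in
  increasing order, each above -b0^2, the expansion follows. The constants \<open>c i\<close> allow
  the eigenfunctions to be written as in the theorem, since normalization removes their
  size.\<close>

theorem kl_expansion_of_roots:
  fixes M :: "'a measure" and W X :: "real \<Rightarrow> 'a \<Rightarrow> real" and I :: "nat set" and \<kappa> c lam :: "nat \<Rightarrow> real"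
  assumes ps: "prob_space M" and bm: "standard_brownian_motion M W" and X: "alpha_brownian_bridge M W a0 X"
    and mono: "\<And>i j. i \<in> I \<Longrightarrow> j \<in> I \<Longrightarrow> i < j \<Longrightarrow> \<kappa> i < \<kappa> j"
    and roots: "\<kappa> ` I = {k. charfun k = 0}"
    and lower: "\<And>i. i \<in> I \<Longrightarrow> - b0\<^sup>2 < \<kappa> i"
    and lam: "\<And>i. i \<in> I \<Longrightarrow> lam i = p / (\<kappa> i + b0\<^sup>2)"
    and c: "\<And>i. i \<in> I \<Longrightarrow> c i \<noteq> 0"
    and e: "\<And>i. i \<in> I \<Longrightarrow> e i = L2_normalize (mu a0 a1 T) (\<lambda>t. c i * efun (\<kappa> i) t)"
  shows "karhunen_loeve_expansion M X (mu a0 a1 T) T I lam e"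
proof -
  let ?\<mu> = "mu a0 a1 T"
  interpret M: brownian M W using ps bm by (simp add: brownian_def brownian_axioms_def)
  have wi: "wiener_integral M W (\<lambda>s. ((1 - t) / (1 - s)) powr a0) t (X t)" if "t \<in> {0..<1}" for t
    using X that by (simp add: alpha_brownian_bridge_def)
  have cov: "covariance_function M X s t = phi s * phi t * tau (min s t)" if "s \<in> {0..<1}" "t \<in> {0..<1}" for s t
    unfolding covariance_function_def by (rule M.bridge_covariance[OF wi that])
  have cl1: "clamp t \<in> {0..<1}" for t using clamp(1)[of t] T1 by auto
  \<comment> \<open>The process stopped outside [0,T] is continuous on the whole line and has the
    clamped kernel as covariance.\<close>
  define Y where "Y t \<omega> = X (clamp t) \<omega>" for t \<omega>
  interpret G: gaussian_path_process ?\<mu> T Bd kern M Y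
  proof (unfold_locales)
    fix \<omega> assume "\<omega> \<in> space M"
    then have "continuous_on {0..1} (\<lambda>t. X t \<omega>)" using X by (simp add: alpha_brownian_bridge_def)
    moreover have "clamp ` UNIV \<subseteq> {0..1}"
    proof (rule image_subsetI)
      fix x show "clamp x \<in> {0..1}" using cl1[of x] by auto
    qed
    ultimately show "continuous_on UNIV (\<lambda>t. Y t \<omega>)" unfolding Y_def
      by (rule continuous_on_compose2[OF _ clamp_cont])
  next
    fix J :: "real set" and d assume "finite J"
    then show "gaussian_rv M (\<lambda>\<omega>. \<Sum>t\<in>J. d t * Y t \<omega>)"
      unfolding Y_def using M.bridge_gaussian[where \<alpha> = a0 and X = X and J = J and u = clamp and c
        = d] wi cl1 by blast
  next
    fix s t
    show "(\<integral>\<omega>. Y s \<omega> * Y t \<omega> \<partial>M) = kern s t"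
      unfolding Y_def kern_def by (rule M.bridge_covariance[OF wi cl1 cl1])
  qed
  have ch: "charfun (\<kappa> i) = 0" if "i \<in> I" for i using roots that by blast
  define d where "d i = c i / sqrt (L2_inner ?\<mu> (\<lambda>t. c i * efun (\<kappa> i) t) (\<lambda>t. c i * efun (\<kappa> i) t))" for i
  have ed: "e i t = d i * efun (\<kappa> i) t" if "i \<in> I" for i t
    unfolding e[OF that] L2_normalize_def d_def by simp
  have em: "e i \<in> borel_measurable borel" if "i \<in> I" for i
  proof -
    have "(\<lambda>t. d i * efun (\<kappa> i) t) \<in> borel_measurable borel" by measurable
    then show ?thesis using ed[OF that] by presburger
  qed
  \<comment> \<open>Continuous representatives, padded by the zero function outside
    \<open>I\<close>; with eigenvalue 0 there, the family over all natural numbers satisfies the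
    eigenvalue equation.\<close>
  define e' where "e' i t = (if i \<in> I then e i (clamp t) else 0)" for i t
  have e'c: "continuous_on UNIV (e' i)" for i
  proof (cases "i \<in> I")
    case True
    then show ?thesis unfolding e'_def[abs_def]
      using cont_clamp[OF continuous_on_mult[OF continuous_on_const[of _ "d i"] efun_cont[of "\<kappa> i"]]]
      by (simp add: ed)
  next
    case False
    then show ?thesis unfolding e'_def[abs_def] by simp
  qed
  have e'm: "e' i \<in> borel_measurable borel" for i by (rule borel_measurable_continuous_onI[OF e'c])
  have e'e: "AE s in ?\<mu>. e' i s = e i s" if "i \<in> I" for i
    using AE_clamp[of "e i"] by eventually_elim (simp add: e'_def that)
  have e'T: "e' i t = e i t" if "i \<in> I" "t \<in> {0..T}" for i t using that by (simp add: e'_def clamp(2))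
  have es: "sqint ?\<mu> (e' i)" for i by (rule sqint_cont[OF e'c])
  have ips: "L2_inner ?\<mu> (e i) (e j) = ip (e' i) (e' j)" if "i \<in> I" "j \<in> I" for i j
    unfolding L2_inner_def using e'e[OF that(1)] e'e[OF that(2)]
    by (intro ip_cong_AE[symmetric] em e'm that) auto
  have nrm1: "ip (e' i) (e' i) = 1" if i: "i \<in> I" for i
  proof -
    let ?f = "\<lambda>t. c i * efun (\<kappa> i) t"
    have fc: "continuous_on UNIV (\<lambda>t. ?f (clamp t))"
      by (rule cont_clamp) (intro continuous_on_mult continuous_on_const efun_cont)
    have fm: "?f \<in> borel_measurable borel" by measurable
    have qe: "L2_inner ?\<mu> ?f ?f = q (\<lambda>t. ?f (clamp t))"
      unfolding L2_inner_def power2_eq_square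
    proof (rule ip_cong_AE[OF fm fm])
      show "(\<lambda>t. ?f (clamp t)) \<in> borel_measurable borel" by (rule borel_measurable_continuous_onI[OF fc])
      then show "(\<lambda>t. ?f (clamp t)) \<in> borel_measurable borel" .
      show "AE s in ?\<mu>. ?f s = ?f (clamp s)" by (rule eventually_mono[OF AE_clamp[of ?f]]) (rule sym)
      then show "AE s in ?\<mu>. ?f s = ?f (clamp s)" .
    qed
    have "q (\<lambda>t. ?f (clamp t)) \<noteq> 0"
    proof
      assume "q (\<lambda>t. ?f (clamp t)) = 0"
      then have "?f (clamp T) = 0" using T0 by (intro q_eq_0[OF fc]) auto
      then show False using c[OF i] charfun_root_nonvanishing[OF ch[OF i]] T0 by (simp add: clamp(2))
    qed
    then have pos: "0 < L2_inner ?\<mu> ?f ?f" unfolding qe by (simp add: less_le)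
    have "L2_inner ?\<mu> (e i) (e i) = (\<integral>s. (1 / sqrt (L2_inner ?\<mu> ?f ?f))\<^sup>2 * (?f s * ?f s) \<partial>?\<mu>)"
      unfolding L2_inner_def[of _ "e i"]
      by (intro Bochner_Integration.integral_cong) (auto simp: e[OF i] L2_normalize_def power2_eq_square)
    also have "\<dots> = (1 / sqrt (L2_inner ?\<mu> ?f ?f))\<^sup>2 * L2_inner ?\<mu> ?f ?f"
      unfolding L2_inner_def by (rule integral_mult_right_zero)
    also have "\<dots> = 1" using pos by (simp add: power_divide)
    finally show ?thesis using ips[OF i i] by simp
  qed
  have Aef: "A (e' i) t = lam i * e' i t" if i: "i \<in> I" for i t
  proof -
    have "A (e' i) t = A (e' i) (clamp t)" by (simp add: A_clamp)
    also have "\<dots> = A (\<lambda>s. d i * efun (\<kappa> i) s + 0 * efun (\<kappa> i) s) (clamp t)"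
      by (rule A_cong[OF e'm]) (use e'e[OF i] in \<open>auto simp: ed[OF i]\<close>)
    also have "\<dots> = d i * A (efun (\<kappa> i)) (clamp t) + 0 * A (efun (\<kappa> i)) (clamp t)"
    proof (rule A_linear)
      have c: "continuous_on UNIV (\<lambda>t. efun (\<kappa> i) (clamp t))" by (rule cont_clamp[OF efun_cont])
      have "integrable ?\<mu> (\<lambda>s. (efun (\<kappa> i) (clamp s))\<^sup>2) \<longleftrightarrow> integrable ?\<mu> (\<lambda>s. (efun (\<kappa> i) s)\<^sup>2)"
      proof (rule integrable_cong_AE)
        show "(\<lambda>s. (efun (\<kappa> i) (clamp s))\<^sup>2) \<in> borel_measurable ?\<mu>"
          by (rule borel_measurable_power[OF sqint_measurable[OF sqint_cont[OF c]]])
        show "AE s in ?\<mu>. (efun (\<kappa> i) (clamp s))\<^sup>2 = (efun (\<kappa> i) s)\<^sup>2"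
          using AE_clamp[of "efun (\<kappa> i)"] by eventually_elim simp
      qed measurable
      then show "sqint ?\<mu> (efun (\<kappa> i))" using sqint_cont[OF c] by (simp add: sqint_def meas_\<mu>)
      then show "sqint ?\<mu> (efun (\<kappa> i))" .
    qed
    also have "A (efun (\<kappa> i)) (clamp t) = lam i * efun (\<kappa> i) (clamp t)"
      unfolding lam[OF i] using lower[OF i] by (intro eigen_converse ch i clamp(1)) simp
    finally have "A (e' i) t = lam i * (d i * efun (\<kappa> i) (clamp t))" by simp
    moreover have "e' i t = d i * efun (\<kappa> i) (clamp t)" using i by (simp add: e'_def ed)
    ultimately show ?thesis by simp
  qed
  define lam' where "lam' i = (if i \<in> I then lam i else 0)" for i
  have eig: "A (e' i) t = lam' i * e' i t" for i t
  proof (cases "i \<in> I")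
    case True
    then show ?thesis using Aef by (simp add: lam'_def)
  next
    case False
    then show ?thesis by (simp add: A_def e'_def lam'_def)
  qed
  have lampos: "0 < lam i" if "i \<in> I" for i unfolding lam[OF that] using lower[OF that] p(1) by simp
  have lamlt: "lam j < lam i" if "i \<in> I" "j \<in> I" "i < j" for i j
    unfolding lam[OF that(1)] lam[OF that(2)] using lower[OF that(1)] mono[OF that] p(1)
    by (intro divide_strict_left_mono mult_pos_pos) auto
  have laminj: "i = j" if "i \<in> I" "j \<in> I" "lam i = lam j" for i j
    using lamlt[of i j] lamlt[of j i] that by (cases i j rule: linorder_cases) auto
  have orth: "ip (e' i) (e' j) = 0" if "i \<noteq> j" for i j
  proof (cases "i \<in> I \<and> j \<in> I")
    case True
    have "lam i * ip (e' i) (e' j) = ip (A (e' i)) (e' j)"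
      using True by (simp add: Aef mult.assoc)
    also have "\<dots> = ip (e' i) (A (e' j))" by (rule A_selfadjoint[OF es es])
    also have "\<dots> = (\<integral>s. lam j * (e' i s * e' j s) \<partial>?\<mu>)"
      using True by (intro Bochner_Integration.integral_cong) (auto simp: Aef)
    also have "\<dots> = lam j * ip (e' i) (e' j)" by simp
    finally show ?thesis using laminj[of i j] True that by auto
  next
    case False
    then show ?thesis by (auto simp: e'_def)
  qed
  have nrm: "e' i = (\<lambda>_. 0) \<or> ip (e' i) (e' i) = 1" for i
    using nrm1[of i] by (cases "i \<in> I") (auto simp: e'_def)
  have forward: "\<exists>cc. (\<forall>t\<in>{0..T}. f t = cc * efun (p / l - b0\<^sup>2) t) \<and> (cc = 0 \<or> charfun (p / l - b0\<^sup>2) = 0)"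
    if l: "l \<noteq> 0" and f: "continuous_on UNIV f" and ef: "\<And>t. t \<in> {0..T} \<Longrightarrow> A f t = l * f t" for l f
  proof -
    show ?thesis
    proof (rule eigen_forward[of f l])
      show "continuous_on {0..T} f" by (rule continuous_on_subset[OF f]) simp
      show "f \<in> borel_measurable borel" by (rule borel_measurable_continuous_onI[OF f])
      show "l \<noteq> 0" by (rule l)
      show "A f t = l * f t" if "t \<in> {0..T}" for t by (rule ef[OF that])
    next
      fix cc assume "\<And>t. t \<in> {0..T} \<Longrightarrow> f t = cc * efun (p / l - b0\<^sup>2) t" "cc = 0 \<or> charfun (p / l - b0\<^sup>2) = 0"
      then show ?thesis by blast
    qed
  qed
  have dnz: "d i \<noteq> 0" if "i \<in> I" for i
  proof
    assume "d i = 0"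
    then have "e' i = (\<lambda>_. 0)" by (intro ext) (simp add: e'_def that ed)
    then show False using nrm1[OF that] by simp
  qed
  \<comment> \<open>The value p / l - b0^2 inverts the relation between \<kappa> and l. If it is a
    zero of \<open>charfun\<close> it occurs among the \<open>\<kappa> i\<close>, and the eigenspace
    is spanned by that one function.\<close>
  have expand: "\<exists>i\<in>I. \<exists>a. lam i = l \<and> (\<forall>t\<in>{0..T}. f t = a * e' i t)"
    if l: "l \<noteq> 0" and ch: "charfun (p / l - b0\<^sup>2) = 0"
      and ff: "\<forall>t\<in>{0..T}. f t = cc * efun (p / l - b0\<^sup>2) t" for l f cc
  proof -
    have "p / l - b0\<^sup>2 \<in> \<kappa> ` I" unfolding roots using ch by simp
    then obtain i where i: "i \<in> I" "\<kappa> i = p / l - b0\<^sup>2" by (metis imageE)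
    have "lam i = l" using lam[OF i(1)] i(2) l p(1) by simp
    moreover have "f t = (cc / d i) * e' i t" if "t \<in> {0..T}" for t
      using ff that dnz[OF i(1)] ed[OF i(1)] e'T[OF i(1) that] i(2) by simp
    ultimately show ?thesis using i(1) by blast
  qed
  have compl: "q f = 0" if l: "l \<noteq> 0" and f: "continuous_on UNIV f" and ef: "\<And>t. t \<in> {0..T} \<Longrightarrow> A f t = l * f t"
     and fo: "\<And>i. ip f (e' i) = 0" for l f
  proof -
    obtain cc where cc: "\<forall>t\<in>{0..T}. f t = cc * efun (p / l - b0\<^sup>2) t" "cc = 0 \<or> charfun (p / l - b0\<^sup>2) = 0"
      using forward[OF l f ef] by blast
    have fz: "\<forall>t\<in>{0..T}. f t = 0"
    proof (cases "charfun (p / l - b0\<^sup>2) = 0")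
      case True
      obtain i a where ia: "i \<in> I" "\<forall>t\<in>{0..T}. f t = a * e' i t" using expand[OF l True cc(1)] by blast
      have "AE s in ?\<mu>. f s = a * e' i s" using AE_mu by eventually_elim (use ia(2) in blast)
      then have "ip f (e' i) = ip (\<lambda>s. a * e' i s) (e' i)"
        using e'm by (intro ip_cong_AE borel_measurable_continuous_onI[OF f] borel_measurable_times) auto
      also have "\<dots> = a * ip (e' i) (e' i)" by (simp add: mult.assoc)
      finally have "a = 0" using fo[of i] nrm1[OF ia(1)] by simp
      then show ?thesis using ia(2) by simp
    next
      case False
      then show ?thesis using cc by simp
    qed
    have "AE s in ?\<mu>. (f s)\<^sup>2 = 0" using AE_mu by eventually_elim (use fz in simp)
    then have "q f = (\<integral>s. 0 \<partial>?\<mu>)"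
      using sqint_cont[OF f] by (intro integral_cong_AE) (auto simp: sqint_def)
    then show ?thesis by simp
  qed
  have lam0: "0 \<le> lam' i" for i using lampos[of i] by (simp add: lam'_def less_imp_le)
  have KL1: "prob_space.indep_vars M (\<lambda>_. borel) (\<lambda>i. G.Zf (e' i)) UNIV"
    by (rule G.karhunen_loeve(1)[of e' lam']) (fact e'c eig orth nrm lam0 compl)+
  have KL2: "distributed M lborel (G.Zf (e' i)) (normal_density 0 (sqrt (lam' i)))"
    if "ip (e' i) (e' i) = 1" "0 < lam' i" for i
    using that by (rule G.karhunen_loeve(2)[of e' lam', rotated 6]) (fact e'c eig orth nrm lam0 compl)+
  have KL3: "AE \<omega> in M. uniform_limit {0..T} (\<lambda>n t. \<Sum>i\<le>n. e' i t * G.Zf (e' i) \<omega>) (\<lambda>t. Y t \<omega>) sequentially"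
    by (rule G.karhunen_loeve(3)[of e' lam']) (fact e'c eig orth nrm lam0 compl)+
  define Z where "Z i = G.Zf (e' i)" for i
  have Zind: "prob_space.indep_vars M (\<lambda>_. borel) Z I"
    unfolding Z_def[abs_def] by (rule M.indep_vars_subset[OF KL1 subset_UNIV])
  have Zdist: "distributed M lborel (Z i) (normal_density 0 (sqrt (lam i)))" if "i \<in> I" for i
    using KL2[of i] nrm1[OF that] lampos[OF that] that by (simp add: Z_def lam'_def)
  have Zlim: "AE \<omega> in M. uniform_limit {0..T} (\<lambda>n t. \<Sum>i\<in>I \<inter> {..n}. Z i \<omega> * e i t) (\<lambda>t. X t \<omega>) sequentially"
    using KL3
  proof eventually_elim
    case (elim \<omega>)
    have 1: "(\<Sum>i\<le>n. e' i t * G.Zf (e' i) \<omega>) = (\<Sum>i\<in>I \<inter> {..n}. Z i \<omega> * e i t)" if t: "t \<in> {0..T}" for n t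
      by (rule sum.mono_neutral_cong_right) (use t in \<open>auto simp: e'T Z_def e'_def[of _ t] clamp(2)\<close>)
    have 2: "Y t \<omega> = X t \<omega>" if "t \<in> {0..T}" for t using that by (simp add: Y_def clamp(2))
    have "uniform_limit {0..T} (\<lambda>n t. \<Sum>i\<le>n. e' i t * G.Zf (e' i) \<omega>) (\<lambda>t. Y t \<omega>) sequentially =
      uniform_limit {0..T} (\<lambda>n t. \<Sum>i\<in>I \<inter> {..n}. Z i \<omega> * e i t) (\<lambda>t. X t \<omega>) sequentially"
      by (rule uniform_limit_cong'[OF 1 2])
    then show ?case using elim by simp
  qed
  have opA: "integral_operator (covariance_function M X) ?\<mu> f t = A f t"
    if "f \<in> borel_measurable borel" "t \<in> {0..T}" for f t
    by (rule integral_operator_eq_A[OF cov that])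
  have conj3: "in_L2 ?\<mu> (e i) \<and> (AE t in ?\<mu>. integral_operator (covariance_function M X) ?\<mu> (e i) t
    = lam i * e i t)" if i: "i \<in> I" for i
  proof
    have "integrable ?\<mu> (\<lambda>s. (e' i s)\<^sup>2) \<longleftrightarrow> integrable ?\<mu> (\<lambda>s. (e i s)\<^sup>2)"
    proof (rule integrable_cong_AE)
      show "(\<lambda>s. (e' i s)\<^sup>2) \<in> borel_measurable ?\<mu>" "(\<lambda>s. (e i s)\<^sup>2) \<in> borel_measurable ?\<mu>"
        unfolding meas_\<mu> using e'm em[OF i] by (auto intro: borel_measurable_power)
      show "AE s in ?\<mu>. (e' i s)\<^sup>2 = (e i s)\<^sup>2" using e'e[OF i] by eventually_elim simp
    qed
    then show "in_L2 ?\<mu> (e i)" using es[of i] em[OF i] by (simp add: in_L2_def sqint_def meas_\<mu>)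
    show "AE t in ?\<mu>. integral_operator (covariance_function M X) ?\<mu> (e i) t = lam i * e i t"
      using AE_mu
    proof eventually_elim
      case (elim t)
      have "integral_operator (covariance_function M X) ?\<mu> (e i) t = A (e i) t" by (rule opA[OF em[OF i] elim])
      also have "\<dots> = A (e' i) t" by (rule A_cong[OF em[OF i] e'm]) (use e'e[OF i] in \<open>auto elim:
        eventually_mono\<close>)
      also have "\<dots> = lam i * e i t" using Aef[OF i] e'T[OF i elim] by simp
      finally show ?case .
    qed
  qed
  have conj5: "finite {i\<in>I. lam i = l} \<and> (AE t in ?\<mu>. f t = (\<Sum>i\<in>{i\<in>I. lam i = l}. L2_inner ?\<mu> f (e i) * e i t))"
    if l: "l \<noteq> 0" and f: "in_L2 ?\<mu> f"
      and ef: "AE t in ?\<mu>. integral_operator (covariance_function M X) ?\<mu> f t = l * f t" for l f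
  proof -
    have fs: "sqint ?\<mu> f" and fm: "f \<in> borel_measurable borel" using f
      by (auto simp: in_L2_def sqint_def meas_\<mu>)
    \<comment> \<open>An eigenfunction is given only almost everywhere; its image under the
      operator, divided by l, is a continuous representative satisfying the equation at every
      point.\<close>
    define g where "g t = (1 / l) * A f t" for t
    have gc: "continuous_on UNIV g" unfolding g_def[abs_def] by (intro continuous_intros A_cont[OF fs])
    have gm: "g \<in> borel_measurable borel" by (rule borel_measurable_continuous_onI[OF gc])
    have fg: "AE t in ?\<mu>. f t = g t" using ef AE_mu
      by eventually_elim (use l in \<open>simp add: opA[OF fm] g_def\<close>)
    have Ag: "A g t = l * g t" for t
    proof -
      have e: "l * g t = A f t" using l by (simp add: g_def)
      show ?thesis unfolding e by (rule A_cong[OF fm gm fg, symmetric])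
    qed
    obtain cc where cc: "\<forall>t\<in>{0..T}. g t = cc * efun (p / l - b0\<^sup>2) t" "cc = 0 \<or> charfun (p / l - b0\<^sup>2) = 0"
      using forward[OF l gc Ag] by blast
    show ?thesis
    proof (cases "charfun (p / l - b0\<^sup>2) = 0")
      case True
      obtain i a where ia: "i \<in> I" "lam i = l" "\<forall>t\<in>{0..T}. g t = a * e' i t" using expand[OF l True cc(1)]
        by blast
      have S: "{i\<in>I. lam i = l} = {i}" using ia laminj by auto
      have fe: "AE s in ?\<mu>. f s = a * e' i s" using AE_mu fg by eventually_elim (use ia(3) in simp)
      have "L2_inner ?\<mu> f (e i) = ip (\<lambda>s. a * e' i s) (e' i)"
        unfolding L2_inner_def using fe e'e[OF ia(1)]
        by (intro ip_cong_AE fm em ia e'm borel_measurable_times borel_measurable_const) (auto elim: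
          eventually_mono)
      also have "\<dots> = a * ip (e' i) (e' i)" by (simp add: mult.assoc)
      finally have a: "L2_inner ?\<mu> f (e i) = a" using nrm1[OF ia(1)] by simp
      have "AE t in ?\<mu>. f t = a * e i t" using fe e'e[OF ia(1)] by eventually_elim simp
      then show ?thesis unfolding S using a by simp
    next
      case False
      have S: "{i\<in>I. lam i = l} = {}"
      proof (rule ccontr)
        assume "{i\<in>I. lam i = l} \<noteq> {}"
        then obtain i where i: "i \<in> I" "lam i = l" by blast
        have "\<kappa> i + b0\<^sup>2 \<noteq> 0" using lower[OF i(1)] by simp
        then have "p / l - b0\<^sup>2 = \<kappa> i" unfolding i(2)[symmetric] lam[OF i(1)] using p(1) by simp
        then show False using ch[OF i(1)] False by simp
      qed
      have "AE t in ?\<mu>. f t = 0" using AE_mu fg by eventually_elim (use cc False in simp)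
      then show ?thesis unfolding S by simp
    qed
  qed
  show ?thesis
    unfolding karhunen_loeve_expansion_def Let_def
  proof (intro conjI ballI allI impI)
    show "0 < lam i" if "i \<in> I" for i by (rule lampos[OF that])
    show "lam j \<le> lam i" if "i \<in> I" "j \<in> I" "i \<le> j" for i j
      using lamlt[OF that(1,2)] that(3) by (cases "i = j") auto
    show "L2_inner ?\<mu> (e i) (e j) = (if i = j then 1 else 0)" if "i \<in> I" "j \<in> I" for i j
      using ips[OF that] nrm1[OF that(1)] orth[of i j] by auto
    show "\<exists>Z. prob_space.indep_vars M (\<lambda>_. borel) Z I \<and>
       (\<forall>i\<in>I. distributed M lborel (Z i) (normal_density 0 (sqrt (lam i)))) \<and>
       (AE \<omega> in M. uniform_limit {0..T} (\<lambda>n t. \<Sum>i\<in>I \<inter> {..n}. Z i \<omega> * e i t) (\<lambda>t. X t \<omega>) sequentially)"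
      using Zind Zdist Zlim by blast
  qed (use conj3 conj5 in auto)
qed

end

section \<open>The zeros of \<open>F\<close> and \<open>G\<close>\<close>

text \<open>The rank, that is the number of smaller elements, is strictly increasing and takes every
  natural value; its inverse enumerates the set.\<close>

lemma increasing_enumeration:
  fixes S :: "real set"
  assumes inf: "infinite S" and fin: "\<And>b. finite {x\<in>S. x \<le> b}"
  obtains f :: "nat \<Rightarrow> real" where "strict_mono f" "range f = S"
proof -
  define r where "r x = card {y\<in>S. y < x}" for x
  have finl: "finite {y\<in>S. y < x}" for x by (rule finite_subset[OF _ fin[of x]]) auto
  have rless: "r x < r y" if "x \<in> S" "y \<in> S" "x < y" for x y
    unfolding r_def using that by (intro psubset_card_mono finl) auto
  have "\<exists>x\<in>S. r x = n" for n
  proof (induction n)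
    case 0
    obtain z where z: "z \<in> S" using inf by (metis finite.emptyI ex_in_conv)
    define x where "x = Min {y\<in>S. y \<le> z}"
    have ne: "{y\<in>S. y \<le> z} \<noteq> {}" using z by auto
    have x: "x \<in> S" "x \<le> z" using Min_in[OF fin ne] by (auto simp: x_def)
    have "{y\<in>S. y < x} = {}"
    proof (rule ccontr)
      assume "{y\<in>S. y < x} \<noteq> {}"
      then obtain y where y: "y \<in> S" "y < x" by auto
      then have "y \<in> {y\<in>S. y \<le> z}" using x(2) by auto
      then have "x \<le> y" unfolding x_def by (rule Min_le[OF fin])
      then show False using y by simp
    qed
    then show ?case using x(1) by (intro bexI[of _ x]) (simp_all only: r_def card.empty)
  next
    case (Suc n)
    then obtain x where x: "x \<in> S" "r x = n" by blast
    have "\<not> S \<subseteq> {y\<in>S. y \<le> x}" using inf fin[of x] finite_subset by blast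
    then obtain z where z: "z \<in> S" "x < z" by force
    define x' where "x' = Min {y\<in>S. x < y \<and> y \<le> z}"
    have fin': "finite {y\<in>S. x < y \<and> y \<le> z}" by (rule finite_subset[OF _ fin[of z]]) auto
    have ne: "{y\<in>S. x < y \<and> y \<le> z} \<noteq> {}" using z by auto
    have x': "x' \<in> S" "x < x'" "x' \<le> z" using Min_in[OF fin' ne] by (auto simp: x'_def)
    have "{y\<in>S. y < x'} = insert x {y\<in>S. y < x}"
    proof (intro set_eqI iffI)
      fix y assume y: "y \<in> {y\<in>S. y < x'}"
      have "\<not> x < y"
      proof
        assume "x < y"
        then have "y \<in> {y\<in>S. x < y \<and> y \<le> z}" using y x'(3) by auto
        then have "x' \<le> y" unfolding x'_def by (rule Min_le[OF fin'])
        then show False using y by simp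
      qed
      then show "y \<in> insert x {y\<in>S. y < x}" using y by auto
    qed (use x x' in auto)
    then have "r x' = Suc n" using x(2) finl[of x] by (simp add: r_def)
    then show ?case using x'(1) by blast
  qed
  then obtain f where f: "\<And>n. f n \<in> S" "\<And>n. r (f n) = n" by metis
  have "strict_mono f"
  proof (rule strict_monoI)
    fix i j :: nat assume "i < j"
    show "f i < f j"
    proof (rule ccontr)
      assume "\<not> f i < f j"
      then consider "f j < f i" | "f i = f j" by linarith
      then have "r (f j) \<le> r (f i)" using rless[OF f(1) f(1), of j i] by cases auto
      then show False using f(2) \<open>i < j\<close> by simp
    qed
  qed
  moreover have "range f = S"
  proof (intro set_eqI iffI)
    fix x assume x: "x \<in> S"
    have "f (r x) = x"
    proof (rule ccontr)
      assume "f (r x) \<noteq> x"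
      then consider "f (r x) < x" | "x < f (r x)" by linarith
      then show False using rless[OF f(1) x, of "r x"] rless[OF x f(1), of "r x"] f(2)[of "r x"] by cases auto
    qed
    then show "x \<in> range f" by (metis rangeI)
  qed (use f in auto)
  ultimately show ?thesis by (rule that)
qed

text \<open>The difference vanishes at 0 and has derivative x sinh x. It compares a negative zero of
  \<open>charfun\<close> with the value at 0.\<close>

lemma sinh_le_mult_cosh:
  assumes "0 \<le> (x::real)" shows "sinh x \<le> x * cosh x"
proof -
  have "0 * cosh 0 - sinh 0 \<le> x * cosh x - sinh x"
  proof (rule DERIV_nonneg_imp_nondecreasing[OF assms])
    fix y :: real assume "0 \<le> y" "y \<le> x"
    have "((\<lambda>x. x * cosh x - sinh x) has_real_derivative y * sinh y) (at y)"
      by (auto intro!: derivative_eq_intros)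
    moreover have "0 \<le> y * sinh y" using \<open>0 \<le> y\<close> by simp
    ultimately show "\<exists>z. ((\<lambda>x. x * cosh x - sinh x) has_real_derivative z) (at y) \<and> 0 \<le> z" by blast
  qed
  then show ?thesis by simp
qed

section \<open>Zeros of the characteristic function and the two thresholds\<close>

context bridge_setup
begin

lemma L_nonneg: "0 \<le> L" using T0 T1 by (simp add: L_def)

lemma L_pos: "0 < L \<longleftrightarrow> 0 < T" using T0 T1 by (simp add: L_def)

lemma beta_radicand_eq: "beta_radicand a0 a1 l = p / l - b0\<^sup>2"
  unfolding beta_radicand_def p_def b0_def by (simp add: power2_eq_square algebra_simps)

lemma charfun_pos: "0 < \<beta> \<Longrightarrow> charfun (\<beta>\<^sup>2) = ((\<beta>\<^sup>2 - b0 * b1) * sin (\<beta> * L) - p * \<beta> * cos (\<beta> * L)) / \<beta>"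
  by (simp add: charfun_def gsin_def gcos_def field_simps)

lemma charfun_neg: "0 < \<sigma> \<Longrightarrow> charfun (- \<sigma>\<^sup>2) = - ((\<sigma>\<^sup>2 + b0 * b1) * sinh (\<sigma> * L) + \<sigma> * p * cosh (\<sigma> * L)) / \<sigma>"
  by (simp add: charfun_def gsin_def gcos_def field_simps)

lemma charfun_0: "charfun 0 = - (p + b0 * b1 * L)"
  by (simp add: charfun_def gsin_def gcos_def)

text \<open>Multiplying by the cosine and the denominator turns the equation for \<open>F\<close>
  into X sin = p \<beta> cos. If one of cos and X vanishes, a solution needs the other to vanish
  too, because sin and cos have no common zero and p \<beta> > 0; this is the common pole counted in
  \<open>F_zeros\<close>.\<close>

lemma F_zeros_iff: "l \<in> F_zeros a0 a1 T \<longleftrightarrow> 0 < p / l - b0\<^sup>2 \<and> charfun (p / l - b0\<^sup>2) = 0"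
proof (cases "0 < p / l - b0\<^sup>2")
  case True
  define \<kappa> where "\<kappa> = p / l - b0\<^sup>2"
  define \<beta> where "\<beta> = sqrt \<kappa>"
  have \<kappa>: "0 < \<kappa>" using True by (simp add: \<kappa>_def)
  have \<beta>: "0 < \<beta>" "\<beta>\<^sup>2 = \<kappa>" using \<kappa> by (auto simp: \<beta>_def)
  have kb: "0 < \<kappa> + b0\<^sup>2" using \<kappa> by (simp add: add_pos_nonneg)
  have l: "l = p / (\<kappa> + b0\<^sup>2)" using p(1) by (simp add: \<kappa>_def)
  \<comment> \<open>Up to the positive factor 1 / (\<kappa> + b0^2) this is the denominator 1 + l/2
    - l a0.\<close>
  define X where "X = \<kappa> - b0 * b1"
  have "1 + l/2 - l * a0 = 1 - l * b0" by (simp add: b0_def algebra_simps)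
  also have "\<dots> = (\<kappa> + b0\<^sup>2 - p * b0) / (\<kappa> + b0\<^sup>2)" unfolding l using kb by (simp add: diff_divide_distrib)
  also have "\<kappa> + b0\<^sup>2 - p * b0 = X" unfolding p(2) X_def by (simp add: power2_eq_square algebra_simps)
  finally have den: "1 + l/2 - l * a0 = X / (\<kappa> + b0\<^sup>2)" .
  have rat: "l * \<beta> / (X / (\<kappa> + b0\<^sup>2)) = p * \<beta> / X" unfolding l using kb by simp
  have arg: "\<beta> * ln (1 - T) = - (\<beta> * L)" by (simp add: L_def)
  have b: "beta a0 a1 l = \<beta>" by (simp add: beta_def beta_radicand_eq \<beta>_def \<kappa>_def)
  have mem: "l \<in> F_zeros a0 a1 T \<longleftrightarrow>
     (cos (\<beta> * L) \<noteq> 0 \<and> X \<noteq> 0 \<and> - tan (\<beta> * L) + p * \<beta> / X = 0) \<or> (cos (\<beta> * L) = 0 \<and> X = 0)"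
    unfolding F_zeros_def F_def mem_Collect_eq arg den b rat using True kb by (simp add: beta_radicand_eq)
  have root: "charfun \<kappa> = 0 \<longleftrightarrow> X * sin (\<beta> * L) = p * \<beta> * cos (\<beta> * L)"
    using charfun_pos[OF \<beta>(1)] \<beta> unfolding X_def by simp
  have sc: "sin (\<beta> * L) \<noteq> 0" if "cos (\<beta> * L) = 0" using sin_cos_squared_add[of "\<beta> * L"] that by auto
  have pb: "p * \<beta> \<noteq> 0" using p(1) \<beta>(1) by simp
  have "l \<in> F_zeros a0 a1 T \<longleftrightarrow> charfun \<kappa> = 0"
  proof (cases "cos (\<beta> * L) = 0")
    case True
    then show ?thesis unfolding mem root using sc by simp
  next
    case False
    show ?thesis
    proof (cases "X = 0")
      case True
      then show ?thesis unfolding mem root using False pb by simp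
    next
      case X: False
      have "- tan (\<beta> * L) + p * \<beta> / X = 0 \<longleftrightarrow> X * sin (\<beta> * L) = p * \<beta> * cos (\<beta> * L)"
        using X False unfolding tan_def by (simp add: field_simps) (auto simp: mult_ac)
      then show ?thesis unfolding mem root using X False by simp
    qed
  qed
  then show ?thesis using True by (simp add: \<kappa>_def)
next
  case False
  then show ?thesis by (simp add: F_zeros_def beta_radicand_eq)
qed

lemma no_root_T0:
  assumes "T = 0" shows "charfun \<kappa> \<noteq> 0"
proof -
  have "L = 0" unfolding L_def using assms by simp
  then show ?thesis using p(1) by (simp add: charfun_def)
qed

lemma F_zeros_image: "F_zeros a0 a1 T = (\<lambda>\<kappa>. p / (\<kappa> + b0\<^sup>2)) ` {\<kappa>. 0 < \<kappa> \<and> charfun \<kappa> = 0}"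
proof (intro set_eqI iffI)
  fix l assume "l \<in> F_zeros a0 a1 T"
  then have "p / l - b0\<^sup>2 \<in> {\<kappa>. 0 < \<kappa> \<and> charfun \<kappa> = 0}" by (simp add: F_zeros_iff)
  moreover have "p / (p / l - b0\<^sup>2 + b0\<^sup>2) = l" using p(1) by simp
  ultimately show "l \<in> (\<lambda>\<kappa>. p / (\<kappa> + b0\<^sup>2)) ` {\<kappa>. 0 < \<kappa> \<and> charfun \<kappa> = 0}"
    by (intro image_eqI[of _ _ "p / l - b0\<^sup>2"]) simp_all
next
  fix l assume "l \<in> (\<lambda>\<kappa>. p / (\<kappa> + b0\<^sup>2)) ` {\<kappa>. 0 < \<kappa> \<and> charfun \<kappa> = 0}"
  then obtain \<kappa> where \<kappa>: "0 < \<kappa>" "charfun \<kappa> = 0" "l = p / (\<kappa> + b0\<^sup>2)" by auto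
  have "p / l - b0\<^sup>2 = \<kappa>" unfolding \<kappa>(3) using p(1) by simp
  then show "l \<in> F_zeros a0 a1 T" using \<kappa> by (simp add: F_zeros_iff)
qed

text \<open>At the points k pi / L the sine vanishes and the remaining term alternates in sign, so
  there is a zero between any two consecutive ones.\<close>

lemma infinite_positive_roots:
  assumes T: "0 < T"
  shows "infinite {\<kappa>. 0 < \<kappa> \<and> charfun \<kappa> = 0}"
proof
  assume fin: "finite {\<kappa>. 0 < \<kappa> \<and> charfun \<kappa> = 0}"
  have L: "0 < L" using T L_pos by simp
  define H where "H \<beta> = (\<beta>\<^sup>2 - b0 * b1) * sin (\<beta> * L) - p * \<beta> * cos (\<beta> * L)" for \<beta>
  have Hc: "isCont H x" for x unfolding H_def by (intro continuous_intros)
  have Hpi: "H (real k * pi / L) = - p * (real k * pi / L) * (-1) ^ k" for k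
    unfolding H_def using L by (simp add: sin_npi cos_npi)
  have ex: "\<exists>\<beta>. real k * pi / L < \<beta> \<and> H \<beta> = 0" if k: "1 \<le> k" for k
  proof -
    let ?x = "real k * pi / L" and ?y = "real (Suc k) * pi / L"
    have xy: "0 < ?x" "?x \<le> ?y" using k L by (auto intro!: divide_right_mono mult_right_mono divide_pos_pos)
    have nz: "H ?x \<noteq> 0" using k L p(1) by (simp add: Hpi)
    have "\<exists>\<beta>\<ge>?x. \<beta> \<le> ?y \<and> H \<beta> = 0"
    proof (cases "even k")
      case True
      have "H ?x \<le> 0" "0 \<le> H ?y" using True xy p(1) L unfolding Hpi by (auto simp: mult_nonneg_nonneg)
      then show ?thesis using IVT[of H ?x 0 ?y] xy Hc by auto
    next
      case False
      have "0 \<le> H ?x" "H ?y \<le> 0" using False xy p(1) L unfolding Hpi by (auto simp: mult_nonneg_nonneg)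
      then show ?thesis using IVT2[of H ?y 0 ?x] xy Hc by auto
    qed
    then obtain \<beta> where "?x \<le> \<beta>" "H \<beta> = 0" by blast
    moreover from this nz have "?x \<noteq> \<beta>" by metis
    ultimately show ?thesis by (intro exI[of _ \<beta>]) simp
  qed
  \<comment> \<open>Including 1 ensures m \<ge> 1; then a \<beta> beyond m has \<beta>^2 > m,
    although \<beta>^2 is one of the zeros bounded by m.\<close>
  define m where "m = Max (insert 1 {\<kappa>. 0 < \<kappa> \<and> charfun \<kappa> = 0})"
  obtain k :: nat where k: "m * L / pi < real k" using reals_Archimedean2 by blast
  have m1: "1 \<le> m" unfolding m_def using fin by (intro Max_ge) auto
  have k0: "0 < real k" using k m1 L by (smt (verit) divide_pos_pos mult_pos_pos pi_gt_zero)
  then obtain \<beta> where \<beta>: "real k * pi / L < \<beta>" "H \<beta> = 0" using ex[of k] by auto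
  have "m < real k * pi / L" using k L by (simp add: field_simps)
  then have mb: "m < \<beta>" using \<beta>(1) by simp
  then have b0: "0 < \<beta>" using m1 by simp
  have "charfun (\<beta>\<^sup>2) = 0" using charfun_pos[OF b0] \<beta>(2) by (simp add: H_def)
  then have "\<beta>\<^sup>2 \<le> m" unfolding m_def using fin b0 by (intro Max_ge) auto
  moreover have "m < \<beta>\<^sup>2" using mb m1 by (simp add: power2_eq_square) (smt (verit) mult_le_cancel_left1)
  ultimately show False by simp
qed

text \<open>In terms of the square root of \<kappa> the function extends to an entire function that
  is not constant, so a disc contains finitely many of its zeros.\<close>

lemma finite_roots_below:
  assumes T: "0 < T"
  shows "finite {\<kappa>\<in>{\<kappa>. 0 < \<kappa> \<and> charfun \<kappa> = 0}. \<kappa> \<le> b}"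
proof -
  have L: "0 < L" using T L_pos by simp
  define H :: "complex \<Rightarrow> complex" where
    "H z = (z\<^sup>2 - of_real (b0 * b1)) * sin (z * of_real L) - of_real p * z * cos (z * of_real L)" for z
  have hol: "H holomorphic_on UNIV" unfolding H_def by (intro holomorphic_intros)
  have H\<beta>: "H (of_real \<beta>) = of_real ((\<beta>\<^sup>2 - b0 * b1) * sin (\<beta> * L) - p * \<beta> * cos (\<beta> * L))" for \<beta> :: real
    by (simp add: H_def sin_of_real[symmetric] cos_of_real[symmetric])
  have "\<not> H constant_on UNIV"
  proof
    assume "H constant_on UNIV"
    then have "H (of_real 0) = H (of_real (pi / L))" by (auto simp: constant_on_def)
    moreover have "H (of_real 0) = 0" by (simp add: H_def)
    moreover have "H (of_real (pi / L)) = of_real (p * (pi / L))" unfolding H\<beta> using L by simp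
    ultimately have "p * (pi / L) = 0" by (metis of_real_eq_0_iff)
    then show False using p(1) L by simp
  qed
  then have fin: "finite {z\<in>cball 0 (sqrt b). H z = 0}"
    by (intro holomorphic_compact_finite_zeros[OF hol]) auto
  show ?thesis
  proof (rule inj_on_finite[of "\<lambda>\<kappa>. complex_of_real (sqrt \<kappa>)", OF _ _ fin])
    show "inj_on (\<lambda>\<kappa>. complex_of_real (sqrt \<kappa>)) {\<kappa>\<in>{\<kappa>. 0 < \<kappa> \<and> charfun \<kappa> = 0}. \<kappa> \<le> b}"
      by (auto simp: inj_on_def)
    show "(\<lambda>\<kappa>. complex_of_real (sqrt \<kappa>)) ` {\<kappa>\<in>{\<kappa>. 0 < \<kappa> \<and> charfun \<kappa> = 0}. \<kappa> \<le> b} \<subseteq> {z\<in>cball 0 (sqrt b). H z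
      = 0}"
    proof (rule image_subsetI)
      fix \<kappa> assume k: "\<kappa> \<in> {\<kappa>\<in>{\<kappa>. 0 < \<kappa> \<and> charfun \<kappa> = 0}. \<kappa> \<le> b}"
      define \<beta> where "\<beta> = sqrt \<kappa>"
      have \<beta>: "0 < \<beta>" "\<beta>\<^sup>2 = \<kappa>" "\<beta> \<le> sqrt b" using k by (auto simp: \<beta>_def)
      have "(\<beta>\<^sup>2 - b0 * b1) * sin (\<beta> * L) - p * \<beta> * cos (\<beta> * L) = 0"
        using charfun_pos[OF \<beta>(1)] \<beta> k by simp
      then have "H (of_real \<beta>) = 0" unfolding H\<beta> by simp
      then show "complex_of_real (sqrt \<kappa>) \<in> {z\<in>cball 0 (sqrt b). H z = 0}"
        using \<beta> by (simp add: \<beta>_def[symmetric] norm_of_real)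
    qed
  qed
qed

lemma ex_decreasing_zeros: "\<exists>lam. decreasing_zeros a0 a1 T lam"
proof (cases "T = 0")
  case True
  have "F_zeros a0 a1 T = {}" unfolding F_zeros_image using no_root_T0[OF True] by simp
  then show ?thesis using True by (simp add: decreasing_zeros_def kl_indices_def)
next
  case False
  then have T: "0 < T" using T0 by simp
  obtain f :: "nat \<Rightarrow> real" where f: "strict_mono f" "range f = {\<kappa>. 0 < \<kappa> \<and> charfun \<kappa> = 0}"
    using increasing_enumeration[OF infinite_positive_roots[OF T] finite_roots_below[OF T]] by blast
  \<comment> \<open>The enumeration of zeros starts at 0, the eigenvalue sequence at 1.\<close>
  define lam where "lam i = p / (f (i - 1) + b0\<^sup>2)" for i
  have fp: "0 < f i" for i using f(2) by blast
  have "lam j < lam i" if "1 \<le> i" "i < j" for i j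
  proof -
    have "f (i - 1) < f (j - 1)" using that by (intro strict_monoD[OF f(1)]) auto
    then show ?thesis unfolding lam_def using fp[of "i - 1"] fp[of "j - 1"] p(1)
      by (intro divide_strict_left_mono mult_pos_pos add_pos_nonneg) auto
  qed
  moreover have "lam ` {1..} = F_zeros a0 a1 T"
  proof -
    have "(\<lambda>i. f (i - 1)) ` {1..} = range f"
    proof (intro set_eqI iffI)
      fix x assume "x \<in> range f"
      then obtain n where "x = f n" by auto
      then show "x \<in> (\<lambda>i. f (i - 1)) ` {1..}" by (intro image_eqI[of _ _ "Suc n"]) auto
    qed auto
    then have "(\<lambda>\<kappa>. p / (\<kappa> + b0\<^sup>2)) ` (\<lambda>i. f (i - 1)) ` {1..} = F_zeros a0 a1 T"
      unfolding F_zeros_image f(2)[symmetric] by simp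
    then show ?thesis unfolding lam_def[abs_def] image_image .
  qed
  ultimately show ?thesis using False by (auto simp: decreasing_zeros_def kl_indices_def)
qed

text \<open>On \<kappa> > -b0^2 the map \<kappa> \<mapsto> p / (\<kappa> + b0^2) is a decreasing
  bijection onto the positive numbers, so decreasing eigenvalues correspond to increasing
  zeros.\<close>

lemma decreasing_zeros_roots:
  assumes dz: "decreasing_zeros a0 a1 T lam"
  defines "\<kappa> i \<equiv> p / lam i - b0\<^sup>2"
  shows "\<kappa> ` kl_indices T = {\<kappa>. 0 < \<kappa> \<and> charfun \<kappa> = 0}"
    and "\<And>i. i \<in> kl_indices T \<Longrightarrow> lam i = p / (\<kappa> i + b0\<^sup>2)"
    and "\<And>i. i \<in> kl_indices T \<Longrightarrow> 0 < \<kappa> i"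
    and "\<And>i j. i \<in> kl_indices T \<Longrightarrow> j \<in> kl_indices T \<Longrightarrow> i < j \<Longrightarrow> \<kappa> i < \<kappa> j"
proof -
  have im: "lam ` kl_indices T = F_zeros a0 a1 T" using dz by (simp add: decreasing_zeros_def)
  have FZ: "lam i \<in> F_zeros a0 a1 T" if "i \<in> kl_indices T" for i using im that by blast
  show l: "lam i = p / (\<kappa> i + b0\<^sup>2)" for i unfolding \<kappa>_def using p(1) by simp
  show pos: "0 < \<kappa> i" if "i \<in> kl_indices T" for i using FZ[OF that] by (simp add: F_zeros_iff \<kappa>_def)
  show "\<kappa> i < \<kappa> j" if "i \<in> kl_indices T" "j \<in> kl_indices T" "i < j" for i j
  proof -
    have "lam j < lam i" using dz that by (auto simp: decreasing_zeros_def)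
    then have "p / (\<kappa> j + b0\<^sup>2) < p / (\<kappa> i + b0\<^sup>2)" by (simp only: l[symmetric])
    moreover have "0 < \<kappa> j + b0\<^sup>2" "0 < \<kappa> i + b0\<^sup>2" using pos that by (auto intro: add_pos_nonneg)
    ultimately have "\<kappa> i + b0\<^sup>2 < \<kappa> j + b0\<^sup>2" using p(1)
      by (simp add: divide_less_eq less_divide_eq mult.commute)
    then show ?thesis by simp
  qed
  show "\<kappa> ` kl_indices T = {\<kappa>. 0 < \<kappa> \<and> charfun \<kappa> = 0}"
  proof (intro set_eqI iffI)
    fix k assume "k \<in> \<kappa> ` kl_indices T"
    then show "k \<in> {\<kappa>. 0 < \<kappa> \<and> charfun \<kappa> = 0}" using FZ by (auto simp: F_zeros_iff \<kappa>_def)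
  next
    fix k assume k: "k \<in> {\<kappa>. 0 < \<kappa> \<and> charfun \<kappa> = 0}"
    then have "p / (k + b0\<^sup>2) \<in> lam ` kl_indices T" unfolding im F_zeros_image by blast
    then obtain i where i: "i \<in> kl_indices T" "p / (k + b0\<^sup>2) = lam i" by auto
    have "\<kappa> i = k" unfolding \<kappa>_def i(2)[symmetric] using p(1) by simp
    then show "k \<in> \<kappa> ` kl_indices T" using i(1) by blast
  qed
qed

text \<open>Clearing the denominator b0 L + 1 gives the equation. If the denominator is 0, the
  quotient is 0 by convention and the condition reads p = 0, which is false; the other side then
  equals b0, and b0 \<noteq> 0.\<close>

lemma star_iff: "star_condition a0 a1 T \<longleftrightarrow> p + b0 * b1 * L = 0"
proof -
  have "star_condition a0 a1 T \<longleftrightarrow> b1 = - b0 + 4 * b0\<^sup>2 * L / (4 * b0 * L + 4)"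
  proof -
    have e1: "(1 - 2 * a0)\<^sup>2 * ln (1 - T) = - (4 * b0\<^sup>2 * L)"
      by (simp add: b0_def L_def power2_eq_square algebra_simps)
    have e2: "2 * (1 - 2 * a0) * ln (1 - T) + 4 = 4 * b0 * L + 4" by (simp add: b0_def L_def algebra_simps)
    have "a1 = 1 - a0 - - N / D \<longleftrightarrow> b1 = - b0 + N / D" for N D :: real by (auto simp: b0_def b1_def)
    then show ?thesis unfolding star_condition_def e1 e2 by blast
  qed
  also have "4 * b0\<^sup>2 * L / (4 * b0 * L + 4) = b0\<^sup>2 * L / (b0 * L + 1)"
    using mult_divide_mult_cancel_left[of 4 "b0\<^sup>2 * L" "b0 * L + 1"] by (simp add: algebra_simps)
  also have "b1 = - b0 + b0\<^sup>2 * L / (b0 * L + 1) \<longleftrightarrow> p + b0 * b1 * L = 0"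
  proof (cases "b0 * L + 1 = 0")
    case True
    have "p + b0 * b1 * L = b0 + b1 * (b0 * L + 1)" unfolding p(2) by (simp add: algebra_simps)
    also have "\<dots> \<noteq> 0" using True by auto
    finally show ?thesis using True p by auto
  next
    case False
    have "b1 = - b0 + b0\<^sup>2 * L / (b0 * L + 1) \<longleftrightarrow> (b1 + b0) * (b0 * L + 1) = b0\<^sup>2 * L"
      using False by (simp add: field_simps)
    also have "\<dots> \<longleftrightarrow> p + b0 * b1 * L = 0" unfolding p(2) by (simp add: power2_eq_square algebra_simps)
    finally show ?thesis .
  qed
  finally show ?thesis .
qed

lemma max_b_pos: "0 < max b0 b1" using p by (auto simp: max_def)

text \<open>The larger of b0 and b1 is positive, so the denominator of the threshold is positive and
  can be cleared without reversing the inequality. The result is symmetric in b0 and b1.\<close>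

lemma threshold_iff: "min a0 a1 < c_threshold a0 a1 T \<longleftrightarrow> p + b0 * b1 * L < 0"
proof -
  define x m where "x = max b0 b1" and "m = min b0 b1"
  have x: "0 < x" using max_b_pos by (simp add: x_def)
  have xm: "b0 * b1 = m * x" "p = m + x" unfolding p(2) x_def m_def by (auto simp: min_def max_def)
  have "1/2 - max a0 a1 = - x" "min a0 a1 = m + 1/2" by (auto simp: x_def m_def b0_def b1_def max_def min_def)
  then have "min a0 a1 < c_threshold a0 a1 T \<longleftrightarrow> m < - x / (x * L + 1)"
    unfolding c_threshold_def L_def by simp
  also have "\<dots> \<longleftrightarrow> m * (x * L + 1) < - x"
    using pos_less_divide_eq[of "x * L + 1" m "- x"] x L_nonneg by (simp add: add_nonneg_pos)
  also have "\<dots> \<longleftrightarrow> p + b0 * b1 * L < 0" unfolding xm by (simp add: algebra_simps) linarith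
  finally show ?thesis .
qed

text \<open>\<open>G\<close> is, up to a positive factor, the bracket in \<open>charfun_neg\<close>;
  the power of 1 - T supplies the exponential that makes the expression hyperbolic.\<close>

lemma G_eq: "G a0 a1 T \<sigma> = 2 * exp (- (\<sigma> * L)) * ((\<sigma>\<^sup>2 + b0 * b1) * sinh (\<sigma> * L) + \<sigma> * p * cosh (\<sigma> * L))"
proof -
  define E where "E = exp (\<sigma> * L)"
  have E: "E \<noteq> 0" "exp (- (\<sigma> * L)) = 1 / E" by (auto simp: E_def exp_minus inverse_eq_divide)
  have "(1 - T) powr (2 * \<sigma>) = exp (- (\<sigma> * L)) * exp (- (\<sigma> * L))"
    using T1 by (simp add: powr_def L_def exp_add[symmetric])
  then have pw: "(1 - T) powr (2 * \<sigma>) = 1 / (E * E)" by (simp add: E(2))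
  have G: "G a0 a1 T \<sigma> = (\<sigma> + b0) * (\<sigma> + b1) - 1 / (E * E) * (\<sigma> - b0) * (\<sigma> - b1)"
    unfolding G_def pw b0_def b1_def by (simp add: algebra_simps)
  have sh: "sinh (\<sigma> * L) = (E - 1 / E) / 2" "cosh (\<sigma> * L) = (E + 1 / E) / 2"
    by (simp_all add: sinh_field_def cosh_field_def E_def exp_minus inverse_eq_divide)
  have eq: "2 * (1 / E) * ((\<sigma>\<^sup>2 + b0 * b1) * ((E - 1 / E) / 2) + \<sigma> * p * ((E + 1 / E) / 2))
    = (\<sigma>\<^sup>2 + b0 * b1) * (1 - 1 / (E * E)) + \<sigma> * p * (1 + 1 / (E * E))"
    using E(1) by (simp add: field_simps)
  have ring: "(\<sigma> + b0) * (\<sigma> + b1) - I * (\<sigma> - b0) * (\<sigma> - b1) = (\<sigma>\<^sup>2 + b0 * b1) * (1 - I) + \<sigma> * p * (1 + I)" for I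
    unfolding p(2) by (simp add: algebra_simps power2_eq_square)
  show ?thesis unfolding G sh E(2) eq ring ..
qed

lemma charfun_neg_iff: "0 < \<sigma> \<Longrightarrow> charfun (- \<sigma>\<^sup>2) = 0 \<longleftrightarrow> G a0 a1 T \<sigma> = 0"
  unfolding charfun_neg G_eq by auto

text \<open>Replacing cosh by the smaller sinh leaves (\<sigma> + b0)(\<sigma> + b1) sinh, and both
  factors are nonnegative for such \<sigma>. So zeros occur only below the bound in
  \<open>is_sigma0\<close>.\<close>

lemma neg_root_pos:
  assumes s: "0 < \<sigma>" and ge: "1/2 - min a0 a1 \<le> \<sigma>"
  shows "0 < (\<sigma>\<^sup>2 + b0 * b1) * sinh (\<sigma> * L) + \<sigma> * p * cosh (\<sigma> * L)"
proof -
  define x m where "x = max b0 b1" and "m = min b0 b1"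
  have x: "0 < x" using max_b_pos by (simp add: x_def)
  have xm: "b0 * b1 = m * x" "p = m + x" unfolding p(2) x_def m_def by (auto simp: min_def max_def)
  have "min a0 a1 = m + 1/2" by (auto simp: m_def b0_def b1_def min_def)
  then have sm: "0 \<le> \<sigma> + m" using ge by simp
  have sh: "0 \<le> sinh (\<sigma> * L)" using s L_nonneg by simp
  have "0 \<le> (\<sigma> + m) * (\<sigma> + x) * sinh (\<sigma> * L)" using sm s x sh by (intro mult_nonneg_nonneg) auto
  also have "\<dots> = (\<sigma>\<^sup>2 + b0 * b1) * sinh (\<sigma> * L) + \<sigma> * p * sinh (\<sigma> * L)"
    unfolding xm by (simp add: power2_eq_square algebra_simps)
  also have "\<dots> < (\<sigma>\<^sup>2 + b0 * b1) * sinh (\<sigma> * L) + \<sigma> * p * cosh (\<sigma> * L)"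
    using s p(1) sinh_less_cosh_real[of "\<sigma> * L"] by simp
  finally show ?thesis .
qed

lemma neg_root_is_sigma0:
  assumes "0 < \<sigma>" "charfun (- \<sigma>\<^sup>2) = 0"
  shows "is_sigma0 a0 a1 T \<sigma>"
proof -
  have e: "(\<sigma>\<^sup>2 + b0 * b1) * sinh (\<sigma> * L) + \<sigma> * p * cosh (\<sigma> * L) = 0"
    using assms charfun_neg[OF assms(1)] by simp
  have "\<sigma> < 1/2 - min a0 a1"
  proof (rule ccontr)
    assume "\<not> \<sigma> < 1/2 - min a0 a1"
    then have "1/2 - min a0 a1 \<le> \<sigma>" by simp
    from neg_root_pos[OF assms(1) this] e show False by simp
  qed
  then show ?thesis using assms charfun_neg_iff by (simp add: is_sigma0_def)
qed

text \<open>At a zero the coefficient of sinh must be negative. Bounding sinh x by x cosh x and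
  dividing by \<sigma> cosh gives p + b0 b1 L \<le> - \<sigma>^2 L.\<close>

lemma sigma0_threshold:
  assumes "0 < \<sigma>" "charfun (- \<sigma>\<^sup>2) = 0"
  shows "p + b0 * b1 * L < 0"
proof (rule ccontr)
  assume nn: "\<not> p + b0 * b1 * L < 0"
  have e: "(\<sigma>\<^sup>2 + b0 * b1) * sinh (\<sigma> * L) + \<sigma> * p * cosh (\<sigma> * L) = 0"
    using assms charfun_neg[OF assms(1)] by simp
  have sh: "0 \<le> sinh (\<sigma> * L)" using assms L_nonneg by simp
  have ch: "0 < cosh (\<sigma> * L)" by simp
  have pp: "0 < \<sigma> * p * cosh (\<sigma> * L)" using assms p(1) ch by simp
  have neg: "\<sigma>\<^sup>2 + b0 * b1 < 0"
  proof (rule ccontr)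
    assume "\<not> \<sigma>\<^sup>2 + b0 * b1 < 0"
    then have "0 \<le> (\<sigma>\<^sup>2 + b0 * b1) * sinh (\<sigma> * L)" using sh by simp
    then show False using e pp by linarith
  qed
  have "\<sigma> * p * cosh (\<sigma> * L) = - (\<sigma>\<^sup>2 + b0 * b1) * sinh (\<sigma> * L)" using e unfolding mult_minus_left by linarith
  also have "\<dots> \<le> - (\<sigma>\<^sup>2 + b0 * b1) * (\<sigma> * L * cosh (\<sigma> * L))"
    using sinh_le_mult_cosh[of "\<sigma> * L"] assms L_nonneg neg by (intro mult_left_mono) auto
  finally have "(\<sigma> * cosh (\<sigma> * L)) * p \<le> (\<sigma> * cosh (\<sigma> * L)) * (- (\<sigma>\<^sup>2 + b0 * b1) * L)" by (simp add: mult_ac)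
  then have "p \<le> - (\<sigma>\<^sup>2 + b0 * b1) * L" using assms ch by (subst (asm) mult_le_cancel_left_pos) auto
  then have le: "p + b0 * b1 * L \<le> - \<sigma>\<^sup>2 * L" by (simp add: algebra_simps)
  have "0 < L"
  proof (rule ccontr)
    assume "\<not> 0 < L"
    then have "L = 0" using L_nonneg by simp
    then show False using e assms p(1) by simp
  qed
  then have "0 < \<sigma>\<^sup>2 * L" using assms by simp
  then show False using le nn by simp
qed

lemma sigma0_root: "is_sigma0 a0 a1 T \<sigma> \<Longrightarrow> charfun (- \<sigma>\<^sup>2) = 0"
  using charfun_neg_iff by (simp add: is_sigma0_def)

text \<open>If b1 is the smaller one, then - b1 < b0 because p > 0. The inequality places the zero
  above -b0^2 and so makes the eigenvalue positive.\<close>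

lemma sigma0_sq:
  assumes "is_sigma0 a0 a1 T \<sigma>" shows "\<sigma>\<^sup>2 < b0\<^sup>2"
proof -
  have s: "0 < \<sigma>" "\<sigma> < - min b0 b1" using assms by (auto simp: is_sigma0_def b0_def b1_def min_def)
  have "- min b0 b1 \<le> \<bar>b0\<bar>" using p by (auto simp: min_def)
  then have "\<bar>\<sigma>\<bar> < \<bar>b0\<bar>" using s by linarith
  then show ?thesis by (meson abs_le_square_iff not_less)
qed

text \<open>The function vanishes at 0 with slope p + b0 b1 L < 0 and is positive at the upper
  bound, so it crosses 0 in between.\<close>

lemma ex_sigma0:
  assumes Q: "p + b0 * b1 * L < 0"
  shows "\<exists>\<sigma>. is_sigma0 a0 a1 T \<sigma>"
proof -
  define H where "H \<sigma> = (\<sigma>\<^sup>2 + b0 * b1) * sinh (\<sigma> * L) + \<sigma> * p * cosh (\<sigma> * L)" for \<sigma>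
  define n where "n = 1/2 - min a0 a1"
  have n: "n = - min b0 b1" by (auto simp: n_def b0_def b1_def min_def)
  have "b0 * b1 * L < 0" using Q p(1) by simp
  then have "b0 * b1 < 0" using L_nonneg by (simp add: mult_less_0_iff)
  then have n0: "0 < n" unfolding n by (auto simp: mult_less_0_iff min_def)
  have "(H has_real_derivative p + b0 * b1 * L) (at 0)"
    unfolding H_def by (auto intro!: derivative_eq_intros)
  from DERIV_neg_dec_right[OF this Q] obtain d where d: "0 < d" "\<And>h. 0 < h \<Longrightarrow> h < d \<Longrightarrow> H h < H 0" by auto
  \<comment> \<open>Close enough to 0 for the negative slope to show, and still to the left of the
    upper bound.\<close>
  define \<epsilon> where "\<epsilon> = min (d / 2) (n / 2)"
  have \<epsilon>: "0 < \<epsilon>" "\<epsilon> < d" "\<epsilon> \<le> n" using d n0 by (auto simp: \<epsilon>_def)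
  have "H \<epsilon> < 0" using d(2)[OF \<epsilon>(1,2)] by (simp add: H_def)
  moreover have Hn: "0 < H n" unfolding H_def using neg_root_pos[OF n0] by (simp add: n_def)
  moreover have "isCont H x" for x unfolding H_def by (intro continuous_intros)
  ultimately obtain \<sigma> where \<sigma>: "\<epsilon> \<le> \<sigma>" "\<sigma> \<le> n" "H \<sigma> = 0"
    using IVT[of H \<epsilon> 0 n] \<epsilon>(3) by auto
  have s: "0 < \<sigma>" using \<sigma>(1) \<epsilon>(1) by simp
  have "charfun (- \<sigma>\<^sup>2) = 0" unfolding charfun_neg[OF s] using \<sigma>(3) by (simp add: H_def)
  then show ?thesis using neg_root_is_sigma0[OF s] by blast
qed

text \<open>Eigenfunctions belonging to two different zeros would be orthogonal, but both are positive on \<open>(0,T]\<close>.\<close>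
lemma sigma0_unique:
  assumes s: "is_sigma0 a0 a1 T \<sigma>" and s': "is_sigma0 a0 a1 T \<sigma>'"
  shows "\<sigma> = \<sigma>'"
proof (rule ccontr)
  assume ne: "\<sigma> \<noteq> \<sigma>'"
  have pos: "0 < \<sigma>" "0 < \<sigma>'" using s s' by (auto simp: is_sigma0_def)
  define k k' where "k = - \<sigma>\<^sup>2" and "k' = - \<sigma>'\<^sup>2"
  have r: "charfun k = 0" "charfun k' = 0" using sigma0_root s s' by (auto simp: k_def k'_def)
  have lo: "0 < k + b0\<^sup>2" "0 < k' + b0\<^sup>2" using sigma0_sq s s' by (auto simp: k_def k'_def)
  have kk: "k \<noteq> k'" using ne pos by (simp add: k_def k'_def)
  let ?l = "p / (k + b0\<^sup>2)" and ?l' = "p / (k' + b0\<^sup>2)"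
  have ll: "?l \<noteq> ?l'" using kk lo p(1) by (simp add: field_simps)
  define f where "f \<kappa> t = efun \<kappa> (clamp t)" for \<kappa> t
  have fc: "continuous_on UNIV (f \<kappa>)" for \<kappa> unfolding f_def[abs_def] by (rule cont_clamp[OF efun_cont])
  have fs: "sqint (mu a0 a1 T) (f \<kappa>)" for \<kappa> by (rule sqint_cont[OF fc])
  have Af: "A (f \<kappa>) t = p / (\<kappa> + b0\<^sup>2) * f \<kappa> t" if "charfun \<kappa> = 0" "0 < \<kappa> + b0\<^sup>2" for \<kappa> t
  proof -
    have "A (f \<kappa>) t = A (f \<kappa>) (clamp t)" by (simp add: A_clamp)
    also have "\<dots> = A (efun \<kappa>) (clamp t)"
      by (rule A_cong[OF borel_measurable_continuous_onI[OF fc] efun_meas]) (unfold f_def, rule AE_clamp)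
    also have "\<dots> = p / (\<kappa> + b0\<^sup>2) * f \<kappa> t"
      unfolding f_def using that by (intro eigen_converse clamp(1)) auto
    finally show ?thesis .
  qed
  have "?l * ip (f k) (f k') = ip (A (f k)) (f k')" by (simp add: Af[OF r(1) lo(1)] mult.assoc)
  also have "\<dots> = ip (f k) (A (f k'))" by (rule A_selfadjoint[OF fs fs])
  also have "\<dots> = (\<integral>s. ?l' * (f k s * f k' s) \<partial>mu a0 a1 T)"
    by (intro Bochner_Integration.integral_cong) (auto simp: Af[OF r(2) lo(2)])
  also have "\<dots> = ?l' * ip (f k) (f k')" by (rule integral_mult_right_zero)
  finally have z: "ip (f k) (f k') = 0" using ll by simp
  have L: "0 < L"
  proof (rule ccontr)
    assume "\<not> 0 < L"
    then have "T = 0" using L_pos T0 by simp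
    then show False using no_root_T0 r by blast
  qed
  have eT: "0 < efun (- s\<^sup>2) T" if "0 < s" for s using that L T1 by (simp add: efun_def u_T gsin_def)
  have e0: "0 \<le> f (- s\<^sup>2) t" if "0 < s" for s t
  proof -
    have "0 \<le> u (clamp t)" unfolding u_def using clamp(1)[of t] T1 by simp
    then show ?thesis using that clamp(1)[of t] T1 by (simp add: f_def efun_def gsin_def)
  qed
  have cont: "continuous_on {0..T} (\<lambda>s. f k s * f k' s)"
    by (intro continuous_on_mult continuous_on_subset[OF fc]) auto
  have "ip (f k) (f k') = f k T * f k' T / (1 - T) + integral {0..T} (\<lambda>s. f k s * f k' s * (p / (1 - s)\<^sup>2))"
    by (intro integral_mu cont borel_measurable_times borel_measurable_continuous_onI[OF fc])
  moreover have "0 \<le> integral {0..T} (\<lambda>s. f k s * f k' s * (p / (1 - s)\<^sup>2))"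
    using e0 pos p(1) unfolding k_def k'_def
    by (intro integral_nonneg integrable_continuous_real continuous_on_mult w_cont cont[unfolded k_def
      k'_def]) auto
  \<comment> \<open>The point mass at T makes the inner product strictly positive.\<close>
  moreover have "0 < f k T * f k' T / (1 - T)"
    using eT[OF pos(1)] eT[OF pos(2)] T0 T1 by (simp add: f_def k_def k'_def clamp(2))
  ultimately show False using z by simp
qed

lemma nonpos_root_cases:
  assumes "charfun k = 0" "k \<le> 0"
  shows "(k = 0 \<and> p + b0 * b1 * L = 0) \<or> (\<exists>\<sigma>. is_sigma0 a0 a1 T \<sigma> \<and> k = - \<sigma>\<^sup>2 \<and> p + b0 * b1 * L < 0)"
proof (cases "k = 0")
  case True
  then show ?thesis using assms charfun_0 by simp
next
  case False
  define \<sigma> where "\<sigma> = sqrt (- k)"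
  have s: "0 < \<sigma>" "k = - \<sigma>\<^sup>2" using False assms by (auto simp: \<sigma>_def)
  then show ?thesis using neg_root_is_sigma0[of \<sigma>] sigma0_threshold[of \<sigma>] assms by auto
qed

text \<open>The sign comes from ln (1 - t) = - \<open>u t\<close>, the size from the normalization
  y'(0) = 1 of \<open>gsin\<close>. The same holds for the constants in the two lemmas that
  follow.\<close>

lemma e_sin_eq:
  assumes "0 < p / l - b0\<^sup>2"
  shows "e_sin a0 a1 T l = L2_normalize (mu a0 a1 T) (\<lambda>t. - sqrt (p / l - b0\<^sup>2) * efun (p / l - b0\<^sup>2) t)"
proof -
  have "sqrt (1 - t) * sin (beta a0 a1 l * ln (1 - t)) = - sqrt (p / l - b0\<^sup>2) * efun (p / l - b0\<^sup>2) t" for t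
    using assms by (simp add: beta_def beta_radicand_eq efun_def gsin_def u_def)
  then show ?thesis by (simp only: e_sin_def)
qed

lemma e_0_eq:
  assumes "0 < \<sigma>"
  shows "e_0 a0 a1 T \<sigma> = L2_normalize (mu a0 a1 T) (\<lambda>t. - (2 * \<sigma>) * efun (- \<sigma>\<^sup>2) t)"
proof -
  have "sqrt (1 - t) * ((1 - t) powr \<sigma> - (1 - t) powr (- \<sigma>)) = - (2 * \<sigma>) * efun (- \<sigma>\<^sup>2) t" for t
  \<comment> \<open>At t = 1 the factor sqrt (1 - t) makes both sides 0. Elsewhere the powers are
    exponentials of logarithms.\<close>
  proof (cases "t = 1")
    case False
    have "sinh (- (\<sigma> * ln (1 - t))) = (exp (- (\<sigma> * ln (1 - t))) - exp (\<sigma> * ln (1 - t))) / 2"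
      by (simp add: sinh_field_def)
    then show ?thesis using assms False by (simp add: powr_def efun_def gsin_def u_def)
  qed (simp add: efun_def)
  then show ?thesis by (simp only: e_0_def)
qed

lemma e_star_eq: "e_star a0 a1 T = L2_normalize (mu a0 a1 T) (\<lambda>t. - 1 * efun 0 t)"
  unfolding e_star_def by (simp add: efun_def gsin_def u_def)

lemma lambda_0_eq: "lambda_0 a0 a1 \<sigma> = p / (- \<sigma>\<^sup>2 + b0\<^sup>2)"
  unfolding lambda_0_def p_def b0_def by (simp add: power2_eq_square algebra_simps)

lemma lambda_star_eq: "lambda_star a0 a1 = p / (0 + b0\<^sup>2)"
  unfolding lambda_star_def p_def b0_def by (simp add: power2_eq_square algebra_simps)

section \<open>The expansions with and without an extra eigenvalue\<close>

context
  fixes M :: "'a measure" and W X :: "real \<Rightarrow> 'a \<Rightarrow> real" and lam :: "nat \<Rightarrow> real"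
  assumes ps: "prob_space M" and bm: "standard_brownian_motion M W" and X: "alpha_brownian_bridge M W a0 X"
    and dz: "decreasing_zeros a0 a1 T lam"
begin

lemma lower_positive: "0 < k \<Longrightarrow> - b0\<^sup>2 < k" for k
  by (smt (verit) zero_le_power2)

lemma kl_no_extra:
  assumes Q: "0 < p + b0 * b1 * L"
  shows "karhunen_loeve_expansion M X (mu a0 a1 T) T (kl_indices T) lam (\<lambda>k. e_sin a0 a1 T (lam k))"
proof (rule kl_expansion_of_roots[OF ps bm X, where \<kappa> = "\<lambda>i. p / lam i - b0\<^sup>2" and c =
  "\<lambda>i. - sqrt (p / lam i - b0\<^sup>2)"])
  note D = decreasing_zeros_roots[OF dz]
  show "p / lam i - b0\<^sup>2 < p / lam j - b0\<^sup>2" if "i \<in> kl_indices T" "j \<in> kl_indices T" "i < j" for i j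
    by (rule D(4)[OF that])
  have "0 < k" if "charfun k = 0" for k using nonpos_root_cases[OF that] Q by force
  then show "(\<lambda>i. p / lam i - b0\<^sup>2) ` kl_indices T = {k. charfun k = 0}" unfolding D(1) by auto
  show "- b0\<^sup>2 < p / lam i - b0\<^sup>2" if "i \<in> kl_indices T" for i by (rule lower_positive[OF D(3)[OF that]])
  show "lam i = p / (p / lam i - b0\<^sup>2 + b0\<^sup>2)" if "i \<in> kl_indices T" for i by (rule D(2)[OF that])
  show "- sqrt (p / lam i - b0\<^sup>2) \<noteq> 0" if "i \<in> kl_indices T" for i using D(3)[OF that] by simp
  show "e_sin a0 a1 T (lam i) = L2_normalize (mu a0 a1 T) (\<lambda>t. - sqrt (p / lam i - b0\<^sup>2) * efun (p / lam i
    - b0\<^sup>2) t)"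
    if "i \<in> kl_indices T" for i by (rule e_sin_eq[OF D(3)[OF that]])
qed

text \<open>Serves for both kinds of extra eigenvalue, k0 = 0 and k0 < 0. Index 0 is free in
  \<open>kl_indices\<close>, and putting k0 there keeps the zeros increasing because all others are
  positive.\<close>

lemma kl_extra:
  assumes k0: "k0 \<le> 0" "- b0\<^sup>2 < k0" and roots: "{k. charfun k = 0 \<and> k \<le> 0} = {k0}"
    and c0: "c0 \<noteq> 0" and e0: "e0 = L2_normalize (mu a0 a1 T) (\<lambda>t. c0 * efun k0 t)"
  shows "karhunen_loeve_expansion M X (mu a0 a1 T) T (insert 0 (kl_indices T)) (lam(0 := p / (k0 + b0\<^sup>2)))
      ((\<lambda>k. e_sin a0 a1 T (lam k))(0 := e0))"
proof (rule kl_expansion_of_roots[OF ps bm X, where \<kappa> = "(\<lambda>i. p / lam i - b0\<^sup>2)(0 := k0)" and c =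
  "(\<lambda>i. - sqrt (p / lam i - b0\<^sup>2))(0 := c0)"])
  note D = decreasing_zeros_roots[OF dz]
  have n0: "i \<noteq> 0" if "i \<in> kl_indices T" for i using that by (auto simp: kl_indices_def split: if_splits)
  show "((\<lambda>i. p / lam i - b0\<^sup>2)(0 := k0)) i < ((\<lambda>i. p / lam i - b0\<^sup>2)(0 := k0)) j"
    if "i \<in> insert 0 (kl_indices T)" "j \<in> insert 0 (kl_indices T)" "i < j" for i j
  proof -
    have j: "j \<in> kl_indices T" "j \<noteq> 0" using that by auto
    show ?thesis
    proof (cases "i = 0")
      case True
      then show ?thesis using D(3)[OF j(1)] k0 j by simp
    next
      case False
      then show ?thesis using D(4)[of i j] that j by simp
    qed
  qed
  have "((\<lambda>i. p / lam i - b0\<^sup>2)(0 := k0)) ` insert 0 (kl_indices T)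
    = insert k0 ((\<lambda>i. p / lam i - b0\<^sup>2) ` kl_indices T)"
    using n0 by (auto simp: image_iff)
  also have "\<dots> = {k. charfun k = 0}"
  proof -
    have z: "charfun k0 = 0" using roots by blast
    have "k = k0" if "charfun k = 0" "\<not> 0 < k" for k
    proof -
      have "k \<in> {k. charfun k = 0 \<and> k \<le> 0}" using that by simp
      then show ?thesis unfolding roots by simp
    qed
    then show ?thesis unfolding D(1) using z by blast
  qed
  finally show "((\<lambda>i. p / lam i - b0\<^sup>2)(0 := k0)) ` insert 0 (kl_indices T) = {k. charfun k = 0}" .
  fix i assume i: "i \<in> insert 0 (kl_indices T)"
  show "- b0\<^sup>2 < ((\<lambda>i. p / lam i - b0\<^sup>2)(0 := k0)) i"
    using i k0 lower_positive[OF D(3)[of i]] by (cases "i = 0") auto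
  show "(lam(0 := p / (k0 + b0\<^sup>2))) i = p / (((\<lambda>i. p / lam i - b0\<^sup>2)(0 := k0)) i + b0\<^sup>2)"
    using p(1) by simp
  show "((\<lambda>i. - sqrt (p / lam i - b0\<^sup>2))(0 := c0)) i \<noteq> 0"
    using i c0 D(3)[of i] by (cases "i = 0") auto
  show "((\<lambda>k. e_sin a0 a1 T (lam k))(0 := e0)) i =
      L2_normalize (mu a0 a1 T) (\<lambda>t. ((\<lambda>i. - sqrt (p / lam i - b0\<^sup>2))(0 := c0)) i * efun (((\<lambda>i. p / lam i
        - b0\<^sup>2)(0 := k0)) i) t)"
    using i e0 e_sin_eq[OF D(3)[of i]] by (cases "i = 0") auto
qed

text \<open>The eigenvalue decreases in \<kappa> and the zero at index 1 is positive; T > 0 ensures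
  that index 1 is in use.\<close>

lemma extra_greater:
  assumes "k0 \<le> 0" "- b0\<^sup>2 < k0" "0 < T"
  shows "lam 1 < p / (k0 + b0\<^sup>2)"
proof -
  note D = decreasing_zeros_roots[OF dz]
  have 1: "1 \<in> kl_indices T" using assms by (simp add: kl_indices_def)
  have "k0 < p / lam 1 - b0\<^sup>2" "0 < k0 + b0\<^sup>2" using D(3)[OF 1] assms by auto
  then show ?thesis using p(1)
    by (subst D(2)[OF 1], intro divide_strict_left_mono mult_pos_pos) auto
qed

end

end

theorem theorem3p3:
  fixes M :: "'a measure" and W X :: "real \<Rightarrow> 'a \<Rightarrow> real" and \<alpha>\<^sub>0 \<alpha>\<^sub>1 T :: real
  assumes "prob_space M"
    and "standard_brownian_motion M W"
    and "alpha_brownian_bridge M W \<alpha>\<^sub>0 X"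
    and "0 \<le> \<alpha>\<^sub>0" and "0 \<le> \<alpha>\<^sub>1" and "\<alpha>\<^sub>0 \<noteq> \<alpha>\<^sub>1" and "\<alpha>\<^sub>0 + \<alpha>\<^sub>1 > 1"
    and "0 \<le> T" and "T < 1"
  shows "(\<exists>lam. decreasing_zeros \<alpha>\<^sub>0 \<alpha>\<^sub>1 T lam) \<and>
    (\<forall>lam. decreasing_zeros \<alpha>\<^sub>0 \<alpha>\<^sub>1 T lam \<longrightarrow>
      (let \<mu> = mu \<alpha>\<^sub>0 \<alpha>\<^sub>1 T;
           c = c_threshold \<alpha>\<^sub>0 \<alpha>\<^sub>1 T;
           e = (\<lambda>k. e_sin \<alpha>\<^sub>0 \<alpha>\<^sub>1 T (lam k))
       in
       (min \<alpha>\<^sub>0 \<alpha>\<^sub>1 \<ge> c \<longrightarrow>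
          \<not> star_condition \<alpha>\<^sub>0 \<alpha>\<^sub>1 T \<longrightarrow>
          karhunen_loeve_expansion M X \<mu> T (kl_indices T) lam e) \<and>
       (min \<alpha>\<^sub>0 \<alpha>\<^sub>1 < c \<longrightarrow>
          (\<exists>!\<sigma>\<^sub>0. is_sigma0 \<alpha>\<^sub>0 \<alpha>\<^sub>1 T \<sigma>\<^sub>0) \<and>
          (\<forall>\<sigma>\<^sub>0. is_sigma0 \<alpha>\<^sub>0 \<alpha>\<^sub>1 T \<sigma>\<^sub>0 \<longrightarrow>
             lambda_0 \<alpha>\<^sub>0 \<alpha>\<^sub>1 \<sigma>\<^sub>0 > lam 1 \<and>
             (\<not> star_condition \<alpha>\<^sub>0 \<alpha>\<^sub>1 T \<longrightarrow>
                karhunen_loeve_expansion M X \<mu> T (insert 0 (kl_indices T))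
                  (lam(0 := lambda_0 \<alpha>\<^sub>0 \<alpha>\<^sub>1 \<sigma>\<^sub>0)) (e(0 := e_0 \<alpha>\<^sub>0 \<alpha>\<^sub>1 T \<sigma>\<^sub>0))))) \<and>
       (star_condition \<alpha>\<^sub>0 \<alpha>\<^sub>1 T \<longrightarrow>
          lambda_star \<alpha>\<^sub>0 \<alpha>\<^sub>1 > lam 1 \<and>
          (min \<alpha>\<^sub>0 \<alpha>\<^sub>1 \<ge> c \<longrightarrow>
             karhunen_loeve_expansion M X \<mu> T (insert 0 (kl_indices T))
               (lam(0 := lambda_star \<alpha>\<^sub>0 \<alpha>\<^sub>1)) (e(0 := e_star \<alpha>\<^sub>0 \<alpha>\<^sub>1 T))) \<and>
          (min \<alpha>\<^sub>0 \<alpha>\<^sub>1 < c \<longrightarrow>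
             (\<forall>\<sigma>\<^sub>0. is_sigma0 \<alpha>\<^sub>0 \<alpha>\<^sub>1 T \<sigma>\<^sub>0 \<longrightarrow>
                lambda_star \<alpha>\<^sub>0 \<alpha>\<^sub>1 < lambda_0 \<alpha>\<^sub>0 \<alpha>\<^sub>1 \<sigma>\<^sub>0 \<and>
                karhunen_loeve_expansion M X \<mu> T UNIV
                  (case_nat (lambda_0 \<alpha>\<^sub>0 \<alpha>\<^sub>1 \<sigma>\<^sub>0) (lam(0 := lambda_star \<alpha>\<^sub>0 \<alpha>\<^sub>1)))
                  (case_nat (e_0 \<alpha>\<^sub>0 \<alpha>\<^sub>1 T \<sigma>\<^sub>0) (e(0 := e_star \<alpha>\<^sub>0 \<alpha>\<^sub>1 T))))))))"
proof -
  interpret B: bridge_setup \<alpha>\<^sub>0 \<alpha>\<^sub>1 T using assms by unfold_locales auto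
  \<comment> \<open>Minus the value of the characteristic function at 0. Its sign separates the
    cases: positive for no extra term, zero for \<open>lambda_star\<close>, negative for
    \<open>lambda_0\<close>.\<close>
  define Q where "Q = B.p + B.b0 * B.b1 * B.L"
  have thr: "min \<alpha>\<^sub>0 \<alpha>\<^sub>1 < c_threshold \<alpha>\<^sub>0 \<alpha>\<^sub>1 T \<longleftrightarrow> Q < 0" unfolding Q_def by (rule B.threshold_iff)
  have star: "star_condition \<alpha>\<^sub>0 \<alpha>\<^sub>1 T \<longleftrightarrow> Q = 0" unfolding Q_def by (rule B.star_iff)
  \<comment> \<open>For T = 0 the number Q equals p > 0; so whenever an extra term occurs,
    \<open>lam 1\<close> is a genuine eigenvalue and the comparison with it has a meaning.\<close>
  have Tpos: "0 < T" if "Q \<le> 0"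
  proof (rule ccontr)
    assume "\<not> 0 < T"
    then have "B.L = 0" using B.L_pos B.L_nonneg by simp
    then show False using that B.p(1) by (simp add: Q_def)
  qed
  have part_i: "karhunen_loeve_expansion M X (mu \<alpha>\<^sub>0 \<alpha>\<^sub>1 T) T (kl_indices T) lam (\<lambda>k. e_sin \<alpha>\<^sub>0 \<alpha>\<^sub>1 T (lam k))"
    if "decreasing_zeros \<alpha>\<^sub>0 \<alpha>\<^sub>1 T lam" "0 < Q" for lam
    using B.kl_no_extra[OF assms(1-3) that(1)] that(2) by (simp add: Q_def)
  have part_ii: "lam 1 < lambda_0 \<alpha>\<^sub>0 \<alpha>\<^sub>1 \<sigma> \<and>
      karhunen_loeve_expansion M X (mu \<alpha>\<^sub>0 \<alpha>\<^sub>1 T) T (insert 0 (kl_indices T)) (lam(0 := lambda_0 \<alpha>\<^sub>0 \<alpha>\<^sub>1 \<sigma>))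
        ((\<lambda>k. e_sin \<alpha>\<^sub>0 \<alpha>\<^sub>1 T (lam k))(0 := e_0 \<alpha>\<^sub>0 \<alpha>\<^sub>1 T \<sigma>))"
    if dz: "decreasing_zeros \<alpha>\<^sub>0 \<alpha>\<^sub>1 T lam" and Q: "Q < 0" and s: "is_sigma0 \<alpha>\<^sub>0 \<alpha>\<^sub>1 T \<sigma>" for lam \<sigma>
  proof -
    have \<sigma>: "0 < \<sigma>" "\<sigma>\<^sup>2 < B.b0\<^sup>2" using s B.sigma0_sq[OF s] by (auto simp: is_sigma0_def)
    have k0: "- \<sigma>\<^sup>2 \<le> 0" "- B.b0\<^sup>2 < - \<sigma>\<^sup>2" using \<sigma> by auto
    have roots: "{k. B.charfun k = 0 \<and> k \<le> 0} = {- \<sigma>\<^sup>2}"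
    proof (intro set_eqI iffI)
      fix k assume "k \<in> {k. B.charfun k = 0 \<and> k \<le> 0}"
      then obtain \<sigma>' where "is_sigma0 \<alpha>\<^sub>0 \<alpha>\<^sub>1 T \<sigma>'" "k = - \<sigma>'\<^sup>2"
        using B.nonpos_root_cases[of k] Q by (auto simp: Q_def)
      then show "k \<in> {- \<sigma>\<^sup>2}" using B.sigma0_unique[OF s] by auto
    qed (use B.sigma0_root[OF s] in auto)
    have "- (2 * \<sigma>) \<noteq> 0" using \<sigma> by simp
    from B.kl_extra[OF assms(1-3) dz k0 roots this B.e_0_eq[OF \<sigma>(1)]]
      B.extra_greater[OF assms(1-3) dz k0 Tpos] Q
    show ?thesis unfolding B.lambda_0_eq by simp
  qed
  have part_iii: "lam 1 < lambda_star \<alpha>\<^sub>0 \<alpha>\<^sub>1 \<and>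
      karhunen_loeve_expansion M X (mu \<alpha>\<^sub>0 \<alpha>\<^sub>1 T) T (insert 0 (kl_indices T)) (lam(0 := lambda_star \<alpha>\<^sub>0 \<alpha>\<^sub>1))
        ((\<lambda>k. e_sin \<alpha>\<^sub>0 \<alpha>\<^sub>1 T (lam k))(0 := e_star \<alpha>\<^sub>0 \<alpha>\<^sub>1 T))"
    if dz: "decreasing_zeros \<alpha>\<^sub>0 \<alpha>\<^sub>1 T lam" and Q: "Q = 0" for lam
  proof -
    have "B.b0 \<noteq> 0" using Q B.p(1) by (auto simp: Q_def)
    then have k0: "0 \<le> (0::real)" "- B.b0\<^sup>2 < 0" by auto
    have roots: "{k. B.charfun k = 0 \<and> k \<le> 0} = {0}"
    proof (intro set_eqI iffI)
      fix k assume "k \<in> {k. B.charfun k = 0 \<and> k \<le> 0}"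
      then show "k \<in> {0}" using B.nonpos_root_cases[of k] Q by (auto simp: Q_def)
    qed (use B.charfun_0 Q in \<open>auto simp: Q_def\<close>)
    have "- 1 \<noteq> (0::real)" by simp
    from B.kl_extra[OF assms(1-3) dz k0 roots this B.e_star_eq]
      B.extra_greater[OF assms(1-3) dz k0 Tpos] Q
    show ?thesis unfolding B.lambda_star_eq by simp
  qed
  have uniq: "\<exists>!\<sigma>. is_sigma0 \<alpha>\<^sub>0 \<alpha>\<^sub>1 T \<sigma>" if "Q < 0"
    using B.ex_sigma0 that B.sigma0_unique unfolding Q_def by blast
  show ?thesis
    unfolding Let_def thr star not_less[symmetric]
  proof (intro conjI allI impI)
    show "\<exists>lam. decreasing_zeros \<alpha>\<^sub>0 \<alpha>\<^sub>1 T lam" by (rule B.ex_decreasing_zeros)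
  next
    fix lam assume dz: "decreasing_zeros \<alpha>\<^sub>0 \<alpha>\<^sub>1 T lam" and "\<not> Q < 0" "Q \<noteq> 0"
    then show "karhunen_loeve_expansion M X (mu \<alpha>\<^sub>0 \<alpha>\<^sub>1 T) T (kl_indices T) lam (\<lambda>k. e_sin \<alpha>\<^sub>0 \<alpha>\<^sub>1 T (lam k))"
      by (intro part_i) auto
  next
    assume "Q < 0" then show "\<exists>!\<sigma>. is_sigma0 \<alpha>\<^sub>0 \<alpha>\<^sub>1 T \<sigma>" by (rule uniq)
  next
    fix lam \<sigma> assume *: "decreasing_zeros \<alpha>\<^sub>0 \<alpha>\<^sub>1 T lam" "Q < 0" "is_sigma0 \<alpha>\<^sub>0 \<alpha>\<^sub>1 T \<sigma>"
    show "lam 1 < lambda_0 \<alpha>\<^sub>0 \<alpha>\<^sub>1 \<sigma>"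
      "karhunen_loeve_expansion M X (mu \<alpha>\<^sub>0 \<alpha>\<^sub>1 T) T (insert 0 (kl_indices T)) (lam(0 := lambda_0 \<alpha>\<^sub>0 \<alpha>\<^sub>1 \<sigma>))
        ((\<lambda>k. e_sin \<alpha>\<^sub>0 \<alpha>\<^sub>1 T (lam k))(0 := e_0 \<alpha>\<^sub>0 \<alpha>\<^sub>1 T \<sigma>))"
      using part_ii[OF *] by (rule conjunct1, rule conjunct2)
  next
    fix lam assume *: "decreasing_zeros \<alpha>\<^sub>0 \<alpha>\<^sub>1 T lam" "Q = 0"
    show "lam 1 < lambda_star \<alpha>\<^sub>0 \<alpha>\<^sub>1"
      "karhunen_loeve_expansion M X (mu \<alpha>\<^sub>0 \<alpha>\<^sub>1 T) T (insert 0 (kl_indices T)) (lam(0 := lambda_star \<alpha>\<^sub>0 \<alpha>\<^sub>1))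
        ((\<lambda>k. e_sin \<alpha>\<^sub>0 \<alpha>\<^sub>1 T (lam k))(0 := e_star \<alpha>\<^sub>0 \<alpha>\<^sub>1 T))"
      using part_iii[OF *] by (rule conjunct1, rule conjunct2)
  \<comment> \<open>The goals that remain assume Q = 0 and Q < 0 together: the two extra terms never
    occur at once.\<close>
  qed simp_all
qed

end
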